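(* Suppose that $U\le O_{2n+1}(q)$, and let $\chi$ be an irreducible character of $U$. Let $D\subseteq\Phi$ be the (unique) basic subset and $\phi\colon D\to\mathbb{F}_q^\times$ the (unique) map such that $\langle\chi,\xi_{D,\phi}\rangle\neq 0$. Then the following holds. (i) If $n$ is even, then $\chi$ has maximum degree (among the irreducible characters of $U$) if and only if $$D=\{\varepsilon_1+\varepsilon_2,\varepsilon_3+\varepsilon_4,\dots,\varepsilon_{n-3}+\varepsilon_{n-2}\}\cup D_1$$ where either $D_1=\{\varepsilon_{n-1}+\varepsilon_n\}$ or $D_1=\{\varepsilon_{n-1}\}$. (ii) If $n$ is odd, then $\chi$ has maximum degree if and only if $$D=\{\varepsilon_1+\varepsilon_2,\varepsilon_3+\varepsilon_4,\dots,\varepsilon_{n-2}+\varepsilon_{n-1}\}\cup D_1$$ where $D_1\subseteq\{\varepsilon_n\}$.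
   Context: Let $p\ge 3$ be a prime, $q=p^e$ ($e\ge 1$), $\mathbb{F}_q$ the field with $q$ elements, and $n\ge 1$. Let $U_k(q)$ be the group of unipotent upper-triangular $k\times k$ matrices over $\mathbb{F}_q$, and $U=O_{2n+1}(q)\cap U_{2n+1}(q)$, a Sylow $p$-subgroup of $O_{2n+1}(q)$. Explicitly, with $J$ the $n\times n$ matrix with 1's on the anti-diagonal and 0's elsewhere, $U$ consists of all block matrices $\begin{pmatrix} x & xu & xz \\ 0 & 1 & -u^TJ \\ 0 & 0 & Jx^{-T}J\end{pmatrix}$ with $x\in U_n(q)$, $u$ an $n\times 1$ matrix and $z$ an $n\times n$ matrix over $\mathbb{F}_q$ with $Jz^T+zJ=-uu^T$. Rows and columns of $(2n+1)\times(2n+1)$ matrices are indexed, in order, by $1,\dots,n,0,-n,\dots,-1$; this order is denoted $\prec$. Roots: $\Phi=\{\varepsilon_i\pm\varepsilon_j:1\le i<j\le n\}\cup\{\varepsilon_i:1\le i\le n\}$, where $\varepsilon_1,\dots,\varepsilon_n$ are the coordinate functions on the diagonal torus. Entries: for $i<j$, $\mathcal{E}(\varepsilon_i-\varepsilon_j)=\{(i,j),(-j,-i)\}$, $\mathcal{E}(\varepsilon_i+\varepsilon_j)=\{(i,-j),(j,-i)\}$; $\mathcal{E}(\varepsilon_i)=\{(i,0),(0,-i)\}$. For $D\subseteq\Phi$, $\mathcal{E}(D)=\bigcup_{\alpha\in D}\mathcal{E}(\alpha)$. For each $\alpha\in\Phi$ there is exactly one $(i,j)\in\mathcal{E}(\alpha)$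 with $1\le i\le n$ and $i\prec j\preceq -i$. A subset $D\subseteq\Phi$ is basic if $\mathcal{E}(D)$ contains at most one entry from each row and at most one entry from each column. Supercharacters: for $i<j$, $U_{\varepsilon_i-\varepsilon_j}=\{x\in U: x_{i,k}=0,\ i<k<j\}$; $U_{\varepsilon_i+\varepsilon_j}=\{x\in U:x_{i,k}=x_{j,l}=0,\ i<k\le n,\ j\prec l\preceq 0\}$; $U_{\varepsilon_i}=\{x\in U:x_{i,k}=0,\ i<k\le n\}$. Fix a nontrivial linear character $\vartheta\colon\mathbb{F}_q^+\to\mathbb{C}^\times$. For $\alpha\in\Phi$, $r\in\mathbb{F}_q^\times$, $\lambda_{\alpha,r}(x)=\vartheta(rx_{i,j})$ (with $(i,j)$ the distinguished entry of $\mathcal{E}(\alpha)$ above) is a linear character of $U_\alpha$, and $\xi_{\alpha,r}=(\lambda_{\alpha,r})^U$ (induced character). For a basic $D\subseteq\Phi$ and $\phi\colon D\to\mathbb{F}_q^\times$, $\xi_{D,\phi}=\prod_{\alpha\in D}\xi_{\alpha,\phi(\alpha)}$ (the trivial character $1_U$ if $D=\emptyset$). Every irreducible character of $U$ is a constituent of $\xi_{D,\phi}$ for exactly one pair $(D,\phi)$. $\langle\cdot,\cdot\rangle$ is the usual scalar product of class functions on $U$. A list such as $\{\varepsilon_1+\varepsilon_2,\dots\}$ of consecutive pairs is empty when there are no such pairs. *)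

theory Defs
  imports
    "HOL-Algebra.Algebra"
    "HOL-Library.Cardinality"
    "Jordan_Normal_Form.VS_Connect"
begin

section \<open>Ordinary characters of a group\<close>

abbreviation GL :: "nat \<Rightarrow> 'a::semiring_1 mat monoid" where
  "GL d \<equiv> units_of (ring_mat TYPE('a) d ())"

definition mat_trace :: "'a::comm_monoid_add mat \<Rightarrow> 'a" where
  "mat_trace A = (\<Sum>i<dim_row A. A $$ (i, i))"

definition irreducible_rep :: "('g, 'b) monoid_scheme \<Rightarrow> nat \<Rightarrow> ('g \<Rightarrow> complex mat) \<Rightarrow> bool" where
  "irreducible_rep G d \<rho> \<longleftrightarrow>
     \<rho> \<in> hom G (GL d) \<and> 1 \<le> d \<and>
     (\<forall>W. VectorSpace.subspace class_ring W (module_vec TYPE(complex) d) \<and>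
          (\<forall>g\<in>carrier G. \<forall>v\<in>W. \<rho> g *\<^sub>v v \<in> W)
        \<longrightarrow> W = {0\<^sub>v d} \<or> W = carrier_vec d)"

text \<open>Characters are functions on the whole type; only their values on the carrier matter, and
  no condition is imposed elsewhere.\<close>

definition irr_chars :: "('g, 'b) monoid_scheme \<Rightarrow> ('g \<Rightarrow> complex) set" where
  "irr_chars G = {\<chi>. \<exists>d \<rho>. irreducible_rep G d \<rho> \<and> (\<forall>g\<in>carrier G. \<chi> g = mat_trace (\<rho> g))}"

text \<open>The value of a character at the identity is the natural number \<^term>\<open>d\<close>, so its real part
  is the degree.\<close>

definition char_degree :: "('g, 'b) monoid_scheme \<Rightarrow> ('g \<Rightarrow> complex) \<Rightarrow> real" where
  "char_degree G \<chi> = Re (\<chi> \<one>\<^bsub>G\<^esub>)"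

definition has_max_degree :: "('g, 'b) monoid_scheme \<Rightarrow> ('g \<Rightarrow> complex) \<Rightarrow> bool" where
  "has_max_degree G \<chi> \<longleftrightarrow>
     \<chi> \<in> irr_chars G \<and> (\<forall>\<psi>\<in>irr_chars G. char_degree G \<psi> \<le> char_degree G \<chi>)"

definition char_inner :: "('g, 'b) monoid_scheme \<Rightarrow> ('g \<Rightarrow> complex) \<Rightarrow> ('g \<Rightarrow> complex) \<Rightarrow> complex" where
  "char_inner G \<chi> \<psi> = (\<Sum>g\<in>carrier G. \<chi> g * cnj (\<psi> g)) / of_nat (card (carrier G))"

definition induced_char ::
    "('g, 'b) monoid_scheme \<Rightarrow> 'g set \<Rightarrow> ('g \<Rightarrow> complex) \<Rightarrow> 'g \<Rightarrow> complex" where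
  "induced_char G H f g =
     (\<Sum>y\<in>carrier G. if inv\<^bsub>G\<^esub> y \<otimes>\<^bsub>G\<^esub> g \<otimes>\<^bsub>G\<^esub> y \<in> H
                      then f (inv\<^bsub>G\<^esub> y \<otimes>\<^bsub>G\<^esub> g \<otimes>\<^bsub>G\<^esub> y) else 0) / of_nat (card H)"

definition nontrivial_additive_char :: "('a::ab_group_add \<Rightarrow> complex) \<Rightarrow> bool" where
  "nontrivial_additive_char \<theta> \<longleftrightarrow>
     (\<forall>a. \<theta> a \<noteq> 0) \<and> (\<forall>a b. \<theta> (a + b) = \<theta> a * \<theta> b) \<and> (\<exists>a. \<theta> a \<noteq> 1)"


section \<open>The unipotent subgroup of the odd orthogonal group\<close>

definition antidiag :: "nat \<Rightarrow> 'a::zero_neq_one mat" where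
  "antidiag k = mat k k (\<lambda>(i, j). if i + j + 1 = k then 1 else 0)"

definition unitriangular :: "nat \<Rightarrow> 'a::{zero, one} mat set" where
  "unitriangular k = {x \<in> carrier_mat k k. upper_triangular x \<and> (\<forall>i<k. x $$ (i, i) = 1)}"

text \<open>In odd characteristic the orthogonal group of a quadratic form is that of its polar form;
  the symmetric form here is the one whose Gram matrix is \<^term>\<open>antidiag k\<close>.\<close>

definition orthogonal :: "nat \<Rightarrow> 'a::field mat set" where
  "orthogonal k = {x \<in> carrier (GL k). transpose_mat x * antidiag k * x = antidiag k}"

definition U_set :: "nat \<Rightarrow> 'a::field mat set" where
  "U_set n = orthogonal (2 * n + 1) \<inter> unitriangular (2 * n + 1)"

definition U_group :: "nat \<Rightarrow> 'a::field mat monoid" where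
  "U_group n = (GL (2 * n + 1))\<lparr>carrier := U_set n\<rparr>"


section \<open>Signed indices, roots and supercharacters\<close>

text \<open>Rows and columns are labelled, in this order, by the integers
  \<open>1, \<dots>, n, 0, -n, \<dots>, -1\<close>; \<open>pos n\<close> converts a label into the library's index in
  \<open>{0..2n}\<close>.\<close>

definition pos :: "nat \<Rightarrow> int \<Rightarrow> nat" where
  "pos n i = (if 0 < i then nat i - 1 else if i = 0 then n else 2 * n + 1 - nat (- i))"

definition labels :: "nat \<Rightarrow> int set" where
  "labels n = {- int n..int n}"

definition prec :: "nat \<Rightarrow> int \<Rightarrow> int \<Rightarrow> bool" where
  "prec n i j \<longleftrightarrow> pos n i < pos n j"

definition preceq :: "nat \<Rightarrow> int \<Rightarrow> int \<Rightarrow> bool" where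
  "preceq n i j \<longleftrightarrow> pos n i \<le> pos n j"

definition ent :: "nat \<Rightarrow> 'a mat \<Rightarrow> int \<Rightarrow> int \<Rightarrow> 'a" where
  "ent n x i j = x $$ (pos n i, pos n j)"

text \<open>The roots only serve as names for positions, so they are given by a free datatype; the
  constructors stand for \<open>\<epsilon>\<^sub>i - \<epsilon>\<^sub>j\<close>, \<open>\<epsilon>\<^sub>i + \<epsilon>\<^sub>j\<close> and \<open>\<epsilon>\<^sub>i\<close>.\<close>

datatype root = EpsDiff nat nat | EpsSum nat nat | EpsSingle nat

definition roots :: "nat \<Rightarrow> root set" where
  "roots n = {EpsDiff i j | i j. 1 \<le> i \<and> i < j \<and> j \<le> n} \<union>
             {EpsSum i j | i j. 1 \<le> i \<and> i < j \<and> j \<le> n} \<union>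
             {EpsSingle i | i. 1 \<le> i \<and> i \<le> n}"

fun root_entries :: "root \<Rightarrow> (int \<times> int) set" where
  "root_entries (EpsDiff i j) = {(int i, int j), (- int j, - int i)}"
| "root_entries (EpsSum i j) = {(int i, - int j), (int j, - int i)}"
| "root_entries (EpsSingle i) = {(int i, 0), (0, - int i)}"

definition entries :: "root set \<Rightarrow> (int \<times> int) set" where
  "entries D = (\<Union>\<alpha>\<in>D. root_entries \<alpha>)"

definition basic :: "nat \<Rightarrow> root set \<Rightarrow> bool" where
  "basic n D \<longleftrightarrow> D \<subseteq> roots n \<and>
     (\<forall>i j k. (i, j) \<in> entries D \<and> (i, k) \<in> entries D \<longrightarrow> j = k) \<and>
     (\<forall>i j k. (i, k) \<in> entries D \<and> (j, k) \<in> entries D \<longrightarrow> i = j)"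

text \<open>The entry by which \<^term>\<open>\<alpha>\<close> enters its linear character; \<open>main_entry_unique\<close>
  characterises it.\<close>

fun main_entry :: "root \<Rightarrow> int \<times> int" where
  "main_entry (EpsDiff i j) = (int i, int j)"
| "main_entry (EpsSum i j) = (int i, - int j)"
| "main_entry (EpsSingle i) = (int i, 0)"

lemma main_entry_unique:
  assumes "\<alpha> \<in> roots n"
  shows "(i, j) \<in> root_entries \<alpha> \<and> 1 \<le> i \<and> i \<le> int n \<and> prec n i j \<and> preceq n j (- i)
    \<longleftrightarrow> (i, j) = main_entry \<alpha>"
  using assms by (cases \<alpha>) (auto simp: roots_def prec_def preceq_def pos_def)

fun U_root :: "nat \<Rightarrow> root \<Rightarrow> 'a::field mat set" where
  "U_root n (EpsDiff i j) = {x \<in> U_set n. \<forall>k. i < k \<and> k < j \<longrightarrow> ent n x (int i) (int k) = 0}"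
| "U_root n (EpsSum i j) = {x \<in> U_set n.
     (\<forall>k. i < k \<and> k \<le> n \<longrightarrow> ent n x (int i) (int k) = 0) \<and>
     (\<forall>l\<in>labels n. prec n (int j) l \<and> preceq n l 0 \<longrightarrow> ent n x (int j) l = 0)}"
| "U_root n (EpsSingle i) = {x \<in> U_set n. \<forall>k. i < k \<and> k \<le> n \<longrightarrow> ent n x (int i) (int k) = 0}"

definition lin_char :: "nat \<Rightarrow> ('a::field \<Rightarrow> complex) \<Rightarrow> root \<Rightarrow> 'a \<Rightarrow> 'a mat \<Rightarrow> complex" where
  "lin_char n \<theta> \<alpha> r x = \<theta> (r * ent n x (fst (main_entry \<alpha>)) (snd (main_entry \<alpha>)))"

definition xi_root :: "nat \<Rightarrow> ('a::field \<Rightarrow> complex) \<Rightarrow> root \<Rightarrow> 'a \<Rightarrow> 'a mat \<Rightarrow> complex" where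
  "xi_root n \<theta> \<alpha> r = induced_char (U_group n) (U_root n \<alpha>) (lin_char n \<theta> \<alpha> r)"

definition xi :: "nat \<Rightarrow> ('a::field \<Rightarrow> complex) \<Rightarrow> root set \<Rightarrow> (root \<Rightarrow> 'a) \<Rightarrow> 'a mat \<Rightarrow> complex" where
  "xi n \<theta> D \<phi> x = (\<Prod>\<alpha>\<in>D. xi_root n \<theta> \<alpha> (\<phi> \<alpha>) x)"


section \<open>The block description of \<^const>\<open>U_set\<close>\<close>

text \<open>Nothing below is needed to state the result; it confirms that \<^const>\<open>U_set\<close> is the group of
  block matrices with first block row \<open>x, xu, xz\<close> (see \<open>U_set_explicit\<close>).\<close>

lemma antidiag_carrier [simp]: "antidiag k \<in> carrier_mat k k"
  by (simp add: antidiag_def)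

lemma antidiag_dim [simp]: "dim_row (antidiag k) = k" "dim_col (antidiag k) = k"
  by (simp_all add: antidiag_def)

lemma mat_eq_carrier:
  "A \<in> carrier_mat m k \<Longrightarrow> B \<in> carrier_mat m k \<Longrightarrow> A = B \<longleftrightarrow> (\<forall>i<m. \<forall>j<k. A $$ (i, j) = B $$ (i, j))"
  by (auto intro: eq_matI)

lemma antidiag_mult_index:
  fixes A :: "'a::field mat"
  assumes "A \<in> carrier_mat k m" "i < k" "j < m"
  shows "(antidiag k * A) $$ (i, j) = A $$ (k - 1 - i, j)"
proof -
  have "(antidiag k * A) $$ (i, j) = (\<Sum>l\<in>{0..<k}. (if l = k - 1 - i then A $$ (l, j) else 0))"
  proof -
    have "(antidiag k * A) $$ (i, j) = (\<Sum>l\<in>{0..<k}. antidiag k $$ (i, l) * A $$ (l, j))"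
      using assms by (simp add: scalar_prod_def carrier_matD[OF antidiag_carrier])
    thus ?thesis using assms by (subst sum.cong[OF refl]) (auto simp: antidiag_def)
  qed
  also have "\<dots> = A $$ (k - 1 - i, j)" using assms by simp
  finally show ?thesis .
qed

lemma mult_antidiag_index:
  fixes A :: "'a::field mat"
  assumes "A \<in> carrier_mat m k" "i < m" "j < k"
  shows "(A * antidiag k) $$ (i, j) = A $$ (i, k - 1 - j)"
proof -
  have "(A * antidiag k) $$ (i, j) = (\<Sum>l\<in>{0..<k}. (if l = k - 1 - j then A $$ (i, l) else 0))"
  proof -
    have "(A * antidiag k) $$ (i, j) = (\<Sum>l\<in>{0..<k}. A $$ (i, l) * antidiag k $$ (l, j))"
      using assms by (simp add: scalar_prod_def carrier_matD[OF antidiag_carrier])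
    thus ?thesis using assms by (subst sum.cong[OF refl]) (auto simp: antidiag_def)
  qed
  also have "\<dots> = A $$ (i, k - 1 - j)" using assms by simp
  finally show ?thesis .
qed

lemma transpose_antidiag [simp]: "transpose_mat (antidiag k) = antidiag k"
  by (auto simp: antidiag_def add.commute)

lemma antidiag_sq [simp]: "antidiag k * antidiag k = (1\<^sub>m k :: 'a::field mat)"
proof (rule eq_matI)
  fix i j assume "i < dim_row (1\<^sub>m k :: 'a mat)" "j < dim_col (1\<^sub>m k :: 'a mat)"
  hence ij: "i < k" "j < k" by auto
  show "(antidiag k * antidiag k :: 'a mat) $$ (i, j) = 1\<^sub>m k $$ (i, j)"
    unfolding antidiag_mult_index[OF antidiag_carrier ij] using ij by (auto simp: antidiag_def)
qed (auto simp: carrier_matD[OF antidiag_carrier])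

lemma tJ_index:
  fixes A B :: "'a::field mat"
  assumes "A \<in> carrier_mat k m" "B \<in> carrier_mat k m'" "i < m" "j < m'"
  shows "(transpose_mat A * antidiag k * B) $$ (i, j) = (\<Sum>l<k. A $$ (l, i) * B $$ (k - 1 - l, j))"
proof -
  have "transpose_mat A * antidiag k * B = transpose_mat A * (antidiag k * B)"
    by (rule assoc_mult_mat[where ?n\<^sub>1=m and ?n\<^sub>2=k and ?n\<^sub>3=k and ?n\<^sub>4=m']) (use assms in auto)
  moreover have "(transpose_mat A * (antidiag k * B)) $$ (i, j)
      = (\<Sum>l\<in>{0..<k}. A $$ (l, i) * (antidiag k * B) $$ (l, j))"
    using assms by (auto simp: scalar_prod_def carrier_matD[OF antidiag_carrier] intro!: sum.cong)
  ultimately show ?thesis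
    using assms by (simp add: antidiag_mult_index atLeast0LessThan del: index_mult_mat(1))
qed

lemma sum_split_add:
  fixes f :: "nat \<Rightarrow> 'a::comm_monoid_add"
  shows "(\<Sum>l<m+k. f l) = (\<Sum>l<m. f l) + (\<Sum>l<k. f (m + l))"
  by (induction k) (auto simp: add.assoc)

lemma sum_split3:
  fixes f :: "nat \<Rightarrow> 'a::comm_monoid_add"
  shows "(\<Sum>l<2*n+1. f l) = (\<Sum>l<n. f l) + f n + (\<Sum>l<n. f (Suc (n + l)))"
proof -
  have "2 * n + 1 = Suc n + n" by simp
  show ?thesis unfolding \<open>2 * n + 1 = Suc n + n\<close> sum_split_add[of f "Suc n" n] by simp
qed

definition blk :: "nat \<Rightarrow> 'a::field mat \<Rightarrow> 'a mat \<Rightarrow> 'a mat \<Rightarrow> 'a mat \<Rightarrow> 'a mat \<Rightarrow> 'a mat" where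
  "blk n A b C d E = four_block_mat (four_block_mat A b (0\<^sub>m 1 n) (1\<^sub>m 1)) (C @\<^sub>r d) (0\<^sub>m n (n + 1)) E"

lemma blk_index:
  fixes A :: "'a::field mat"
  assumes c: "A \<in> carrier_mat n n" "b \<in> carrier_mat n 1" "C \<in> carrier_mat n n" "d \<in> carrier_mat 1 n" "E \<in> carrier_mat n n"
  shows "blk n A b C d E \<in> carrier_mat (2*n+1) (2*n+1)"
   "i < n \<Longrightarrow> j < n \<Longrightarrow> blk n A b C d E $$ (i,j) = A $$ (i,j)"
   "i < n \<Longrightarrow> blk n A b C d E $$ (i,n) = b $$ (i,0)"
   "i < n \<Longrightarrow> j < n \<Longrightarrow> blk n A b C d E $$ (i,Suc (n+j)) = C $$ (i,j)"
   "j < n \<Longrightarrow> blk n A b C d E $$ (n,j) = 0"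
   "blk n A b C d E $$ (n,n) = 1"
   "j < n \<Longrightarrow> blk n A b C d E $$ (n,Suc (n+j)) = d $$ (0,j)"
   "i < n \<Longrightarrow> j < n \<Longrightarrow> blk n A b C d E $$ (Suc (n+i),j) = 0"
   "i < n \<Longrightarrow> blk n A b C d E $$ (Suc (n+i),n) = 0"
   "i < n \<Longrightarrow> j < n \<Longrightarrow> blk n A b C d E $$ (Suc (n+i),Suc (n+j)) = E $$ (i,j)"
  using c by (auto simp: blk_def append_rows_def)

lemma blk_form:
  fixes A :: "'a::field mat"
  assumes c: "A \<in> carrier_mat n n" "b \<in> carrier_mat n 1" "C \<in> carrier_mat n n" "d \<in> carrier_mat 1 n" "E \<in> carrier_mat n n"
  defines "g \<equiv> blk n A b C d E"
  shows "transpose_mat g * antidiag (2*n+1) * g = antidiag (2*n+1) \<longleftrightarrow>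
     transpose_mat A * antidiag n * E = antidiag n \<and>
     transpose_mat b * antidiag n * E + d = 0\<^sub>m 1 n \<and>
     transpose_mat C * antidiag n * E + transpose_mat d * d + transpose_mat E * antidiag n * C = 0\<^sub>m n n"
    (is "?L \<longleftrightarrow> ?R1 \<and> ?R2 \<and> ?R3")
proof -
  let ?B = "\<lambda>r s. \<Sum>l<2*n+1. g $$ (l, r) * g $$ (2*n - l, s)"
  note bi = blk_index[OF c, folded g_def]
  have nn: "Suc (n + n - Suc l) = Suc (n + (n - 1 - l))" if "l < n" for l using that by simp
  have bi2: "g $$ (Suc (n + n - Suc l), s) = 0" "g $$ (Suc (n + n - Suc l), n) = 0"
    "g $$ (Suc (n + n - Suc l), Suc (n + s)) = E $$ (n - Suc l, s)" if "l < n" "s < n" for l s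
  proof -
    have l: "n - 1 - l < n" "n - 1 - l = n - Suc l" using that by auto
    show "g $$ (Suc (n + n - Suc l), s) = 0" unfolding nn[OF that(1)] by (rule bi(8)[OF l(1) that(2)])
    show "g $$ (Suc (n + n - Suc l), n) = 0" unfolding nn[OF that(1)] by (rule bi(9)[OF l(1)])
    show "g $$ (Suc (n + n - Suc l), Suc (n + s)) = E $$ (n - Suc l, s)"
      unfolding nn[OF that(1)] bi(10)[OF l(1) that(2)] unfolding l(2) ..
  qed
  have sym: "?B r s = ?B s r" for r s
    by (rule sum.reindex_bij_witness[where i="\<lambda>l. 2*n-l" and j="\<lambda>l. 2*n-l"]) auto
  have rw: "2 * n - l = Suc (n + (n - 1 - l))" if "l < n" for l using that by simp
  have rw2: "2 * n - Suc (n + l) = n - 1 - l" if "l < n" for l using that by simp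
  have rw3: "2 * n - n = n" by simp
  have B: "?B r s = (\<Sum>l<n. g $$ (l, r) * g $$ (Suc (n + (n - 1 - l)), s)) + g $$ (n, r) * g $$ (n, s)
      + (\<Sum>l<n. g $$ (Suc (n + l), r) * g $$ (n - 1 - l, s))" for r s
    unfolding sum_split3 by (intro arg_cong2[where f="(+)"] sum.cong) (auto simp: rw rw2)
  have L: "?L \<longleftrightarrow> (\<forall>r<2*n+1. \<forall>s<2*n+1. ?B r s = antidiag (2*n+1) $$ (r, s))"
    (is "_ \<longleftrightarrow> ?Q")
  proof -
    have d: "dim_row (transpose_mat g * antidiag (2*n+1) * g) = 2*n+1"
      "dim_col (transpose_mat g * antidiag (2*n+1) * g) = 2*n+1"
      using bi(1) by auto
    have e: "(transpose_mat g * antidiag (2*n+1) * g) $$ (r, s) = ?B r s" if "r < 2*n+1" "s < 2*n+1" for r s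
      using tJ_index[OF bi(1) bi(1) that] by simp
    have "?L \<longleftrightarrow> (\<forall>r<2*n+1. \<forall>s<2*n+1. (transpose_mat g * antidiag (2*n+1) * g) $$ (r, s) = antidiag (2*n+1) $$ (r, s))"
      by (rule mat_eq_carrier) (use bi(1) in auto)
    thus ?thesis using e by simp
  qed
  have ex: "(\<exists>r. n = r \<and> P r) = P n" for P by auto
  have split: "(\<forall>r<2*n+1. P r) \<longleftrightarrow> (\<forall>r<n. P r) \<and> P n \<and> (\<forall>r<n. P (Suc (n + r)))" for P
  proof (intro iffI allI impI; (elim conjE)?)
    fix r assume *: "\<forall>r<n. P r" "P n" "\<forall>r<n. P (Suc (n + r))" "r < 2*n+1"
    show "P r"
    proof (cases "r \<le> n")
      case True thus ?thesis using * by (cases "r = n") auto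
    next
      case False
      hence "r = Suc (n + (r - n - 1))" "r - n - 1 < n" using *(4) by auto
      thus ?thesis using *(3) by metis
    qed
  qed auto
  have a: "antidiag (2*n+1) $$ (r, s) = (if r + s = 2 * n then 1 else 0)" if "r < 2*n+1" "s < 2*n+1" for r s
    using that by (simp add: antidiag_def)
  have a': "antidiag (Suc (2*n)) $$ (r, s) = (if r + s = 2 * n then 1 else 0)" if "r < 2*n+1" "s < 2*n+1" for r s
    using a[OF that] by simp
  have an: "antidiag n $$ (r, s) = (if r + s + 1 = n then 1 else 0)" if "r < n" "s < n" for r s
    using that by (simp add: antidiag_def)
  have asym: "antidiag (2*n+1) $$ (r, s) = antidiag (2*n+1) $$ (s, r)" if "r < 2*n+1" "s < 2*n+1" for r s
    unfolding a[OF that] a[OF that(2,1)] by (simp add: add.commute)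
  have v11: "?B r s = antidiag (2*n+1) $$ (r, s)" if "r < n" "s < n" for r s
    using that unfolding B by (simp add: bi bi2 a')
  have v12: "?B r n = antidiag (2*n+1) $$ (r, n)" if "r < n" for r
    using that unfolding B by (simp add: bi bi2 a')
  have v22: "?B n n = antidiag (2*n+1) $$ (n, n)"
    unfolding B by (simp add: bi bi2 a')
  have v13: "?B r (Suc (n + s)) = antidiag (2*n+1) $$ (r, Suc (n + s)) \<longleftrightarrow>
      (transpose_mat A * antidiag n * E) $$ (r, s) = antidiag n $$ (r, s)" if "r < n" "s < n" for r s
    using that unfolding B by (auto simp add: bi bi2 a' an tJ_index[OF c(1) c(5)])
  have v23: "?B n (Suc (n + s)) = antidiag (2*n+1) $$ (n, Suc (n + s)) \<longleftrightarrow>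
      (transpose_mat b * antidiag n * E + d) $$ (0, s) = (0\<^sub>m 1 n) $$ (0, s)" if "s < n" for s
  proof -
    have "(transpose_mat b * antidiag n * E + d) $$ (0, s) = (\<Sum>l<n. b $$ (l, 0) * E $$ (n - 1 - l, s)) + d $$ (0, s)"
      using that tJ_index[OF c(2) c(5), of 0 s] c by simp
    thus ?thesis using that unfolding B by (simp add: bi bi2 a')
  qed
  have v33: "?B (Suc (n + r)) (Suc (n + s)) = antidiag (2*n+1) $$ (Suc (n + r), Suc (n + s)) \<longleftrightarrow>
      (transpose_mat C * antidiag n * E + transpose_mat d * d + transpose_mat E * antidiag n * C) $$ (r, s) = (0\<^sub>m n n) $$ (r, s)"
      if "r < n" "s < n" for r s
  proof -
    have "(transpose_mat C * antidiag n * E + transpose_mat d * d + transpose_mat E * antidiag n * C) $$ (r, s)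
      = (\<Sum>l<n. C $$ (l, r) * E $$ (n - 1 - l, s)) + d $$ (0, r) * d $$ (0, s) + (\<Sum>l<n. E $$ (l, r) * C $$ (n - 1 - l, s))"
    proof -
      have "(transpose_mat d * d) $$ (r, s) = d $$ (0, r) * d $$ (0, s)"
        using that c by (simp add: scalar_prod_def)
      thus ?thesis
        using that tJ_index[OF c(3) c(5), of r s] tJ_index[OF c(5) c(3), of r s] c by simp
    qed
    thus ?thesis using that unfolding B by (simp add: bi bi2 a')
  qed
  have R1: "?R1 \<longleftrightarrow> (\<forall>r<n. \<forall>s<n. (transpose_mat A * antidiag n * E) $$ (r, s) = antidiag n $$ (r, s))"
    by (rule mat_eq_carrier) (use c in auto)
  have R2: "?R2 \<longleftrightarrow> (\<forall>s<n. (transpose_mat b * antidiag n * E + d) $$ (0, s) = (0\<^sub>m 1 n) $$ (0, s))"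
    by (subst mat_eq_carrier[of _ 1 n]) (use c in auto)
  have R3: "?R3 \<longleftrightarrow> (\<forall>r<n. \<forall>s<n. (transpose_mat C * antidiag n * E + transpose_mat d * d + transpose_mat E * antidiag n * C) $$ (r, s) = (0\<^sub>m n n) $$ (r, s))"
    by (rule mat_eq_carrier) (use c in auto)
  have s21: "?B n s = antidiag (2*n+1) $$ (n, s)" if "s < n" for s
    by (rule trans[OF sym[of n s] trans[OF v12[OF that] asym]]) (use that in auto)
  have tsym: "?B r s = antidiag (2*n+1) $$ (r, s) \<longleftrightarrow> ?B s r = antidiag (2*n+1) $$ (s, r)"
    if "r < 2*n+1" "s < 2*n+1" for r s
    unfolding sym[of r s] asym[OF that] ..
  have s31: "?B (Suc (n+r)) s = antidiag (2*n+1) $$ (Suc (n+r), s) \<longleftrightarrow> ?B s (Suc (n+r)) = antidiag (2*n+1) $$ (s, Suc (n+r))" if "s < n" "r < n" for r s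
    by (rule tsym) (use that in auto)
  have s32: "?B (Suc (n+r)) n = antidiag (2*n+1) $$ (Suc (n+r), n) \<longleftrightarrow> ?B n (Suc (n+r)) = antidiag (2*n+1) $$ (n, Suc (n+r))" if "r < n" for r
    by (rule tsym) (use that in auto)
  define T where "T r s \<longleftrightarrow> ?B r s = antidiag (2*n+1) $$ (r, s)" for r s
  have "?L \<longleftrightarrow> (\<forall>r<2*n+1. \<forall>s<2*n+1. T r s)" unfolding L T_def ..
  also have "\<dots> \<longleftrightarrow> (\<forall>r<n. \<forall>s<n. T r (Suc (n+s))) \<and> (\<forall>s<n. T n (Suc (n+s))) \<and> (\<forall>r<n. \<forall>s<n. T (Suc (n+r)) (Suc (n+s)))"
    unfolding split
    using v11[folded T_def] v12[folded T_def] v22[folded T_def] s21[folded T_def] s31[folded T_def] s32[folded T_def] by auto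
  also have "\<dots> \<longleftrightarrow> ?R1 \<and> ?R2 \<and> ?R3"
    unfolding R1 R2 R3 using v13[folded T_def] v23[folded T_def] v33[folded T_def] by simp
  finally show ?thesis .
qed


lemma unitriangular_inverse:
  fixes x y :: "'a::field mat"
  assumes x: "x \<in> unitriangular n" and y: "y \<in> carrier_mat n n" and xy: "x * y = 1\<^sub>m n"
  shows "y \<in> unitriangular n"
proof -
  have xc: "x \<in> carrier_mat n n" and xu: "\<And>i j. j < i \<Longrightarrow> i < n \<Longrightarrow> x $$ (i, j) = 0"
    and xd: "\<And>i. i < n \<Longrightarrow> x $$ (i, i) = 1"
    using x by (auto simp: unitriangular_def upper_triangular_def)
  have "j \<le> i \<longrightarrow> y $$ (i, j) = (if i = j then 1 else 0)" if "i < n" "j < n" for i j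
    using that
  proof (induction "n - i" arbitrary: i rule: less_induct)
    case less
    show ?case
    proof
      assume ji: "j \<le> i"
      have "(if i = j then 1 else 0) = (x * y) $$ (i, j)" using xy less.prems by simp
      also have "\<dots> = (\<Sum>k\<in>{0..<n}. x $$ (i, k) * y $$ (k, j))"
        using xc y less.prems by (simp add: scalar_prod_def)
      also have "\<dots> = (\<Sum>k\<in>{0..<n}. if k = i then y $$ (i, j) else 0)"
      proof (rule sum.cong[OF refl])
        fix k assume k: "k \<in> {0..<n}"
        consider "k < i" | "k = i" | "i < k" by linarith
        thus "x $$ (i, k) * y $$ (k, j) = (if k = i then y $$ (i, j) else 0)"
        proof cases
          case 3
          hence "y $$ (k, j) = 0" using less.hyps[of k] k ji less.prems by auto
          thus ?thesis using 3 by simp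
        qed (use xu xd less.prems in auto)
      qed
      also have "\<dots> = y $$ (i, j)" using less.prems by simp
      finally show "y $$ (i, j) = (if i = j then 1 else 0)" by simp
    qed
  qed
  thus ?thesis using y by (auto simp: unitriangular_def upper_triangular_def)
qed

lemma blk_unitriangular:
  fixes A :: "'a::field mat"
  assumes c: "A \<in> carrier_mat n n" "b \<in> carrier_mat n 1" "C \<in> carrier_mat n n" "d \<in> carrier_mat 1 n" "E \<in> carrier_mat n n"
    and "A \<in> unitriangular n" "E \<in> unitriangular n"
  shows "blk n A b C d E \<in> unitriangular (2*n+1)"
proof -
  note bi = blk_index[OF c]
  have main: "blk n A b C d E $$ (i, j) = (if i = j then 1 else 0)" if ij: "j \<le> i" "i < 2*n+1" for i j
  proof -
    have "i < n \<or> i = n \<or> (\<exists>i'. i = Suc (n + i') \<and> i' < n)" using ij by presburger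
    then consider "i < n" | "i = n" | i' where "i = Suc (n + i')" "i' < n" by blast
    thus ?thesis
    proof cases
      case 1 thus ?thesis using ij assms(6) by (auto simp: bi unitriangular_def upper_triangular_def)
    next
      case 2 thus ?thesis using ij by (cases "j = n") (auto simp: bi)
    next
      case 3
      have "j < n \<or> j = n \<or> (\<exists>j'. j = Suc (n + j') \<and> j' < n)" using ij by presburger
      then consider "j < n" | "j = n" | j' where "j = Suc (n + j')" "j' < n" by blast
      thus ?thesis using 3 ij assms(7) by cases (auto simp: bi unitriangular_def upper_triangular_def)
    qed
  qed
  show ?thesis unfolding unitriangular_def upper_triangular_def
    using bi(1) main by auto
qed

lemma unitriangular_blk:
  fixes g :: "'a::field mat"
  assumes g: "g \<in> unitriangular (2*n+1)"
  obtains A b C d E where "A \<in> unitriangular n" "A \<in> carrier_mat n n" "b \<in> carrier_mat n 1" "C \<in> carrier_mat n n"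
    "d \<in> carrier_mat 1 n" "E \<in> carrier_mat n n" "g = blk n A b C d E"
proof -
  define A where "A = mat n n (\<lambda>(i, j). g $$ (i, j))"
  define b where "b = mat n 1 (\<lambda>(i, j). g $$ (i, n))"
  define C where "C = mat n n (\<lambda>(i, j). g $$ (i, Suc (n + j)))"
  define d where "d = mat 1 n (\<lambda>(i, j). g $$ (n, Suc (n + j)))"
  define E where "E = mat n n (\<lambda>(i, j). g $$ (Suc (n + i), Suc (n + j)))"
  note defs = A_def b_def C_def d_def E_def
  have gc: "g \<in> carrier_mat (2*n+1) (2*n+1)"
    and gu: "\<And>i j. j < i \<Longrightarrow> i < 2*n+1 \<Longrightarrow> g $$ (i, j) = 0"
    and gd: "\<And>i. i < 2*n+1 \<Longrightarrow> g $$ (i, i) = 1"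
    using g by (auto simp: unitriangular_def upper_triangular_def)
  have "g = blk n A b C d E"
  proof (rule eq_matI)
    fix i j assume "i < dim_row (blk n A b C d E)" "j < dim_col (blk n A b C d E)"
    hence ij: "i < 2*n+1" "j < 2*n+1" by (auto simp: blk_def append_rows_def defs)
    show "g $$ (i, j) = blk n A b C d E $$ (i, j)"
    proof -
      show ?thesis using ij gu[of j i] gd[of i]
        by (cases "i = n"; cases "j = n") (auto simp: blk_def append_rows_def defs)
    qed
  qed (use gc in \<open>auto simp: blk_def append_rows_def defs\<close>)
  moreover have "A \<in> unitriangular n"
    using gu gd by (auto simp: unitriangular_def upper_triangular_def A_def)
  ultimately show thesis by (intro that[of A b C d E]) (auto simp: defs)
qed

lemma orthogonal_iff:
  fixes g :: "'a::field mat"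
  shows "g \<in> orthogonal k \<longleftrightarrow> g \<in> carrier_mat k k \<and> transpose_mat g * antidiag k * g = antidiag k"
proof
  assume "g \<in> orthogonal k"
  thus "g \<in> carrier_mat k k \<and> transpose_mat g * antidiag k * g = antidiag k"
    by (auto simp: orthogonal_def units_of_def Units_def ring_mat_def)
next
  assume *: "g \<in> carrier_mat k k \<and> transpose_mat g * antidiag k * g = antidiag k"
  let ?J = "antidiag k :: 'a mat" let ?h = "?J * (transpose_mat g * ?J)"
  have h: "?h \<in> carrier_mat k k" using * by auto
  have "?h * g = ?J * (transpose_mat g * ?J * g)"
    by (rule assoc_mult_mat[where ?n\<^sub>1=k and ?n\<^sub>2=k and ?n\<^sub>3=k and ?n\<^sub>4=k]) (use * in auto)
  hence "?h * g = 1\<^sub>m k" using * by simp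
  moreover from mat_mult_left_right_inverse[OF h _ this] have "g * ?h = 1\<^sub>m k" using * by blast
  ultimately show "g \<in> orthogonal k"
    using * h by (auto simp: orthogonal_def units_of_def Units_def ring_mat_def)
qed

lemma U_conditions:
  fixes x :: "'a::field mat"
  assumes x: "x \<in> carrier_mat n n" and y: "y \<in> carrier_mat n n" and yx: "y * x = 1\<^sub>m n"
    and u: "u \<in> carrier_mat n 1" and z: "z \<in> carrier_mat n n"
  defines "J \<equiv> antidiag n"
  defines "E \<equiv> J * transpose_mat y * J" and "d \<equiv> - (transpose_mat u * J)"
  shows "transpose_mat x * J * E = J"
    and "transpose_mat (x * u) * J * E = transpose_mat u * J"
    and "transpose_mat (x * z) * J * E + transpose_mat d * d + transpose_mat E * J * (x * z) = 0\<^sub>m n n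
       \<longleftrightarrow> J * transpose_mat z + z * J = - (u * transpose_mat u)"
proof -
  have J: "J \<in> carrier_mat n n" and JJ: "J * J = 1\<^sub>m n" and JT: "transpose_mat J = J" by (simp_all add: J_def)
  have yT: "transpose_mat y \<in> carrier_mat n n" and xT: "transpose_mat x \<in> carrier_mat n n" using x y by auto
  have E: "E \<in> carrier_mat n n" unfolding E_def by (rule mult_carrier_mat[OF mult_carrier_mat[OF J yT] J])
  have JE: "J * E = transpose_mat y * J"
  proof -
    have "J * E = J * (J * (transpose_mat y * J))" unfolding E_def using J yT by (simp add: assoc_mult_mat[OF J yT J])
    also have "\<dots> = J * J * (transpose_mat y * J)" by (rule assoc_mult_mat[symmetric, where ?n\<^sub>4=n]) (use J yT in auto)
    finally show ?thesis using J yT by (simp add: JJ)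
  qed
  have "transpose_mat x * J * E = transpose_mat x * (transpose_mat y * J)"
    unfolding assoc_mult_mat[OF xT J E] JE ..
  also have "\<dots> = transpose_mat (y * x) * J"
    unfolding transpose_mult[OF y x] assoc_mult_mat[OF xT yT J] ..
  also have "\<dots> = J" using J by (simp add: yx)
  finally show 1: "transpose_mat x * J * E = J" .
  have H: "transpose_mat (x * w) * J * E = transpose_mat w * J" if w: "w \<in> carrier_mat n m" for w m
  proof -
    have wT: "transpose_mat w \<in> carrier_mat m n" using w by simp
    have "transpose_mat (x * w) * J * E = transpose_mat w * transpose_mat x * (J * E)"
      unfolding transpose_mult[OF x w] by (rule assoc_mult_mat[where ?n\<^sub>4=n]) (use wT xT J E in auto)
    also have "\<dots> = transpose_mat w * (transpose_mat x * (J * E))"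
      by (rule assoc_mult_mat[where ?n\<^sub>4=n]) (use wT xT J E in auto)
    also have "transpose_mat x * (J * E) = J" using 1 assoc_mult_mat[OF xT J E] by simp
    finally show ?thesis .
  qed
  show "transpose_mat (x * u) * J * E = transpose_mat u * J" by (rule H[OF u])
  have uT: "transpose_mat u \<in> carrier_mat 1 n" and zT: "transpose_mat z \<in> carrier_mat n n" using u z by auto
  let ?uu = "u * transpose_mat u"
  have uu: "?uu \<in> carrier_mat n n" using u uT by auto
  have xz: "x * z \<in> carrier_mat n n" using x z by auto
  have t3: "transpose_mat E * J * (x * z) = J * z"
  proof -
    have "transpose_mat (transpose_mat (x * z) * J * E) = transpose_mat E * (J * (x * z))"
      using transpose_mult[of "transpose_mat (x*z) * J" n n E n] transpose_mult[of "transpose_mat (x*z)" n n J n] E J xz JT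
      by simp
    also have "\<dots> = transpose_mat E * J * (x * z)"
      by (rule assoc_mult_mat[symmetric, where ?n\<^sub>4=n]) (use E J xz in auto)
    finally show ?thesis unfolding H[OF z] using transpose_mult[OF zT J] JT by simp
  qed
  have t2: "transpose_mat d * d = J * (?uu * J)"
  proof -
    have uTJ: "transpose_mat u * J \<in> carrier_mat 1 n" using uT J by auto
    have "transpose_mat d * d = transpose_mat (transpose_mat u * J) * (transpose_mat u * J)"
      unfolding d_def using uTJ by (intro eq_matI) (auto simp: scalar_prod_def)
    also have "\<dots> = J * u * (transpose_mat u * J)"
      using transpose_mult[OF uT J] JT by simp
    also have "\<dots> = J * (u * (transpose_mat u * J))"
      by (rule assoc_mult_mat[where ?n\<^sub>4=n]) (use u J in auto)
    also have "u * (transpose_mat u * J) = ?uu * J"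
      by (rule assoc_mult_mat[symmetric, where ?n\<^sub>4=n]) (use u J in auto)
    finally show ?thesis .
  qed
  define M where "M = transpose_mat z * J + J * (?uu * J) + J * z"
  have M: "M \<in> carrier_mat n n" using zT J uu z by (auto simp: M_def)
  have Ji: "(J * B) $$ (i, j) = B $$ (n - 1 - i, j)" if "B \<in> carrier_mat n n" "i < n" "j < n" for B i j
    using that unfolding J_def by (rule antidiag_mult_index)
  have iJ: "(B * J) $$ (i, j) = B $$ (i, n - 1 - j)" if "B \<in> carrier_mat n n" "i < n" "j < n" for B i j
    using that unfolding J_def by (rule mult_antidiag_index)
  have M_ent: "M $$ (i, j) = z $$ (n - 1 - j, i) + ?uu $$ (n - 1 - i, n - 1 - j) + z $$ (n - 1 - i, j)"
    if "i < n" "j < n" for i j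
  proof -
    have "(J * (?uu * J)) $$ (i, j) = ?uu $$ (n - 1 - i, n - 1 - j)"
      using that uu J by (subst Ji) (auto simp del: index_mult_mat simp: iJ)
    moreover have "(transpose_mat z * J) $$ (i, j) = z $$ (n - 1 - j, i)"
      using that z zT by (subst iJ) auto
    moreover have "(J * z) $$ (i, j) = z $$ (n - 1 - i, j)" using that z by (subst Ji) auto
    moreover have "M $$ (i, j) = (transpose_mat z * J) $$ (i, j) + (J * (?uu * J)) $$ (i, j) + (J * z) $$ (i, j)"
      unfolding M_def using that J z uu by (simp del: index_mult_mat add: index_mult_mat(2,3))
    ultimately show ?thesis by simp
  qed
  have N_ent: "(J * transpose_mat z + z * J) $$ (i, j) = z $$ (j, n - 1 - i) + z $$ (i, n - 1 - j)"
    if "i < n" "j < n" for i j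
  proof -
    have "(J * transpose_mat z) $$ (i, j) = z $$ (j, n - 1 - i)"
      using that z zT by (subst Ji) auto
    moreover have "(z * J) $$ (i, j) = z $$ (i, n - 1 - j)" using that z by (subst iJ) auto
    moreover have "(J * transpose_mat z + z * J) $$ (i, j) = (J * transpose_mat z) $$ (i, j) + (z * J) $$ (i, j)"
      using that J z by (simp del: index_mult_mat add: index_mult_mat(2,3))
    ultimately show ?thesis by simp
  qed
  have "M = 0\<^sub>m n n \<longleftrightarrow> (\<forall>i<n. \<forall>j<n. M $$ (i, j) = 0)"
    by (subst mat_eq_carrier[OF M]) auto
  also have "\<dots> \<longleftrightarrow> (\<forall>i<n. \<forall>j<n. M $$ (n - 1 - i, j) = 0)"
  proof (intro iffI allI impI)
    fix i j assume *: "\<forall>i<n. \<forall>j<n. M $$ (n - 1 - i, j) = 0" "i < n" "j < n"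
    have "M $$ (n - 1 - (n - 1 - i), j) = 0" using * by (intro *(1)[rule_format]) auto
    thus "M $$ (i, j) = 0" using * by simp
  qed auto
  also have "\<dots> \<longleftrightarrow> (\<forall>i<n. \<forall>j<n. M $$ (n - 1 - i, n - 1 - j) = 0)"
  proof (intro iffI allI impI)
    fix i j assume *: "\<forall>i<n. \<forall>j<n. M $$ (n - 1 - i, n - 1 - j) = 0" "i < n" "j < n"
    have "M $$ (n - 1 - i, n - 1 - (n - 1 - j)) = 0" using * by (intro *(1)[rule_format]) auto
    thus "M $$ (n - 1 - i, j) = 0" using * by simp
  qed auto
  also have "\<dots> \<longleftrightarrow> (\<forall>i<n. \<forall>j<n. (J * transpose_mat z + z * J) $$ (i, j) = (- ?uu) $$ (i, j))"
  proof -
    have "M $$ (n - 1 - i, n - 1 - j) = 0 \<longleftrightarrow> (J * transpose_mat z + z * J) $$ (i, j) = (- ?uu) $$ (i, j)"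
      if "i < n" "j < n" for i j
    proof -
      have m: "(- ?uu) $$ (i, j) = - (?uu $$ (i, j))" by (rule index_uminus_mat(1)) (use that uu in auto)
      have "M $$ (n - 1 - i, n - 1 - j) = z $$ (j, n - 1 - i) + ?uu $$ (i, j) + z $$ (i, n - 1 - j)"
        using that by (subst M_ent) (auto simp del: index_mult_mat)
      moreover have "a + b + c = 0 \<longleftrightarrow> a + c = - b" for a b c :: 'a
        by (simp add: eq_neg_iff_add_eq_0 add.assoc add.commute[of b c])
      ultimately show ?thesis unfolding m N_ent[OF that] by (simp only:)
    qed
    thus ?thesis by simp
  qed
  also have "\<dots> \<longleftrightarrow> J * transpose_mat z + z * J = - ?uu"
    by (rule mat_eq_carrier[symmetric]) (use J z uu in auto)
  finally show "transpose_mat (x * z) * J * E + transpose_mat d * d + transpose_mat E * J * (x * z) = 0\<^sub>m n n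
       \<longleftrightarrow> J * transpose_mat z + z * J = - (u * transpose_mat u)"
    unfolding H[OF z] t2 t3 M_def .
qed

theorem U_set_explicit:
  "U_set n = {four_block_mat (four_block_mat x (x * u) (0\<^sub>m 1 n) (1\<^sub>m 1))
                             ((x * z) @\<^sub>r (- (transpose_mat u * antidiag n)))
                             (0\<^sub>m n (n + 1)) (antidiag n * transpose_mat y * antidiag n)
     | x y u z :: 'a::field mat.
         x \<in> unitriangular n \<and> y \<in> carrier_mat n n \<and> x * y = 1\<^sub>m n \<and> y * x = 1\<^sub>m n \<and>
         u \<in> carrier_mat n 1 \<and> z \<in> carrier_mat n n \<and>
         antidiag n * transpose_mat z + z * antidiag n = - (u * transpose_mat u)}"
  (is "_ = ?S")
proof (intro Set.set_eqI iffI)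
  fix g :: "'a mat"
  let ?J = "antidiag n :: 'a mat"
  assume "g \<in> U_set n"
  hence gu: "g \<in> unitriangular (2*n+1)" and go: "transpose_mat g * antidiag (2*n+1) * g = antidiag (2*n+1)"
    by (auto simp: U_set_def orthogonal_iff)
  obtain A b C d E where Au: "A \<in> unitriangular n"
    and c: "A \<in> carrier_mat n n" "b \<in> carrier_mat n 1" "C \<in> carrier_mat n n" "d \<in> carrier_mat 1 n" "E \<in> carrier_mat n n"
    and g: "g = blk n A b C d E" by (rule unitriangular_blk[OF gu])
  from go[unfolded g blk_form[OF c]]
  have R1: "transpose_mat A * ?J * E = ?J" and R2: "transpose_mat b * ?J * E + d = 0\<^sub>m 1 n"
    and R3: "transpose_mat C * ?J * E + transpose_mat d * d + transpose_mat E * ?J * C = 0\<^sub>m n n" by auto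
  have AT: "transpose_mat A \<in> carrier_mat n n" and J: "?J \<in> carrier_mat n n" using c by auto
  define y where "y = transpose_mat (?J * E * ?J)"
  have y: "y \<in> carrier_mat n n" unfolding y_def transpose_carrier_mat by (rule mult_carrier_mat[OF mult_carrier_mat[OF J c(5)] J])
  have yT: "transpose_mat y = ?J * E * ?J" by (simp add: y_def)
  have "transpose_mat A * (?J * E * ?J) = transpose_mat A * (?J * E) * ?J"
    by (rule assoc_mult_mat[symmetric, where ?n\<^sub>4=n]) (use c in auto)
  also have "transpose_mat A * (?J * E) = ?J" using R1 assoc_mult_mat[OF AT J c(5)] by simp
  finally have "transpose_mat A * transpose_mat y = 1\<^sub>m n" by (simp add: yT)
  hence "transpose_mat (y * A) = transpose_mat (1\<^sub>m n)" using transpose_mult[OF y c(1)] by simp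
  hence "transpose_mat (transpose_mat (y * A)) = transpose_mat (transpose_mat (1\<^sub>m n))" by (rule arg_cong)
  hence yA: "y * A = 1\<^sub>m n" unfolding transpose_transpose .
  have Ay: "A * y = 1\<^sub>m n" by (rule mat_mult_left_right_inverse[OF y c(1) yA])
  have Ee: "E = ?J * transpose_mat y * ?J"
  proof -
    have "?J * (?J * E * ?J) * ?J = ?J * (?J * E) * ?J * ?J"
      by (subst assoc_mult_mat[symmetric, where ?n\<^sub>1=n and ?n\<^sub>2=n and ?n\<^sub>3=n and ?n\<^sub>4=n]) (use c in auto)
    also have "\<dots> = ?J * (?J * E) * (?J * ?J)"
      by (rule assoc_mult_mat[where ?n\<^sub>4=n]) (use c in auto)
    also have "\<dots> = ?J * (?J * E)" using c by simp
    also have "\<dots> = ?J * ?J * E"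
      by (rule assoc_mult_mat[symmetric, where ?n\<^sub>4=n]) (use c in auto)
    finally show ?thesis using c by (simp add: yT)
  qed
  define u where "u = y * b" define z where "z = y * C"
  have u: "u \<in> carrier_mat n 1" and z: "z \<in> carrier_mat n n" using y c by (auto simp: u_def z_def)
  have b: "b = A * u" unfolding u_def using assoc_mult_mat[OF c(1) y c(2)] Ay c by simp
  have C: "C = A * z" unfolding z_def using assoc_mult_mat[OF c(1) y c(3)] Ay c by simp
  note cond = U_conditions[OF c(1) y yA u z, folded Ee]
  have uJ: "transpose_mat u * ?J \<in> carrier_mat 1 n" using u by auto
  have d: "d = - (transpose_mat u * ?J)"
  proof (rule eq_matI)
    fix i j assume "i < dim_row (- (transpose_mat u * ?J))" "j < dim_col (- (transpose_mat u * ?J))"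
    hence ij: "i < 1" "j < n" using uJ by auto
    have "(transpose_mat u * ?J + d) $$ (i, j) = 0" using R2[unfolded b cond(2)] ij by simp
    moreover have "(transpose_mat u * ?J + d) $$ (i, j) = (transpose_mat u * ?J) $$ (i, j) + d $$ (i, j)"
      using ij c by simp
    moreover have "(- (transpose_mat u * ?J)) $$ (i, j) = - ((transpose_mat u * ?J) $$ (i, j))"
      by (rule index_uminus_mat(1)) (use ij uJ in auto)
    ultimately show "d $$ (i, j) = (- (transpose_mat u * ?J)) $$ (i, j)"
      by (simp only: minus_unique)
  qed (use c uJ in auto)
  have "?J * transpose_mat z + z * ?J = - (u * transpose_mat u)"
    using R3 unfolding C d cond(3) .
  moreover have "g = four_block_mat (four_block_mat A (A * u) (0\<^sub>m 1 n) (1\<^sub>m 1))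
      ((A * z) @\<^sub>r (- (transpose_mat u * ?J))) (0\<^sub>m n (n + 1)) (?J * transpose_mat y * ?J)"
    using g unfolding blk_def b[symmetric] C[symmetric] d[symmetric] Ee[symmetric] .
  ultimately show "g \<in> ?S" unfolding mem_Collect_eq using Au y Ay yA u z by (intro exI conjI)
next
  fix g :: "'a mat"
  let ?J = "antidiag n :: 'a mat"
  assume "g \<in> ?S"
  then obtain x y u z where g: "g = blk n x (x * u) (x * z) (- (transpose_mat u * ?J)) (?J * transpose_mat y * ?J)"
    and x: "x \<in> unitriangular n" and y: "y \<in> carrier_mat n n" and xy: "x * y = 1\<^sub>m n" and yx: "y * x = 1\<^sub>m n"
    and u: "u \<in> carrier_mat n 1" and z: "z \<in> carrier_mat n n"
    and zz: "?J * transpose_mat z + z * ?J = - (u * transpose_mat u)"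
    unfolding mem_Collect_eq blk_def[symmetric] by (elim exE conjE)
  have xc: "x \<in> carrier_mat n n" using x by (simp add: unitriangular_def)
  have yu: "y \<in> unitriangular n" by (rule unitriangular_inverse[OF x y xy])
  let ?E = "?J * transpose_mat y * ?J"
  have Eu: "?E \<in> unitriangular n"
  proof -
    have "?E $$ (i, j) = y $$ (n - 1 - j, n - 1 - i)" if "i < n" "j < n" for i j
    proof -
      have "?E $$ (i, j) = (?J * transpose_mat y) $$ (i, n - 1 - j)"
        by (rule mult_antidiag_index) (use that y in auto)
      also have "\<dots> = transpose_mat y $$ (n - 1 - i, n - 1 - j)"
        by (rule antidiag_mult_index) (use that y in auto)
      finally show ?thesis using that y by simp
    qed
    note ent = this
    have Ec: "?E \<in> carrier_mat n n" using y by auto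
    have y0: "y $$ (i, j) = 0" if "j < i" "i < n" for i j
      using yu that by (auto simp: unitriangular_def upper_triangular_def)
    have y1: "y $$ (i, i) = 1" if "i < n" for i using yu that by (simp add: unitriangular_def)
    have "?E $$ (i, j) = 0" if "j < i" "i < n" for i j
      unfolding ent[OF that(2) less_trans[OF that]] by (rule y0) (use that in auto)
    moreover have "?E $$ (i, i) = 1" if "i < n" for i
      unfolding ent[OF that that] by (rule y1) (use that in auto)
    ultimately show ?thesis
      unfolding unitriangular_def upper_triangular_def using Ec carrier_matD(1)[OF Ec]
      by (simp del: index_mult_mat)
  qed
  have c: "x * u \<in> carrier_mat n 1" "x * z \<in> carrier_mat n n" "- (transpose_mat u * ?J) \<in> carrier_mat 1 n"
    "?E \<in> carrier_mat n n" using xc y u z by auto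
  note cond = U_conditions[OF xc y yx u z]
  have uJ: "transpose_mat u * ?J \<in> carrier_mat 1 n" using u by auto
  have "transpose_mat g * antidiag (2*n+1) * g = antidiag (2*n+1)"
    unfolding g blk_form[OF xc c] cond(3) cond(1,2) using zz add_uminus_minus_mat[OF uJ uJ] minus_r_inv_mat[OF uJ] by simp
  moreover have "g \<in> unitriangular (2*n+1)" unfolding g by (rule blk_unitriangular[OF xc c x Eu])
  moreover hence "g \<in> carrier_mat (2*n+1) (2*n+1)" by (simp add: unitriangular_def)
  ultimately show "g \<in> U_set n" by (simp add: U_set_def orthogonal_iff)
qed

end

theory Submission
  imports Defs "HOL-Library.Function_Algebras"
begin

text \<open>The unipotent group acts on an orthogonal space with basis \<open>e\<^sub>l\<close>, \<open>l\<close> a signed index.  The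
  Siegel-Eichler transformations attached to \<open>e\<^sub>1\<close> form an abelian normal subgroup, complemented by
  the stabiliser of \<open>e\<^sub>1\<close>, which is a group of the same kind on the nonzero indices other than
  \<open>1, -1\<close>.  Decomposing a representation into weights of this normal subgroup and inducing from the
  stabiliser of a weight shows by induction that a nonzero invariant subspace contains a nonzero
  invariant subspace of dimension at most \<open>q\<^bsup>n(n-1)/2\<^esup>\<close>, and at most \<open>q\<^bsup>n(n-1)/2-1\<^esup>\<close> if the first
  root subgroups act trivially.  Conversely, a weight with nonzero component in direction \<open>\<epsilon>\<^sub>1 + \<epsilon>\<^sub>2\<close>
  has an orbit of the largest possible size.

  If \<open>\<chi>\<close> is a constituent of \<open>\<xi>\<^bsub>D,\<phi>\<^esub>\<close>, then averaging a vector against the linear characters of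
  \<open>\<epsilon>\<^sub>1 + \<epsilon>\<^sub>2, \<epsilon>\<^sub>3 + \<epsilon>\<^sub>4, \<dots>\<close>, as far as these roots belong to \<open>D\<close>, yields a simultaneous eigenvector.
  It fixes the weights for the first steps of the induction, and the first root of this chain which
  is missing from \<open>D\<close> decides whether the largest degree is attained.\<close>

section \<open>Vectors with signed indices\<close>

text \<open>A weight for \<epsilon>_1 + \<epsilon>_2 has an orbit of q^(2n-3) elements, and its
  stabiliser in the complement is the group of rank n-2. As 2n-3 is the difference of the values of
  n(n-1)/2 at n and n-2, such weights exhaust the bound. Every other weight loses a factor q, with
  one exception: a weight for \<epsilon>_1 has a stabiliser of type D and rank n-1, whose exponent
  is smaller than that of type B except in rank at most 1. Hence \<epsilon>_{n-1} may replace
  \<epsilon>_{n-1} + \<epsilon>_n at the end of the chain.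

  The supercharacter is a product of induced characters, and a vector averaged against it is in
  general not an eigenvector. So the factors of the chain are replaced one by one by the linear
  characters they are induced from. The product then ceases to be a class function, but remains
  invariant under the group of the next block, in which the next conjugating element can be chosen.

  Upper bounds come from finite spanning sets, lower bounds from independent families. That some
  irreducible character reaches the bound is shown separately, inside the regular
  representation.\<close>

definition scl :: "'b::times \<Rightarrow> ('i \<Rightarrow> 'b) \<Rightarrow> 'i \<Rightarrow> 'b" where
  "scl c v = (\<lambda>i. c * v i)"

definition bas :: "'i \<Rightarrow> 'i \<Rightarrow> 'b::{zero,one}" where
  "bas i = (\<lambda>j. if j = i then 1 else 0)"

text \<open>The span of the basis vectors with index in \<open>I\<close>, kept as total functions
  vanishing off \<open>I\<close>. The subspaces for different \<open>I\<close> then live in one type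
  and are compared by inclusion.\<close>

definition vecs :: "'i set \<Rightarrow> ('i \<Rightarrow> 'b::zero) set" where
  "vecs I = {v. \<forall>i. i \<notin> I \<longrightarrow> v i = 0}"

definition bil :: "nat \<Rightarrow> (int \<Rightarrow> 'a::field) \<Rightarrow> (int \<Rightarrow> 'a) \<Rightarrow> 'a" where
  "bil n v w = (\<Sum>i\<in>labels n. v i * w (- i))"

definition app :: "nat \<Rightarrow> 'a::field mat \<Rightarrow> (int \<Rightarrow> 'a) \<Rightarrow> int \<Rightarrow> 'a" where
  "app n x v = (\<lambda>i. if i \<in> labels n then \<Sum>j\<in>labels n. ent n x i j * v j else 0)"

lemma scl_apply [simp]: "scl c v i = c * v i"
  by (simp add: scl_def)

lemma bas_apply: "bas i j = (if j = i then 1 else 0)"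
  by (simp add: bas_def)

lemma bas_same [simp]: "bas i i = 1"
  and bas_other [simp]: "j \<noteq> i \<Longrightarrow> bas i j = 0"
  by (simp_all add: bas_def)

lemma vecs_D: "v \<in> vecs I \<Longrightarrow> i \<notin> I \<Longrightarrow> v i = 0"
  by (simp add: vecs_def)

lemma vecs_I: "(\<And>i. i \<notin> I \<Longrightarrow> v i = 0) \<Longrightarrow> v \<in> vecs I"
  by (simp add: vecs_def)

lemma vecs_mono: "I \<subseteq> J \<Longrightarrow> vecs I \<subseteq> vecs J"
  by (auto simp: vecs_def)

lemma vecs_add: "v \<in> vecs I \<Longrightarrow> w \<in> vecs I \<Longrightarrow> (v + w :: 'i \<Rightarrow> 'b::monoid_add) \<in> vecs I"
  and vecs_diff: "v' \<in> vecs I \<Longrightarrow> w' \<in> vecs I \<Longrightarrow> (v' - w' :: 'i \<Rightarrow> 'c::group_add) \<in> vecs I"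
  and vecs_uminus: "v' \<in> vecs I \<Longrightarrow> (- v' :: 'i \<Rightarrow> 'c::group_add) \<in> vecs I"
  and vecs_scl: "u \<in> vecs I \<Longrightarrow> (scl c u :: 'i \<Rightarrow> 'd::mult_zero) \<in> vecs I"
  and vecs_zero: "(0 :: 'i \<Rightarrow> 'b::monoid_add) \<in> vecs I"
  by (auto simp: vecs_def)

lemma vecs_bas: "i \<in> I \<Longrightarrow> bas i \<in> vecs I"
  by (auto simp: vecs_def bas_def)

lemma scl_one [simp]: "scl (1::'b::monoid_mult) v = v"
  by (auto simp: scl_def)

lemma finite_labels [simp]: "finite (labels n)"
  by (simp add: labels_def)

lemma uminus_labels [simp]: "- i \<in> labels n \<longleftrightarrow> i \<in> labels n"
  by (auto simp: labels_def)

lemma zero_labels [simp]: "0 \<in> labels n"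
  by (simp add: labels_def)

lemma card_vecs:
  assumes "finite I"
  shows "finite (vecs I :: ('i \<Rightarrow> 'b::{finite,zero}) set)"
    and "card (vecs I :: ('i \<Rightarrow> 'b) set) = CARD('b) ^ card I"
proof -
  let ?r = "\<lambda>v::'i \<Rightarrow> 'b. restrict v I"
  have b: "bij_betw ?r (vecs I) (I \<rightarrow>\<^sub>E UNIV)"
    by (rule bij_betw_byWitness[where f' = "\<lambda>f i. if i \<in> I then f i else 0"])
       (auto simp: vecs_def fun_eq_iff PiE_def extensional_def)
  have f: "finite (I \<rightarrow>\<^sub>E (UNIV::'b set))"
    by (rule finite_PiE) (use assms in auto)
  show "finite (vecs I :: ('i \<Rightarrow> 'b) set)" using bij_betw_finite[OF b] f by simp
  show "card (vecs I :: ('i \<Rightarrow> 'b) set) = CARD('b) ^ card I"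
    using bij_betw_same_card[OF b] card_PiE[OF assms, of "\<lambda>_. UNIV::'b set"] by simp
qed

section \<open>Labels and their positions in the order\<close>

definition lab :: "nat \<Rightarrow> nat \<Rightarrow> int" where
  "lab n p = (if p < n then int p + 1 else if p = n then 0 else int p - int (2 * n + 1))"

lemma lab_pos [simp]: "i \<in> labels n \<Longrightarrow> lab n (pos n i) = i"
  by (auto simp: lab_def pos_def labels_def)

lemma pos_lab [simp]: "p < 2 * n + 1 \<Longrightarrow> pos n (lab n p) = p"
  by (auto simp: lab_def pos_def labels_def)

lemma pos_less [simp]: "i \<in> labels n \<Longrightarrow> pos n i < Suc (2 * n)"
  by (auto simp: pos_def labels_def)

lemma lab_labels [simp]: "p < 2 * n + 1 \<Longrightarrow> lab n p \<in> labels n"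
  by (auto simp: lab_def labels_def)

lemma pos_uminus: "i \<in> labels n \<Longrightarrow> pos n (- i) = 2 * n - pos n i"
  by (auto simp: pos_def labels_def)

lemma pos_eq_iff: "i \<in> labels n \<Longrightarrow> j \<in> labels n \<Longrightarrow> pos n i = pos n j \<longleftrightarrow> i = j"
  by (metis lab_pos)

lemma pos_less_iff:
  assumes "i \<in> labels n" "j \<in> labels n"
  shows "pos n i < pos n j \<longleftrightarrow> (if 0 < i then j \<le> 0 \<or> i < j else if i = 0 then j < 0 else i < j \<and> j < 0)"
  using assms by (auto simp: pos_def labels_def)

lemma sum_labels_pos: "(\<Sum>i\<in>labels n. f (pos n i)) = (\<Sum>p<2*n+1. f p)"
  by (rule sum.reindex_bij_witness[where i="lab n" and j="pos n"]) auto

lemma sum_labels_uminus: "(\<Sum>i\<in>labels n. f (- i)) = (\<Sum>i\<in>labels n. f i)"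
  by (rule sum.reindex_bij_witness[where i=uminus and j=uminus]) auto

section \<open>Matrices acting on labelled vectors\<close>

lemma ent_mult:
  fixes x y :: "'a::field mat"
  assumes "x \<in> carrier_mat (2*n+1) (2*n+1)" "y \<in> carrier_mat (2*n+1) (2*n+1)"
    and "i \<in> labels n" "j \<in> labels n"
  shows "ent n (x * y) i j = (\<Sum>k\<in>labels n. ent n x i k * ent n y k j)"
  unfolding ent_def sum_labels_pos[of "\<lambda>p. x $$ (pos n i, p) * y $$ (p, pos n j)"]
  using assms by (simp add: scalar_prod_def atLeast0LessThan)

lemma ent_one:
  assumes "i \<in> labels n" "j \<in> labels n"
  shows "ent n (1\<^sub>m (Suc (2*n))) i j = (if i = j then 1 else 0)"
  using assms by (simp add: ent_def pos_eq_iff)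

lemma mat_eq_entI:
  assumes "x \<in> carrier_mat (2*n+1) (2*n+1)" "y \<in> carrier_mat (2*n+1) (2*n+1)"
    and "\<And>i j. i \<in> labels n \<Longrightarrow> j \<in> labels n \<Longrightarrow> ent n x i j = ent n y i j"
  shows "x = y"
proof (rule eq_matI)
  fix i j assume ij: "i < dim_row y" "j < dim_col y"
  show "x $$ (i, j) = y $$ (i, j)"
    using assms(3)[of "lab n i" "lab n j"] ij assms(1,2) by (simp add: ent_def)
qed (use assms in auto)

lemma app_vecs [simp]: "app n x v \<in> vecs (labels n)"
  by (simp add: vecs_def app_def)

lemma app_add: "app n x (v + w) = app n x v + app n x w"
  by (auto simp: app_def algebra_simps sum.distrib)

lemma app_diff: "app n x (v - w) = app n x v - app n x w"
  by (auto simp: app_def algebra_simps sum_subtractf)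

lemma app_scl: "app n x (scl c v) = scl c (app n x v)"
  by (auto simp: app_def algebra_simps sum_distrib_left)

lemma app_zero [simp]: "app n x 0 = 0"
  by (auto simp: app_def)

lemma sum_bas:
  assumes "finite I" "j \<in> I"
  shows "(\<Sum>i\<in>I. f i * bas j i) = (f j :: 'b::semiring_1)"
    and "(\<Sum>i\<in>I. bas j i * f i) = (f j :: 'b::semiring_1)"
  using assms by (simp_all add: bas_def if_distrib if_distribR cong: if_cong)

lemma app_bas: "i \<in> labels n \<Longrightarrow> j \<in> labels n \<Longrightarrow> app n x (bas j) i = ent n x i j"
  by (simp add: app_def sum_bas)

lemma app_mult:
  fixes x y :: "'a::field mat"
  assumes "x \<in> carrier_mat (2*n+1) (2*n+1)" "y \<in> carrier_mat (2*n+1) (2*n+1)"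
  shows "app n (x * y) v = app n x (app n y v)"
proof
  fix i
  have "(\<Sum>j\<in>labels n. (\<Sum>k\<in>labels n. ent n x i k * ent n y k j) * v j) =
     (\<Sum>k\<in>labels n. ent n x i k * (\<Sum>j\<in>labels n. ent n y k j * v j))"
    unfolding sum_distrib_left sum_distrib_right
    by (subst sum.swap) (simp add: mult.assoc)
  thus "app n (x * y) v i = app n x (app n y v) i"
    using ent_mult[OF assms, of i] by (auto simp: app_def cong: sum.cong)
qed

lemma app_one: "v \<in> vecs (labels n) \<Longrightarrow> app n (1\<^sub>m (Suc (2*n))) v = v"
  by (auto simp: app_def ent_one vecs_def fun_eq_iff if_distrib[of "\<lambda>c. c * _"] cong: if_cong sum.cong)

lemma mat_eq_appI:
  fixes x y :: "'a::field mat"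
  assumes "x \<in> carrier_mat (2*n+1) (2*n+1)" "y \<in> carrier_mat (2*n+1) (2*n+1)"
    and "\<And>j. j \<in> labels n \<Longrightarrow> app n x (bas j) = app n y (bas j)"
  shows "x = y"
  by (rule mat_eq_entI[OF assms(1,2)]) (metis app_bas assms(3))

section \<open>The symmetric form and isometries\<close>

lemma bil_add_left: "bil n (u + v) w = bil n u w + bil n v w"
  and bil_add_right: "bil n w (u + v) = bil n w u + bil n w v"
  and bil_diff_left: "bil n (u - v) w = bil n u w - bil n v w"
  and bil_diff_right: "bil n w (u - v) = bil n w u - bil n w v"
  and bil_scl_left: "bil n (scl c u) w = c * bil n u w"
  and bil_scl_right: "bil n w (scl c u) = c * bil n w u"
  and bil_uminus_left: "bil n (- u) w = - bil n u w"
  and bil_uminus_right: "bil n w (- u) = - bil n w u"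
  and bil_zero_left: "bil n 0 w = 0"
  and bil_zero_right: "bil n w 0 = 0"
  by (simp_all add: bil_def algebra_simps sum.distrib sum_subtractf sum_distrib_left sum_negf)

lemmas bil_lin = bil_add_left bil_add_right bil_diff_left bil_diff_right bil_scl_left bil_scl_right
  bil_uminus_left bil_uminus_right bil_zero_left bil_zero_right

lemma bil_commute: "bil n v w = bil n w v"
  unfolding bil_def by (subst sum_labels_uminus[symmetric]) (simp add: mult.commute)

lemma bil_bas_left: "j \<in> labels n \<Longrightarrow> bil n (bas j) v = v (- j)"
  by (simp add: bil_def sum_bas)

lemma bil_bas_right: "j \<in> labels n \<Longrightarrow> bil n v (bas j) = v (- j)"
  by (simp add: bil_commute[of n v] bil_bas_left)

text \<open>\<open>antidiag\<close> pairs position p with 2n - p, which on labels is negation, so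
  the entry of the matrix product at (i, j) is the form on columns i and j. The matrix identity thus
  becomes preservation of \<open>bil\<close>.\<close>

lemma orth_sum_iff:
  fixes x :: "'a::field mat"
  assumes x: "x \<in> carrier_mat (2*n+1) (2*n+1)"
  shows "transpose_mat x * antidiag (2*n+1) * x = antidiag (2*n+1) \<longleftrightarrow>
    (\<forall>i\<in>labels n. \<forall>j\<in>labels n. bil n (app n x (bas i)) (app n x (bas j)) = bil n (bas i) (bas j))"
proof -
  let ?P = "transpose_mat x * antidiag (2*n+1) * x"
  have P: "?P \<in> carrier_mat (2*n+1) (2*n+1)" using x by auto
  have e: "ent n ?P i j = bil n (app n x (bas i)) (app n x (bas j))"
    if ij: "i \<in> labels n" "j \<in> labels n" for i j
  proof -
    have "ent n ?P i j = (\<Sum>l<2*n+1. x $$ (l, pos n i) * x $$ (2*n+1 - 1 - l, pos n j))"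
      unfolding ent_def by (rule tJ_index[OF x x]) (use ij in auto)
    also have "\<dots> = (\<Sum>k\<in>labels n. x $$ (pos n k, pos n i) * x $$ (2*n - pos n k, pos n j))"
      by (subst sum_labels_pos[symmetric]) simp
    also have "\<dots> = bil n (app n x (bas i)) (app n x (bas j))"
      unfolding bil_def by (rule sum.cong[OF refl]) (use ij in \<open>simp add: app_bas ent_def pos_uminus\<close>)
    finally show ?thesis .
  qed
  have a: "ent n (antidiag (2*n+1) :: 'a mat) i j = bil n (bas i) (bas j)"
    if ij: "i \<in> labels n" "j \<in> labels n" for i j
  proof -
    have "pos n i + pos n j = 2 * n \<longleftrightarrow> pos n (- i) = pos n j"
      using pos_less[OF ij(1)] pos_less[OF ij(2)] pos_uminus[OF ij(1)] by linarith
    also have "\<dots> \<longleftrightarrow> - i = j" by (rule pos_eq_iff) (use ij in auto)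
    finally show ?thesis using ij pos_less[OF ij(1)] pos_less[OF ij(2)]
      by (auto simp: ent_def antidiag_def bil_bas_left bas_apply)
  qed
  show ?thesis
  proof
    assume "?P = antidiag (2*n+1)"
    thus "\<forall>i\<in>labels n. \<forall>j\<in>labels n. bil n (app n x (bas i)) (app n x (bas j)) = bil n (bas i) (bas j)"
      using e a by metis
  next
    assume "\<forall>i\<in>labels n. \<forall>j\<in>labels n. bil n (app n x (bas i)) (app n x (bas j)) = bil n (bas i) (bas j)"
    thus "?P = antidiag (2*n+1)"
      by (intro mat_eq_entI[OF P antidiag_carrier]) (metis e a)
  qed
qed

lemma unitriangular_ent_iff:
  fixes x :: "'a::field mat"
  assumes x: "x \<in> carrier_mat (2*n+1) (2*n+1)"
  shows "x \<in> unitriangular (2*n+1) \<longleftrightarrow> (\<forall>i\<in>labels n. ent n x i i = 1) \<and>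
     (\<forall>i\<in>labels n. \<forall>j\<in>labels n. pos n j < pos n i \<longrightarrow> ent n x i j = 0)"
proof
  assume "x \<in> unitriangular (2*n+1)"
  thus "(\<forall>i\<in>labels n. ent n x i i = 1) \<and>
     (\<forall>i\<in>labels n. \<forall>j\<in>labels n. pos n j < pos n i \<longrightarrow> ent n x i j = 0)"
    by (auto simp: unitriangular_def ent_def upper_triangular_def)
next
  assume *: "(\<forall>i\<in>labels n. ent n x i i = 1) \<and>
     (\<forall>i\<in>labels n. \<forall>j\<in>labels n. pos n j < pos n i \<longrightarrow> ent n x i j = 0)"
  have "x $$ (p, q) = 0" if "q < p" "p < 2*n+1" for p q
    using *[THEN conjunct2, rule_format, of "lab n p" "lab n q"] that by (simp add: ent_def)
  moreover have "x $$ (p, p) = 1" if "p < 2*n+1" for p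
    using *[THEN conjunct1, rule_format, of "lab n p"] that by (simp add: ent_def)
  ultimately show "x \<in> unitriangular (2*n+1)"
    using x by (auto simp: unitriangular_def upper_triangular_def)
qed

lemma U_set_iff:
  fixes x :: "'a::field mat"
  shows "x \<in> U_set n \<longleftrightarrow> x \<in> carrier_mat (2*n+1) (2*n+1) \<and> (\<forall>i\<in>labels n. ent n x i i = 1) \<and>
     (\<forall>i\<in>labels n. \<forall>j\<in>labels n. pos n j < pos n i \<longrightarrow> ent n x i j = 0) \<and>
     (\<forall>i\<in>labels n. \<forall>j\<in>labels n. bil n (app n x (bas i)) (app n x (bas j)) = bil n (bas i) (bas j))"
proof -
  have "x \<in> U_set n \<longleftrightarrow> x \<in> carrier_mat (2*n+1) (2*n+1) \<and> x \<in> unitriangular (2*n+1) \<and>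
    transpose_mat x * antidiag (2*n+1) * x = antidiag (2*n+1)"
    by (auto simp: U_set_def orthogonal_iff)
  thus ?thesis using unitriangular_ent_iff[of x n] orth_sum_iff[of x n] by blast
qed

lemma U_carrier: "x \<in> U_set n \<Longrightarrow> x \<in> carrier_mat (2*n+1) (2*n+1)"
  by (simp add: U_set_iff)

lemma U_ent_diag: "x \<in> U_set n \<Longrightarrow> i \<in> labels n \<Longrightarrow> ent n x i i = 1"
  by (simp add: U_set_iff)

lemma U_ent_below:
  "x \<in> U_set n \<Longrightarrow> i \<in> labels n \<Longrightarrow> j \<in> labels n \<Longrightarrow> pos n j < pos n i \<Longrightarrow> ent n x i j = 0"
  by (simp add: U_set_iff)

lemma sum_fun_apply: "sum f J i = (\<Sum>j\<in>J. f j i)"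
  by (induction J rule: infinite_finite_induct) auto

lemma lvec_expand:
  assumes "v \<in> vecs (labels n)"
  shows "v = (\<Sum>j\<in>labels n. scl (v j) (bas j) :: int \<Rightarrow> 'a::field)"
proof
  fix i
  have "(\<Sum>j\<in>labels n. scl (v j) (bas j)) i = (\<Sum>j\<in>labels n. v j * bas j i)"
    by (induction rule: finite_induct[OF finite_labels[of n]]) auto
  also have "\<dots> = (\<Sum>j\<in>labels n. v j * bas i j)" by (intro sum.cong) (auto simp: bas_def)
  also have "\<dots> = v i" using assms vecs_D[OF assms, of i]
    by (cases "i \<in> labels n") (auto simp: sum_bas, auto simp: bas_def intro!: sum.neutral)
  finally show "v i = (\<Sum>j\<in>labels n. scl (v j) (bas j)) i" ..
qed

lemma app_expand:
  assumes "v \<in> vecs (labels n)"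
  shows "app n x v = (\<Sum>j\<in>labels n. scl (v j) (app n x (bas j)))"
proof
  fix i
  have "(\<Sum>j\<in>labels n. scl (v j) (app n x (bas j))) i = (\<Sum>j\<in>labels n. v j * app n x (bas j) i)"
    by (induction rule: finite_induct[OF finite_labels[of n]]) auto
  thus "app n x v i = (\<Sum>j\<in>labels n. scl (v j) (app n x (bas j))) i"
    by (cases "i \<in> labels n") (auto simp: app_bas app_def mult.commute sum_bas intro!: sum.cong)
qed

lemma bil_sum_left: "bil n (\<Sum>j\<in>J. f j) w = (\<Sum>j\<in>J. bil n (f j) w)"
  unfolding bil_def sum_fun_apply sum_distrib_right by (rule sum.swap)

lemma bil_sum_right: "bil n w (\<Sum>j\<in>J. f j) = (\<Sum>j\<in>J. bil n w (f j))"
  unfolding bil_def sum_fun_apply sum_distrib_left by (rule sum.swap)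

lemma bil_app:
  fixes x :: "'a::field mat"
  assumes x: "x \<in> U_set n" and v: "v \<in> vecs (labels n)" and w: "w \<in> vecs (labels n)"
  shows "bil n (app n x v) (app n x w) = bil n v w"
proof -
  have *: "bil n (app n x (bas i)) (app n x (bas j)) = bil n (bas i) (bas j)"
    if "i \<in> labels n" "j \<in> labels n" for i j
    using x that by (simp add: U_set_iff)
  have "bil n v w = bil n (\<Sum>i\<in>labels n. scl (v i) (bas i)) (\<Sum>j\<in>labels n. scl (w j) (bas j))"
    using lvec_expand[OF v] lvec_expand[OF w] by simp
  also have "\<dots> = (\<Sum>i\<in>labels n. \<Sum>j\<in>labels n. v i * (w j * bil n (bas i) (bas j)))"
    by (simp add: bil_sum_left bil_scl_left) (simp add: bil_sum_right bil_scl_right sum_distrib_left)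
  also have "\<dots> = (\<Sum>i\<in>labels n. \<Sum>j\<in>labels n. v i * (w j * bil n (app n x (bas i)) (app n x (bas j))))"
    by (intro sum.cong refl) (simp add: *)
  also have "\<dots> = bil n (app n x v) (app n x w)"
    unfolding app_expand[OF v] app_expand[OF w] 
    by (simp add: bil_sum_left bil_scl_left) (simp add: bil_sum_right bil_scl_right sum_distrib_left)
  finally show ?thesis ..
qed

section \<open>The group structure\<close>

lemma one_U: "(1\<^sub>m (2*n+1) :: 'a::field mat) \<in> U_set n"
  by (auto simp: U_set_iff ent_one app_one vecs_bas)

lemma mult_U:
  fixes x y :: "'a::field mat"
  assumes x: "x \<in> U_set n" and y: "y \<in> U_set n"
  shows "x * y \<in> U_set n"
proof -
  note c = U_carrier[OF x] U_carrier[OF y]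
  have xy: "ent n x i k * ent n y k j = 0" if "i \<in> labels n" "j \<in> labels n" "k \<in> labels n"
    "pos n k < pos n i \<or> pos n j < pos n k" for i j k
    using that U_ent_below[OF x] U_ent_below[OF y] by auto
  have d: "ent n (x * y) i i = 1" if i: "i \<in> labels n" for i
  proof -
    have "ent n (x * y) i i = (\<Sum>k\<in>labels n. if k = i then 1 else 0)"
      unfolding ent_mult[OF c i i]
    proof (rule sum.cong[OF refl])
      fix k assume k: "k \<in> labels n"
      show "ent n x i k * ent n y k i = (if k = i then 1 else 0)"
        using xy[OF i i k] pos_eq_iff[OF k i] U_ent_diag[OF x i] U_ent_diag[OF y i]
        by (cases "k = i") (auto dest: linorder_neqE)
    qed
    thus ?thesis using i by simp
  qed
  have b: "ent n (x * y) i j = 0" if i: "i \<in> labels n" and j: "j \<in> labels n" and ij: "pos n j < pos n i" for i j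
    unfolding ent_mult[OF c i j]
  proof (rule sum.neutral, rule)
    fix k assume "k \<in> labels n"
    thus "ent n x i k * ent n y k j = 0" using xy[OF i j, of k] ij by fastforce
  qed
  have o: "bil n (app n (x * y) (bas i)) (app n (x * y) (bas j)) = bil n (bas i) (bas j)"
    if "i \<in> labels n" "j \<in> labels n" for i j
    using that by (simp add: app_mult[OF c] bil_app[OF x] bil_app[OF y] vecs_bas)
  show ?thesis unfolding U_set_iff using c d b o by auto
qed

lemma inverse_U:
  fixes x :: "'a::field mat"
  assumes x: "x \<in> U_set n"
  shows "\<exists>y\<in>U_set n. x * y = 1\<^sub>m (2*n+1) \<and> y * x = 1\<^sub>m (2*n+1)"
proof -
  have "x \<in> carrier (GL (2*n+1))" using x by (simp add: U_set_def orthogonal_def)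
  then obtain y where y: "y \<in> carrier_mat (2*n+1) (2*n+1)" "x * y = 1\<^sub>m (2*n+1)" "y * x = 1\<^sub>m (2*n+1)"
    by (auto simp: units_of_def Units_def ring_mat_def)
  have "y \<in> unitriangular (2*n+1)"
    by (rule unitriangular_inverse[OF _ y(1,2)]) (use x in \<open>simp add: U_set_def\<close>)
  moreover have "bil n (app n y (bas i)) (app n y (bas j)) = bil n (bas i) (bas j)"
    if "i \<in> labels n" "j \<in> labels n" for i j
  proof -
    have "bil n (app n y (bas i)) (app n y (bas j)) = bil n (app n x (app n y (bas i))) (app n x (app n y (bas j)))"
      by (simp add: bil_app[OF x])
    also have "\<dots> = bil n (bas i) (bas j)"
      unfolding app_mult[OF U_carrier[OF x] y(1), symmetric] y(2)
      using that by (simp add: app_one vecs_bas)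
    finally show ?thesis .
  qed
  ultimately have "y \<in> U_set n"
    using y(1) unfolding U_set_iff unitriangular_ent_iff[OF y(1)] by blast
  thus ?thesis using y by blast
qed

lemma U_group_simps [simp]:
  "carrier (U_group n) = U_set n" "x \<otimes>\<^bsub>U_group n\<^esub> y = x * y" "\<one>\<^bsub>U_group n\<^esub> = 1\<^sub>m (2*n+1)"
  by (simp_all add: U_group_def units_of_def ring_mat_def)

lemma group_U: "group (U_group n :: 'a::field mat monoid)"
proof (rule groupI)
  fix x y z :: "'a mat"
  assume "x \<in> carrier (U_group n)" "y \<in> carrier (U_group n)" "z \<in> carrier (U_group n)"
  thus "x \<otimes>\<^bsub>U_group n\<^esub> y \<otimes>\<^bsub>U_group n\<^esub> z = x \<otimes>\<^bsub>U_group n\<^esub> (y \<otimes>\<^bsub>U_group n\<^esub> z)"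
    by (auto dest!: U_carrier simp: assoc_mult_mat)
next
  fix x :: "'a mat" assume "x \<in> carrier (U_group n)"
  thus "\<one>\<^bsub>U_group n\<^esub> \<otimes>\<^bsub>U_group n\<^esub> x = x"
    by (auto dest!: U_carrier)
next
  fix x :: "'a mat" assume "x \<in> carrier (U_group n)"
  thus "\<exists>y\<in>carrier (U_group n). y \<otimes>\<^bsub>U_group n\<^esub> x = \<one>\<^bsub>U_group n\<^esub>"
    using inverse_U[of x n] by (metis U_group_simps)
qed (use mult_U one_U in auto)

abbreviation uinv :: "nat \<Rightarrow> 'a::field mat \<Rightarrow> 'a mat" where
  "uinv n x \<equiv> inv\<^bsub>U_group n\<^esub> x"

lemma uinv_U: "x \<in> U_set n \<Longrightarrow> uinv n x \<in> U_set n"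
  using group.inv_closed[OF group_U] by simp

lemma uinv_mult: "x \<in> U_set n \<Longrightarrow> uinv n x * x = 1\<^sub>m (2*n+1)" "x \<in> U_set n \<Longrightarrow> x * uinv n x = 1\<^sub>m (2*n+1)"
  using group.l_inv[OF group_U, of x n] group.r_inv[OF group_U, of x n] by simp_all

lemma app_multU: "x \<in> U_set n \<Longrightarrow> y \<in> U_set n \<Longrightarrow> app n (x * y) v = app n x (app n y v)"
  by (rule app_mult) (auto dest: U_carrier)

lemma app_uinv:
  assumes "x \<in> U_set n" "v \<in> vecs (labels n)"
  shows "app n (uinv n x) (app n x v) = v" "app n x (app n (uinv n x) v) = v"
  using assms by (simp_all add: app_multU[symmetric] uinv_U uinv_mult app_one)

lemma uinv_unique: "x \<in> U_set n \<Longrightarrow> y \<in> U_set n \<Longrightarrow> y * x = 1\<^sub>m (2*n+1) \<Longrightarrow> uinv n x = y"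
  using group.inv_equality[OF group_U, of n y x] by simp

lemma finite_U: "finite (U_set n :: 'a::{field,finite} mat set)"
proof -
  have "finite (vecs (labels n \<times> labels n) :: (int \<times> int \<Rightarrow> 'a) set)"
    by (rule card_vecs) simp
  hence "finite ({f. \<exists>v\<in>vecs (labels n \<times> labels n) :: (int \<times> int \<Rightarrow> 'a) set.
     f = mat (2*n+1) (2*n+1) (\<lambda>(p,q). v (lab n p, lab n q))})"
    by simp
  moreover have "U_set n \<subseteq> {f. \<exists>v\<in>vecs (labels n \<times> labels n) :: (int \<times> int \<Rightarrow> 'a) set.
     f = mat (2*n+1) (2*n+1) (\<lambda>(p,q). v (lab n p, lab n q))}"
  proof
    fix x :: "'a mat" assume "x \<in> U_set n"
    note c = U_carrier[OF this]
    have "x = mat (2*n+1) (2*n+1) (\<lambda>(p,q). (\<lambda>(i,j). if (i,j) \<in> labels n \<times> labels n then ent n x i j else 0) (lab n p, lab n q))"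
      using c by (intro eq_matI) (auto simp: ent_def)
    thus "x \<in> {f. \<exists>v\<in>vecs (labels n \<times> labels n) :: (int \<times> int \<Rightarrow> 'a) set.
     f = mat (2*n+1) (2*n+1) (\<lambda>(p,q). v (lab n p, lab n q))}"
      by (intro CollectI bexI[of _ "\<lambda>(i,j). if (i,j) \<in> labels n \<times> labels n then ent n x i j else 0"])
         (auto simp: vecs_def)
  qed
  ultimately show ?thesis by (rule finite_subset[rotated])
qed

section \<open>Siegel-Eichler transformations and stabilisers\<close>

definition qf :: "nat \<Rightarrow> (int \<Rightarrow> 'a::field) \<Rightarrow> 'a" where
  "qf n y = bil n y y / 2"

text \<open>The matrix of the Siegel-Eichler transformation
  \<open>v \<mapsto> v + B(v, e) y - B(v, y) e - q(y) B(v, e) e\<close>.  For isotropic \<open>e\<close> orthogonal to \<open>y\<close> it is an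
  isometry, additive in \<open>y\<close>.\<close>

definition eich :: "nat \<Rightarrow> (int \<Rightarrow> 'a::field) \<Rightarrow> (int \<Rightarrow> 'a) \<Rightarrow> 'a mat" where
  "eich n e y = mat (2*n+1) (2*n+1) (\<lambda>(p, q).
     (if p = q then 1 else 0) + e (- lab n q) * y (lab n p) - y (- lab n q) * e (lab n p)
      - qf n y * e (- lab n q) * e (lab n p))"

lemma eich_carrier: "eich n e y \<in> carrier_mat (2*n+1) (2*n+1)"
  by (simp add: eich_def)

lemma ent_eich:
  "i \<in> labels n \<Longrightarrow> j \<in> labels n \<Longrightarrow>
    ent n (eich n e y) i j = (if i = j then 1 else 0) + e (- j) * y i - y (- j) * e i - qf n y * e (- j) * e i"
  by (simp add: eich_def ent_def pos_eq_iff)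

lemma app_eich:
  assumes "v \<in> vecs (labels n)" "e \<in> vecs (labels n)" "y \<in> vecs (labels n)"
  shows "app n (eich n e y) v = v + scl (bil n v e) y - scl (bil n v y) e - scl (qf n y * bil n v e) e"
proof
  fix i
  show "app n (eich n e y) v i = (v + scl (bil n v e) y - scl (bil n v y) e - scl (qf n y * bil n v e) e) i"
  proof (cases "i \<in> labels n")
    case True
    have "app n (eich n e y) v i = (\<Sum>j\<in>labels n. (if i = j then v j else 0) + (v j * e (- j)) * y i
       - (v j * y (- j)) * e i - qf n y * (v j * e (- j)) * e i)"
      using True by (simp add: app_def ent_eich) (intro sum.cong refl, auto simp: algebra_simps)
    also have "\<dots> = v i + bil n v e * y i - bil n v y * e i - qf n y * bil n v e * e i"
      using True unfolding bil_def sum_distrib_right sum_distrib_left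
      by (simp add: sum.distrib sum_subtractf)
    finally show ?thesis by simp
  next
    case False
    thus ?thesis using assms by (simp add: app_def vecs_D)
  qed
qed

lemma qf_add:
  assumes "(2::'a::field) \<noteq> 0"
  shows "qf n (y + y' :: int \<Rightarrow> 'a) = qf n y + qf n y' + bil n y y'"
  using assms by (simp add: qf_def bil_add_left bil_add_right bil_commute[of n y' y] field_simps)

text \<open>The products of \<open>e\<close> with \<open>e\<close>, \<open>y\<close> and
  \<open>y'\<close> vanish, so the only cross term of the composition is B(y, y'), and this is the
  polarisation term of q(y + y').\<close>

lemma eich_mult:
  assumes two: "(2::'a::field) \<noteq> 0" and v: "e \<in> vecs (labels n)" "y \<in> vecs (labels n)" "y' \<in> vecs (labels n)"
    and iso: "bil n e e = 0" "bil n e y = (0::'a)" "bil n e y' = 0"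
  shows "eich n e y * eich n e y' = eich n e (y + y')"
proof (rule mat_eq_appI)
  fix j assume "j \<in> labels n"
  hence u: "(bas j :: int \<Rightarrow> 'a) \<in> vecs (labels n)" by (rule vecs_bas)
  have iso': "bil n y e = 0" "bil n y' e = 0" using iso by (simp_all add: bil_commute)
  let ?v1 = "app n (eich n e y') (bas j)"
  have v1: "?v1 \<in> vecs (labels n)" by simp
  have 1: "bil n ?v1 e = bil n (bas j) e" "bil n ?v1 y = bil n (bas j) y + bil n (bas j) e * bil n y' y"
    using iso iso' by (simp_all add: app_eich[OF u v(1,3)] bil_lin)
  show "app n (eich n e y * eich n e y') (bas j) = app n (eich n e (y + y')) (bas j)"
    unfolding app_mult[OF eich_carrier eich_carrier]
    unfolding app_eich[OF v1 v(1,2)] app_eich[OF u v(1) vecs_add[OF v(2,3)]] 1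
    unfolding app_eich[OF u v(1,3)]
    by (rule ext) (simp add: algebra_simps qf_add[OF two] bil_add_right bil_commute[of n y' y])
qed (use eich_carrier[of n e y] eich_carrier[of n e y'] eich_carrier[of n e "y + y'"] in auto)

lemma eich_isometry:
  assumes two: "(2::'a::field) \<noteq> 0" and v: "e \<in> vecs (labels n)" "y \<in> vecs (labels n)"
    and iso: "bil n e e = 0" "bil n e y = (0::'a)"
    and u: "u \<in> vecs (labels n)" "w \<in> vecs (labels n)"
  shows "bil n (app n (eich n e y) u) (app n (eich n e y) w) = bil n u w"
proof -
  have iso': "bil n y e = 0" using iso by (simp_all add: bil_commute)
  have q: "bil n y y = 2 * qf n y" using two by (simp add: qf_def)
  show ?thesis
    unfolding app_eich[OF u(1) v] app_eich[OF u(2) v]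
    using iso iso' by (simp add: bil_lin q bil_commute[of n e w] bil_commute[of n y w] algebra_simps)
qed

text \<open>The transformation is expressed by the form alone, so conjugation by an isometry just
  moves the two vectors. This is where the action of the complement on weights comes from.\<close>

lemma eich_conj:
  assumes g: "g \<in> U_set n" and v: "e \<in> vecs (labels n)" "y \<in> vecs (labels n)"
  shows "g * eich n e y = eich n (app n g e) (app n g y) * g"
proof (rule mat_eq_appI)
  note gc = U_carrier[OF g]
  fix j assume "j \<in> labels n"
  hence u: "bas j \<in> vecs (labels n)" by (rule vecs_bas)
  have q: "qf n (app n g y) = qf n y" by (simp add: qf_def bil_app[OF g v(2) v(2)])
  show "app n (g * eich n e y) (bas j) = app n (eich n (app n g e) (app n g y) * g) (bas j)"
    unfolding app_mult[OF gc eich_carrier] app_mult[OF eich_carrier gc] app_eich[OF u v]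
      app_eich[OF app_vecs app_vecs app_vecs] app_diff app_add app_scl q bil_app[OF g u v(1)] bil_app[OF g u v(2)] ..
qed (rule mult_carrier_mat[OF U_carrier[OF g] eich_carrier] mult_carrier_mat[OF eich_carrier U_carrier[OF g]])+

text \<open>The last condition is upper triangularity of \<open>eich n e y\<close>. It mentions only
  the terms e(-j) y(i) and e(-j) e(i) of the entry at (i, j), since y(-j) e(i) is the first of them
  at (-j, -i), and negation reverses the order.\<close>

definition adm :: "nat \<Rightarrow> (int \<Rightarrow> 'a::field) \<Rightarrow> (int \<Rightarrow> 'a) \<Rightarrow> bool" where
  "adm n e y \<longleftrightarrow> e \<in> vecs (labels n) \<and> y \<in> vecs (labels n) \<and> bil n e e = 0 \<and> bil n e y = 0 \<and>
     (\<forall>i\<in>labels n. \<forall>j\<in>labels n. e (- j) \<noteq> 0 \<and> (y i \<noteq> 0 \<or> e i \<noteq> 0) \<longrightarrow> pos n i < pos n j)"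

lemma adm_D:
  assumes "adm n e y"
  shows "e \<in> vecs (labels n)" "y \<in> vecs (labels n)" "bil n e e = 0" "bil n e y = 0"
    "bil n y e = 0"
  using assms by (auto simp: adm_def bil_commute[of n y e])

lemma eich_U:
  assumes two: "(2::'a::field) \<noteq> 0" and a: "adm n e (y :: int \<Rightarrow> 'a)"
  shows "eich n e y \<in> U_set n"
proof -
  note v = adm_D[OF a]
  have t: "e (- j) * y i = 0 \<and> y (- j) * e i = 0 \<and> e (- j) * e i = 0"
    if ij: "i \<in> labels n" "j \<in> labels n" "pos n j \<le> pos n i" for i j
  proof -
    have *: "e (- j') = 0 \<or> y i' = 0 \<and> e i' = 0" if "i' \<in> labels n" "j' \<in> labels n" "pos n j' \<le> pos n i'" for i' j'
      using a that unfolding adm_def by (metis linorder_not_less)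
    have "pos n (- i) \<le> pos n (- j)" using ij by (simp add: pos_uminus)
    thus ?thesis using *[of i j] *[of "- j" "- i"] ij by auto
  qed
  have "ent n (eich n e y) i j = (if i = j then 1 else 0)"
    if "i \<in> labels n" "j \<in> labels n" "pos n j \<le> pos n i" for i j
    using t[OF that] that by (auto simp: ent_eich)
  thus ?thesis
    unfolding U_set_iff using eich_carrier eich_isometry[OF two v(1,2,3,4)]
    by (auto simp: vecs_bas)
qed

lemma adm_bas:
  assumes "0 < a" "a \<in> labels n" "y \<in> vecs {j \<in> labels n. pos n j < pos n (- a) \<and> j \<noteq> a}"
  shows "adm n (bas a) (y :: int \<Rightarrow> 'a::field)"
proof -
  have y: "y i = 0" if "i \<notin> labels n \<or> pos n (- a) \<le> pos n i \<or> i = a" for i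
    using assms(3) that by (intro vecs_D[OF assms(3)]) auto
  have "pos n a < pos n (- a)" using assms by (simp add: pos_less_iff)
  moreover have "y (- a) = 0" by (rule y) simp
  moreover have "y \<in> vecs (labels n)" using assms(3) vecs_mono[of "{j \<in> labels n. pos n j < pos n (- a) \<and> j \<noteq> a}" "labels n"] by auto
  ultimately show ?thesis using assms(1,2) y
    by (auto simp: adm_def vecs_bas bil_bas_left bas_apply linorder_not_less[symmetric] split: if_splits)
qed

lemma adm_zero:
  assumes "e \<in> vecs {j \<in> labels n. 0 < j}"
  shows "adm n e (scl c (bas 0) :: int \<Rightarrow> 'a::field)"
proof -
  have e: "e i = 0" if "i \<notin> labels n \<or> i \<le> 0" for i
    using assms that by (intro vecs_D[OF assms]) auto
  have "bil n e e = 0" unfolding bil_def by (intro sum.neutral) (metis e linorder_le_cases mult_eq_0_iff neg_0_le_iff_le)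
  moreover have "e \<in> vecs (labels n)" using assms vecs_mono[of "{j \<in> labels n. 0 < j}" "labels n"] by auto
  moreover have "pos n i < pos n j" if ij: "i \<in> labels n" "j \<in> labels n" "e (- j) \<noteq> 0" "c * bas 0 i \<noteq> 0 \<or> e i \<noteq> 0" for i j
  proof -
    have "0 < - j" using e[of "- j"] ij by (meson linorder_not_le)
    moreover have "0 \<le> i" using e[of i] ij by (cases "i = 0") (auto simp: bas_apply)
    ultimately show ?thesis using ij by (simp add: pos_less_iff)
  qed
  ultimately show ?thesis unfolding adm_def
    by (auto simp: vecs_scl vecs_bas bil_scl_right bil_bas_right e)
qed

lemma adm_scl: "adm n e y \<Longrightarrow> adm n e (scl c y)"
  by (auto simp: adm_def vecs_scl bil_scl_right)

lemma adm_uminus: "adm n e y \<Longrightarrow> adm n e (- y)"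
  by (auto simp: adm_def vecs_uminus bil_uminus_right)

lemma eich_zero: "eich n e 0 = 1\<^sub>m (2*n+1)"
  by (rule eq_matI) (auto simp: eich_def qf_def bil_zero_left)

lemma eich_uinv:
  assumes two: "(2::'a::field) \<noteq> 0" and a: "adm n e (y :: int \<Rightarrow> 'a)"
  shows "uinv n (eich n e y) = eich n e (- y)"
proof (rule uinv_unique[OF eich_U[OF two a] eich_U[OF two adm_uminus[OF a]]])
  show "eich n e (- y) * eich n e y = 1\<^sub>m (2*n+1)"
    using eich_mult[OF two, of e n "- y" y] adm_D[OF a] by (simp add: vecs_uminus bil_uminus_right eich_zero)
qed

section \<open>Pointwise stabilisers of basis vectors\<close>

definition symm :: "nat \<Rightarrow> int set \<Rightarrow> bool" where
  "symm n I \<longleftrightarrow> I \<subseteq> labels n \<and> (\<forall>i\<in>I. - i \<in> I)"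

text \<open>The group of the block with labels \<open>I\<close>: for symmetric \<open>I\<close> it
  is again a unipotent group, of type B or D according to whether \<open>I\<close> contains 0. All
  blocks give subgroups of one matrix group, so passing to a smaller block requires no
  embedding.\<close>

definition stab :: "nat \<Rightarrow> int set \<Rightarrow> 'a::field mat set" where
  "stab n I = {x \<in> U_set n. \<forall>i\<in>labels n - I. app n x (bas i) = bas i}"

lemma stab_U: "x \<in> stab n I \<Longrightarrow> x \<in> U_set n"
  by (simp add: stab_def)

lemma stab_labels: "stab n (labels n) = U_set n"
  by (simp add: stab_def)

lemma stab_mono: "I \<subseteq> J \<Longrightarrow> stab n I \<subseteq> stab n J"
  by (auto simp: stab_def)

lemma stab_one: "1\<^sub>m (2*n+1) \<in> stab n I"
  using one_U by (auto simp: stab_def app_one vecs_bas)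

lemma stab_mult: "x \<in> stab n I \<Longrightarrow> y \<in> stab n I \<Longrightarrow> x * y \<in> stab n I"
  by (auto simp: stab_def mult_U app_multU)

lemma stab_uinv: "x \<in> stab n I \<Longrightarrow> uinv n x \<in> stab n I"
proof -
  assume x: "x \<in> stab n I"
  have "app n (uinv n x) (bas i) = bas i" if "i \<in> labels n - I" for i
    using app_uinv(1)[OF stab_U[OF x] vecs_bas, of i] x that by (simp add: stab_def)
  thus ?thesis using uinv_U[OF stab_U[OF x]] by (simp add: stab_def)
qed

lemma symm_uminus: "symm n I \<Longrightarrow> - i \<in> I \<longleftrightarrow> i \<in> I"
  unfolding symm_def by (metis minus_minus)

lemma symm_sub: "symm n I \<Longrightarrow> I \<subseteq> labels n"
  by (simp add: symm_def)

lemma symm_finite: "symm n I \<Longrightarrow> finite I"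
  using finite_subset[OF symm_sub] by auto

lemma symm_remove: "symm n I \<Longrightarrow> symm n (I - {k, - k})"
  by (auto simp: symm_def)

lemma symm_remove0: "symm n I \<Longrightarrow> symm n (I - {0})"
  by (auto simp: symm_def)

lemma symm_vecs: "symm n I \<Longrightarrow> v \<in> vecs I \<Longrightarrow> v \<in> vecs (labels n)"
  using vecs_mono[OF symm_sub] by blast

lemma eich_stab:
  assumes two: "(2::'a::field) \<noteq> 0" and a: "adm n e (y :: int \<Rightarrow> 'a)" and s: "symm n I"
    and v: "e \<in> vecs I" "y \<in> vecs I"
  shows "eich n e y \<in> stab n I"
  unfolding stab_def
proof (intro CollectI conjI ballI)
  show "eich n e y \<in> U_set n" by (rule eich_U[OF two a])
  fix i assume i: "i \<in> labels n - I"
  hence "- i \<notin> I" by (simp add: symm_uminus[OF s])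
  hence "e (- i) = 0" "y (- i) = 0" using v by (auto dest: vecs_D)
  thus "app n (eich n e y) (bas i) = bas i" using i
    by (auto simp: app_eich[OF vecs_bas adm_D(1,2)[OF a]] bil_bas_left fun_eq_iff)
qed

text \<open>The coordinate at \<open>i\<close> is the pairing with \<open>bas (- i)\<close>, which
  \<open>x\<close> fixes. So an element of \<open>stab n I\<close> is trivial in the rows outside
  \<open>I\<close> as well as in the columns.\<close>

lemma stab_app_out:
  assumes x: "x \<in> stab n I" and s: "symm n I" and v: "v \<in> vecs (labels n)" and i: "i \<in> labels n" "i \<notin> I"
  shows "app n x v i = v i"
proof -
  have b: "bas (- i) \<in> vecs (labels n)" using i by (simp add: vecs_bas)
  have "app n x (bas (- i)) = bas (- i)" using x i by (simp add: stab_def symm_uminus[OF s])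
  hence "bil n (app n x v) (bas (- i)) = bil n v (bas (- i))"
    using bil_app[OF stab_U[OF x] v b] by simp
  thus ?thesis using i by (simp add: bil_bas_right)
qed

lemma stab_app_vecs:
  assumes x: "x \<in> stab n I" and s: "symm n I" and v: "v \<in> vecs I"
  shows "app n x v \<in> vecs I"
proof (rule vecs_I)
  fix i assume i: "i \<notin> I"
  show "app n x v i = 0"
  proof (cases "i \<in> labels n")
    case True
    thus ?thesis using stab_app_out[OF x s symm_vecs[OF s v] True i] vecs_D[OF v i] by simp
  qed (simp add: app_def)
qed

lemma app_top:
  assumes x: "x \<in> U_set n" and i: "i \<in> labels n" and v: "\<And>j. j \<in> labels n \<Longrightarrow> pos n i < pos n j \<Longrightarrow> v j = 0"
  shows "app n x v i = v i"
proof -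
  have "app n x v i = (\<Sum>j\<in>labels n. if j = i then v j else 0)"
    unfolding app_def using i
  proof (simp only: if_True, intro sum.cong refl)
    fix j assume j: "j \<in> labels n"
    show "ent n x i j * v j = (if j = i then v j else 0)"
      using v[OF j] U_ent_below[OF x i j] U_ent_diag[OF x i] pos_eq_iff[OF i j] by (cases "j = i") (auto dest: linorder_neqE)
  qed
  thus ?thesis using i by simp
qed

definition minpos :: "int set \<Rightarrow> int \<Rightarrow> bool" where
  "minpos I a \<longleftrightarrow> a \<in> I \<and> 0 < a \<and> (\<forall>i\<in>I. 0 < i \<longrightarrow> a \<le> i)"

lemma minpos_ex:
  assumes "finite I" "i \<in> I" "0 < i"
  shows "\<exists>a. minpos I a"
proof -
  let ?P = "{i \<in> I. 0 < i}"
  have "finite ?P" "?P \<noteq> {}" using assms by auto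
  hence "minpos I (Min ?P)" using Min_in[of ?P] by (auto simp: minpos_def)
  thus ?thesis by blast
qed

lemma minpos_fixed:
  assumes x: "x \<in> stab n I" and s: "symm n I" and a: "minpos I a"
  shows "app n x (bas a) = bas a"
proof
  fix i
  have al: "a \<in> labels n" using a s by (auto simp: minpos_def symm_def)
  show "app n x (bas a) i = bas a i"
  proof (cases "i \<in> labels n")
    case i: True
    show ?thesis
    proof (cases "pos n i < pos n a")
      case True
      hence "i \<notin> I" using a i al by (auto simp: minpos_def pos_less_iff split: if_splits)
      thus ?thesis using stab_app_out[OF x s _ i] al by (simp add: vecs_bas)
    next
      case False
      show ?thesis by (rule app_top[OF stab_U[OF x] i]) (use False in \<open>auto simp: bas_apply\<close>)
    qed
  qed (use al in \<open>auto simp: app_def bas_apply\<close>)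
qed

lemma stab_remove:
  assumes "x \<in> stab n I" "app n x (bas k) = bas k" "app n x (bas (- k)) = bas (- k)"
  shows "x \<in> stab n (I - {k, - k})"
  using assms by (auto simp: stab_def)

lemma minpos_adm:
  assumes s: "symm n I" and a: "minpos I a" and y: "y \<in> vecs (I - {a, - a})"
  shows "adm n (bas a) (y :: int \<Rightarrow> 'a::field)"
proof (rule adm_bas)
  show "0 < a" "a \<in> labels n" using a s by (auto simp: minpos_def symm_def)
  have "I - {a, - a} \<subseteq> {j \<in> labels n. pos n j < pos n (- a) \<and> j \<noteq> a}"
  proof
    fix j assume j: "j \<in> I - {a, - a}"
    have jl: "j \<in> labels n" "a \<in> labels n" using j a s by (auto simp: minpos_def symm_def)
    have "- j \<in> I" using j s by (auto simp: symm_def)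
    hence "- j \<le> 0 \<or> a \<le> - j" using a by (auto simp: minpos_def)
    hence "pos n j < pos n (- a)" using j jl a by (auto simp: pos_less_iff minpos_def)
    thus "j \<in> {j \<in> labels n. pos n j < pos n (- a) \<and> j \<noteq> a}" using j jl by auto
  qed
  from vecs_mono[OF this] y show "y \<in> vecs {j \<in> labels n. pos n j < pos n (- a) \<and> j \<noteq> a}" by auto
qed

lemma minpos_eich_stab:
  assumes two: "(2::'a::field) \<noteq> 0" and s: "symm n I" and a: "minpos I a" and y: "y \<in> vecs (I - {a, - a})"
  shows "eich n (bas a) (y :: int \<Rightarrow> 'a) \<in> stab n I"
proof (rule eich_stab[OF two minpos_adm[OF s a y] s])
  show "bas a \<in> vecs I" using a by (simp add: minpos_def vecs_bas)
  show "y \<in> vecs I" using y vecs_mono[of "I - {a, - a}" I] by auto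
qed

lemma restrict_vec:
  fixes v :: "int \<Rightarrow> 'a::field"
  assumes "v \<in> vecs I" "k \<in> I" "- k \<in> I" "k \<noteq> 0"
  obtains y where "y \<in> vecs (I - {k, - k})" "v = scl (v (- k)) (bas (- k)) + y + scl (v k) (bas k)"
proof
  let ?y = "\<lambda>i. if i \<in> {k, - k} then 0 else v i"
  show "?y \<in> vecs (I - {k, - k})" using assms(1) by (auto simp: vecs_def)
  show "v = scl (v (- k)) (bas (- k)) + ?y + scl (v k) (bas k)"
    using assms(4) by (auto simp: fun_eq_iff bas_apply)
qed

text \<open>The vector \<open>y\<close> is read off from the image f of \<open>bas (- a)\<close>. As
  f is isotropic with coordinate 1 at -a, its coordinate at \<open>a\<close> must be -q(y), which is
  what the transformation attached to \<open>y\<close> produces; so both elements agree on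
  \<open>bas (- a)\<close> and differ by one that fixes \<open>bas a\<close> and
  \<open>bas (- a)\<close>.\<close>

lemma stab_decomp:
  assumes two: "(2::'a::field) \<noteq> 0" and s: "symm n I" and a: "minpos I a" and x: "x \<in> stab n I"
  obtains y g where "y \<in> vecs (I - {a, - a})" "g \<in> stab n (I - {a, - a})" "x = eich n (bas a) y * (g :: 'a mat)"
proof -
  have al: "a \<in> labels n" "a \<in> I" "- a \<in> I" "0 < a" "a \<noteq> 0" using a s by (auto simp: minpos_def symm_def)
  define f where "f = app n x (bas (- a))"
  have f: "f \<in> vecs I" unfolding f_def by (rule stab_app_vecs[OF x s]) (simp add: vecs_bas al)
  have fa: "f (- a) = 1" unfolding f_def
  proof (subst app_top[OF stab_U[OF x]])
    fix j assume "j \<in> labels n" "pos n (- a) < pos n j"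
    thus "bas (- a) j = (0::'a)" by (auto simp: bas_apply)
  qed (use al in auto)
  obtain y where y: "y \<in> vecs (I - {a, - a})" and fy: "f = scl (f (- a)) (bas (- a)) + y + scl (f a) (bas a)"
    by (rule restrict_vec[OF f al(2,3,5)])
  have y0: "y a = 0" "y (- a) = 0" using vecs_D[OF y] by auto
  have yl: "y \<in> vecs (labels n)" using y vecs_mono[of "I - {a, - a}" "labels n"] s by (auto simp: symm_def)
  have E: "eich n (bas a) y \<in> stab n I" by (rule minpos_eich_stab[OF two s a y])
  have "bil n f f = 0"
    unfolding f_def by (subst bil_app[OF stab_U[OF x]]) (use al in \<open>auto simp: vecs_bas bil_bas_left bas_apply\<close>)
  moreover have "bil n f f = 2 * f a + bil n y y"
    by (subst (1 2) fy) (use al y0 fa in \<open>simp add: bil_lin bil_bas_left bil_bas_right bas_apply\<close>)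
  ultimately have "2 * f a = - bil n y y" by (simp add: eq_neg_iff_add_eq_0)
  hence c: "f a = - qf n y" using two nonzero_mult_div_cancel_left[OF two, of "f a"] by (simp add: qf_def)
  have bl: "(bas (- a) :: int \<Rightarrow> 'a) \<in> vecs (labels n)" "(bas a :: int \<Rightarrow> 'a) \<in> vecs (labels n)" using al by (simp_all add: vecs_bas)
  have Ef: "app n (eich n (bas a) y) (bas (- a)) = f"
    by (subst fy) (use al y0 fa c in \<open>auto simp: app_eich[OF bl yl] bil_bas_left fun_eq_iff bas_apply algebra_simps\<close>)
  define g where "g = uinv n (eich n (bas a) y) * x"
  have gI: "g \<in> stab n I" unfolding g_def by (rule stab_mult[OF stab_uinv[OF E] x])
  have "app n g (bas (- a)) = bas (- a)"
    unfolding g_def app_multU[OF uinv_U[OF stab_U[OF E]] stab_U[OF x]] f_def[symmetric] Ef[symmetric]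
    by (rule app_uinv(1)[OF stab_U[OF E] bl(1)])
  hence g: "g \<in> stab n (I - {a, - a})"
    by (intro stab_remove[OF gI minpos_fixed[OF gI s a]])
  note c = U_carrier[OF stab_U[OF E]] U_carrier[OF uinv_U[OF stab_U[OF E]]] U_carrier[OF stab_U[OF x]]
  have "eich n (bas a) y * g = eich n (bas a) y * uinv n (eich n (bas a) y) * x"
    unfolding g_def using c by (simp add: assoc_mult_mat)
  also have "\<dots> = x" using c uinv_mult[OF stab_U[OF E]] by simp
  finally show thesis using that[OF y g] by simp
qed

text \<open>If the last nonzero coordinate is at -k, all coordinates other than those at k and -k
  are created from \<open>bas (- k)\<close> by one transformation attached to \<open>bas k\<close>.
  The coordinate at \<open>k\<close> survives as a parameter, since the value of the form on
  \<open>w\<close> is an invariant.\<close>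

lemma orbit_rep:
  assumes two: "(2::'a::field) \<noteq> 0" and s: "symm n I" and w: "w \<in> vecs I" and k: "k \<in> I" "0 < k"
    and r: "w (- k) \<noteq> 0" and top: "\<And>j. j \<in> I \<Longrightarrow> pos n (- k) < pos n j \<Longrightarrow> w j = 0"
  obtains g c where "g \<in> stab n I" "w = app n (g :: 'a mat) (scl (w (- k)) (bas (- k)) + scl c (bas k))"
proof -
  have kl: "k \<in> labels n" "- k \<in> I" "k \<noteq> 0" using k s by (auto simp: symm_def)
  obtain y where y: "y \<in> vecs (I - {k, - k})" and wy: "w = scl (w (- k)) (bas (- k)) + y + scl (w k) (bas k)"
    by (rule restrict_vec[OF w k(1) kl(2,3)])
  define z where "z = scl (1 / w (- k)) y"
  have yj: "y j = 0" if "j \<in> I" "pos n (- k) < pos n j" for j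
    using top[OF that] that vecs_D[OF y, of j] fun_cong[OF wy, of j] by (cases "j = k \<or> j = - k") (auto simp: bas_apply)
  have zI: "z \<in> vecs (I - {k, - k})" unfolding z_def by (rule vecs_scl[OF y])
  have z0: "z k = 0" "z (- k) = 0" using vecs_D[OF zI] by auto
  have zl: "z \<in> vecs (labels n)" using zI vecs_mono[of "I - {k, - k}" "labels n"] s by (auto simp: symm_def)
  have a: "adm n (bas k) z"
  proof (rule adm_bas[OF k(2) kl(1)])
    show "z \<in> vecs {j \<in> labels n. pos n j < pos n (- k) \<and> j \<noteq> k}"
    proof (rule vecs_I)
      fix j assume j: "j \<notin> {j \<in> labels n. pos n j < pos n (- k) \<and> j \<noteq> k}"
      show "z j = 0"
      proof (cases "j \<in> I - {k, - k}")
        case True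
        hence "pos n (- k) < pos n j" using j s kl pos_eq_iff[of j n "- k"] by (auto simp: symm_def)
        thus ?thesis using yj True by (simp add: z_def)
      qed (rule vecs_D[OF zI])
    qed
  qed
  have zI': "z \<in> vecs I" using zI vecs_mono[of "I - {k, - k}" I] by auto
  \<comment> \<open>The transformation subtracts w(-k) q(z) from the coordinate at \<open>k\<close>;
    this is compensated in advance.\<close>
  define c where "c = w k + w (- k) * qf n z"
  define w0 where "w0 = scl (w (- k)) (bas (- k)) + scl c (bas k)"
  have w0l: "w0 \<in> vecs (labels n)" unfolding w0_def using kl by (simp add: vecs_add vecs_scl vecs_bas)
  have E: "eich n (bas k) z \<in> stab n I" by (rule eich_stab[OF two a s vecs_bas[OF k(1)] zI'])
  have "app n (eich n (bas k) z) w0 = w"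
    unfolding app_eich[OF w0l adm_D(1,2)[OF a]]
    by (rule trans[OF _ wy[symmetric]]) (use kl z0 r in \<open>auto simp: w0_def bil_lin bil_bas_left bil_bas_right fun_eq_iff bas_apply c_def z_def algebra_simps\<close>)
  thus thesis using that[OF E, of c] by (simp add: w0_def)
qed

text \<open>The positive part of \<open>w\<close> itself is the isotropic vector, and
  \<open>bas 0\<close> supplies the second one. The term -B(v, y) e then adds the whole positive
  part at once, and the scalar -1 / w(0) makes its coefficient 1.\<close>

lemma orbit_rep0:
  assumes two: "(2::'a::field) \<noteq> 0" and s: "symm n I" and w: "w \<in> vecs I" and r: "w 0 \<noteq> 0"
    and top: "\<And>j. j < 0 \<Longrightarrow> w j = 0"
  obtains g where "g \<in> stab n I" "w = app n (g :: 'a mat) (scl (w 0) (bas 0))"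
proof -
  define e where "e = (\<lambda>j. if 0 < j then w j else 0)"
  define c where "c = - (1 / w 0)"
  have "0 \<in> I" using vecs_D[OF w] r by auto
  have e: "e \<in> vecs {j \<in> labels n. 0 < j}"
    using symm_vecs[OF s w] by (auto simp: e_def vecs_def)
  have eI: "e \<in> vecs I" using w by (auto simp: e_def vecs_def)
  note a = adm_zero[OF e, of c]
  have bI: "scl c (bas 0) \<in> vecs I" using \<open>0 \<in> I\<close> by (simp add: vecs_scl vecs_bas)
  have l: "scl (w 0) (bas 0) \<in> vecs (labels n)" by (simp add: vecs_scl vecs_bas)
  have E: "eich n e (scl c (bas 0)) \<in> stab n I" by (rule eich_stab[OF two a s eI bI])
  have "e 0 = 0" by (simp add: e_def)
  hence "app n (eich n e (scl c (bas 0))) (scl (w 0) (bas 0)) = w"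
    unfolding app_eich[OF l adm_D(1,2)[OF a]] using r top
    by (auto simp: bil_lin bil_bas_left fun_eq_iff bas_apply e_def c_def not_less)
  thus thesis using that[OF E] by simp
qed

section \<open>Linear actions and weights\<close>

lemma of_nat_card_eq_0: "of_nat CARD('a) = (0::'a::{ring_1,finite})"
proof -
  have "(\<Sum>x\<in>UNIV. x + 1) = (\<Sum>x\<in>UNIV. x :: 'a)"
    by (rule sum.reindex_bij_witness[where i="\<lambda>x. x - 1" and j="\<lambda>x. x + 1"]) auto
  thus ?thesis by (simp add: sum.distrib)
qed

locale odd_char =
  fixes n :: nat and \<theta> :: "'a::{field,finite} \<Rightarrow> complex"
  assumes two: "(2::'a) \<noteq> 0" and theta: "nontrivial_additive_char \<theta>"
begin

lemma theta_add: "\<theta> (x + y) = \<theta> x * \<theta> y"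
  and theta_nz: "\<theta> x \<noteq> 0"
  and theta_nontriv: "\<exists>x. \<theta> x \<noteq> 1"
  using theta by (auto simp: nontrivial_additive_char_def)

lemma theta_0 [simp]: "\<theta> 0 = 1"
  using theta_add[of 0 0] theta_nz[of 0] by simp

lemma theta_minus: "\<theta> (- x) = inverse (\<theta> x)"
  using theta_add[of x "- x"] theta_nz[of x] by (simp add: field_simps)

lemma theta_minus_mult: "\<theta> (- x) * \<theta> x = 1" "\<theta> x * \<theta> (- x) = 1"
  using theta_nz[of x] by (simp_all add: theta_minus)

lemma theta_diff: "\<theta> (x - y) = \<theta> x * \<theta> (- y)"
  using theta_add[of x "- y"] by simp

lemma theta_scale_nontriv:
  assumes "c \<noteq> 0" shows "\<exists>t. \<theta> (t * c) \<noteq> 1"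
proof -
  obtain x where "\<theta> x \<noteq> 1" using theta_nontriv by blast
  hence "\<theta> ((x / c) * c) \<noteq> 1" using assms by simp
  thus ?thesis by blast
qed

text \<open>The number of field elements is zero in the field, so the values of \<theta> are roots
  of unity.\<close>

lemma cnj_theta: "cnj (\<theta> x) = \<theta> (- x)"
proof -
  have "\<theta> (of_nat k * x) = \<theta> x ^ k" for k
    by (induction k) (auto simp: distrib_right theta_add)
  from this[of "CARD('a)"] have "\<theta> x ^ CARD('a) = 1" by (simp add: of_nat_card_eq_0)
  hence "norm (\<theta> x) ^ CARD('a) = 1" by (metis norm_one norm_power)
  hence "norm (\<theta> x) = 1" using power_eq_1_iff[of "norm (\<theta> x)" "CARD('a)"] by simp
  hence "\<theta> x * cnj (\<theta> x) = 1" by (simp add: complex_norm_square[symmetric])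
  thus ?thesis using theta_nz[of x] by (simp add: theta_minus field_simps)
qed

text \<open>Orthogonality of characters. As \<open>J\<close> is symmetric, the form is nondegenerate
  on \<open>vecs J\<close>: a nonzero coordinate of \<open>y\<close> at i is detected by
  \<open>bas (- i)\<close>, which lies in \<open>vecs J\<close>.\<close>

lemma sum_theta_bil:
  assumes s: "symm n J" and y: "y \<in> vecs J"
  shows "(\<Sum>w\<in>vecs J. \<theta> (bil n w y)) = (if y = 0 then of_nat (CARD('a) ^ card J) else 0)"
proof (cases "y = 0")
  case True
  thus ?thesis using card_vecs(2)[OF symm_finite[OF s], where 'b='a] by (simp add: bil_zero_right)
next
  case False
  then obtain i where i: "y i \<noteq> 0" by (auto simp: fun_eq_iff)
  hence iJ: "i \<in> J" using vecs_D[OF y] by blast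
  hence l: "- i \<in> J" "- i \<in> labels n" using s by (auto simp: symm_def)
  obtain t where t: "\<theta> (t * y i) \<noteq> 1" using theta_scale_nontriv[OF i] by blast
  let ?b = "scl t (bas (- i))"
  have b: "?b \<in> vecs J" using l by (simp add: vecs_scl vecs_bas)
  let ?s = "\<Sum>w\<in>vecs J. \<theta> (bil n w y)"
  have "?s = (\<Sum>w\<in>vecs J. \<theta> (bil n (w + ?b) y))"
    by (rule sum.reindex_bij_witness[where i="\<lambda>w. w + ?b" and j="\<lambda>w. w - ?b"])
       (auto simp: vecs_add vecs_diff b)
  also have "\<dots> = ?s * \<theta> (t * y i)"
    using l by (simp add: bil_add_left bil_scl_left bil_bas_left theta_add sum_distrib_right)
  finally have "?s = 0" using t by (simp add: mult_cancel_left2[symmetric])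
  thus ?thesis using False by simp
qed

end

text \<open>The group laws are required on the subspace \<open>M\<close> only, whereas linearity
  holds on the whole type. Both the coordinate space of a matrix representation and the space of
  functions on the group become instances without new types.\<close>

locale linear_action = odd_char n \<theta> + vector_space scale
  for n and \<theta> :: "'a::{field,finite} \<Rightarrow> complex"
    and scale :: "complex \<Rightarrow> 'v::ab_group_add \<Rightarrow> 'v" (infixr "*s" 75) +
  fixes act :: "'a mat \<Rightarrow> 'v \<Rightarrow> 'v" and M :: "'v set"
  assumes act_add: "act g (x + y) = act g x + act g y"
    and act_scale: "act g (c *s x) = c *s act g x"
    and act_mult: "g \<in> U_set n \<Longrightarrow> h \<in> U_set n \<Longrightarrow> x \<in> M \<Longrightarrow> act (g * h) x = act g (act h x)"
    and act_one: "x \<in> M \<Longrightarrow> act (1\<^sub>m (2*n+1)) x = x"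
    and subspace_M: "subspace M"
    and act_M: "g \<in> U_set n \<Longrightarrow> x \<in> M \<Longrightarrow> act g x \<in> M"
begin

lemma act_zero [simp]: "act g 0 = 0"
  using act_scale[of g 0 0] by simp

lemma act_sum: "act g (\<Sum>i\<in>A. f i) = (\<Sum>i\<in>A. act g (f i))"
  by (induction A rule: infinite_finite_induct) (auto simp: act_add)

lemma act_span:
  assumes "\<And>s. s \<in> S \<Longrightarrow> act g s \<in> span T" and "x \<in> span S"
  shows "act g x \<in> span T"
  using assms(2)
proof (induction rule: span_induct_alt)
  case (step c s y)
  thus ?case using assms(1)[of s] by (simp add: act_add act_scale span_add span_scale)
qed (simp add: span_zero)

lemma act_uinv:
  assumes "g \<in> U_set n" "x \<in> M"
  shows "act (uinv n g) (act g x) = x" "act g (act (uinv n g) x) = x"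
  using assms by (metis act_mult act_one uinv_U uinv_mult)+

definition inv_on :: "int set \<Rightarrow> 'v set \<Rightarrow> bool" where
  "inv_on I W \<longleftrightarrow> subspace W \<and> W \<subseteq> M \<and> (\<forall>g\<in>stab n I. \<forall>x\<in>W. act g x \<in> W)"

definition avg :: "'y set \<Rightarrow> ('y \<Rightarrow> complex) \<Rightarrow> ('y \<Rightarrow> 'v \<Rightarrow> 'v) \<Rightarrow> 'v \<Rightarrow> 'v" where
  "avg Y k A x = (1 / of_nat (card Y)) *s (\<Sum>y\<in>Y. k y *s A y x)"

lemma avg_eigen:
  fixes Y :: "'y::ab_group_add set"
  assumes b: "bij_betw ((+) t) Y Y" and A: "\<And>y. y \<in> Y \<Longrightarrow> act h (A y x) = A (t + y) x"
    and k: "\<And>y. y \<in> Y \<Longrightarrow> k (t + y) = k t * k y" and nz: "k t \<noteq> 0"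
  shows "act h (avg Y k A x) = (1 / k t) *s avg Y k A x"
proof -
  have "(\<Sum>y\<in>Y. k y *s A (t + y) x) = (\<Sum>y\<in>Y. (1 / k t) *s (k (t + y) *s A (t + y) x))"
    by (intro sum.cong refl) (simp add: k nz)
  also have "\<dots> = (\<Sum>y\<in>Y. (1 / k t) *s (k y *s A y x))"
    by (rule sum.reindex_bij_betw[OF b])
  also have "\<dots> = (1 / k t) *s (\<Sum>y\<in>Y. k y *s A y x)"
    by (rule scale_sum_right[symmetric])
  finally have "(\<Sum>y\<in>Y. k y *s act h (A y x)) = (1 / k t) *s (\<Sum>y\<in>Y. k y *s A y x)"
    by (simp add: A)
  thus ?thesis
    unfolding avg_def act_scale act_sum by (simp only: scale_left_commute)
qed

text \<open>When the coefficient functions sum to a multiple of the delta function at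
  \<open>z\<close>, the averages form a decomposition of \<open>x\<close>. It is applied to all
  characters of a finite additive group, with z = 0.\<close>

lemma avg_sum:
  assumes "finite Y" "z \<in> Y" "\<And>y. y \<in> Y \<Longrightarrow> (\<Sum>w\<in>C. k w y) = (if y = z then of_nat (card Y) else 0)"
    and "A z x = x"
  shows "(\<Sum>w\<in>C. avg Y (k w) A x) = x"
proof -
  have "card Y \<noteq> 0" using assms(1,2) by auto
  have "(\<Sum>w\<in>C. \<Sum>y\<in>Y. k w y *s A y x) = (\<Sum>y\<in>Y. (\<Sum>w\<in>C. k w y) *s A y x)"
    by (subst sum.swap) (simp add: scale_sum_left)
  also have "\<dots> = (\<Sum>y\<in>Y. if y = z then of_nat (card Y) *s A y x else 0)"
    by (intro sum.cong refl) (simp add: assms(3))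
  also have "\<dots> = of_nat (card Y) *s x" using assms(1,2,4) by simp
  finally show ?thesis using \<open>card Y \<noteq> 0\<close>
    by (simp add: avg_def scale_sum_right[symmetric])
qed

lemma avg_closed:
  assumes "subspace W" "\<And>y. y \<in> Y \<Longrightarrow> A y x \<in> W"
  shows "avg Y k A x \<in> W"
  unfolding avg_def by (intro subspace_scale[OF assms(1)] subspace_sum[OF assms(1)] assms(2))

abbreviation V :: "int \<Rightarrow> (int \<Rightarrow> 'a) \<Rightarrow> 'v \<Rightarrow> 'v" where
  "V a y \<equiv> act (eich n (bas a) y)"

text \<open>The characters of the additive group \<open>vecs J\<close> are written as \<theta>(B(w,
  -)), so that weights are vectors and \<open>stab n J\<close> acts on them as it acts on
  vectors.\<close>

definition wt :: "int \<Rightarrow> int set \<Rightarrow> (int \<Rightarrow> 'a) \<Rightarrow> 'v set" where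
  "wt a J w = {x \<in> M. \<forall>y\<in>vecs J. V a y x = \<theta> (bil n w y) *s x}"

definition prj :: "int \<Rightarrow> int set \<Rightarrow> (int \<Rightarrow> 'a) \<Rightarrow> 'v \<Rightarrow> 'v" where
  "prj a J w = avg (vecs J) (\<lambda>y. \<theta> (- bil n w y)) (V a)"

lemma wt_M: "x \<in> wt a J w \<Longrightarrow> x \<in> M"
  by (simp add: wt_def)

lemma wt_D: "x \<in> wt a J w \<Longrightarrow> y \<in> vecs J \<Longrightarrow> V a y x = \<theta> (bil n w y) *s x"
  by (simp add: wt_def)

lemma subspace_wt: "subspace (wt a J w)"
  using subspace_M by (auto simp: subspace_def wt_def act_add act_scale scale_right_distrib scale_left_commute)

lemma prj_add: "prj a J w (x + y) = prj a J w x + prj a J w y"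
  by (simp add: prj_def avg_def act_add scale_right_distrib sum.distrib)

lemma prj_scale: "prj a J w (c *s x) = c *s prj a J w x"
  by (simp add: prj_def avg_def act_scale scale_left_commute[of c] scale_sum_right mult.commute[of c])

lemma prj_zero [simp]: "prj a J w 0 = 0"
  using prj_scale[of a J w 0 0] by simp

lemma prj_sum: "prj a J w (\<Sum>i\<in>A. f i) = (\<Sum>i\<in>A. prj a J w (f i))"
  by (induction A rule: infinite_finite_induct) (auto simp: prj_add)

text \<open>Weights of the abelian normal subgroup of \<^term>\<open>stab n I\<close> formed by the transformations
  \<^term>\<open>eich n (bas a) y\<close>.\<close>

context
  fixes I J :: "int set" and a :: int
  assumes sI: "symm n I" and aI: "minpos I a" and J: "J = I - {a, - a}"
begin

lemma symm_J: "symm n J"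
  unfolding J by (rule symm_remove[OF sI])

lemma a_labels: "a \<in> labels n" "0 < a" "a \<noteq> 0"
  using aI sI by (auto simp: minpos_def symm_def)

lemma V_stab: "y \<in> vecs J \<Longrightarrow> eich n (bas a) (y :: int \<Rightarrow> 'a) \<in> stab n I"
  using minpos_eich_stab[OF two sI aI] by (simp add: J)

lemma V_U: "y \<in> vecs J \<Longrightarrow> eich n (bas a) (y :: int \<Rightarrow> 'a) \<in> U_set n"
  by (rule stab_U[OF V_stab])

lemma V_adm: "y \<in> vecs J \<Longrightarrow> adm n (bas a) (y :: int \<Rightarrow> 'a)"
  using minpos_adm[OF sI aI] by (simp add: J)

lemma V_add: "y \<in> vecs J \<Longrightarrow> y' \<in> vecs J \<Longrightarrow> x \<in> M \<Longrightarrow> V a y (V a y' x) = V a (y + y') x"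
  using eich_mult[OF two, of "bas a" n y y'] V_adm[of y] V_adm[of y'] V_U[of y] V_U[of y']
  by (simp add: act_mult[symmetric] adm_def)

lemma V_zero: "x \<in> M \<Longrightarrow> V a 0 x = x"
  by (simp add: eich_zero act_one[simplified])

lemma fin_vecs: "finite (vecs J :: (int \<Rightarrow> 'a) set)"
  by (rule card_vecs(1)[OF symm_finite[OF symm_J]])

lemma card_vecs_J: "card (vecs J :: (int \<Rightarrow> 'a) set) = CARD('a) ^ card J"
  by (rule card_vecs(2)[OF symm_finite[OF symm_J]])

lemma V_conj:
  assumes g: "g \<in> stab n J" and y: "y \<in> vecs J" and x: "x \<in> M"
  shows "act g (V a y x) = V a (app n g y) (act g x)"
proof -
  have "app n g (bas a) = bas a" using g a_labels by (auto simp: stab_def J)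
  hence "g * eich n (bas a) y = eich n (bas a) (app n g y) * g"
    using eich_conj[OF stab_U[OF g], of "bas a" y] a_labels symm_vecs[OF symm_J y] by (simp add: vecs_bas)
  thus ?thesis
    using act_mult[OF stab_U[OF g] V_U[OF y] x] act_mult[OF V_U[OF stab_app_vecs[OF g symm_J y]] stab_U[OF g] x]
    by simp
qed

lemma bil_app_uinv:
  assumes g: "g \<in> stab n J" and w: "w \<in> vecs J" and y: "y \<in> vecs J"
  shows "bil n (app n g w) y = bil n w (app n (uinv n g) y)"
  using bil_app[OF stab_U[OF g] symm_vecs[OF symm_J w] app_vecs, of "uinv n g" y]
    app_uinv(2)[OF stab_U[OF g] symm_vecs[OF symm_J y]] by simp

text \<open>Conjugation replaces \<open>y\<close> by its image under the inverse of
  \<open>g\<close>, and invariance of the form shifts this to \<open>w\<close>.\<close>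

lemma wt_act:
  assumes g: "g \<in> stab n J" and w: "w \<in> vecs J" and x: "x \<in> wt a J w"
  shows "act g x \<in> wt a J (app n g w)"
  unfolding wt_def
proof (intro CollectI conjI ballI)
  show "act g x \<in> M" by (rule act_M[OF stab_U[OF g] wt_M[OF x]])
  fix y :: "int \<Rightarrow> 'a" assume y: "y \<in> vecs J"
  let ?z = "app n (uinv n g) y"
  have z: "?z \<in> vecs J" by (rule stab_app_vecs[OF stab_uinv[OF g] symm_J y])
  have "V a y (act g x) = act g (V a ?z x)"
    using V_conj[OF g z wt_M[OF x]] app_uinv(2)[OF stab_U[OF g] symm_vecs[OF symm_J y]] by simp
  thus "V a y (act g x) = \<theta> (bil n (app n g w) y) *s act g x"
    using wt_D[OF x z] by (simp add: act_scale bil_app_uinv[OF g w y])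
qed

lemma prj_wt:
  assumes w: "w \<in> vecs J" and x: "x \<in> M"
  shows "prj a J w x \<in> wt a J w"
  unfolding wt_def
proof (intro CollectI conjI ballI)
  show "prj a J w x \<in> M"
    unfolding prj_def by (rule avg_closed[OF subspace_M]) (rule act_M[OF V_U x])
  fix y :: "int \<Rightarrow> 'a" assume y: "y \<in> vecs J"
  have "bij_betw ((+) y) (vecs J) (vecs J)"
    by (rule bij_betw_byWitness[where f'="\<lambda>v. v - y"]) (auto simp: y vecs_add vecs_diff)
  hence "V a y (prj a J w x) = (1 / \<theta> (- bil n w y)) *s prj a J w x"
    unfolding prj_def by (rule avg_eigen) (auto simp: V_add[OF y _ x] bil_add_right theta_add[symmetric] theta_nz)
  thus "V a y (prj a J w x) = \<theta> (bil n w y) *s prj a J w x"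
    by (simp add: theta_minus divide_inverse)
qed

lemma sum_prj:
  assumes x: "x \<in> M"
  shows "(\<Sum>w\<in>vecs J. prj a J w x) = x"
  unfolding prj_def
proof (rule avg_sum[where z=0])
  fix y :: "int \<Rightarrow> 'a" assume y: "y \<in> vecs J"
  have "(\<Sum>w\<in>vecs J. \<theta> (- bil n w y)) = (\<Sum>w\<in>vecs J. \<theta> (bil n w y))"
    by (rule sum.reindex_bij_witness[where i=uminus and j=uminus]) (auto simp: vecs_uminus bil_lin)
  thus "(\<Sum>w\<in>vecs J. \<theta> (- bil n w y)) = (if y = 0 then of_nat (card (vecs J :: (int \<Rightarrow> 'a) set)) else 0)"
    by (simp add: sum_theta_bil[OF symm_J y] card_vecs_J)
qed (use V_zero[OF x] in \<open>auto simp: fin_vecs vecs_zero\<close>)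

lemma prj_of_wt:
  assumes v: "v \<in> vecs J" and w: "w \<in> vecs J" and x: "x \<in> wt a J v"
  shows "prj a J w x = (if w = v then x else 0)"
proof -
  have "prj a J w x = (1 / of_nat (card (vecs J :: (int \<Rightarrow> 'a) set))) *s (\<Sum>y\<in>vecs J. \<theta> (bil n (v - w) y) *s x)"
    unfolding prj_def avg_def
    by (intro arg_cong[where f="\<lambda>z. _ *s z"] sum.cong refl)
       (simp add: wt_D[OF x] bil_diff_left theta_diff mult.commute)
  also have "(\<Sum>y\<in>vecs J. \<theta> (bil n (v - w) y) *s x) = (\<Sum>y\<in>vecs J. \<theta> (bil n y (v - w))) *s x"
    by (simp add: scale_sum_left bil_commute[of n "v - w"])
  also have "\<dots> = (if w = v then of_nat (card (vecs J :: (int \<Rightarrow> 'a) set)) *s x else 0)"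
    using sum_theta_bil[OF symm_J vecs_diff[OF v w]] by (simp add: card_vecs_J)
  finally show ?thesis using card_vecs_J by simp
qed

text \<open>Expand \<open>x\<close> into weight components. The component of weight v goes to one of
  weight g v, and \<open>g\<close> is injective on vectors, so only v = w contributes.\<close>

lemma prj_act:
  assumes g: "g \<in> stab n J" and w: "w \<in> vecs J" and x: "x \<in> M"
  shows "act g (prj a J w x) = prj a J (app n g w) (act g x)"
proof -
  have gw: "app n g w \<in> vecs J" by (rule stab_app_vecs[OF g symm_J w])
  have "prj a J (app n g w) (act g x) = prj a J (app n g w) (act g (\<Sum>v\<in>vecs J. prj a J v x))"
    by (simp add: sum_prj[OF x])
  also have "\<dots> = (\<Sum>v\<in>vecs J. prj a J (app n g w) (act g (prj a J v x)))"
    by (simp add: act_sum prj_sum)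
  also have "\<dots> = (\<Sum>v\<in>vecs J. if v = w then act g (prj a J w x) else 0)"
  proof (intro sum.cong refl)
    fix v :: "int \<Rightarrow> 'a" assume v: "v \<in> vecs J"
    have "app n g v = app n g w \<longleftrightarrow> v = w"
      using app_uinv(1)[OF stab_U[OF g] symm_vecs[OF symm_J v]] app_uinv(1)[OF stab_U[OF g] symm_vecs[OF symm_J w]] by metis
    thus "prj a J (app n g w) (act g (prj a J v x)) = (if v = w then act g (prj a J w x) else 0)"
      using prj_of_wt[OF stab_app_vecs[OF g symm_J v] gw wt_act[OF g v prj_wt[OF v x]]] by auto
  qed
  also have "\<dots> = act g (prj a J w x)" using w fin_vecs by simp
  finally show ?thesis ..
qed

lemma prj_inv_on: "inv_on I W \<Longrightarrow> x \<in> W \<Longrightarrow> prj a J w x \<in> W"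
  unfolding prj_def by (rule avg_closed) (auto simp: inv_on_def V_stab)

lemma ex_weight:
  assumes "x \<in> M" "x \<noteq> 0"
  obtains w where "w \<in> vecs J" "prj a J w x \<noteq> 0"
  using sum_prj[OF assms(1)] assms(2) by (metis sum.neutral)

end

end

section \<open>Small invariant subspaces\<close>

context linear_action begin

text \<open>Bounds the dimension of some nonzero invariant subspace by the size of a spanning set,
  so that cosets and translates can simply be counted.\<close>

definition small :: "int set \<Rightarrow> 'v set \<Rightarrow> nat \<Rightarrow> bool" where
  "small I W m \<longleftrightarrow> (\<exists>S. finite S \<and> S \<subseteq> W \<and> card S \<le> m \<and> (\<exists>x\<in>S. x \<noteq> 0) \<and>
     (\<forall>g\<in>stab n I. \<forall>x\<in>span S. act g x \<in> span S))"

lemma small_mono: "small I W m \<Longrightarrow> W \<subseteq> W' \<Longrightarrow> m \<le> m' \<Longrightarrow> small I W' m'"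
  unfolding small_def by (meson order_trans)

lemma span_M: "S \<subseteq> M \<Longrightarrow> span S \<subseteq> M"
  by (rule span_minimal[OF _ subspace_M])

context
  fixes I J :: "int set" and a :: int
  assumes sI: "symm n I" and aI: "minpos I a" and J: "J = I - {a, - a}"
begin

lemmas ctx = sI aI J

lemma stab_JI: "g \<in> stab n J \<Longrightarrow> g \<in> stab n I"
  using stab_mono[of J I n] by (auto simp: J)

text \<open>The upper bound for an induced module: the translates of \<open>S\<close> by one element
  for each value of \<delta> span an invariant subspace. The abelian normal subgroup acts on every
  translate by scalars, and two elements with the same value of \<delta> differ by one that maps
  \<open>S\<close> into its span. Only the number of values enters, so \<delta> may be any function
  with this property.\<close>

lemma small_induced:
  assumes W: "inv_on I W" and S: "finite S" "S \<subseteq> W" "S \<subseteq> wt a J w" "\<exists>x\<in>S. x \<noteq> 0" and w: "w \<in> vecs J"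
    and d: "finite \<Delta>" "\<And>g. g \<in> stab n J \<Longrightarrow> \<delta> g \<in> \<Delta>"
    and e: "\<And>g g' s. g \<in> stab n J \<Longrightarrow> g' \<in> stab n J \<Longrightarrow> \<delta> g = \<delta> g' \<Longrightarrow> s \<in> S \<Longrightarrow> act (uinv n g * g') s \<in> span S"
  shows "small I W (card \<Delta> * card S)"
proof -
  define R where "R = (\<lambda>d. SOME g. g \<in> stab n J \<and> \<delta> g = d) ` (\<delta> ` stab n J)"
  have R1: "g \<in> stab n J" if "g \<in> R" for g
    using that unfolding R_def by (auto intro: someI2_ex)
  have R2: "\<exists>h\<in>R. \<delta> h = \<delta> g" if "g \<in> stab n J" for g
  proof
    show "(SOME h. h \<in> stab n J \<and> \<delta> h = \<delta> g) \<in> R" using that by (auto simp: R_def)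
    show "\<delta> (SOME h. h \<in> stab n J \<and> \<delta> h = \<delta> g) = \<delta> g"
      using someI_ex[of "\<lambda>h. h \<in> stab n J \<and> \<delta> h = \<delta> g"] that by blast
  qed
  have D: "\<delta> ` stab n J \<subseteq> \<Delta>" using d(2) by blast
  have fR: "finite R" unfolding R_def using finite_subset[OF D d(1)] by simp
  have cR: "card R \<le> card \<Delta>"
    using card_mono[OF d(1) D] card_image_le[OF finite_subset[OF D d(1)], of "\<lambda>d. SOME g. g \<in> stab n J \<and> \<delta> g = d"]
    unfolding R_def by linarith
  define S' where "S' = (\<lambda>(g, s). act g s) ` (R \<times> S)"
  have SM: "S \<subseteq> M" using S(2) W by (auto simp: inv_on_def)
  have "card S' \<le> card (R \<times> S)" unfolding S'_def by (rule card_image_le) (simp add: fR S)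
  also have "\<dots> \<le> card \<Delta> * card S" using cR by (simp add: card_cartesian_product)
  finally have c: "card S' \<le> card \<Delta> * card S" .
  have f: "finite S'" unfolding S'_def using fR S(1) by auto
  have S'W: "S' \<subseteq> W"
  proof
    fix x assume "x \<in> S'"
    then obtain g s where "g \<in> R" "s \<in> S" "x = act g s" by (auto simp: S'_def)
    thus "x \<in> W" using stab_JI[OF R1] S(2) W unfolding inv_on_def by blast
  qed
  have S'M: "S' \<subseteq> M" using S'W W by (auto simp: inv_on_def)
  have A: "act g s \<in> span S'" if g: "g \<in> stab n J" and s: "s \<in> S" for g s
  proof -
    obtain h where h: "h \<in> R" "\<delta> h = \<delta> g" using R2[OF g] by blast
    note hU = stab_U[OF R1[OF h(1)]] and gU = stab_U[OF g]
    have "h * (uinv n h * g) = g"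
      using U_carrier[OF hU] U_carrier[OF gU] U_carrier[OF uinv_U[OF hU]] uinv_mult[OF hU]
      by (simp add: assoc_mult_mat[symmetric])
    hence "act g s = act h (act (uinv n h * g) s)"
      using act_mult[OF hU mult_U[OF uinv_U[OF hU] gU], of s] s SM by auto
    moreover have "act (uinv n h * g) s \<in> span S" by (rule e[OF R1[OF h(1)] g h(2) s])
    ultimately show ?thesis
      using act_span[of S h S' "act (uinv n h * g) s"] h(1) span_base[of _ S'] unfolding S'_def by auto
  qed
  have B: "act g x \<in> span S'" if g: "g \<in> stab n J" and x: "x \<in> span S'" for g x
  proof (rule act_span[OF _ x])
    fix s' assume "s' \<in> S'"
    then obtain h s where hs: "h \<in> R" "s \<in> S" "s' = act h s" by (auto simp: S'_def)
    have "act g s' = act (g * h) s"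
      unfolding hs(3) using act_mult[OF stab_U[OF g] stab_U[OF R1[OF hs(1)]]] hs(2) SM by auto
    thus "act g s' \<in> span S'" using A[OF stab_mult[OF g R1[OF hs(1)]] hs(2)] by simp
  qed
  have C: "V a y x \<in> span S'" if y: "y \<in> vecs J" and x: "x \<in> span S'" for y x
  proof (rule act_span[OF _ x])
    fix s' assume s': "s' \<in> S'"
    then obtain h s where hs: "h \<in> R" "s \<in> S" "s' = act h s" by (auto simp: S'_def)
    have "s' \<in> wt a J (app n h w)" unfolding hs(3) by (rule wt_act[OF ctx R1[OF hs(1)] w]) (use S(3) hs(2) in auto)
    thus "V a y s' \<in> span S'" using wt_D[OF _ y] s' by (simp add: span_scale span_base)
  qed
  have "act g x \<in> span S'" if g: "g \<in> stab n I" and x: "x \<in> span S'" for g x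
  proof -
    obtain y h where yh: "y \<in> vecs J" "h \<in> stab n J" "g = eich n (bas a) y * h"
      using stab_decomp[OF two sI aI g] unfolding J by blast
    have "act g x = V a y (act h x)"
      unfolding yh(3) by (rule act_mult[OF V_U[OF ctx yh(1)] stab_U[OF yh(2)]]) (use x span_M[OF S'M] in auto)
    thus ?thesis using C[OF yh(1) B[OF yh(2) x]] by simp
  qed
  moreover have "\<exists>x\<in>S'. x \<noteq> 0"
  proof -
    obtain s where s: "s \<in> S" "s \<noteq> 0" using S(4) by blast
    obtain h where h: "h \<in> R" using R2[OF stab_one] by blast
    have "act h s \<noteq> 0" using act_uinv(1)[OF stab_U[OF R1[OF h]], of s] s SM by auto
    thus ?thesis using h s by (force simp: S'_def)
  qed
  ultimately show ?thesis unfolding small_def using f c S'W by blast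
qed

text \<open>Weights for the root \<epsilon>_a + \<epsilon>_k. The stabiliser of \<open>w\<close>
  contains \<open>stab n (J - {k, - k})\<close> and, if k \<noteq> b, also the one-parameter group
  at \<open>b\<close> along r e_{-k} - c e_k, a vector orthogonal to \<open>w\<close>. With both
  acting on \<open>span S\<close>, cosets are described by coordinates indexed by J - {k, -k, -b}.
  For k \<noteq> b the label -b is a further one, and omitting it makes these weights fall short of
  the largest degree.\<close>

lemma small_neg:
  assumes W: "inv_on I W" and S: "finite S" "S \<subseteq> W" "S \<subseteq> wt a J w" "\<exists>x\<in>S. x \<noteq> 0"
    and k: "k \<in> J" "0 < k" and r: "r \<noteq> 0" and w: "w = scl r (bas (- k)) + scl c (bas k)"
    and b: "minpos J b"
    and S2: "\<And>g x. g \<in> stab n (J - {k, - k}) \<Longrightarrow> x \<in> span S \<Longrightarrow> act g x \<in> span S"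
    and S3: "\<And>t x. k \<noteq> b \<Longrightarrow> x \<in> span S \<Longrightarrow> V b (scl t (scl r (bas (- k)) - scl c (bas k))) x \<in> span S"
  shows "small I W (CARD('a) ^ card (J - {k, - k, - b}) * card S)"
proof -
  note sJ = symm_J[OF ctx]
  have kl: "k \<in> labels n" "- k \<in> J" "k \<noteq> 0" "- k \<noteq> k" using k sJ by (auto simp: symm_def)
  have bl: "b \<in> J" "0 < b" "- b \<in> J" "b \<in> labels n" "b \<le> k" using b sJ k by (auto simp: symm_def minpos_def)
  have wJ: "w \<in> vecs J" unfolding w using k kl by (simp add: vecs_add vecs_scl vecs_bas)
  have wi: "w (- k) = r" "w k = c" "\<And>i. i \<noteq> k \<Longrightarrow> i \<noteq> - k \<Longrightarrow> w i = 0" using kl by (auto simp: w bas_apply)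
  define K where "K = J - {k, - k, - b}"
  have fK: "finite K" using symm_finite[OF sJ] by (simp add: K_def)
  \<comment> \<open>Before -k the coordinates of g w are recorded. The labels of \<open>K\<close>
    after -k are of the form -j with 0 < j < k; there g w vanishes, and the coordinate of g (bas k)
    at j is recorded instead.\<close>
  define \<delta> where "\<delta> g = (\<lambda>i. if i \<in> K then if pos n i < pos n (- k) then app n g w i else app n g (bas k) (- i) else 0)" for g
  have "small I W (card (vecs K :: (int \<Rightarrow> 'a) set) * card S)"
  proof (rule small_induced[OF W S wJ])
    show "finite (vecs K :: (int \<Rightarrow> 'a) set)" by (rule card_vecs(1)[OF fK])
    show "\<delta> g \<in> vecs K" for g by (simp add: \<delta>_def vecs_def)
    fix g g' s assume g: "g \<in> stab n J" and g': "g' \<in> stab n J" and d: "\<delta> g = \<delta> g'" and s: "s \<in> S"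
    note gU = stab_U[OF g] and g'U = stab_U[OF g']
    have kk: "pos n k < pos n (- k)" using k kl by (simp add: pos_less_iff)
    have top: "app n h w i = w i" if "h \<in> stab n J" "i \<in> labels n" "pos n (- k) \<le> pos n i" for h i
    proof (rule app_top[OF stab_U[OF that(1)] that(2)])
      fix j assume "j \<in> labels n" "pos n i < pos n j"
      thus "w j = 0" using that kk by (intro wi(3)) auto
    qed
    let ?v = "app n g w" let ?v' = "app n g' w"
    have vJ: "?v \<in> vecs J" "?v' \<in> vecs J" using stab_app_vecs[OF _ sJ wJ] g g' by auto
    have vi: "?v i = ?v' i" if "i \<noteq> k" for i
    proof (cases "i \<in> J")
      case True
      hence il: "i \<in> labels n" using sJ by (auto simp: symm_def)
      show ?thesis
      proof (cases "pos n i < pos n (- k)")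
        case pl: True
        hence "i \<noteq> - b" using bl kl k by (auto simp: pos_less_iff)
        hence "i \<in> K" using True that pl by (auto simp: K_def)
        thus ?thesis using fun_cong[OF d, of i] pl by (simp add: \<delta>_def)
      next
        case False
        thus ?thesis using top[OF g il] top[OF g' il] by simp
      qed
    next
      case False
      thus ?thesis using vecs_D[OF vJ(1)] vecs_D[OF vJ(2)] by simp
    qed
    \<comment> \<open>The two images of \<open>w\<close> differ at most at \<open>k\<close>.
      Equality of the form on them gives 2 t r = 0, so they coincide.\<close>
    define t where "t = ?v' k - ?v k"
    have v'v: "?v' = ?v + scl t (bas k)" using vi by (auto simp: fun_eq_iff bas_apply t_def)
    have "?v (- k) = r" using top[OF g, of "- k"] kl wi by simp
    hence "bil n ?v' ?v' = bil n ?v ?v + 2 * t * r"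
      unfolding v'v using kl by (simp add: bil_lin bil_bas_left bil_bas_right)
    moreover have "bil n ?v' ?v' = bil n ?v ?v"
      using bil_app[OF gU, of w w] bil_app[OF g'U, of w w] symm_vecs[OF sJ wJ] by simp
    ultimately have "t = 0" using r two by simp
    hence vv: "?v' = ?v" unfolding v'v by (simp add: fun_eq_iff)
    define h where "h = uinv n g * g'"
    have h: "h \<in> stab n J" unfolding h_def by (rule stab_mult[OF stab_uinv[OF g] g'])
    have hU: "h \<in> U_set n" by (rule stab_U[OF h])
    have happ: "app n h x = app n (uinv n g) (app n g' x)" for x
      unfolding h_def by (rule app_multU[OF uinv_U[OF gU] g'U])
    have hw: "app n h w = w" unfolding happ vv by (rule app_uinv(1)[OF gU symm_vecs[OF sJ wJ]])
    have bk: "(bas k :: int \<Rightarrow> 'a) \<in> vecs J" "(bas k :: int \<Rightarrow> 'a) \<in> vecs (labels n)"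
      "(bas (- k) :: int \<Rightarrow> 'a) \<in> vecs (labels n)" "(bas b :: int \<Rightarrow> 'a) \<in> vecs (labels n)"
      using k kl bl by (auto simp: vecs_bas)
    let ?e = "app n g (bas k)" let ?e' = "app n g' (bas k)"
    have eJ: "?e \<in> vecs J" "?e' \<in> vecs J" using stab_app_vecs[OF _ sJ bk(1)] g g' by auto
    define u where "u = ?e' b - ?e b"
    have ei: "?e i = ?e' i" if "i \<noteq> b" for i
    proof (cases "i \<in> J")
      case True
      hence il: "i \<in> labels n" "- i \<in> J" using sJ by (auto simp: symm_def)
      show ?thesis
      proof (cases "pos n i < pos n k")
        case pl: True
        hence i0: "0 < i" "i < k" using k kl il by (auto simp: pos_less_iff split: if_splits)
        hence "\<not> pos n (- i) < pos n (- k)" using kl il by (auto simp: pos_less_iff)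
        moreover have "- i \<in> K" using il i0 that by (auto simp: K_def)
        ultimately show ?thesis using fun_cong[OF d, of "- i"] by (simp add: \<delta>_def)
      next
        case False
        hence z: "bas k j = (0::'a)" if "pos n i < pos n j" for j using that by (auto simp: bas_apply)
        show ?thesis using app_top[OF gU il(1) z] app_top[OF g'U il(1) z] by simp
      qed
    next
      case False
      thus ?thesis using vecs_D[OF eJ(1)] vecs_D[OF eJ(2)] by simp
    qed
    have "?e' = ?e + scl u (bas b)" using ei by (auto simp: fun_eq_iff bas_apply u_def)
    hence "app n h (bas k) = app n (uinv n g) ?e + scl u (app n (uinv n g) (bas b))"
      unfolding happ by (simp add: app_add app_scl)
    hence hk: "app n h (bas k) = bas k + scl u (bas b)"
      using app_uinv(1)[OF gU bk(2)] minpos_fixed[OF stab_uinv[OF g] sJ b] by simp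
    have fix_neg: "app n f (bas (- k)) = bas (- k)" if "app n f w = w" "app n f (bas k) = bas k" for f
    proof -
      have "bas (- k) = scl (1 / r) (w - scl c (bas k))" using r by (auto simp: w fun_eq_iff)
      thus ?thesis using that by (simp add: app_scl app_diff)
    qed
    show "act (uinv n g * g') s \<in> span S"
      unfolding h_def[symmetric]
    proof (cases "k = b")
      case True
      have "app n h (bas k) = bas k" using minpos_fixed[OF h sJ b] True by simp
      hence "h \<in> stab n (J - {k, - k})" using stab_remove[OF h _ fix_neg[OF hw]] by simp
      thus "act h s \<in> span S" by (rule S2) (rule span_base[OF s])
    next
      case False
      \<comment> \<open>The coefficient makes y(-k) = -u, so that the transformation at
        \<open>b\<close> sends \<open>bas k\<close> to bas k + u bas b exactly as h does. The
        remaining factor f then fixes \<open>bas k\<close> and \<open>w\<close>, hence also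
        \<open>bas (- k)\<close>.\<close>
      define y where "y = scl (- (u / r)) (scl r (bas (- k)) - scl c (bas k))"
      have kb: "- k \<noteq> b" using k bl by auto
      have yJ: "y \<in> vecs (J - {b, - b})" unfolding y_def
        using False k kl bl by (intro vecs_scl vecs_diff vecs_bas) auto
      have yl: "y \<in> vecs (labels n)" using yJ vecs_mono[of "J - {b, - b}" "labels n"] sJ by (auto simp: symm_def)
      have E: "eich n (bas b) y \<in> stab n J" by (rule minpos_eich_stab[OF two sJ b yJ])
      have wb: "w (- b) = 0" by (rule wi(3)) (use False kb in auto)
      have "bil n w y = 0" unfolding y_def w using kl by (simp add: bil_lin bil_bas_left bas_apply)
      hence Ew: "app n (eich n (bas b) y) w = w"
        unfolding app_eich[OF symm_vecs[OF sJ wJ] bk(4) yl] using bl wb by (auto simp: bil_bas_right fun_eq_iff)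
      have "y (- k) = - u" unfolding y_def using kl r by (simp add: bas_apply)
      hence Ek: "app n (eich n (bas b) y) (bas k) = bas k + scl u (bas b)"
        unfolding app_eich[OF bk(2,4) yl] using kl False kb by (auto simp: bil_bas_left fun_eq_iff bas_apply)
      define f where "f = uinv n (eich n (bas b) y) * h"
      have EU: "eich n (bas b) y \<in> U_set n" by (rule stab_U[OF E])
      have f: "f \<in> stab n J" unfolding f_def by (rule stab_mult[OF stab_uinv[OF E] h])
      have fapp: "app n f x = app n (uinv n (eich n (bas b) y)) (app n h x)" for x
        unfolding f_def by (rule app_multU[OF uinv_U[OF EU] hU])
      have fw: "app n f w = w" using app_uinv(1)[OF EU symm_vecs[OF sJ wJ]] by (simp add: fapp hw Ew)
      have fk: "app n f (bas k) = bas k" using app_uinv(1)[OF EU bk(2)] by (simp add: fapp hk Ek)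
      have "f \<in> stab n (J - {k, - k})" by (rule stab_remove[OF f fk fix_neg[OF fw fk]])
      hence fs: "act f s \<in> span S" by (rule S2) (rule span_base[OF s])
      have "eich n (bas b) y * f = h" unfolding f_def
        using U_carrier[OF EU] U_carrier[OF hU] U_carrier[OF uinv_U[OF EU]] uinv_mult[OF EU]
        by (simp add: assoc_mult_mat[symmetric])
      hence "act h s = V b y (act f s)"
        using act_mult[OF EU stab_U[OF f], of s] s S(2) W by (auto simp: inv_on_def)
      thus "act h s \<in> span S" using S3[OF False fs] by (simp add: y_def)
    qed
  qed
  thus ?thesis unfolding card_vecs(2)[OF fK] by (simp add: K_def)
qed

text \<open>The stabiliser of \<open>bas 0\<close> in \<open>stab n J\<close> is
  \<open>stab n (J - {0})\<close>, a group of type D. By triangularity only the positive coordinates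
  of the image of \<open>bas 0\<close> can vary, which bounds the number of cosets.\<close>

lemma small_zero:
  assumes W: "inv_on I W" and S: "finite S" "S \<subseteq> W" "S \<subseteq> wt a J (scl r (bas 0))" "\<exists>x\<in>S. x \<noteq> 0"
    and z: "0 \<in> J"
    and S2: "\<And>g x. g \<in> stab n (J - {0}) \<Longrightarrow> x \<in> span S \<Longrightarrow> act g x \<in> span S"
  shows "small I W (CARD('a) ^ card {i \<in> J. 0 < i} * card S)"
proof -
  note sJ = symm_J[OF ctx]
  define K where "K = {i \<in> J. 0 < i}"
  have fK: "finite K" using symm_finite[OF sJ] by (simp add: K_def)
  define \<delta> where "\<delta> g = (\<lambda>i. if i \<in> K then app n g (bas 0) i else 0 :: 'a)" for g
  have b0: "(bas 0 :: int \<Rightarrow> 'a) \<in> vecs J" by (rule vecs_bas[OF z])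
  have "small I W (card (vecs K :: (int \<Rightarrow> 'a) set) * card S)"
  proof (rule small_induced[OF W S])
    show "scl r (bas 0) \<in> vecs J" by (rule vecs_scl[OF b0])
    show "finite (vecs K :: (int \<Rightarrow> 'a) set)" by (rule card_vecs(1)[OF fK])
    show "\<delta> g \<in> vecs K" for g by (simp add: \<delta>_def vecs_def)
    fix g g' s assume g: "g \<in> stab n J" and g': "g' \<in> stab n J" and d: "\<delta> g = \<delta> g'" and s: "s \<in> S"
    have "app n g (bas 0) i = app n g' (bas 0) i" for i
    proof (cases "i \<in> K")
      case True
      thus ?thesis using fun_cong[OF d, of i] by (simp add: \<delta>_def)
    next
      case False
      show ?thesis
      proof (cases "i \<in> J")
        case True
        hence il: "i \<in> labels n" "i \<le> 0" using sJ False by (auto simp: symm_def K_def)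
        have z: "bas 0 j = (0::'a)" if "j \<in> labels n" "pos n i < pos n j" for j
          using that il by (auto simp: bas_apply pos_less_iff split: if_splits)
        show ?thesis using app_top[OF stab_U[OF g] il(1) z] app_top[OF stab_U[OF g'] il(1) z] by simp
      next
        case False
        thus ?thesis using vecs_D[OF stab_app_vecs[OF g sJ b0]] vecs_D[OF stab_app_vecs[OF g' sJ b0]] by simp
      qed
    qed
    hence e: "app n g' (bas 0) = app n g (bas 0)" by (simp add: fun_eq_iff)
    define h where "h = uinv n g * g'"
    have h: "h \<in> stab n J" unfolding h_def by (rule stab_mult[OF stab_uinv[OF g] g'])
    have "app n h (bas 0) = bas 0"
      unfolding h_def app_multU[OF uinv_U[OF stab_U[OF g]] stab_U[OF g']] e
      by (rule app_uinv(1)[OF stab_U[OF g] symm_vecs[OF sJ b0]])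
    hence "h \<in> stab n (J - {0})" using h by (auto simp: stab_def)
    thus "act (uinv n g * g') s \<in> span S" unfolding h_def[symmetric] by (rule S2) (rule span_base[OF s])
  qed
  thus ?thesis unfolding card_vecs(2)[OF fK] by (simp add: K_def)
qed

text \<open>Weights for roots \<epsilon>_a - \<epsilon>_k: the last nonzero coordinate never changes
  and the later ones stay zero, which leaves at most the other positive labels. For w = 0 the orbit
  is a point, and the bound is at least 1 also under truncated subtraction.\<close>

lemma card_orbit_pos:
  fixes w :: "int \<Rightarrow> 'a"
  assumes w: "w \<in> vecs {i \<in> J. 0 < i}"
  shows "finite ((\<lambda>g. app n g w) ` stab n J)"
    and "card ((\<lambda>g. app n g w) ` stab n J) \<le> CARD('a) ^ (card {i \<in> J. 0 < i} - 1)"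
proof -
  note sJ = symm_J[OF ctx]
  have fJ: "finite {i \<in> J. 0 < i}" using symm_finite[OF sJ] by simp
  let ?O = "(\<lambda>g. app n g w) ` stab n J"
  have "finite ?O \<and> card ?O \<le> CARD('a) ^ (card {i \<in> J. 0 < i} - 1)"
  proof (cases "w = 0")
    case True
    hence "?O = {0}" using stab_one by (auto simp: image_iff)
    thus ?thesis by (simp add: Suc_le_eq)
  next
    case False
    then obtain i where "w i \<noteq> 0" by (auto simp: fun_eq_iff)
    let ?T = "{i. w i \<noteq> 0}"
    have T: "?T \<subseteq> {i \<in> J. 0 < i}" using vecs_D[OF w] by blast
    have "finite ?T" "?T \<noteq> {}" using finite_subset[OF T fJ] \<open>w i \<noteq> 0\<close> by auto
    define k where "k = Max ?T"
    have k: "w k \<noteq> 0" "k \<in> J" "0 < k" "\<And>j. w j \<noteq> 0 \<Longrightarrow> j \<le> k"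
      using Max_in[OF \<open>finite ?T\<close> \<open>?T \<noteq> {}\<close>] T Max_ge[OF \<open>finite ?T\<close>] unfolding k_def by auto
    define K where "K = {i \<in> J. 0 < i} - {k}"
    have fK: "finite K" using fJ by (simp add: K_def)
    have cK: "card K = card {i \<in> J. 0 < i} - 1" using k fJ by (simp add: K_def)
    have gk: "app n g w i = (if i = k then w k else 0)" if g: "g \<in> stab n J" and i: "i \<notin> K" for g i
    proof (cases "i \<in> J")
      case True
      hence il: "i \<in> labels n" "k \<in> labels n" using sJ k by (auto simp: symm_def)
      have "app n g w i = w i"
      proof (rule app_top[OF stab_U[OF g] il(1)])
        fix j assume j: "j \<in> labels n" "pos n i < pos n j"
        have "i \<le> 0 \<or> i = k" using i True by (auto simp: K_def)
        moreover have "w j = 0" if "j \<le> 0" using vecs_D[OF w, of j] that by auto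
        moreover have "w j = 0" if "k < j" using k(4)[of j] that by force
        ultimately show "w j = 0" using j il k(3)
          by (auto simp: pos_less_iff split: if_splits)
      qed
      thus ?thesis using vecs_D[OF w, of i] i True by (auto simp: K_def)
    next
      case False
      hence "i \<noteq> k" using k by auto
      thus ?thesis using vecs_D[OF stab_app_vecs[OF g sJ]] False w vecs_mono[of "{i \<in> J. 0 < i}" J] by auto
    qed
    let ?r = "\<lambda>v i. if i \<in> K then v i else (0::'a)"
    have inj: "inj_on ?r ?O"
    proof (rule inj_onI)
      fix v v' assume v: "v \<in> ?O" "v' \<in> ?O" and e: "?r v = ?r v'"
      show "v = v'"
      proof
        fix i show "v i = v' i" using v gk fun_cong[OF e, of i] by (cases "i \<in> K") auto
      qed
    qed
    have sub: "?r ` ?O \<subseteq> vecs K" by (auto simp: vecs_def)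
    have fv: "finite (vecs K :: (int \<Rightarrow> 'a) set)" by (rule card_vecs(1)[OF fK])
    have "finite ?O" using finite_imageD[OF finite_subset[OF sub fv] inj] .
    moreover have "card ?O \<le> card (vecs K :: (int \<Rightarrow> 'a) set)"
      using card_image[OF inj] card_mono[OF fv sub] by simp
    ultimately show ?thesis unfolding card_vecs(2)[OF fK] cK by simp
  qed
  thus "finite ?O" "card ?O \<le> CARD('a) ^ (card {i \<in> J. 0 < i} - 1)" by auto
qed

text \<open>Here the stabiliser of the weight need not be of the form \<^term>\<open>stab n K\<close>.  Instead, the
  projections of a small \<^term>\<open>stab n J\<close>-stable subspace to the weight spaces of one orbit span
  something stable under \<^term>\<open>stab n I\<close>.\<close>

lemma small_pos:
  assumes W: "inv_on I W" and w: "w \<in> vecs {i \<in> J. 0 < i}" and x: "x \<in> W" "x \<in> wt a J w" "x \<noteq> 0"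
    and IH: "\<And>W'. inv_on J W' \<Longrightarrow> x \<in> W' \<Longrightarrow> small J W' m"
  shows "small I W (CARD('a) ^ (card {i \<in> J. 0 < i} - 1) * m)"
proof -
  note sJ = symm_J[OF ctx]
  have wJ: "w \<in> vecs J" using w vecs_mono[of "{i \<in> J. 0 < i}" J] by auto
  define Ob where "Ob = (\<lambda>g. app n g w) ` stab n J"
  note cO = card_orbit_pos[OF w, folded Ob_def]
  have ObJ: "Ob \<subseteq> vecs J" unfolding Ob_def using stab_app_vecs[OF _ sJ wJ] by auto
  have Ob_act: "app n g v \<in> Ob" if "g \<in> stab n J" "v \<in> Ob" for g :: "'a mat" and v
    using that stab_mult[of g n J] unfolding Ob_def
    by (auto simp: image_iff) (metis app_multU stab_U)
  \<comment> \<open>The vectors all of whose weights lie in the orbit. A nonzero vector found inside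
    then has a nonzero projection belonging to the spanning set.\<close>
  define W' where "W' = {x \<in> W. \<forall>v\<in>vecs J - Ob. prj a J v x = 0}"
  have WM: "W \<subseteq> M" "subspace W" using W by (auto simp: inv_on_def)
  have W': "inv_on J W'"
    unfolding inv_on_def
  proof (intro conjI ballI)
    show "subspace W'" using WM(2) unfolding W'_def subspace_def by (auto simp: prj_add prj_scale)
    show "W' \<subseteq> M" using WM by (auto simp: W'_def)
    fix g :: "'a mat" and x assume g: "g \<in> stab n J" and x: "x \<in> W'"
    have "prj a J v (act g x) = 0" if v: "v \<in> vecs J - Ob" for v
    proof -
      let ?u = "app n (uinv n g) v"
      have u: "?u \<in> vecs J" using stab_app_vecs[OF stab_uinv[OF g] sJ] v by auto
      have gu: "app n g ?u = v" by (rule app_uinv(2)[OF stab_U[OF g] symm_vecs[OF sJ]]) (use v in auto)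
      have "?u \<notin> Ob" using Ob_act[OF g, of ?u] gu v by auto
      hence "prj a J ?u x = 0" using x u by (auto simp: W'_def)
      thus ?thesis using prj_act[OF ctx g u, of x] x WM gu by (auto simp: W'_def)
    qed
    thus "act g x \<in> W'" using x W stab_JI[OF g] by (auto simp: W'_def inv_on_def)
  qed
  have "w \<in> Ob" unfolding Ob_def using stab_one app_one[OF symm_vecs[OF sJ wJ]] by (force simp: image_iff)
  hence "x \<in> W'" using x(1) prj_of_wt[OF ctx wJ _ x(2)] by (auto simp: W'_def)
  from IH[OF W' this] obtain S where S: "finite S" "S \<subseteq> W'" "card S \<le> m" "\<exists>x\<in>S. x \<noteq> 0"
    "\<And>g x. g \<in> stab n J \<Longrightarrow> x \<in> span S \<Longrightarrow> act g x \<in> span S" unfolding small_def by blast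
  define S' where "S' = (\<lambda>(v, s). prj a J v s) ` (Ob \<times> S)"
  have "card S' \<le> card (Ob \<times> S)" unfolding S'_def by (rule card_image_le) (simp add: cO S)
  also have "\<dots> \<le> CARD('a) ^ (card {i \<in> J. 0 < i} - 1) * m"
    using cO(2) S(3) by (simp add: card_cartesian_product mult_le_mono)
  finally have c: "card S' \<le> CARD('a) ^ (card {i \<in> J. 0 < i} - 1) * m" .
  have SM: "S \<subseteq> M" "S \<subseteq> W" using S(2) WM by (auto simp: W'_def)
  have S'W: "S' \<subseteq> W" unfolding S'_def using prj_inv_on[OF ctx W] SM(2) by auto
  have S'M: "S' \<subseteq> M" using S'W WM by auto
  have A: "prj a J v x \<in> span S'" if v: "v \<in> Ob" and x: "x \<in> span S" for v x
    using x
  proof (induction rule: span_induct_alt)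
    case (step c s y)
    have "prj a J v s \<in> S'" using v step by (force simp: S'_def)
    thus ?case using step by (simp add: prj_add prj_scale span_add span_scale span_base)
  qed (simp add: span_zero)
  have B: "act g x \<in> span S'" if g: "g \<in> stab n J" and x: "x \<in> span S'" for g x
  proof (rule act_span[OF _ x])
    fix s' assume "s' \<in> S'"
    then obtain v s where vs: "v \<in> Ob" "s \<in> S" "s' = prj a J v s" by (auto simp: S'_def)
    have "act g s' = prj a J (app n g v) (act g s)"
      unfolding vs(3) by (rule prj_act[OF ctx g]) (use vs ObJ SM in auto)
    thus "act g s' \<in> span S'" using A[OF Ob_act[OF g vs(1)] S(5)[OF g span_base[OF vs(2)]]] by simp
  qed
  have C: "V a y x \<in> span S'" if y: "y \<in> vecs J" and x: "x \<in> span S'" for y x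
  proof (rule act_span[OF _ x])
    fix s' assume s': "s' \<in> S'"
    then obtain v s where vs: "v \<in> Ob" "s \<in> S" "s' = prj a J v s" by (auto simp: S'_def)
    have "s' \<in> wt a J v" unfolding vs(3) by (rule prj_wt[OF ctx]) (use vs ObJ SM in auto)
    thus "V a y s' \<in> span S'" using wt_D[OF _ y] s' by (simp add: span_scale span_base)
  qed
  have "act g x \<in> span S'" if g: "g \<in> stab n I" and x: "x \<in> span S'" for g x
  proof -
    obtain y h where yh: "y \<in> vecs J" "h \<in> stab n J" "g = eich n (bas a) y * h"
      using stab_decomp[OF two sI aI g] unfolding J by blast
    have "act g x = V a y (act h x)"
      unfolding yh(3) by (rule act_mult[OF V_U[OF ctx yh(1)] stab_U[OF yh(2)]]) (use x span_M[OF S'M] in auto)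
    thus ?thesis using C[OF yh(1) B[OF yh(2) x]] by simp
  qed
  moreover have "\<exists>x\<in>S'. x \<noteq> 0"
  proof -
    obtain s where s: "s \<in> S" "s \<noteq> 0" using S(4) by blast
    obtain v where v: "v \<in> vecs J" "prj a J v s \<noteq> 0" by (rule ex_weight[OF ctx _ s(2)]) (use s SM in auto)
    hence "v \<in> Ob" using s S(2) by (auto simp: W'_def)
    thus ?thesis using v s by (force simp: S'_def)
  qed
  moreover have "finite S'" unfolding S'_def using cO(1) S(1) by auto
  ultimately show ?thesis unfolding small_def using c S'W by blast
qed

end

end

section \<open>Ranks of blocks and the exponent of the largest degree\<close>

definition pc :: "int set \<Rightarrow> nat" where
  "pc I = card {i \<in> I. 0 < i}"

lemma card_symm:
  assumes "symm n I"
  shows "card I = 2 * pc I + of_bool (0 \<in> I)"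
proof -
  let ?P = "{i \<in> I. 0 < i}" and ?N = "{i \<in> I. i < 0}" and ?Z = "{i \<in> I. i = 0}"
  have f: "finite I" by (rule symm_finite[OF assms])
  have "bij_betw uminus ?P ?N"
    by (rule bij_betw_byWitness[where f'=uminus]) (use assms in \<open>auto simp: symm_def\<close>)
  hence c: "card ?N = pc I" by (simp add: bij_betw_same_card pc_def)
  have "card (?N \<union> ?Z) = card ?N + card ?Z"
    by (rule card_Un_disjoint) (use f in \<open>simp_all add: disjoint_iff\<close>)
  moreover have "card (?P \<union> (?N \<union> ?Z)) = card ?P + card (?N \<union> ?Z)"
    by (rule card_Un_disjoint) (use f in \<open>simp_all add: disjoint_iff\<close>)
  moreover have "?P \<union> (?N \<union> ?Z) = I" by force
  moreover have "card ?Z = of_bool (0 \<in> I)"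
  proof (cases "0 \<in> I")
    case True
    hence "?Z = {0}" by blast
    thus ?thesis using True by simp
  next
    case False
    hence "?Z = {}" by blast
    thus ?thesis using False by simp
  qed
  ultimately show ?thesis using c by (simp add: pc_def)
qed

lemma pc_remove:
  assumes "symm n I" "k \<in> I" "0 < k"
  shows "pc I = Suc (pc (I - {k, - k}))"
proof -
  have "{i \<in> I. 0 < i} = insert k {i \<in> I - {k, - k}. 0 < i}" using assms by auto
  thus ?thesis using symm_finite[OF assms(1)] by (simp add: pc_def)
qed

lemma pc_remove0: "pc (I - {0}) = pc I"
  unfolding pc_def by (rule arg_cong[where f=card]) auto

definition tri :: "nat \<Rightarrow> nat" where
  "tri p = p * (p - 1) div 2"

lemma tri_Suc: "tri (Suc p) = tri p + p"
proof -
  have "Suc p * p = p * (p - 1) + p * 2" by (cases p) auto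
  thus ?thesis unfolding tri_def by simp
qed

lemma tri_0 [simp]: "tri 0 = 0"
  by (simp add: tri_def)

lemma tri_pos: "2 \<le> p \<Longrightarrow> 1 \<le> tri p"
  by (induction p rule: nat_induct_at_least) (auto simp: tri_Suc eval_nat_numeral)

text \<open>The exponent of the largest degree of \<^term>\<open>stab n I\<close> if \<^term>\<open>0 \<in> I\<close>.  Otherwise
  \<^term>\<open>stab n I\<close> is of type D and the value is only an upper bound.\<close>

definition dexp :: "int set \<Rightarrow> nat" where
  "dexp I = (if 0 \<in> I then tri (pc I) else tri (pc I) - 1)"

context linear_action begin

lemma inv_on_wt:
  assumes s: "symm n I" "minpos I a" "J = I - {a, - a}" and W: "inv_on I W" and K: "K \<subseteq> J" and w: "w \<in> vecs J"
    and f: "\<And>g. g \<in> stab n K \<Longrightarrow> app n g w = w"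
  shows "inv_on K (W \<inter> wt a J w)"
  unfolding inv_on_def
proof (intro conjI ballI)
  show "subspace (W \<inter> wt a J w)" using W by (intro subspace_inter subspace_wt) (simp add: inv_on_def)
  show "W \<inter> wt a J w \<subseteq> M" using W by (auto simp: inv_on_def)
  fix g :: "'a mat" and x assume g: "g \<in> stab n K" and x: "x \<in> W \<inter> wt a J w"
  have gJ: "g \<in> stab n J" using stab_mono[OF K] g by blast
  have "g \<in> stab n I" using stab_mono[of J I n] gJ s(3) by auto
  hence "act g x \<in> W" using W x by (simp add: inv_on_def)
  moreover have "act g x \<in> wt a J w" using wt_act[OF s gJ w, of x] x f[OF g] by simp
  ultimately show "act g x \<in> W \<inter> wt a J w" by simp
qed

lemma sum_theta_mult: "(\<Sum>c\<in>UNIV. \<theta> (c * t)) = (if t = 0 then of_nat CARD('a) else 0)"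
proof (cases "t = 0")
  case False
  obtain u where u: "\<theta> (u * t) \<noteq> 1" using theta_scale_nontriv[OF False] by blast
  let ?s = "\<Sum>c\<in>UNIV. \<theta> (c * t)"
  have "?s = (\<Sum>c\<in>UNIV. \<theta> ((c + u) * t))"
    by (rule sum.reindex_bij_witness[where i="\<lambda>c. c + u" and j="\<lambda>c. c - u"]) simp_all
  also have "\<dots> = ?s * \<theta> (u * t)" by (simp add: distrib_right theta_add sum_distrib_right)
  finally have "?s = ?s * \<theta> (u * t)" .
  hence "?s = 0" using u by (metis mult_cancel_left1)
  thus ?thesis using False by simp
qed simp

text \<open>The multiples of \<open>v\<close> give an action of the additive group of the field. The
  averages of \<open>x\<close> against all its characters sum to \<open>x\<close>, so one of them is
  nonzero, and it is an eigenvector.\<close>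

lemma ex_line_weight:
  assumes v: "adm n e v" and x: "x \<in> M" "x \<noteq> 0" and L: "subspace L" "L \<subseteq> M" "x \<in> L"
    and inv: "\<And>t x. x \<in> L \<Longrightarrow> act (eich n e (scl t v)) x \<in> L"
  obtains c z where "z \<in> L" "z \<noteq> 0" "\<And>t. act (eich n e (scl t v)) z = \<theta> (c * t) *s z"
proof -
  let ?A = "\<lambda>t. act (eich n e (scl t v))"
  let ?P = "\<lambda>c. avg UNIV (\<lambda>t. \<theta> (- (c * t))) ?A x"
  have A0: "?A 0 x = x" using act_one[OF x(1)] eich_zero[of n e] by (simp add: scl_def zero_fun_def)
  have "(\<Sum>c\<in>UNIV. ?P c) = x"
  proof (rule avg_sum[where z=0 and A="?A", OF finite UNIV_I _ A0])
    fix t :: 'a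
    have "(\<Sum>c\<in>UNIV. \<theta> (- (c * t))) = (\<Sum>c\<in>UNIV. \<theta> (c * t))"
      by (rule sum.reindex_bij_witness[where i=uminus and j=uminus]) simp_all
    thus "(\<Sum>c\<in>UNIV. \<theta> (- (c * t))) = (if t = 0 then of_nat CARD('a) else 0)"
      unfolding sum_theta_mult .
  qed
  hence "\<not> (\<forall>c. ?P c = 0)" using x(2) by force
  then obtain c where c: "?P c \<noteq> 0" by blast
  have "?P c \<in> L" by (rule avg_closed[OF L(1)]) (rule inv[OF L(3)])
  moreover have "?A t (?P c) = \<theta> (c * t) *s ?P c" for t
  proof -
    have "?A t (?P c) = (1 / \<theta> (- (c * t))) *s ?P c"
    proof (rule avg_eigen)
      show "bij_betw ((+) t) UNIV UNIV"
        by (rule bij_betw_byWitness[where f'="\<lambda>s. s - t"]) simp_all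
      fix s
      have "scl t v + scl s v = scl (t + s) v" by (simp add: fun_eq_iff distrib_right)
      hence "eich n e (scl t v) * eich n e (scl s v) = eich n e (scl (t + s) v)"
        using eich_mult[OF two, of e n "scl t v" "scl s v"] adm_D[OF adm_scl[OF v]] adm_D[OF v] by simp
      thus "?A t (?A s x) = ?A (t + s) x"
        using act_mult[OF eich_U[OF two adm_scl[OF v]] eich_U[OF two adm_scl[OF v]] x(1), of t s] by simp
    qed (auto simp: theta_nz distrib_left theta_add[symmetric])
    thus ?thesis by (simp add: theta_minus divide_inverse)
  qed
  ultimately show thesis using that c by blast
qed

lemma wt_translate:
  assumes s: "symm n I" "minpos I a" "J = I - {a, - a}" and W: "inv_on I W" and g: "g \<in> stab n J"
    and w0: "w0 \<in> vecs J" and x: "x \<in> W" "x \<in> wt a J (app n g w0)" "x \<noteq> 0"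
  obtains x0 where "x0 \<in> W \<inter> wt a J w0" "x0 \<noteq> 0"
proof
  note sJ = symm_J[OF s]
  have gw: "app n g w0 \<in> vecs J" by (rule stab_app_vecs[OF g sJ w0])
  have g': "uinv n g \<in> stab n J" by (rule stab_uinv[OF g])
  have "uinv n g \<in> stab n I" using stab_mono[of J I n] g' s(3) by auto
  thus "act (uinv n g) x \<in> W \<inter> wt a J w0"
    using wt_act[OF s g' gw x(2)] app_uinv(1)[OF stab_U[OF g] symm_vecs[OF sJ w0]] W x(1)
    by (auto simp: inv_on_def)
  show "act (uinv n g) x \<noteq> 0"
    using act_uinv(2)[OF stab_U[OF g] wt_M[OF x(2)]] x(3) by auto
qed

lemma smallD:
  assumes "small K L m"
  obtains S where "finite S" "S \<subseteq> L" "card S \<le> m" "\<exists>x\<in>S. x \<noteq> 0"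
    "\<And>g x. g \<in> stab n K \<Longrightarrow> x \<in> span S \<Longrightarrow> act g x \<in> span S"
  using assms unfolding small_def by blast

text \<open>\<open>small_neg\<close> asks that \<open>span S\<close> be stable under a one-parameter
  group at \<open>b\<close>, which lies outside the group of the induction hypothesis. So the
  hypothesis is applied to an eigenspace of that one-parameter group in the weight space. It
  commutes with \<open>stab n (J - {k, - k})\<close>, whose elements fix both \<open>bas b\<close>
  and the direction \<tau>; hence the eigenspace is invariant, and scalars preserve every span
  inside it.\<close>

lemma small_step_neg:
  assumes s: "symm n I" "minpos I a" "J = I - {a, - a}" and W: "inv_on I W"
    and k: "k \<in> J" "0 < k" and r: "r \<noteq> 0" and w: "w = scl r (bas (- k)) + scl c (bas k)"
    and b: "minpos J b" and x: "x \<in> W \<inter> wt a J w" "x \<noteq> 0"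
    and IH: "\<And>L x. inv_on (J - {k, - k}) L \<Longrightarrow> x \<in> L \<Longrightarrow> x \<noteq> 0 \<Longrightarrow> L \<subseteq> W \<inter> wt a J w \<Longrightarrow> small (J - {k, - k}) L m"
  shows "small I W (CARD('a) ^ card (J - {k, - k, - b}) * m)"
proof -
  note sJ = symm_J[OF s]
  let ?K = "J - {k, - k}"
  have kl: "k \<in> labels n" "- k \<in> J" "k \<noteq> 0" "- k \<noteq> k" using k sJ by (auto simp: symm_def)
  have wJ: "w \<in> vecs J" unfolding w using k kl by (simp add: vecs_add vecs_scl vecs_bas)
  have fixk: "app n g (bas k) = bas k" "app n g (bas (- k)) = bas (- k)" if "g \<in> stab n ?K" for g
    using that kl by (auto simp: stab_def)
  have L: "inv_on ?K (W \<inter> wt a J w)"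
    by (rule inv_on_wt[OF s W _ wJ]) (auto simp: w fixk app_add app_scl)
  have WM: "W \<subseteq> M" using W by (simp add: inv_on_def)
  let ?\<tau> = "scl r (bas (- k)) - scl c (bas k) :: int \<Rightarrow> 'a"
  have "\<exists>S. finite S \<and> S \<subseteq> W \<inter> wt a J w \<and> card S \<le> m \<and> (\<exists>x\<in>S. x \<noteq> 0) \<and>
    (\<forall>g x. g \<in> stab n ?K \<longrightarrow> x \<in> span S \<longrightarrow> act g x \<in> span S) \<and>
    (\<forall>t x. k \<noteq> b \<longrightarrow> x \<in> span S \<longrightarrow> V b (scl t ?\<tau>) x \<in> span S)"
  proof (cases "k = b")
    case True
    obtain S where "finite S" "S \<subseteq> W \<inter> wt a J w" "card S \<le> m" "\<exists>x\<in>S. x \<noteq> 0"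
      "\<And>g x. g \<in> stab n ?K \<Longrightarrow> x \<in> span S \<Longrightarrow> act g x \<in> span S"
      using smallD[OF IH[OF L x order_refl]] by blast
    thus ?thesis using True by blast
  next
    case False
    have bl: "b \<in> J" "0 < b" "b \<in> labels n" using b sJ by (auto simp: symm_def minpos_def)
    have kb: "- k \<noteq> b" "- b \<noteq> - k" using k bl False by auto
    have \<tau>J: "?\<tau> \<in> vecs (J - {b, - b})"
      using False k kl bl kb by (intro vecs_diff vecs_scl vecs_bas) auto
    note \<tau>a = minpos_adm[OF sJ b \<tau>J]
    have E: "eich n (bas b) (scl t ?\<tau>) \<in> stab n J" for t
      by (rule minpos_eich_stab[OF two sJ b vecs_scl[OF \<tau>J]])
    have Ew: "app n (eich n (bas b) (scl t ?\<tau>)) w = w" for t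
    proof -
      have "w (- b) = 0" unfolding w using kb k bl by (simp add: bas_apply)
      moreover have "bil n w ?\<tau> = 0" unfolding w using kl by (simp add: bil_lin bil_bas_left bas_apply)
      ultimately show ?thesis
        using app_eich[OF symm_vecs[OF sJ wJ] adm_D(1,2)[OF adm_scl[OF \<tau>a]], of t] bl
        by (auto simp: bil_bas_right bil_scl_right fun_eq_iff)
    qed
    have inv: "V b (scl t ?\<tau>) y \<in> W \<inter> wt a J w" if y: "y \<in> W \<inter> wt a J w" for t y
    proof -
      have "eich n (bas b) (scl t ?\<tau>) \<in> stab n I" using stab_mono[of J I n] E s(3) by auto
      thus ?thesis using wt_act[OF s E wJ, of y t] y W Ew[of t] by (auto simp: inv_on_def)
    qed
    have LL: "subspace (W \<inter> wt a J w)" "W \<inter> wt a J w \<subseteq> M" using L by (auto simp: inv_on_def)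
    have xM: "x \<in> M" using x(1) LL by auto
    obtain c' z where z: "z \<in> W \<inter> wt a J w" "z \<noteq> 0" "\<And>t. V b (scl t ?\<tau>) z = \<theta> (c' * t) *s z"
      using ex_line_weight[OF \<tau>a xM x(2) LL x(1) inv] by blast
    let ?L = "{y \<in> W \<inter> wt a J w. \<forall>t. V b (scl t ?\<tau>) y = \<theta> (c' * t) *s y}"
    have "inv_on ?K ?L"
      unfolding inv_on_def
    proof (intro conjI ballI)
      show "subspace ?L" using LL(1)
        by (auto simp: subspace_def act_add act_scale scale_right_distrib scale_left_commute)
      show "?L \<subseteq> M" using LL(2) by auto
      fix g :: "'a mat" and y assume g: "g \<in> stab n ?K" and y: "y \<in> ?L"
      have gJ: "g \<in> stab n J" using stab_mono[of ?K J n] g by auto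
      have gb: "app n g (bas b) = bas b" by (rule minpos_fixed[OF gJ sJ b])
      have g\<tau>: "app n g (scl t ?\<tau>) = scl t ?\<tau>" for t by (simp add: app_scl app_diff fixk[OF g])
      have yM: "y \<in> M" using y LL by auto
      have "V b (scl t ?\<tau>) (act g y) = \<theta> (c' * t) *s act g y" for t
      proof -
        have "g * eich n (bas b) (scl t ?\<tau>) = eich n (bas b) (scl t ?\<tau>) * g"
          using eich_conj[OF stab_U[OF gJ] adm_D(1,2)[OF adm_scl[OF \<tau>a]], of t] unfolding gb g\<tau> .
        hence "V b (scl t ?\<tau>) (act g y) = act g (V b (scl t ?\<tau>) y)"
          using act_mult[OF stab_U[OF E] stab_U[OF gJ] yM, of t] act_mult[OF stab_U[OF gJ] stab_U[OF E] yM, of t] by simp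
        thus ?thesis using y by (simp add: act_scale)
      qed
      moreover have "act g y \<in> W \<inter> wt a J w" using L g y by (auto simp: inv_on_def)
      ultimately show "act g y \<in> ?L" by simp
    qed
    from IH[OF this _ z(2)] z obtain S where S: "finite S" "S \<subseteq> ?L" "card S \<le> m" "\<exists>x\<in>S. x \<noteq> 0"
      "\<And>g x. g \<in> stab n ?K \<Longrightarrow> x \<in> span S \<Longrightarrow> act g x \<in> span S"
      using smallD[of ?K ?L m] by blast
    have "V b (scl t ?\<tau>) y \<in> span S" if "y \<in> span S" for t y
    proof (rule act_span[OF _ that])
      fix s assume "s \<in> S"
      hence "V b (scl t ?\<tau>) s = \<theta> (c' * t) *s s" using S(2) by blast
      thus "V b (scl t ?\<tau>) s \<in> span S" using \<open>s \<in> S\<close> by (simp add: span_scale span_base)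
    qed
    thus ?thesis using S by blast
  qed
  then obtain S where S: "finite S" "S \<subseteq> W \<inter> wt a J w" "card S \<le> m" "\<exists>x\<in>S. x \<noteq> 0"
    "\<And>g x. g \<in> stab n ?K \<Longrightarrow> x \<in> span S \<Longrightarrow> act g x \<in> span S"
    "\<And>t x. k \<noteq> b \<Longrightarrow> x \<in> span S \<Longrightarrow> V b (scl t ?\<tau>) x \<in> span S" by blast
  have "small I W (CARD('a) ^ card (J - {k, - k, - b}) * card S)"
    by (rule small_neg[OF s W S(1) _ _ S(4) k r w b S(5) S(6)]) (use S(2) in auto)
  thus ?thesis by (rule small_mono[OF _ order_refl]) (simp add: S(3))
qed

lemma small_step_zero:
  assumes s: "symm n I" "minpos I a" "J = I - {a, - a}" and W: "inv_on I W" and z: "0 \<in> J"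
    and x: "x \<in> W \<inter> wt a J (scl r (bas 0))" "x \<noteq> 0"
    and IH: "\<And>L x. inv_on (J - {0}) L \<Longrightarrow> x \<in> L \<Longrightarrow> x \<noteq> 0 \<Longrightarrow> small (J - {0}) L m"
  shows "small I W (CARD('a) ^ card {i \<in> J. 0 < i} * m)"
proof -
  have wJ: "scl r (bas 0) \<in> vecs J" by (rule vecs_scl[OF vecs_bas[OF z]])
  have L: "inv_on (J - {0}) (W \<inter> wt a J (scl r (bas 0)))"
    by (rule inv_on_wt[OF s W _ wJ]) (auto simp: app_scl stab_def)
  obtain S where S: "finite S" "S \<subseteq> W \<inter> wt a J (scl r (bas 0))" "card S \<le> m" "\<exists>x\<in>S. x \<noteq> 0"
    "\<And>g x. g \<in> stab n (J - {0}) \<Longrightarrow> x \<in> span S \<Longrightarrow> act g x \<in> span S"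
    using smallD[OF IH[OF L x]] by blast
  have "small I W (CARD('a) ^ card {i \<in> J. 0 < i} * card S)"
    by (rule small_zero[OF s W S(1) _ _ S(4) z S(5)]) (use S(2) in auto)
  thus ?thesis by (rule small_mono[OF _ order_refl]) (simp add: S(3))
qed

text \<open>The weight \<^term>\<open>w\<close> below is moved to a normal form depending on its last nonzero
  coordinate, which corresponds to a root \<open>\<epsilon>\<^sub>a + \<epsilon>\<^sub>k\<close>, \<open>\<epsilon>\<^sub>a\<close> or \<open>\<epsilon>\<^sub>a - \<epsilon>\<^sub>k\<close>.\<close>

lemma ex_small:
  assumes "symm n I" "inv_on I W" "x \<in> W" "x \<noteq> 0"
  shows "\<exists>d. small I W (CARD('a) ^ d) \<and> d \<le> dexp I \<and>
    (0 \<in> I \<longrightarrow> (\<forall>a b. minpos I a \<longrightarrow> minpos (I - {a, - a}) b \<longrightarrow>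
      (\<forall>t. \<forall>x\<in>W. V a (scl t (bas b)) x = x) \<longrightarrow>
      (3 \<le> pc I \<or> (\<forall>t. \<forall>x\<in>W. V a (scl t (bas 0)) x = x)) \<longrightarrow> d < dexp I))"
  using assms
proof (induction "card I" arbitrary: I W x rule: less_induct)
  case less
  note s = less.prems(1) and W = less.prems(2) and x = less.prems(3,4)
  have WM: "W \<subseteq> M" using W by (simp add: inv_on_def)
  show ?case
  proof (cases "\<exists>i\<in>I. 0 < i")
    case False
    have "i \<le> 0 \<and> 0 \<le> i" if "i \<in> I" for i using False that s by (force simp: symm_def)
    hence I: "I \<subseteq> {0}" by force
    have "act g y = y" if g: "g \<in> stab n I" and y: "y \<in> M" for g y
    proof -
      have f: "app n g (bas j) = bas j" if j: "j \<in> labels n" for j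
      proof (cases "j \<in> I")
        case True
        hence j0: "j = 0" using I by auto
        show ?thesis
        proof
          fix i show "app n g (bas j) i = bas j i"
          proof (cases "i \<in> labels n \<and> i \<noteq> j")
            case True
            hence "i \<notin> I" using I j0 by auto
            thus ?thesis using stab_app_out[OF g s vecs_bas[OF j]] True by simp
          next
            case False
            have "app n g (bas j) j = bas j j"
              by (rule app_top[OF stab_U[OF g] j]) (auto simp: bas_apply)
            thus ?thesis using False j by (cases "i = j") (auto simp: app_def bas_apply)
          qed
        qed
      next
        case False
        thus ?thesis using g j by (simp add: stab_def)
      qed
      have "g = 1\<^sub>m (2*n+1)"
        by (rule mat_eq_appI[of g n, OF U_carrier[OF stab_U[OF g]]]) (use f in \<open>auto simp: app_one vecs_bas\<close>)
      thus ?thesis using act_one[OF y] by simp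
    qed
    moreover have "span {x} \<subseteq> M" by (rule span_M) (use x WM in auto)
    ultimately have "small I W (CARD('a) ^ 0)"
      unfolding small_def by (intro exI[of _ "{x}"]) (use x in auto)
    moreover have "\<not> minpos I a" for a using False by (auto simp: minpos_def)
    ultimately show ?thesis by blast
  next
    case True
    then obtain a where a: "minpos I a" using minpos_ex[OF symm_finite[OF s]] by blast
    define J where "J = I - {a, - a}"
    note ctx = s a J_def
    note sJ = symm_J[OF ctx]
    have aI: "a \<in> I" "0 < a" "- a \<in> I" using a s by (auto simp: minpos_def symm_def)
    have pI: "pc I = Suc (pc J)" unfolding J_def by (rule pc_remove[OF s aI(1,2)])
    have cI: "card I = card J + 2" and z: "0 \<in> J \<longleftrightarrow> 0 \<in> I"
      using card_symm[OF s] card_symm[OF sJ] pI aI by (auto simp: J_def)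
    have a': "a' = a" if "minpos I a'" for a' using that a by (auto simp: minpos_def intro: order_antisym)
    obtain w where w: "w \<in> vecs J" "prj a J w x \<noteq> 0"
      by (rule ex_weight[OF ctx _ x(2)]) (use x WM in auto)
    define y where "y = prj a J w x"
    have y: "y \<in> W" "y \<in> wt a J w" "y \<noteq> 0"
      using prj_inv_on[OF ctx W x(1)] prj_wt[OF ctx w(1)] x WM w(2) by (auto simp: y_def)
    \<comment> \<open>A root subgroup acting trivially forces the corresponding coordinate of the
      weight to vanish; this is how the triviality assumptions of the strict bound take
      effect.\<close>
    have triv: "w (- v) = 0" if v: "v \<in> J" and "\<forall>t. \<forall>x\<in>W. V a (scl t (bas v)) x = x" for v
    proof (rule ccontr)
      assume "w (- v) \<noteq> 0"
      then obtain t where t: "\<theta> (t * w (- v)) \<noteq> 1" using theta_scale_nontriv by blast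
      have vl: "v \<in> labels n" using v sJ by (auto simp: symm_def)
      have "\<theta> (bil n w (scl t (bas v))) *s y = 1 *s y"
        using wt_D[OF y(2), of "scl t (bas v)"] that y(1) v by (simp add: vecs_scl vecs_bas)
      thus False using y(3) t vl by (simp add: bil_scl_right bil_bas_right del: scale_one)
    qed
    consider (neg) k where "k \<in> J" "0 < k" "w (- k) \<noteq> 0"
      | (zero) "w 0 \<noteq> 0" "\<And>k. 0 < k \<Longrightarrow> w (- k) = 0"
      | (pos) "w \<in> vecs {i \<in> J. 0 < i}"
    proof (cases "\<exists>k\<in>J. 0 < k \<and> w (- k) \<noteq> 0")
      case True thus thesis using neg by blast
    next
      case False
      hence f: "w (- k) = 0" if "0 < k" for k
        using that vecs_D[OF w(1), of "- k"] symm_uminus[OF sJ, of k] by auto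
      show thesis
      proof (cases "w 0 = 0")
        case True
        have "w i = 0" if "i \<notin> {i \<in> J. 0 < i}" for i
          using that f[of "- i"] True vecs_D[OF w(1), of i] by (cases i "0::int" rule: linorder_cases) auto
        thus thesis using pos by (simp add: vecs_def)
      qed (use zero f in auto)
    qed
    thus ?thesis
    proof cases
      case (neg k0)
      \<comment> \<open>Among negative labels a smaller absolute value means a later position, so
        the least \<open>k\<close> gives the last nonzero coordinate.\<close>
      define k where "k = Min {k \<in> J. 0 < k \<and> w (- k) \<noteq> 0}"
      have fin: "finite {k \<in> J. 0 < k \<and> w (- k) \<noteq> 0}" "{k \<in> J. 0 < k \<and> w (- k) \<noteq> 0} \<noteq> {}"
        using symm_finite[OF sJ] neg by auto
      have k: "k \<in> J" "0 < k" "w (- k) \<noteq> 0" using Min_in[OF fin] by (auto simp: k_def)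
      have kmin: "k \<le> j" if "j \<in> J" "0 < j" "w (- j) \<noteq> 0" for j
        using Min_le[OF fin(1), of j] that by (auto simp: k_def)
      have kl: "- k \<in> J" "k \<in> labels n" using k sJ by (auto simp: symm_def)
      obtain b where b: "minpos J b" using minpos_ex[OF symm_finite[OF sJ] k(1,2)] by blast
      have bJ: "b \<in> J" "0 < b" "- b \<in> J" "b \<le> k" using b sJ k by (auto simp: minpos_def symm_def)
      have b': "b' = b" if "minpos J b'" for b' using that b by (auto simp: minpos_def intro: order_antisym)
      have top: "w j = 0" if j: "j \<in> J" "pos n (- k) < pos n j" for j
      proof (rule ccontr)
        assume "w j \<noteq> 0"
        have "j \<in> labels n" "- j \<in> J" using j sJ by (auto simp: symm_def)
        hence "0 < - j" "- j < k" using j k kl by (auto simp: pos_less_iff split: if_splits)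
        thus False using kmin[of "- j"] \<open>- j \<in> J\<close> \<open>w j \<noteq> 0\<close> by auto
      qed
      obtain g c where g: "g \<in> stab n J" "w = app n g (scl (w (- k)) (bas (- k)) + scl c (bas k))"
        using orbit_rep[OF two sJ w(1) k top] by blast
      define w0 where "w0 = scl (w (- k)) (bas (- k)) + scl c (bas k)"
      have w0: "w0 \<in> vecs J" unfolding w0_def using k kl by (simp add: vecs_add vecs_scl vecs_bas)
      obtain x0 where x0: "x0 \<in> W \<inter> wt a J w0" "x0 \<noteq> 0"
        by (rule wt_translate[OF ctx W g(1) w0 y(1) _ y(3)]) (use y(2) g(2) in \<open>simp add: w0_def\<close>)
      let ?K = "J - {k, - k}"
      have sK: "symm n ?K" by (rule symm_remove[OF sJ])
      have pJ: "pc J = Suc (pc ?K)" by (rule pc_remove[OF sJ k(1,2)])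
      have zK: "0 \<in> ?K \<longleftrightarrow> 0 \<in> I" using k z by auto
      have cK: "card ?K < card I" using card_symm[OF sK] card_symm[OF s] pI pJ zK by simp
      have IH: "small ?K L (CARD('a) ^ dexp ?K)" if L: "inv_on ?K L" "x \<in> L" "x \<noteq> 0" for L x
      proof -
        obtain d where "small ?K L (CARD('a) ^ d)" "d \<le> dexp ?K" using less.hyps[OF cK sK L] by blast
        thus ?thesis by (auto elim!: small_mono intro: power_increasing)
      qed
      have sm: "small I W (CARD('a) ^ (card (J - {k, - k, - b}) + dexp ?K))"
        using small_step_neg[OF ctx W k(1,2,3) w0_def b x0 IH] by (simp add: power_add)
      have "J - {k, - k, - b} = (if k = b then ?K else ?K - {- b})" using k bJ by auto
      moreover have "k \<noteq> b \<Longrightarrow> - b \<in> ?K" using bJ k by auto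
      ultimately have c3: "card (J - {k, - k, - b}) = (if k = b then card ?K else card ?K - 1)"
        using symm_finite[OF sK] by simp
      have cK2: "card ?K = 2 * pc ?K + of_bool (0 \<in> I)" using card_symm[OF sK] zK by simp
      have p1: "k \<noteq> b \<Longrightarrow> 1 \<le> pc ?K"
      proof -
        assume "k \<noteq> b"
        hence "b \<in> {i \<in> ?K. 0 < i}" using bJ k by auto
        thus ?thesis using symm_finite[OF sK] by (auto simp: pc_def Suc_le_eq card_gt_0_iff)
      qed
      \<comment> \<open>With p the rank of the remaining block, tri(p + 2) = tri(p) + 2p + 1, and if
        0 is a label then 2p + 1 is the size of that block. In this case the bound is met exactly
        for k = b, and for k \<noteq> b one is left over.\<close>
      have dI: "dexp I = (if 0 \<in> I then tri (pc ?K) + (2 * pc ?K + 1) else tri (pc ?K) + (2 * pc ?K + 1) - 1)"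
        by (simp add: dexp_def pI pJ tri_Suc)
      have dK: "dexp ?K = (if 0 \<in> I then tri (pc ?K) else tri (pc ?K) - 1)" using zK by (simp add: dexp_def)
      have kb: "k \<noteq> b" if "0 \<in> I" "minpos I a'" "minpos (I - {a', - a'}) b'" "\<forall>t. \<forall>x\<in>W. V a' (scl t (bas b')) x = x" for a' b'
      proof -
        have "a' = a" by (rule a'[OF that(2)])
        hence "b' = b" using b' that(3) by (simp add: J_def)
        hence "w (- b) = 0" using triv[OF bJ(1)] that(4) \<open>a' = a\<close> by simp
        thus ?thesis using k(3) by auto
      qed
      have le: "card (J - {k, - k, - b}) + dexp ?K \<le> dexp I"
        unfolding c3 cK2 dI dK by auto
      have less: "card (J - {k, - k, - b}) + dexp ?K < dexp I" if "0 \<in> I" "k \<noteq> b"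
        using that p1 unfolding c3 cK2 dI dK by auto
      show ?thesis using sm le less kb by blast
    next
      case zero
      have zJ: "0 \<in> J" using vecs_D[OF w(1), of 0] zero by auto
      obtain g where g: "g \<in> stab n J" "w = app n g (scl (w 0) (bas 0))"
        using orbit_rep0[OF two sJ w(1) zero(1)] zero(2)[of "- j" for j] by (metis minus_minus neg_0_less_iff_less)
      have w0: "scl (w 0) (bas 0) \<in> vecs J" by (rule vecs_scl[OF vecs_bas[OF zJ]])
      obtain x0 where x0: "x0 \<in> W \<inter> wt a J (scl (w 0) (bas 0))" "x0 \<noteq> 0"
        by (rule wt_translate[OF ctx W g(1) w0 y(1) _ y(3)]) (use y(2) g(2) in simp)
      let ?K = "J - {0}"
      have sK: "symm n ?K" by (rule symm_remove0[OF sJ])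
      have pK: "pc ?K = pc J" by (rule pc_remove0)
      have cK: "card ?K < card I" using card_symm[OF sK] card_symm[OF s] pI pK by simp
      have IH: "small ?K L (CARD('a) ^ dexp ?K)" if L: "inv_on ?K L" "x \<in> L" "x \<noteq> 0" for L x
      proof -
        obtain d where "small ?K L (CARD('a) ^ d)" "d \<le> dexp ?K" using less.hyps[OF cK sK L] by blast
        thus ?thesis by (auto elim!: small_mono intro: power_increasing)
      qed
      have sm: "small I W (CARD('a) ^ (pc J + dexp ?K))"
        using small_step_zero[OF ctx W zJ x0 IH] by (simp add: power_add pc_def)
      have dI: "dexp I = tri (pc J) + pc J" using zJ z pI by (simp add: dexp_def tri_Suc)
      have dK: "dexp ?K = tri (pc J) - 1" using pK by (simp add: dexp_def)
      \<comment> \<open>The exponent for type D is tri(pc J) - 1 in truncated subtraction, which is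
        less than tri(pc J) only if \<open>I\<close> has rank at least 3. In rank 2 the estimate for
        a weight of \<epsilon>_a equals \<open>dexp I\<close>, and this case is excluded by the
        trivial action of the transformations along \<open>bas 0\<close>.\<close>
      have "3 \<le> pc I" if "minpos I a'" "3 \<le> pc I \<or> (\<forall>t. \<forall>x\<in>W. V a' (scl t (bas 0)) x = x)" for a'
        using that a'[OF that(1)] triv[OF zJ] zero(1) by auto
      moreover have "tri (pc J) - 1 < tri (pc J)" if "3 \<le> pc I" using tri_pos[of "pc J"] that pI by simp
      ultimately show ?thesis using sm unfolding dI dK
        by (intro exI[of _ "pc J + (tri (pc J) - 1)"]) auto
    next
      case pos
      have cJ: "card J < card I" using cI by simp
      have IH: "small J L (CARD('a) ^ dexp J)" if L: "inv_on J L" "y \<in> L" for L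
      proof -
        obtain d where "small J L (CARD('a) ^ d)" "d \<le> dexp J" using less.hyps[OF cJ sJ L y(3)] by blast
        thus ?thesis by (auto elim!: small_mono intro: power_increasing)
      qed
      have sm: "small I W (CARD('a) ^ (pc J - 1 + dexp J))"
        using small_pos[OF ctx W pos y IH] by (simp add: power_add pc_def)
      have dI: "dexp I = (if 0 \<in> I then tri (pc J) + pc J else tri (pc J) + pc J - 1)"
        using pI by (simp add: dexp_def tri_Suc)
      have dJ: "dexp J = (if 0 \<in> I then tri (pc J) else tri (pc J) - 1)" using z by (simp add: dexp_def)
      have "1 \<le> pc J" if "minpos I a'" "minpos (I - {a', - a'}) b" for a' b
      proof -
        have "b \<in> {i \<in> J. 0 < i}" using that a'[OF that(1)] by (auto simp: minpos_def J_def)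
        thus ?thesis using symm_finite[OF sJ] by (auto simp: pc_def Suc_le_eq card_gt_0_iff)
      qed
      moreover have "pc J - 1 + dexp J \<le> dexp I" unfolding dI dJ using tri_Suc[of 0] by (cases "pc J") auto
      moreover have "pc J - 1 + dexp J < dexp I" if "0 \<in> I" "1 \<le> pc J" unfolding dI dJ using that by auto
      ultimately show ?thesis using sm by blast
    qed
  qed
qed

end

section \<open>Chains of roots\<close>

text \<open>The terms s B(v, e) e arising from y + s e cancel each other, and q is unchanged because
  \<open>e\<close> is isotropic and orthogonal to \<open>y\<close>.\<close>

lemma eich_add_e:
  assumes e: "e \<in> vecs (labels n)" "y \<in> vecs (labels n)" "bil n e e = 0" "bil n e y = 0"
  shows "eich n e (y + scl s e) = eich n e (y :: int \<Rightarrow> 'a::field)"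
proof (rule mat_eq_appI[OF eich_carrier eich_carrier])
  fix j assume "j \<in> labels n"
  hence u: "(bas j :: int \<Rightarrow> 'a) \<in> vecs (labels n)" by (rule vecs_bas)
  have y': "y + scl s e \<in> vecs (labels n)" by (intro vecs_add vecs_scl e)
  have "bil n y e = 0" using e(4) by (simp add: bil_commute)
  hence q: "qf n (y + scl s e) = qf n y" using e(3,4) by (simp add: qf_def bil_lin)
  show "app n (eich n e (y + scl s e)) (bas j) = app n (eich n e y) (bas j)"
    unfolding app_eich[OF u e(1) y'] app_eich[OF u e(1,2)] q
    by (rule ext) (simp add: bil_lin algebra_simps)
qed

text \<open>The block left after splitting off the first \<open>i\<close> pairs of labels 2j + 1, 2j
  + 2 and their negatives. The label 0 always belongs to it, so the block is of type B at every
  level.\<close>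

definition lev :: "nat \<Rightarrow> nat \<Rightarrow> int set" where
  "lev n i = {l \<in> labels n. l = 0 \<or> 2 * int i + 1 \<le> \<bar>l\<bar>}"

definition above :: "nat \<Rightarrow> int \<Rightarrow> int set" where
  "above n a = {l \<in> labels n. a < l}"

lemma up_adm:
  assumes "a \<in> labels n" "0 < a" "y \<in> vecs (insert 0 (above n a))"
  shows "adm n (bas a) (y :: int \<Rightarrow> 'a::field)"
proof (rule adm_bas[OF assms(2,1)])
  have "insert 0 (above n a) \<subseteq> {j \<in> labels n. pos n j < pos n (- a) \<and> j \<noteq> a}"
    using assms by (auto simp: above_def pos_less_iff)
  from vecs_mono[OF this] assms(3) show "y \<in> vecs {j \<in> labels n. pos n j < pos n (- a) \<and> j \<noteq> a}" by blast
qed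

text \<open>The transformations with \<^term>\<open>y \<in> vecs Q\<close> are permuted by conjugation, because the component
  of \<^term>\<open>app n g y\<close> along \<^term>\<open>bas a\<close> does not matter.\<close>

lemma eich_conj_above:
  assumes two: "(2::'a::field) \<noteq> 0" and s: "symm n I" and a: "minpos I a" and QI: "Q \<subseteq> I"
    and Q: "Q \<subseteq> insert 0 (above n a)"
    and cl: "\<And>p q. q \<in> Q \<Longrightarrow> p \<in> I \<Longrightarrow> pos n p < pos n q \<Longrightarrow> p = a \<or> p \<in> Q"
    and g: "g \<in> stab n I" and y: "y \<in> vecs Q"
  obtains y' where "y' \<in> vecs Q" "eich n (bas a) y * g = g * eich n (bas a) (y' :: int \<Rightarrow> 'a)"
    "(\<And>p. p \<in> I \<Longrightarrow> pos n 0 < pos n p \<Longrightarrow> y p = 0) \<Longrightarrow> 0 \<in> I \<Longrightarrow> y' 0 = y 0"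
proof -
  have al: "a \<in> labels n" "0 < a" using a s by (auto simp: minpos_def symm_def)
  have gU: "g \<in> U_set n" and g'U: "uinv n g \<in> U_set n" using stab_U[OF g] uinv_U by auto
  have g': "uinv n g \<in> stab n I" by (rule stab_uinv[OF g])
  have yl: "y \<in> vecs I" using y vecs_mono[OF QI] by blast
  let ?z = "app n (uinv n g) y"
  have zl: "?z \<in> vecs I" by (rule stab_app_vecs[OF g' s yl])
  define y' where "y' = (\<lambda>i. if i = a then 0 else ?z i)"
  have zi: "?z i = y i" if i: "i \<in> I" and f: "\<And>j. j \<in> I \<Longrightarrow> pos n i < pos n j \<Longrightarrow> y j = 0" for i
  proof (rule app_top[OF g'U])
    show "i \<in> labels n" using i s by (auto simp: symm_def)
    fix j assume "j \<in> labels n" "pos n i < pos n j"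
    thus "y j = 0" using f[of j] vecs_D[OF yl, of j] by blast
  qed
  have z0: "?z i = 0" if "i \<noteq> a" "i \<notin> Q" for i
  proof (cases "i \<in> I")
    case True
    have "?z i = y i"
    proof (rule zi[OF True])
      fix j assume j: "j \<in> I" "pos n i < pos n j"
      show "y j = 0" using cl[of j i] that True j vecs_D[OF y, of j] by blast
    qed
    thus ?thesis using vecs_D[OF y that(2)] by simp
  qed (rule vecs_D[OF zl])
  have y'Q: "y' \<in> vecs Q" using z0 by (auto simp: y'_def vecs_def)
  have zy': "?z = y' + scl (?z a) (bas a)"
  proof -
    have "a \<notin> Q" using Q al by (auto simp: above_def)
    thus ?thesis using vecs_D[OF y'Q, of a] by (auto simp: fun_eq_iff y'_def bas_apply)
  qed
  have y'U: "y' \<in> vecs (insert 0 (above n a))" using y'Q vecs_mono[OF Q] by blast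
  have ez: "eich n (bas a) ?z = eich n (bas a) y'"
    by (subst zy') (rule eich_add_e[OF adm_D(1,2,3,4)[OF up_adm[OF al y'U]]])
  have "g * eich n (bas a) ?z = eich n (app n g (bas a)) (app n g ?z) * g"
    by (rule eich_conj[OF gU]) (use al in \<open>simp_all add: vecs_bas\<close>)
  also have "app n g (bas a) = bas a" by (rule minpos_fixed[OF g s a])
  also have "app n g ?z = y" by (rule app_uinv(2)[OF gU symm_vecs[OF s yl]])
  finally have e: "eich n (bas a) y * g = g * eich n (bas a) y'" unfolding ez by simp
  have "y' 0 = y 0" if "\<And>p. p \<in> I \<Longrightarrow> pos n 0 < pos n p \<Longrightarrow> y p = 0" "0 \<in> I"
    using zi[OF that(2,1)] al by (simp add: y'_def)
  thus thesis using that[OF y'Q e] by blast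
qed

lemma symm_lev: "symm n (lev n i)"
  by (auto simp: symm_def lev_def)

lemma lev_0: "lev n 0 = labels n"
  by (auto simp: lev_def)

lemma zero_lev [simp]: "0 \<in> lev n i"
  by (simp add: lev_def)

lemma minpos_lev: "2 * i + 1 \<le> n \<Longrightarrow> minpos (lev n i) (2 * int i + 1)"
  by (auto simp: minpos_def lev_def labels_def)

lemma minpos_lev2:
  "2 * i + 2 \<le> n \<Longrightarrow> minpos (lev n i - {2 * int i + 1, - (2 * int i + 1)}) (2 * int i + 2)"
  by (auto simp: minpos_def lev_def labels_def)

lemma lev_Suc:
  "lev n i - {2 * int i + 1, - (2 * int i + 1)} - {2 * int i + 2, - (2 * int i + 2)} = lev n (Suc i)"
  by (auto simp: lev_def)

lemma pc_lev: "pc (lev n i) = n - 2 * i"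
proof -
  have "{l \<in> lev n i. 0 < l} = {2 * int i + 1..int n}" by (auto simp: lev_def labels_def)
  thus ?thesis by (simp add: pc_def)
qed

lemma card_lev: "card (lev n i) = 2 * (n - 2 * i) + 1"
  using card_symm[OF symm_lev, of n i] by (simp add: pc_lev)

lemma dexp_lev: "dexp (lev n i) = tri (n - 2 * i)"
  by (simp add: dexp_def pc_lev)

section \<open>Lower bounds by independent families\<close>

context linear_action begin

definition large :: "'v set \<Rightarrow> nat \<Rightarrow> bool" where
  "large W m \<longleftrightarrow> (\<exists>T. finite T \<and> \<not> dependent T \<and> T \<subseteq> W \<and> m \<le> card T)"

lemma large_one: "x \<in> W \<Longrightarrow> x \<noteq> 0 \<Longrightarrow> large W 1"
  unfolding large_def by (intro exI[of _ "{x}"]) (simp add: dependent_single)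

lemma scale_fact_eq_0:
  assumes "\<not> dependent T" "finite T" "(\<Sum>t\<in>T. f t *s t) = 0" "t \<in> T"
  shows "f t = 0"
  using assms by (auto simp: dependent_finite)

text \<open>Components of distinct weights are independent: projecting a linear relation to the
  weight g(y) w keeps exactly the translates by g(y), and undoing g(y) leaves a relation inside the
  given independent set.\<close>

lemma large_translate:
  assumes s: "symm n I" "minpos I a" "J = I - {a, - a}" and W: "inv_on I W" and w: "w \<in> vecs J"
    and L: "large (W \<inter> wt a J w) m" and Y: "finite Y" and g: "\<And>y. y \<in> Y \<Longrightarrow> g y \<in> stab n J"
    and inj: "inj_on (\<lambda>y. app n (g y) w) Y"
  shows "large W (card Y * m)"
proof -
  note sJ = symm_J[OF s]
  obtain T where T: "finite T" "\<not> dependent T" "T \<subseteq> W \<inter> wt a J w" "m \<le> card T"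
    using L unfolding large_def by blast
  have TM: "t \<in> M" if "t \<in> T" for t using that T(3) W by (auto simp: inv_on_def)
  let ?f = "\<lambda>(y, t). act (g y) t"
  have gw: "app n (g y) w \<in> vecs J" if "y \<in> Y" for y by (rule stab_app_vecs[OF g[OF that] sJ w])
  have wt: "act (g y) t \<in> wt a J (app n (g y) w)" if "y \<in> Y" "t \<in> T" for y t
    by (rule wt_act[OF s g[OF that(1)] w]) (use that(2) T(3) in blast)
  have key: "c (y, t) = 0" if "(\<Sum>(y, t)\<in>Y \<times> T. c (y, t) *s act (g y) t) = 0" and yt: "y \<in> Y" "t \<in> T" for c y t
  proof -
    have "0 = prj a J (app n (g y) w) (\<Sum>z\<in>Y. \<Sum>t\<in>T. c (z, t) *s act (g z) t)"
      using that(1) by (simp add: sum.cartesian_product)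
    also have "\<dots> = (\<Sum>z\<in>Y. \<Sum>t\<in>T. c (z, t) *s prj a J (app n (g y) w) (act (g z) t))"
      by (simp add: prj_sum prj_scale)
    also have "\<dots> = (\<Sum>z\<in>Y. if z = y then (\<Sum>t\<in>T. c (y, t) *s act (g y) t) else 0)"
    proof (intro sum.cong refl)
      fix z assume z: "z \<in> Y"
      have "app n (g y) w = app n (g z) w \<longleftrightarrow> z = y" using inj z yt(1) by (auto simp: inj_on_def)
      hence "prj a J (app n (g y) w) (act (g z) t) = (if z = y then act (g z) t else 0)" if "t \<in> T" for t
        using prj_of_wt[OF s gw[OF z] gw[OF yt(1)] wt[OF z that]] by simp
      thus "(\<Sum>t\<in>T. c (z, t) *s prj a J (app n (g y) w) (act (g z) t)) =
        (if z = y then (\<Sum>t\<in>T. c (y, t) *s act (g y) t) else 0)" by simp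
    qed
    also have "\<dots> = act (g y) (\<Sum>t\<in>T. c (y, t) *s t)"
      using yt(1) Y by (simp add: act_sum act_scale)
    finally have e: "act (g y) (\<Sum>t\<in>T. c (y, t) *s t) = 0" by simp
    have "(\<Sum>t\<in>T. c (y, t) *s t) \<in> M"
      by (intro subspace_sum[OF subspace_M] subspace_scale[OF subspace_M] TM)
    from act_uinv(1)[OF stab_U[OF g[OF yt(1)]] this] e have "(\<Sum>t\<in>T. c (y, t) *s t) = 0" by simp
    thus ?thesis using scale_fact_eq_0[OF T(2,1) _ yt(2), of "\<lambda>t. c (y, t)"] by simp
  qed
  have inj2: "inj_on ?f (Y \<times> T)"
  proof (rule inj_onI)
    fix p q assume p: "p \<in> Y \<times> T" and q: "q \<in> Y \<times> T" and e: "?f p = ?f q"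
    show "p = q"
    proof (rule ccontr)
      assume ne: "p \<noteq> q"
      \<comment> \<open>If two translates coincided, the coefficients 1 and -1 would give a relation
        contradicting \<open>key\<close>; so no members of the family are lost.\<close>
      define c where "c = (\<lambda>z. (if z = p then 1 else 0) - (if z = q then (1::complex) else 0))"
      have "(\<Sum>z\<in>Y \<times> T. c z *s ?f z) =
         (\<Sum>z\<in>Y \<times> T. if z = p then ?f p else 0) - (\<Sum>z\<in>Y \<times> T. if z = q then ?f q else 0)"
        unfolding sum_subtractf[symmetric] by (intro sum.cong refl) (simp add: c_def scale_left_diff_distrib)
      also have "\<dots> = 0" using p q e Y T(1) by simp
      finally have "(\<Sum>(y, t)\<in>Y \<times> T. c (y, t) *s act (g y) t) = 0" by (simp add: case_prod_unfold)
      from key[OF this, of "fst p" "snd p"] have "c p = 0" using p by (simp add: mem_Times_iff)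
      thus False using ne by (simp add: c_def)
    qed
  qed
  define T' where "T' = ?f ` (Y \<times> T)"
  have f: "finite T'" using Y T(1) by (simp add: T'_def)
  have "\<not> dependent T'"
    unfolding dependent_finite[OF f]
  proof (intro notI, elim exE conjE bexE)
    fix u v assume v: "v \<in> T'" "u v \<noteq> 0" and z: "(\<Sum>v\<in>T'. u v *s v) = 0"
    have "(\<Sum>(y, t)\<in>Y \<times> T. u (?f (y, t)) *s act (g y) t) = 0"
      using z unfolding T'_def sum.reindex[OF inj2] by (simp add: case_prod_unfold)
    from key[of "\<lambda>z. u (?f z)", OF this] v show False by (auto simp: T'_def)
  qed
  moreover have "T' \<subseteq> W"
  proof
    fix x assume "x \<in> T'"
    then obtain y t where yt: "y \<in> Y" "t \<in> T" "x = act (g y) t" by (auto simp: T'_def)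
    have "g y \<in> stab n I" using stab_mono[of J I n] g[OF yt(1)] s(3) by blast
    thus "x \<in> W" using W T(3) yt by (auto simp: inv_on_def)
  qed
  moreover have "card Y * m \<le> card T'"
    using card_image[OF inj2] T(4) by (simp add: T'_def card_cartesian_product)
  ultimately show ?thesis unfolding large_def using f by blast
qed

text \<open>Away from b and -b the transformation at \<open>b\<close> attached to y turns the weight
  into r y, so different elements y of \<open>vecs (J - {b, - b})\<close> give different
  weights.\<close>

lemma large_neg:
  assumes s: "symm n I" "minpos I a" "J = I - {a, - a}" and W: "inv_on I W" and b: "minpos J b"
    and r: "r \<noteq> 0" and w: "w = scl r (bas (- b)) + scl c (bas b)" and L: "large (W \<inter> wt a J w) m"
  shows "large W (CARD('a) ^ card (J - {b, - b}) * m)"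
proof -
  note sJ = symm_J[OF s]
  have bl: "b \<in> J" "- b \<in> J" "b \<in> labels n" "b \<noteq> 0" using b sJ by (auto simp: minpos_def symm_def)
  have wJ: "w \<in> vecs J" unfolding w by (intro vecs_add vecs_scl vecs_bas bl)
  let ?Y = "vecs (J - {b, - b}) :: (int \<Rightarrow> 'a) set"
  have fK: "finite (J - {b, - b})" using symm_finite[OF sJ] by simp
  have "large W (card ?Y * m)"
  proof (rule large_translate[OF s W wJ L card_vecs(1)[OF fK]])
    show "eich n (bas b) y \<in> stab n J" if "y \<in> ?Y" for y
      by (rule minpos_eich_stab[OF two sJ b that])
    show "inj_on (\<lambda>y. app n (eich n (bas b) y) w) ?Y"
    proof (rule inj_onI)
      fix y y' assume y: "y \<in> ?Y" and y': "y' \<in> ?Y" and e: "app n (eich n (bas b) y) w = app n (eich n (bas b) y') w"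
      have *: "app n (eich n (bas b) z) w i = r * z i" if "z \<in> ?Y" "i \<notin> {b, - b}" for z i
      proof -
        have "bil n w (bas b) = r" unfolding w using bl by (simp add: bil_bas_right)
        thus ?thesis
          unfolding app_eich[OF symm_vecs[OF sJ wJ] adm_D(1,2)[OF minpos_adm[OF sJ b that(1)]]]
          using that(2) by (simp add: w)
      qed
      show "y = y'"
      proof
        fix i show "y i = y' i"
          using *[OF y, of i] *[OF y', of i] e r vecs_D[OF y, of i] vecs_D[OF y', of i] by (cases "i \<in> {b, - b}") auto
      qed
    qed
  qed
  thus ?thesis by (simp add: card_vecs(2)[OF fK])
qed

text \<open>The transformation at \<open>b\<close> attached to t bas 0 changes the coordinate of
  \<open>w\<close> at \<open>b\<close> to c - t r, which gives q different weights.\<close>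

lemma large_zero:
  assumes s: "symm n I" "minpos I a" "J = I - {a, - a}" and W: "inv_on I W" and b: "minpos J b"
    and r: "r \<noteq> 0" and w: "w = scl r (bas 0) + scl c (bas b)" and z: "0 \<in> J" and L: "large (W \<inter> wt a J w) m"
  shows "large W (CARD('a) * m)"
proof -
  note sJ = symm_J[OF s]
  have bl: "b \<in> J" "- b \<in> J" "b \<in> labels n" "b \<noteq> 0" using b sJ by (auto simp: minpos_def symm_def)
  have wJ: "w \<in> vecs J" unfolding w by (intro vecs_add vecs_scl vecs_bas bl z)
  have y: "scl t (bas 0) \<in> vecs (J - {b, - b})" for t :: 'a
    using z bl by (intro vecs_scl vecs_bas) auto
  show ?thesis
  proof (rule large_translate[OF s W wJ L, of UNIV])
    show "eich n (bas b) (scl t (bas 0)) \<in> stab n J" for t :: 'a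
      by (rule minpos_eich_stab[OF two sJ b y])
    show "inj_on (\<lambda>t. app n (eich n (bas b) (scl t (bas 0))) w) UNIV"
    proof (rule inj_onI)
      fix t t' assume e: "app n (eich n (bas b) (scl t (bas 0))) w = app n (eich n (bas b) (scl t' (bas 0))) w"
      have "app n (eich n (bas b) (scl t (bas 0))) w b = c - t * r" for t
      proof -
        have "bil n w (bas b) = 0" unfolding w using bl by (simp add: bil_bas_right bas_apply)
        moreover have "bil n w (scl t (bas 0)) = t * r" unfolding w using bl by (simp add: bil_bas_right bil_scl_right)
        ultimately show ?thesis
          unfolding app_eich[OF symm_vecs[OF sJ wJ] adm_D(1,2)[OF minpos_adm[OF sJ b y]]]
          using bl by (simp add: w)
      qed
      thus "t = t'" using fun_cong[OF e, of b] r by simp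
    qed
  qed simp
qed

lemma prj_V:
  assumes s: "symm n I" "minpos I a" "J = I - {a, - a}" and w: "w \<in> vecs J" and y: "y \<in> vecs J" and x: "x \<in> M"
  shows "prj a J w (V a y x) = \<theta> (bil n w y) *s prj a J w x"
proof -
  have "V a y x = V a y (\<Sum>v\<in>vecs J. prj a J v x)" by (simp add: sum_prj[OF s x])
  also have "\<dots> = (\<Sum>v\<in>vecs J. \<theta> (bil n v y) *s prj a J v x)"
    unfolding act_sum by (intro sum.cong refl wt_D[OF prj_wt[OF s _ x] y])
  finally have "prj a J w (V a y x) = (\<Sum>v\<in>vecs J. \<theta> (bil n v y) *s prj a J w (prj a J v x))"
    by (simp add: prj_sum prj_scale)
  also have "\<dots> = (\<Sum>v\<in>vecs J. if v = w then \<theta> (bil n w y) *s prj a J w x else 0)"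
  proof (intro sum.cong refl)
    fix v :: "int \<Rightarrow> 'a" assume v: "v \<in> vecs J"
    show "\<theta> (bil n v y) *s prj a J w (prj a J v x) = (if v = w then \<theta> (bil n w y) *s prj a J w x else 0)"
      using prj_of_wt[OF s v w prj_wt[OF s v x]] by simp
  qed
  also have "\<dots> = \<theta> (bil n w y) *s prj a J w x" using w fin_vecs[OF s] by simp
  finally show ?thesis .
qed

lemma theta_eqI:
  assumes "\<And>t. \<theta> (t * x) = \<theta> (t * y)" shows "x = y"
proof (rule ccontr)
  assume "x \<noteq> y"
  then obtain t where "\<theta> (t * (x - y)) \<noteq> 1" using theta_scale_nontriv[of "x - y"] by auto
  thus False using assms[of t] by (simp add: right_diff_distrib theta_diff theta_minus_mult)
qed

text \<open>On the component of weight \<open>w\<close> the operator \<open>V a y\<close> acts by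
  \<theta>(B(w, y)), while on \<open>u\<close> it acts by the prescribed scalar. Comparing the two
  for multiples of \<open>bas q\<close> determines w(-q).\<close>

lemma weight_of_eigen:
  assumes s: "symm n I" "minpos I a" "J = I - {a, - a}" and u: "u \<in> M"
    and Q: "Q \<subseteq> J" and E: "\<And>y. y \<in> vecs Q \<Longrightarrow> V a y u = \<theta> (\<Sum>q\<in>Q. f q * y q) *s u"
    and w: "w \<in> vecs J" "prj a J w u \<noteq> 0" and q: "q \<in> Q"
  shows "w (- q) = f q"
proof (rule theta_eqI)
  note sJ = symm_J[OF s]
  fix t :: 'a
  have qJ: "q \<in> J" "q \<in> labels n" using q Q sJ by (auto simp: symm_def)
  have fQ: "finite Q" using Q symm_finite[OF sJ] finite_subset by blast
  have y: "scl t (bas q) \<in> vecs Q" "scl t (bas q) \<in> vecs J" using q qJ by (simp_all add: vecs_scl vecs_bas)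
  have "(\<Sum>p\<in>Q. f p * scl t (bas q) p) = (\<Sum>p\<in>Q. (t * f p) * bas q p)"
    by (intro sum.cong refl) (simp add: algebra_simps)
  also have "\<dots> = t * f q" using fQ q by (simp add: sum_bas)
  finally have "\<theta> (t * w (- q)) *s prj a J w u = \<theta> (t * f q) *s prj a J w u"
    using prj_V[OF s w(1) y(2) u] E[OF y(1)] qJ by (auto simp: prj_scale bil_scl_right bil_bas_right)
  thus "\<theta> (t * w (- q)) = \<theta> (t * f q)" using w(2) by (simp add: scale_right_imp_eq)
qed

end

text \<open>Simultaneous eigenvectors for the linear characters of the root subgroups along a chain
  \<open>\<epsilon>\<^sub>1 + \<epsilon>\<^sub>2, \<epsilon>\<^sub>3 + \<epsilon>\<^sub>4, \<dots>\<close>: a triple \<open>(a, y, c)\<close> of \<open>Eg\<close> prescribes the eigenvalue \<open>c\<close> for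
  \<open>eich n (bas a) y\<close>.\<close>

locale chain = linear_action n \<theta> scale act M
  for n and \<theta> :: "'a::{field,finite} \<Rightarrow> complex"
    and scale :: "complex \<Rightarrow> 'v::ab_group_add \<Rightarrow> 'v" (infixr "*s" 75)
    and act :: "'a mat \<Rightarrow> 'v \<Rightarrow> 'v" and M :: "'v set" +
  fixes m :: nat and r :: "nat \<Rightarrow> 'a" and Eg :: "(int \<times> (int \<Rightarrow> 'a) \<times> complex) set"
  assumes r: "i < m \<Longrightarrow> r i \<noteq> 0" and m: "2 * m \<le> n"
    and Eg_adm: "(a, y, c) \<in> Eg \<Longrightarrow> a \<in> labels n \<and> 0 < a \<and> y \<in> vecs (insert 0 (above n a))"
    and Eg1: "i < m \<Longrightarrow> y \<in> vecs (insert 0 (above n (2 * int i + 1))) \<Longrightarrow>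
      (2 * int i + 1, y, \<theta> (r i * y (2 * int i + 2))) \<in> Eg"
    and Eg2: "i < m \<Longrightarrow> y \<in> vecs (above n (2 * int i + 2)) \<Longrightarrow> (2 * int i + 2, y, 1) \<in> Eg"
begin

definition eigen :: "nat \<Rightarrow> 'v \<Rightarrow> bool" where
  "eigen i u \<longleftrightarrow> u \<in> M \<and> (\<forall>(a, y, c)\<in>Eg. 2 * int i + 1 \<le> a \<longrightarrow> V a y u = c *s u)"

lemma eigenD: "eigen i u \<Longrightarrow> (a, y, c) \<in> Eg \<Longrightarrow> 2 * int i + 1 \<le> a \<Longrightarrow> V a y u = c *s u"
  unfolding eigen_def by blast

lemma up_stab:
  assumes "a \<in> labels n" "0 < a" "y \<in> vecs (insert 0 (above n a))" "2 * int i + 1 \<le> a"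
  shows "eich n (bas a) (y :: int \<Rightarrow> 'a) \<in> stab n (lev n i)"
proof (rule eich_stab[OF two up_adm[OF assms(1,2,3)] symm_lev])
  show "bas a \<in> vecs (lev n i)" using assms by (intro vecs_bas) (auto simp: lev_def)
  have "insert 0 (above n a) \<subseteq> lev n i" using assms by (auto simp: above_def lev_def)
  from vecs_mono[OF this] assms(3) show "y \<in> vecs (lev n i)" by blast
qed

abbreviation lv :: "nat \<Rightarrow> int set" where
  "lv i \<equiv> lev n i - {2 * int i + 1, - (2 * int i + 1)}"

definition cw :: "nat \<Rightarrow> 'a \<Rightarrow> int \<Rightarrow> 'a" where
  "cw i c = scl (r i) (bas (- (2 * int i + 2))) + scl c (bas (2 * int i + 2))"

text \<open>The eigenvalues at label a = 2i + 1 prescribe the coordinates w(-q) of an occurring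
  weight for q = 0 and q > a, so \<open>w\<close> is r e_{-b} plus a part with positive support.
  This part is produced from the normal form \<open>cw i c\<close> by a transformation at b = 2i + 2
  which fixes \<open>u\<close>. Therefore already the component of \<open>u\<close> itself at the
  normal form is nonzero, and the elements prescribed for the next level, which fix
  \<open>cw i c\<close>, keep their eigenvalues on it.\<close>

lemma chain_step:
  assumes i: "i < m" and W: "inv_on (lev n i) W" and u: "u \<in> W" "u \<noteq> 0" "eigen i u"
  obtains c v where "v \<in> W \<inter> wt (2 * int i + 1) (lv i) (cw i c)" "v \<noteq> 0" "eigen (Suc i) v"
    "inv_on (lev n (Suc i)) (W \<inter> wt (2 * int i + 1) (lv i) (cw i c))"
proof -
  define a where "a = 2 * int i + 1"
  define b where "b = 2 * int i + 2"
  define J where "J = lev n i - {a, - a}"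
  have i2: "2 * i + 2 \<le> n" using i m by simp
  have ma: "minpos (lev n i) a" unfolding a_def by (rule minpos_lev) (use i2 in simp)
  have mb: "minpos J b" unfolding J_def a_def b_def by (rule minpos_lev2[OF i2])
  note s = symm_lev[of n i] ma J_def
  note sJ = symm_J[OF s]
  have K: "J - {b, - b} = lev n (Suc i)" unfolding J_def a_def b_def by (rule lev_Suc)
  have al: "a \<in> labels n" "0 < a" using i2 by (auto simp: a_def labels_def)
  have bl: "b \<in> J" "- b \<in> J" "b \<in> labels n" "0 < b" "- b \<in> labels n" using mb sJ by (auto simp: minpos_def symm_def)
  have uM: "u \<in> M" using u(1) W by (auto simp: inv_on_def)
  obtain w where w: "w \<in> vecs J" "prj a J w u \<noteq> 0" by (rule ex_weight[OF s uM u(2)])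
  let ?Q = "insert 0 (above n a)"
  have QJ: "?Q \<subseteq> J" using al by (auto simp: above_def J_def lev_def a_def)
  have fQ: "finite ?Q" using finite_subset[OF QJ symm_finite[OF sJ]] .
  have bQ: "b \<in> ?Q" using bl by (simp add: above_def a_def b_def)
  have wq: "w (- q) = (if q = b then r i else 0)" if q: "q \<in> ?Q" for q
  proof (rule weight_of_eigen[where f="\<lambda>q. if q = b then r i else 0", OF s uM QJ _ w q])
    fix y :: "int \<Rightarrow> 'a" assume y: "y \<in> vecs ?Q"
    have "(\<Sum>q\<in>?Q. (if q = b then r i else 0) * y q) = (\<Sum>q\<in>?Q. if q = b then r i * y b else 0)"
      by (intro sum.cong refl) simp
    also have "\<dots> = r i * y b" using fQ bQ by simp
    finally show "V a y u = \<theta> (\<Sum>q\<in>?Q. (if q = b then r i else 0) * y q) *s u"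
      using eigenD[OF u(3) Eg1[OF i, of y]] y by (simp add: a_def b_def)
  qed
  define c where "c = w b"
  \<comment> \<open>Division by r is needed because the transformation adds r y. As \<open>y\<close>
    is supported above b, q(y) = 0 and \<open>y\<close> is orthogonal to the normal form, so nothing
    else changes.\<close>
  define y where "y = (\<lambda>l. if b < l then w l / r i else 0)"
  have rn: "r i \<noteq> 0" by (rule r[OF i])
  have yU: "y \<in> vecs (above n b)" using symm_vecs[OF sJ w(1)] by (auto simp: y_def vecs_def above_def)
  have "above n b \<subseteq> insert 0 (above n b)" by blast
  hence yU': "y \<in> vecs (insert 0 (above n b))" using yU vecs_mono by blast
  note ya = up_adm[OF bl(3,4) yU']
  have "y j * y (- j) = 0" for j using bl(4) by (simp add: y_def)
  hence "bil n y y = 0" by (simp add: bil_def)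
  hence qy: "qf n y = 0" by (simp add: qf_def)
  have w0J: "cw i c \<in> vecs J" unfolding cw_def using bl by (intro vecs_add vecs_scl vecs_bas) (simp_all add: b_def)
  have cwi: "cw i c l = (if l = b then c else if l = - b then r i else 0)" for l
    by (simp add: cw_def b_def[symmetric] bas_apply) (simp add: b_def)
  have b1: "bil n (cw i c) (bas b) = r i" using bl by (simp add: bil_bas_right cwi)
  have b2: "bil n (cw i c) y = 0"
    unfolding cw_def b_def[symmetric] using bl by (simp add: bil_lin bil_bas_left y_def)
  have E: "eich n (bas b) y \<in> stab n J"
  proof (rule minpos_eich_stab[OF two sJ mb])
    have "above n b \<subseteq> J - {b, - b}" unfolding K by (auto simp: above_def lev_def b_def)
    thus "y \<in> vecs (J - {b, - b})" using yU vecs_mono by blast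
  qed
  have Ew: "app n (eich n (bas b) y) (cw i c) = w"
  proof
    fix l
    have "w l = cw i c l + r i * y l"
    proof (cases "l \<in> J")
      case lJ: True
      show ?thesis
      proof (cases "0 < l")
        case True
        hence "b \<le> l" using mb lJ by (simp add: minpos_def)
        thus ?thesis using bl(4) rn by (cases "l = b") (simp_all add: cwi y_def c_def[symmetric])
      next
        case False
        have "- l \<in> ?Q"
        proof -
          have "l \<in> labels n" "l \<noteq> - a" using lJ sJ by (auto simp: symm_def J_def)
          thus ?thesis using False lJ by (auto simp: above_def J_def lev_def a_def)
        qed
        from wq[OF this] show ?thesis using bl(4) False by (auto simp: cwi y_def)
      qed
    next
      case False
      hence "l \<noteq> b" "l \<noteq> - b" using bl by auto
      thus ?thesis using vecs_D[OF w(1) False] by (simp add: cwi y_def)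
    qed
    thus "app n (eich n (bas b) y) (cw i c) l = w l"
      unfolding app_eich[OF symm_vecs[OF sJ w0J] adm_D(1,2)[OF ya]] b1 b2 qy by simp
  qed
  have "V b y u = 1 *s u" unfolding b_def
    by (rule eigenD[OF u(3) Eg2[OF i]]) (use yU in \<open>simp_all add: b_def\<close>)
  hence Eu: "V b y u = u" by simp
  define v where "v = prj a J (cw i c) u"
  have "act (eich n (bas b) y) v = prj a J w u"
    unfolding v_def prj_act[OF s E w0J uM] Ew Eu ..
  hence v0: "v \<noteq> 0" using w(2) by auto
  have fixw: "app n g (cw i c) = cw i c" if "g \<in> stab n (lev n (Suc i))" for g
  proof -
    have "b \<in> labels n - lev n (Suc i)" "- b \<in> labels n - lev n (Suc i)"
      using bl by (auto simp: lev_def b_def)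
    hence "app n g (bas b) = bas b" "app n g (bas (- b)) = bas (- b)" using that by (auto simp: stab_def)
    thus ?thesis unfolding cw_def b_def[symmetric] by (simp add: app_add app_scl)
  qed
  have vW: "v \<in> W \<inter> wt a J (cw i c)"
    unfolding v_def using prj_inv_on[OF s W u(1)] prj_wt[OF s w0J uM] by simp
  have ev: "eigen (Suc i) v"
    unfolding eigen_def
  proof (intro conjI ballI)
    show "v \<in> M" using vW W by (auto simp: inv_on_def)
    fix p assume "p \<in> Eg"
    obtain a' y' c' where p: "p = (a', y', c')" by (cases p) auto
    have e: "(a', y', c') \<in> Eg" using \<open>p \<in> Eg\<close> p by simp
    have "V a' y' v = c' *s v" if le: "2 * int (Suc i) + 1 \<le> a'"
    proof -
      have g: "eich n (bas a') y' \<in> stab n (lev n (Suc i))" using Eg_adm[OF e] le by (intro up_stab) auto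
      have gJ: "eich n (bas a') y' \<in> stab n J" using stab_mono[of "lev n (Suc i)" J n] g K by blast
      have "V a' y' u = c' *s u" by (rule eigenD[OF u(3) e]) (use le in simp)
      thus ?thesis unfolding v_def prj_act[OF s gJ w0J uM] fixw[OF g] by (simp add: prj_scale)
    qed
    thus "case p of (a, y, c) \<Rightarrow> 2 * int (Suc i) + 1 \<le> a \<longrightarrow> V a y v = c *s v" by (simp add: p)
  qed
  have inv: "inv_on (lev n (Suc i)) (W \<inter> wt a J (cw i c))"
    by (rule inv_on_wt[OF s W _ w0J fixw]) (use K in auto)
  show thesis by (rule that[OF vW[unfolded a_def J_def] v0 ev inv[unfolded a_def J_def]])
qed

text \<open>The size of the next block is the exponent of the factor gained from the weight
  \<open>cw i c\<close>. It is also the increment of the largest exponent over two ranks, so nothing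
  is lost along the chain.\<close>

lemma tri_step:
  assumes "i < m" shows "tri (n - 2 * i) = card (lev n (Suc i)) + tri (n - 2 * Suc i)"
proof -
  have "n - 2 * i = Suc (Suc (n - 2 * Suc i))" using assms m by simp
  thus ?thesis unfolding card_lev by (simp add: tri_Suc)
qed

lemma tri_mono_chain: "i \<le> m \<Longrightarrow> tri (n - 2 * m) \<le> tri (n - 2 * i)"
proof (induction "m - i" arbitrary: i)
  case (Suc k)
  have "i < m" using Suc.hyps(2) by simp
  moreover have "tri (n - 2 * m) \<le> tri (n - 2 * Suc i)" by (rule Suc.hyps(1)) (use Suc.hyps(2) in auto)
  ultimately show ?case using tri_step[of i] by linarith
qed simp

text \<open>Every step is \<open>small_neg\<close> with k = b, where the condition on the
  one-parameter group is void. The factors multiply up to the difference of the \<open>tri\<close>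
  values, and the last block contributes \<open>d\<close>.\<close>

lemma chain_small:
  assumes "i \<le> m" "inv_on (lev n i) W" "u \<in> W" "u \<noteq> 0" "eigen i u"
    and T: "\<And>W u. inv_on (lev n m) W \<Longrightarrow> u \<in> W \<Longrightarrow> u \<noteq> 0 \<Longrightarrow> eigen m u \<Longrightarrow> small (lev n m) W (CARD('a) ^ d)"
  shows "small (lev n i) W (CARD('a) ^ (d + (tri (n - 2 * i) - tri (n - 2 * m))))"
  using assms(1-5)
proof (induction "m - i" arbitrary: i W u)
  case 0
  thus ?case using T[of W u] by simp
next
  case (Suc k)
  have i: "i < m" "k = m - Suc i" "Suc i \<le> m" using Suc.hyps(2) by auto
  obtain c v where v: "v \<in> W \<inter> wt (2 * int i + 1) (lv i) (cw i c)" "v \<noteq> 0" "eigen (Suc i) v"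
    "inv_on (lev n (Suc i)) (W \<inter> wt (2 * int i + 1) (lv i) (cw i c))"
    by (rule chain_step[OF i(1) Suc.prems(2-5)])
  let ?W = "W \<inter> wt (2 * int i + 1) (lv i) (cw i c)" and ?e = "d + (tri (n - 2 * Suc i) - tri (n - 2 * m))"
  have sm: "small (lev n (Suc i)) ?W (CARD('a) ^ ?e)" by (rule Suc.hyps(1)[OF i(2,3) v(4,1,2,3)])
  obtain S where S: "finite S" "S \<subseteq> ?W" "card S \<le> CARD('a) ^ ?e" "\<exists>x\<in>S. x \<noteq> 0"
    "\<And>g x. g \<in> stab n (lev n (Suc i)) \<Longrightarrow> x \<in> span S \<Longrightarrow> act g x \<in> span S"
    using smallD[OF sm] by blast
  have i2: "2 * i + 2 \<le> n" using i m by simp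
  have b: "2 * int i + 2 \<in> lv i" "0 < 2 * int i + 2" "minpos (lv i) (2 * int i + 2)"
    using minpos_lev2[OF i2] by (simp_all add: minpos_def)
  have "small (lev n i) W (CARD('a) ^ card (lv i - {2 * int i + 2, - (2 * int i + 2), - (2 * int i + 2)}) * card S)"
    by (rule small_neg[OF symm_lev minpos_lev refl Suc.prems(2) S(1) _ _ S(4) b(1,2) r[OF i(1)] cw_def b(3)])
       (use S(2) S(5) i2 lev_Suc[of n i] in auto)
  moreover have "lv i - {2 * int i + 2, - (2 * int i + 2), - (2 * int i + 2)} = lev n (Suc i)"
    using lev_Suc[of n i] by simp
  ultimately have "small (lev n i) W (CARD('a) ^ card (lev n (Suc i)) * card S)" by simp
  moreover have "CARD('a) ^ card (lev n (Suc i)) * card S \<le> CARD('a) ^ (card (lev n (Suc i)) + ?e)"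
    using S(3) by (simp add: power_add)
  moreover have "card (lev n (Suc i)) + ?e = d + (tri (n - 2 * i) - tri (n - 2 * m))"
    using tri_step[OF i(1)] tri_mono_chain[OF i(3)] by arith
  ultimately show ?case using small_mono[OF _ order_refl] by metis
qed

lemma chain_large:
  assumes "i \<le> m" "inv_on (lev n i) W" "u \<in> W" "u \<noteq> 0" "eigen i u"
    and T: "\<And>W u. inv_on (lev n m) W \<Longrightarrow> u \<in> W \<Longrightarrow> u \<noteq> 0 \<Longrightarrow> eigen m u \<Longrightarrow> large W (CARD('a) ^ d)"
  shows "large W (CARD('a) ^ (d + (tri (n - 2 * i) - tri (n - 2 * m))))"
  using assms(1-5)
proof (induction "m - i" arbitrary: i W u)
  case 0
  thus ?case using T[of W u] by simp
next
  case (Suc k)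
  have i: "i < m" "k = m - Suc i" "Suc i \<le> m" using Suc.hyps(2) by auto
  obtain c v where v: "v \<in> W \<inter> wt (2 * int i + 1) (lv i) (cw i c)" "v \<noteq> 0" "eigen (Suc i) v"
    "inv_on (lev n (Suc i)) (W \<inter> wt (2 * int i + 1) (lv i) (cw i c))"
    by (rule chain_step[OF i(1) Suc.prems(2-5)])
  let ?W = "W \<inter> wt (2 * int i + 1) (lv i) (cw i c)" and ?e = "d + (tri (n - 2 * Suc i) - tri (n - 2 * m))"
  have la: "large ?W (CARD('a) ^ ?e)" by (rule Suc.hyps(1)[OF i(2,3) v(4,1,2,3)])
  have i2: "2 * i + 2 \<le> n" "2 * i + 1 \<le> n" using i m by auto
  have "large W (CARD('a) ^ card (lv i - {2 * int i + 2, - (2 * int i + 2)}) * CARD('a) ^ ?e)"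
    by (rule large_neg[OF symm_lev minpos_lev[OF i2(2)] refl Suc.prems(2) minpos_lev2[OF i2(1)] r[OF i(1)] cw_def la])
  hence "large W (CARD('a) ^ (card (lev n (Suc i)) + ?e))" unfolding lev_Suc by (simp add: power_add)
  moreover have "card (lev n (Suc i)) + ?e = d + (tri (n - 2 * i) - tri (n - 2 * m))"
    using tri_step[OF i(1)] tri_mono_chain[OF i(3)] by arith
  ultimately show ?case by metis
qed

text \<open>By \<open>eich_conj_above\<close> the group of the block permutes the transformations
  attached to \<open>vecs Q\<close>, so it preserves their common fixed vectors.\<close>

lemma inv_on_fixed:
  assumes m2: "2 * m + 1 \<le> n" and W: "inv_on (lev n m) W" and Q: "Q \<subseteq> insert 0 (above n (2 * int m + 1))"
    and cl: "\<And>p q. q \<in> Q \<Longrightarrow> p \<in> lev n m \<Longrightarrow> pos n p < pos n q \<Longrightarrow> p = 2 * int m + 1 \<or> p \<in> Q"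
  shows "inv_on (lev n m) {x \<in> W. \<forall>y\<in>vecs Q. V (2 * int m + 1) y x = x}"
  unfolding inv_on_def
proof (intro conjI ballI)
  define a where "a = 2 * int m + 1"
  have al: "a \<in> labels n" "0 < a" using m2 by (auto simp: a_def labels_def)
  have ma: "minpos (lev n m) a" unfolding a_def by (rule minpos_lev[OF m2])
  have WM: "W \<subseteq> M" "subspace W" using W by (auto simp: inv_on_def)
  show "subspace {x \<in> W. \<forall>y\<in>vecs Q. V (2 * int m + 1) y x = x}"
    using WM(2) by (auto simp: subspace_def act_add act_scale)
  show "{x \<in> W. \<forall>y\<in>vecs Q. V (2 * int m + 1) y x = x} \<subseteq> M" using WM by blast
  fix g :: "'a mat" and x assume g: "g \<in> stab n (lev n m)" and x: "x \<in> {x \<in> W. \<forall>y\<in>vecs Q. V (2 * int m + 1) y x = x}"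
  have "V a y (act g x) = act g x" if y: "y \<in> vecs Q" for y
  proof -
    have Qa: "Q \<subseteq> insert 0 (above n a)" using Q by (simp add: a_def)
    obtain y' where y': "y' \<in> vecs Q" "eich n (bas a) y * g = g * eich n (bas a) y'"
    proof (rule eich_conj_above[OF two symm_lev ma _ Qa _ g y])
      show "Q \<subseteq> lev n m" using Qa by (auto simp: lev_def above_def a_def)
    qed (use cl in \<open>auto simp: a_def\<close>)
    have "z \<in> vecs (insert 0 (above n a))" if "z \<in> vecs Q" for z :: "int \<Rightarrow> 'a" using that vecs_mono[OF Qa] by blast
    hence U: "eich n (bas a) y \<in> U_set n" "eich n (bas a) y' \<in> U_set n"
      using eich_U[OF two up_adm[OF al]] y y'(1) by blast+
    have xM: "x \<in> M" using x WM by auto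
    have "V a y (act g x) = act g (V a y' x)"
      using act_mult[OF U(1) stab_U[OF g] xM] act_mult[OF stab_U[OF g] U(2) xM] y'(2) by simp
    thus ?thesis using x y'(1) by (auto simp: a_def)
  qed
  moreover have "act g x \<in> W" using W g x by (auto simp: inv_on_def)
  ultimately show "act g x \<in> {x \<in> W. \<forall>y\<in>vecs Q. V (2 * int m + 1) y x = x}" by (simp add: a_def)
qed

text \<open>The strict bound of \<open>ex_small\<close> asks for trivial action on a whole invariant
  subspace, while \<open>E\<close> concerns one vector; the fixed vectors of the transformations
  attached to \<open>vecs Q\<close> supply such a subspace. As \<open>Q\<close> must be closed under
  passing to earlier labels, it can consist of 0 and 2m + 2 only when no label lies between them,
  that is in rank 2, and just there the label 0 is required.\<close>

lemma end_small:
  assumes m2: "2 * m + 2 \<le> n" and W: "inv_on (lev n m) W" and u: "u \<in> W" "u \<noteq> 0"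
    and Q: "2 * m + 3 \<le> n \<and> Q = {2 * int m + 2} \<or> n = 2 * m + 2 \<and> Q = {0, 2 * int m + 2}"
    and E: "\<And>y. y \<in> vecs Q \<Longrightarrow> V (2 * int m + 1) y u = u"
  shows "small (lev n m) W (CARD('a) ^ (tri (n - 2 * m) - 1))"
proof -
  let ?a = "2 * int m + 1" and ?b = "2 * int m + 2"
  have ma: "minpos (lev n m) ?a" by (rule minpos_lev) (use m2 in simp)
  have mb: "minpos (lev n m - {?a, - ?a}) ?b" by (rule minpos_lev2[OF m2])
  let ?W = "{x \<in> W. \<forall>y\<in>vecs Q. V ?a y x = x}"
  have inv: "inv_on (lev n m) ?W"
  proof (rule inv_on_fixed[OF _ W])
    show "2 * m + 1 \<le> n" using m2 by simp
    show "Q \<subseteq> insert 0 (above n ?a)" using Q m2 by (auto simp: above_def labels_def)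
    fix p q assume "q \<in> Q" "p \<in> lev n m" "pos n p < pos n q"
    moreover have "p \<in> labels n" "q \<in> labels n" using calculation Q m2 by (auto simp: lev_def labels_def)
    ultimately show "p = ?a \<or> p \<in> Q" using Q by (auto simp: pos_less_iff lev_def labels_def split: if_splits)
  qed
  have uW: "u \<in> ?W" using u E by simp
  obtain d where d: "small (lev n m) ?W (CARD('a) ^ d)" "d \<le> dexp (lev n m)"
    "\<forall>a b. minpos (lev n m) a \<longrightarrow> minpos (lev n m - {a, - a}) b \<longrightarrow>
      (\<forall>t. \<forall>x\<in>?W. V a (scl t (bas b)) x = x) \<longrightarrow>
      (3 \<le> pc (lev n m) \<or> (\<forall>t. \<forall>x\<in>?W. V a (scl t (bas 0)) x = x)) \<longrightarrow> d < dexp (lev n m)"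
    using ex_small[OF symm_lev inv uW u(2)] by auto
  have "\<forall>t. \<forall>x\<in>?W. V ?a (scl t (bas ?b)) x = x"
    using Q by (auto intro!: vecs_scl vecs_bas)
  moreover have "3 \<le> pc (lev n m) \<or> (\<forall>t. \<forall>x\<in>?W. V ?a (scl t (bas 0)) x = x)"
  proof (cases "2 * m + 3 \<le> n")
    case True
    hence "3 \<le> n - 2 * m" by arith
    thus ?thesis by (simp add: pc_lev)
  next
    case False thus ?thesis using Q by (auto intro!: vecs_scl vecs_bas)
  qed
  ultimately have "d < dexp (lev n m)" using d(3) ma mb by blast
  hence "d \<le> tri (n - 2 * m) - 1" by (simp add: dexp_lev)
  hence "CARD('a) ^ d \<le> CARD('a) ^ (tri (n - 2 * m) - 1)" by (intro power_increasing) auto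
  thus ?thesis using small_mono[OF d(1)] by blast
qed

text \<open>In rank 2 the prescribed eigenvalues leave only weights t e_0 + c e_b, and
  \<open>large_zero\<close> gives q independent vectors from one.\<close>

lemma end_large:
  assumes m2: "n = 2 * m + 2" and W: "inv_on (lev n m) W" and u: "u \<in> W" "u \<noteq> 0" and t: "t \<noteq> 0"
    and E: "\<And>y. y \<in> vecs {0, 2 * int m + 2} \<Longrightarrow> V (2 * int m + 1) y u = \<theta> (t * y 0) *s u"
  shows "large W (CARD('a))"
proof -
  define a where "a = 2 * int m + 1"
  define b where "b = 2 * int m + 2"
  define J where "J = lev n m - {a, - a}"
  have ma: "minpos (lev n m) a" unfolding a_def by (rule minpos_lev) (use m2 in simp)
  have mb: "minpos J b" unfolding J_def a_def b_def by (rule minpos_lev2) (use m2 in simp)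
  note s = symm_lev[of n m] ma J_def
  note sJ = symm_J[OF s]
  have J: "J = {0, b, - b}" unfolding J_def using m2 by (auto simp: lev_def a_def b_def labels_def)
  have b0: "b \<noteq> 0" "- b \<noteq> b" by (auto simp: b_def)
  have uM: "u \<in> M" using u(1) W by (auto simp: inv_on_def)
  obtain w where w: "w \<in> vecs J" "prj a J w u \<noteq> 0" by (rule ex_weight[OF s uM u(2)])
  have wq: "w (- q) = (if q = 0 then t else 0)" if q: "q \<in> {0, b}" for q
  proof (rule weight_of_eigen[where f="\<lambda>q. if q = 0 then t else 0", OF s uM _ _ w q])
    show "{0, b} \<subseteq> J" by (auto simp: J)
    fix y :: "int \<Rightarrow> 'a" assume y: "y \<in> vecs {0, b}"
    have "(\<Sum>q\<in>{0, b}. (if q = 0 then t else 0) * y q) = t * y 0" using b0 by simp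
    thus "V a y u = \<theta> (\<Sum>q\<in>{0, b}. (if q = 0 then t else 0) * y q) *s u"
      using E[of y] y by (simp add: a_def b_def)
  qed
  have "w = scl t (bas 0) + scl (w b) (bas b)"
  proof
    fix l show "w l = (scl t (bas 0) + scl (w b) (bas b)) l"
      using wq[of 0] wq[of b] vecs_D[OF w(1), of l] b0 by (cases "l \<in> J") (auto simp: J bas_apply)
  qed
  moreover have "large (W \<inter> wt a J w) 1"
    by (rule large_one[OF _ w(2)]) (use prj_inv_on[OF s W u(1)] prj_wt[OF s w(1) uM] in simp)
  ultimately show ?thesis using large_zero[OF s W mb t _ _, of w "w b" 1] by (simp add: J)
qed

end

section \<open>Root subgroups and supercharacters\<close>

lemma ent_mult_two:
  fixes x y :: "'a::field mat"
  assumes x: "x \<in> U_set n" and y: "y \<in> U_set n" and i: "i \<in> labels n" "k \<in> labels n" "pos n i < pos n k"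
    and z: "\<And>l. l \<in> labels n \<Longrightarrow> pos n i < pos n l \<Longrightarrow> pos n l < pos n k \<Longrightarrow> ent n x i l = 0 \<or> ent n y l k = 0"
  shows "ent n (x * y) i k = ent n x i k + ent n y i k"
proof -
  have "ent n (x * y) i k = (\<Sum>l\<in>labels n. ent n x i l * ent n y l k)"
    by (rule ent_mult[OF U_carrier[OF x] U_carrier[OF y] i(1,2)])
  also have "\<dots> = (\<Sum>l\<in>labels n. (if l = k then ent n x i k else 0) + (if l = i then ent n y i k else 0))"
  proof (intro sum.cong refl)
    fix l assume l: "l \<in> labels n"
    have "i \<noteq> k" using i by auto
    consider "l = i" | "l = k" | "pos n l < pos n i" | "pos n k < pos n l" | "pos n i < pos n l" "pos n l < pos n k"
      using pos_eq_iff[OF l i(1)] pos_eq_iff[OF l i(2)] by linarith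
    thus "ent n x i l * ent n y l k = (if l = k then ent n x i k else 0) + (if l = i then ent n y i k else 0)"
    proof cases
      case 1 thus ?thesis using U_ent_diag[OF x i(1)] \<open>i \<noteq> k\<close> by simp
    next
      case 2 thus ?thesis using U_ent_diag[OF y i(2)] \<open>i \<noteq> k\<close> by simp
    next
      case 3 thus ?thesis using U_ent_below[OF x i(1) l] i by auto
    next
      case 4 thus ?thesis using U_ent_below[OF y l i(2)] i by auto
    next
      case 5 thus ?thesis using z[OF l] by auto
    qed
  qed
  also have "\<dots> = ent n x i k + ent n y i k" using i by (simp add: sum.distrib)
  finally show ?thesis .
qed

lemma ent_uinv:
  assumes y: "y \<in> U_set n" and j: "j \<in> labels n" "l \<in> labels n"
  shows "ent n y (- l) (- j) = ent n (uinv n y) j l"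
proof -
  have "ent n y (- l) (- j) = bil n (app n y (bas (- j))) (bas l)"
    using j by (simp add: app_bas bil_bas_right)
  also have "bas l = app n y (app n (uinv n y) (bas l))"
    using app_uinv(2)[OF y vecs_bas] j by simp
  also have "bil n (app n y (bas (- j))) \<dots> = bil n (bas (- j)) (app n (uinv n y) (bas l))"
    by (rule bil_app[OF y]) (use j in \<open>simp_all add: vecs_bas\<close>)
  also have "\<dots> = ent n (uinv n y) j l" using j by (simp add: bil_bas_left app_bas)
  finally show ?thesis .
qed

text \<open>Column -j of \<open>y\<close> is row j of the inverse by \<open>ent_uinv\<close>, and
  zeros of row j up to position k pass to the inverse. Thus a condition on a row is also one on a
  column.\<close>

lemma ent_column_zero:
  fixes y :: "'a::field mat"
  assumes y: "y \<in> U_set n" and j: "j \<in> labels n"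
    and z: "\<And>p. p \<in> labels n \<Longrightarrow> pos n j < pos n p \<Longrightarrow> pos n p \<le> k \<Longrightarrow> ent n y j p = 0"
    and l: "l \<in> labels n" "pos n j < pos n l" "pos n l \<le> k"
  shows "ent n y (- l) (- j) = 0"
proof -
  have "ent n (y * uinv n y) j l = ent n y j l + ent n (uinv n y) j l"
    by (rule ent_mult_two[OF y uinv_U[OF y] j l(1,2)]) (use z l in auto)
  moreover have "j \<noteq> l" using l(2) by auto
  hence "ent n (y * uinv n y) j l = 0"
    using uinv_mult(2)[OF y] ent_one[OF j l(1), where 'a='a] by simp
  ultimately show ?thesis using z[OF l] ent_uinv[OF y j l(1)] by simp
qed

lemma U_root_U: "x \<in> U_root n \<alpha> \<Longrightarrow> x \<in> U_set n"
  by (cases \<alpha>) auto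

text \<open>Additivity of the main entry makes \<open>lin_char\<close> multiplicative. The delicate
  case is \<epsilon>_i + \<epsilon>_j: in the entry (i, -j) of a product, the terms through
  intermediate positive labels vanish by row i of the first factor, the other intermediate ones by
  column -j of the second, whose zeros come from its row j.\<close>

lemma U_root_mult:
  assumes a: "\<alpha> \<in> roots n" and x: "x \<in> U_root n \<alpha>" and y: "y \<in> U_root n \<alpha>"
  shows "x * y \<in> U_root n \<alpha>"
    and "ent n (x * y) (fst (main_entry \<alpha>)) (snd (main_entry \<alpha>)) =
      ent n x (fst (main_entry \<alpha>)) (snd (main_entry \<alpha>)) + ent n y (fst (main_entry \<alpha>)) (snd (main_entry \<alpha>))"
proof -
  note xU = U_root_U[OF x] and yU = U_root_U[OF y]
  have xy: "x * y \<in> U_set n" by (rule mult_U[OF xU yU])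
  have "x * y \<in> U_root n \<alpha> \<and> ent n (x * y) (fst (main_entry \<alpha>)) (snd (main_entry \<alpha>)) =
      ent n x (fst (main_entry \<alpha>)) (snd (main_entry \<alpha>)) + ent n y (fst (main_entry \<alpha>)) (snd (main_entry \<alpha>))"
  proof (cases \<alpha>)
    case (EpsDiff i j)
    have ij: "1 \<le> i" "i < j" "j \<le> n" using a by (auto simp: roots_def EpsDiff)
    have z: "ent n x (int i) l = 0" if "int i < l" "l < int j" for l
      using x that unfolding EpsDiff by (auto dest!: spec[of _ "nat l"])
    have e: "ent n (x * y) (int i) k = ent n x (int i) k + ent n y (int i) k" if k: "int i < k" "k \<le> int j" for k
      by (rule ent_mult_two[OF xU yU]) (use k ij z in \<open>auto simp: labels_def pos_less_iff split: if_splits\<close>)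
    show ?thesis using x y xy ij e unfolding EpsDiff by auto
  next
    case (EpsSingle i)
    have ij: "1 \<le> i" "i \<le> n" using a by (auto simp: roots_def EpsSingle)
    have z: "ent n x (int i) l = 0" if "int i < l" "l \<le> int n" for l
      using x that unfolding EpsSingle by (auto dest!: spec[of _ "nat l"])
    have e: "ent n (x * y) (int i) k = ent n x (int i) k + ent n y (int i) k" if k: "int i < k \<and> k \<le> int n \<or> k = 0" for k
      by (rule ent_mult_two[OF xU yU]) (use k ij z in \<open>auto simp: labels_def pos_less_iff split: if_splits\<close>)
    show ?thesis using x y xy ij e unfolding EpsSingle by auto
  next
    case (EpsSum i j)
    have ij: "1 \<le> i" "i < j" "j \<le> n" using a by (auto simp: roots_def EpsSum)
    have z: "ent n x (int i) l = 0" if "int i < l" "l \<le> int n" for l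
      using x that unfolding EpsSum by (auto dest!: spec[of _ "nat l"])
    have zx: "ent n x (int j) l = 0" and zy: "ent n y (int j) l = 0"
      if "l \<in> labels n" "pos n (int j) < pos n l" "pos n l \<le> pos n 0" for l
      using x y that unfolding EpsSum by (auto simp: prec_def preceq_def)
    have jl: "int j \<in> labels n" using ij by (simp add: labels_def)
    have e1: "ent n (x * y) (int i) k = ent n x (int i) k + ent n y (int i) k" if k: "int i < k \<and> k \<le> int n" for k
      by (rule ent_mult_two[OF xU yU]) (use k ij z in \<open>auto simp: labels_def pos_less_iff split: if_splits\<close>)
    have e2: "ent n (x * y) (int j) l = ent n x (int j) l + ent n y (int j) l"
      if l: "l \<in> labels n" "pos n (int j) < pos n l" "pos n l \<le> pos n 0" for l
      by (rule ent_mult_two[OF xU yU jl l(1,2)]) (use zx l in auto)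
    have e3: "ent n (x * y) (int i) (- int j) = ent n x (int i) (- int j) + ent n y (int i) (- int j)"
    proof (rule ent_mult_two[OF xU yU])
      show "int i \<in> labels n" "- int j \<in> labels n" "pos n (int i) < pos n (- int j)"
        using ij by (auto simp: labels_def pos_less_iff)
      fix l assume l: "l \<in> labels n" "pos n (int i) < pos n l" "pos n l < pos n (- int j)"
      show "ent n x (int i) l = 0 \<or> ent n y l (- int j) = 0"
      proof (cases "0 < l")
        case True
        thus ?thesis using z[of l] l ij by (auto simp: pos_less_iff labels_def split: if_splits)
      next
        case False
        have "ent n y (- (- l)) (- int j) = 0"
        proof (rule ent_column_zero[OF yU jl zy])
          show "pos n (int j) < pos n (- l)" "pos n (- l) \<le> pos n 0"
            using l False ij jl pos_eq_iff[of "- l" n 0] by (auto simp: pos_less_iff linorder_not_less[symmetric] labels_def split: if_splits)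
        qed (use l in auto)
        thus ?thesis by simp
      qed
    qed
    show ?thesis using x y xy e1 e2 e3 unfolding EpsSum
      by (auto simp: prec_def preceq_def)
  qed
  thus "x * y \<in> U_root n \<alpha>"
    and "ent n (x * y) (fst (main_entry \<alpha>)) (snd (main_entry \<alpha>)) =
      ent n x (fst (main_entry \<alpha>)) (snd (main_entry \<alpha>)) + ent n y (fst (main_entry \<alpha>)) (snd (main_entry \<alpha>))" by auto
qed

text \<open>In a finite set closed under multiplication, multiplication by one of its elements is a
  permutation; this replaces an argument with inverses in \<open>U_root n \<alpha>\<close>.\<close>

lemma U_root_cancel:
  fixes k :: "'a::{field,finite} mat"
  assumes a: "\<alpha> \<in> roots n" and k: "k \<in> U_root n \<alpha>" and h: "h \<in> U_set n"
  shows "k * h \<in> U_root n \<alpha> \<longleftrightarrow> h \<in> U_root n \<alpha>" and "h * k \<in> U_root n \<alpha> \<longleftrightarrow> h \<in> U_root n \<alpha>"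
proof -
  note kU = U_root_U[OF k]
  have fin: "finite (U_root n \<alpha> :: 'a mat set)"
    by (rule finite_subset[OF _ finite_U]) (use U_root_U in auto)
  have c: "x \<in> carrier_mat (2*n+1) (2*n+1)" if "x \<in> U_set n" for x :: "'a mat" by (rule U_carrier[OF that])
  have L: "uinv n k * (k * x) = x" and R: "(x * k) * uinv n k = x" if x: "x \<in> U_set n" for x
    using uinv_mult[OF kU] c[OF x] c[OF kU] c[OF uinv_U[OF kU]]
    by (simp add: assoc_mult_mat[symmetric], simp add: assoc_mult_mat)
  have iL: "inj_on ((*) k) (U_root n \<alpha>)" by (rule inj_on_inverseI[where g="(*) (uinv n k)"]) (use L U_root_U in auto)
  have iR: "inj_on (\<lambda>x. x * k) (U_root n \<alpha>)" by (rule inj_on_inverseI[where g="\<lambda>x. x * uinv n k"]) (use R U_root_U in auto)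
  have sL: "(*) k ` U_root n \<alpha> = U_root n \<alpha>"
    by (rule endo_inj_surj[OF fin _ iL]) (use U_root_mult(1)[OF a k] in auto)
  have sR: "(\<lambda>x. x * k) ` U_root n \<alpha> = U_root n \<alpha>"
    by (rule endo_inj_surj[OF fin _ iR]) (use U_root_mult(1)[OF a _ k] in auto)
  show "k * h \<in> U_root n \<alpha> \<longleftrightarrow> h \<in> U_root n \<alpha>"
  proof
    assume "k * h \<in> U_root n \<alpha>"
    then obtain x where "x \<in> U_root n \<alpha>" "k * h = k * x" using sL by auto
    thus "h \<in> U_root n \<alpha>" using L[OF h] L[OF U_root_U] by metis
  qed (rule U_root_mult(1)[OF a k])
  show "h * k \<in> U_root n \<alpha> \<longleftrightarrow> h \<in> U_root n \<alpha>"
  proof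
    assume "h * k \<in> U_root n \<alpha>"
    then obtain x where "x \<in> U_root n \<alpha>" "h * k = x * k" using sR by auto
    thus "h \<in> U_root n \<alpha>" using R[OF h] R[OF U_root_U] by metis
  qed (rule U_root_mult(1)[OF a _ k])
qed

section \<open>Root subgroups and the middle blocks\<close>

fun idx :: "root \<Rightarrow> int set" where
  "idx (EpsDiff i j) = {int i, int j}"
| "idx (EpsSum i j) = {int i, int j}"
| "idx (EpsSingle i) = {int i}"

lemma stab_ent_out:
  assumes x: "x \<in> stab n I" and s: "symm n I" and i: "i \<in> labels n" "k \<in> labels n" "i \<notin> I \<or> k \<notin> I"
  shows "ent n x i k = (if i = k then 1 else 0)"
proof (cases "k \<in> I")
  case True
  hence "i \<notin> I" using i by auto
  thus ?thesis using stab_app_out[OF x s vecs_bas[OF i(2)] i(1)] i by (auto simp: app_bas bas_apply)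
next
  case False
  hence "app n x (bas k) = bas k" using x i by (auto simp: stab_def)
  from fun_cong[OF this, of i] show ?thesis using i by (auto simp: app_bas bas_apply)
qed

text \<open>The rows of \<open>x\<close> with labels in \<open>idx \<alpha>\<close> are those of the
  identity matrix, and the conditions in \<open>U_root n \<alpha>\<close> and the main entry concern
  only these rows.\<close>

lemma stab_U_root:
  assumes x: "x \<in> stab n I" and s: "symm n I" and a: "\<alpha> \<in> roots n" and d: "idx \<alpha> \<inter> I = {}"
  shows "x \<in> U_root n \<alpha>" "ent n x (fst (main_entry \<alpha>)) (snd (main_entry \<alpha>)) = 0"
proof -
  have xU: "x \<in> U_set n" by (rule stab_U[OF x])
  have e: "ent n x i k = 0" if "i \<in> idx \<alpha>" "k \<in> labels n" "i \<noteq> k" for i k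
  proof -
    have "i \<in> labels n" using that(1) a by (cases \<alpha>) (auto simp: roots_def labels_def)
    thus ?thesis using stab_ent_out[OF x s _ that(2), of i] that d by auto
  qed
  have "k \<noteq> l" if "prec n k l" for k l using that by (auto simp: prec_def)
  thus "x \<in> U_root n \<alpha>" using xU e a by (cases \<alpha>) (auto simp: roots_def labels_def)
  show "ent n x (fst (main_entry \<alpha>)) (snd (main_entry \<alpha>)) = 0"
    by (rule e) (use a in \<open>cases \<alpha>; auto simp: roots_def labels_def\<close>)+
qed

text \<open>Restriction to the middle block is a retraction of the whole group onto
  \<^term>\<open>stab n (lev n i)\<close>.\<close>

definition mid :: "nat \<Rightarrow> nat \<Rightarrow> 'a::field mat \<Rightarrow> 'a mat" where
  "mid n i x = mat (2*n+1) (2*n+1) (\<lambda>(p, q). if lab n p \<in> lev n i \<and> lab n q \<in> lev n i then x $$ (p, q)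
     else if p = q then 1 else 0)"

lemma mid_carrier: "mid n i x \<in> carrier_mat (2*n+1) (2*n+1)"
  by (simp add: mid_def)

lemma ent_mid:
  "p \<in> labels n \<Longrightarrow> q \<in> labels n \<Longrightarrow>
    ent n (mid n i x) p q = (if p \<in> lev n i \<and> q \<in> lev n i then ent n x p q else if p = q then 1 else 0)"
  by (simp add: mid_def ent_def pos_eq_iff)

lemma lev_between:
  assumes "p \<in> lev n i" "q \<in> lev n i" "l \<in> labels n" "pos n p \<le> pos n l" "pos n l \<le> pos n q"
  shows "l \<in> lev n i"
proof -
  have pq: "p \<in> labels n" "q \<in> labels n" using assms by (auto simp: lev_def)
  show ?thesis using assms pq
    by (auto simp: linorder_not_less[symmetric] pos_less_iff lev_def split: if_splits)
qed

text \<open>The labels of \<open>lev n i\<close> form an interval of the order. For columns p, q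
  inside it, a label l outside contributes nothing to the form, because triangularity makes the
  entry at (l, p) or at (-l, q) vanish. So cutting the matrix down to the interval keeps the
  isometry relations.\<close>

lemma mid_U:
  fixes x :: "'a::field mat"
  assumes x: "x \<in> U_set n"
  shows "mid n i x \<in> U_set n"
  unfolding U_set_iff
proof (intro conjI ballI impI)
  show "mid n i x \<in> carrier_mat (2*n+1) (2*n+1)" by (rule mid_carrier)
  fix p assume p: "p \<in> labels n"
  show "ent n (mid n i x) p p = 1" using p U_ent_diag[OF x p] by (simp add: ent_mid)
  fix q assume q: "q \<in> labels n"
  show "ent n (mid n i x) p q = 0" if "pos n q < pos n p"
    using p q that U_ent_below[OF x p q that] by (auto simp: ent_mid)
  let ?m = "\<lambda>q. app n (mid n i x) (bas q)"
  have m: "?m q l = (if l \<in> lev n i \<and> q \<in> lev n i then ent n x l q else if l = q then 1 else 0)"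
    if "q \<in> labels n" "l \<in> labels n" for q l
    using that by (simp add: app_bas ent_mid)
  have ml: "?m q = bas q" if "q \<in> labels n" "q \<notin> lev n i" for q
  proof
    fix l show "?m q l = bas q l"
      using that m[OF that(1), of l] by (cases "l \<in> labels n") (auto simp: bas_apply app_def)
  qed
  have mneg: "- l \<in> lev n i \<longleftrightarrow> l \<in> lev n i" for l by (rule symm_uminus[OF symm_lev])
  show "bil n (?m p) (?m q) = bil n (bas p) (bas q)"
  proof (cases "p \<in> lev n i \<and> q \<in> lev n i")
    case True
    have "bil n (?m p) (?m q) = bil n (app n x (bas p)) (app n x (bas q))"
      unfolding bil_def
    proof (intro sum.cong refl)
      fix l assume l: "l \<in> labels n"
      show "?m p l * ?m q (- l) = app n x (bas p) l * app n x (bas q) (- l)"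
      proof (cases "l \<in> lev n i")
        case lI: True
        thus ?thesis using True l p q m mneg by (simp add: app_bas)
      next
        case False
        have "ent n x l p = 0 \<or> ent n x (- l) q = 0"
        proof -
          have 1: "0 \<in> lev n i" "0 \<in> labels n" by auto
          have "pos n p < pos n l \<or> pos n q < pos n (- l)"
          proof (rule ccontr)
            assume c: "\<not> (pos n p < pos n l \<or> pos n q < pos n (- l))"
            hence "l \<le> 0 \<Longrightarrow> l \<in> lev n i" using lev_between[OF 1(1) _ l, of p] True l
              by (cases "l = 0") (auto simp: pos_less_iff linorder_not_less[symmetric])
            moreover have "0 \<le> l \<Longrightarrow> - l \<in> lev n i" using lev_between[OF 1(1), of q "- l"] True l c
              by (cases "l = 0") (auto simp: pos_less_iff linorder_not_less[symmetric])
            ultimately show False using False mneg[of l] by linarith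
          qed
          thus ?thesis using U_ent_below[OF x l p] U_ent_below[OF x _ q, of "- l"] l by auto
        qed
        moreover have "?m p l = 0" using m[OF p l] False True by auto
        ultimately show ?thesis using l p q by (auto simp: app_bas)
      qed
    qed
    also have "\<dots> = bil n (bas p) (bas q)"
      by (rule bil_app[OF x]) (use p q in \<open>simp_all add: vecs_bas\<close>)
    finally show ?thesis .
  next
    case False
    show ?thesis
    proof (cases "p \<in> lev n i")
      case True
      hence "q \<notin> lev n i" "p \<noteq> - q" using False mneg[of q] by auto
      thus ?thesis using q p ml[OF q] m[OF p, of "- q"] mneg[of q] by (auto simp: bil_bas_right bas_apply)
    next
      case pI: False
      show ?thesis
      proof (cases "q \<in> lev n i")
        case True
        hence "q \<noteq> - p" using pI mneg[of p] by auto
        thus ?thesis using q p pI ml[OF p] m[OF q, of "- p"] mneg[of p] by (auto simp: bil_bas_left bas_apply)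
      qed (use pI ml[OF p] ml[OF q] in simp)
    qed
  qed
qed

lemma mid_stab:
  fixes x :: "'a::field mat"
  assumes x: "x \<in> U_set n"
  shows "mid n i x \<in> stab n (lev n i)"
  unfolding stab_def
proof (intro CollectI conjI ballI)
  show "mid n i x \<in> U_set n" by (rule mid_U[OF x])
  fix q assume q: "q \<in> labels n - lev n i"
  show "app n (mid n i x) (bas q) = bas q"
  proof
    fix l show "app n (mid n i x) (bas q) l = bas q l"
      using q by (cases "l \<in> labels n") (auto simp: app_bas ent_mid bas_apply, auto simp: app_def)
  qed
qed

lemma mid_id:
  fixes x :: "'a::field mat"
  assumes x: "x \<in> stab n (lev n i)"
  shows "mid n i x = x"
proof (rule mat_eq_entI[OF mid_carrier U_carrier[OF stab_U[OF x]]])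
  fix p q assume pq: "p \<in> labels n" "q \<in> labels n"
  show "ent n (mid n i x) p q = ent n x p q"
    using stab_ent_out[OF x symm_lev pq] pq by (auto simp: ent_mid)
qed

lemma mid_mult:
  fixes x y :: "'a::field mat"
  assumes x: "x \<in> U_set n" and y: "y \<in> U_set n"
  shows "mid n i (x * y) = mid n i x * mid n i y"
proof (rule mat_eq_entI[of _ n])
  note c = U_carrier[OF x] U_carrier[OF y]
  note mx = mid_stab[OF x, of i] and my = mid_stab[OF y, of i]
  have mxy: "mid n i x * mid n i y \<in> stab n (lev n i)" by (rule stab_mult[OF mx my])
  show "mid n i (x * y) \<in> carrier_mat (2*n+1) (2*n+1)" by (rule mid_carrier)
  show "mid n i x * mid n i y \<in> carrier_mat (2*n+1) (2*n+1)" by (rule U_carrier[OF stab_U[OF mxy]])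
  fix p q assume p: "p \<in> labels n" and q: "q \<in> labels n"
  show "ent n (mid n i (x * y)) p q = ent n (mid n i x * mid n i y) p q"
  proof (cases "p \<in> lev n i \<and> q \<in> lev n i")
    case True
    have "ent n (mid n i x * mid n i y) p q = (\<Sum>l\<in>labels n. ent n x p l * ent n y l q)"
      unfolding ent_mult[OF mid_carrier mid_carrier p q]
    proof (intro sum.cong refl)
      fix l assume l: "l \<in> labels n"
      show "ent n (mid n i x) p l * ent n (mid n i y) l q = ent n x p l * ent n y l q"
      proof (cases "l \<in> lev n i")
        case False
        hence "\<not> (pos n p \<le> pos n l \<and> pos n l \<le> pos n q)" using lev_between[of p n i q l] True l by blast
        hence "ent n x p l = 0 \<or> ent n y l q = 0"
          using U_ent_below[OF x p l] U_ent_below[OF y l q] by linarith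
        moreover have "ent n (mid n i x) p l = 0" using False True p l by (auto simp: ent_mid)
        ultimately show ?thesis by auto
      qed (use True p q l in \<open>simp add: ent_mid\<close>)
    qed
    thus ?thesis using True p q by (simp add: ent_mid ent_mult[OF c p q])
  next
    case False
    thus ?thesis using stab_ent_out[OF mxy symm_lev p q] p q by (auto simp: ent_mid)
  qed
qed

lemma mid_uinv:
  fixes x :: "'a::field mat"
  assumes x: "x \<in> U_set n"
  shows "mid n i (uinv n x) = uinv n (mid n i x)"
proof (rule uinv_unique[OF mid_U[OF x] mid_U[OF uinv_U[OF x]], symmetric])
  show "mid n i (uinv n x) * mid n i x = 1\<^sub>m (2*n+1)"
    unfolding mid_mult[OF uinv_U[OF x] x, symmetric] uinv_mult(1)[OF x] by (rule mid_id[OF stab_one])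
qed

text \<open>Being an interval of the order, the block contains all rows and columns by which
  \<open>U_root n \<alpha>\<close> and the main entry are defined.\<close>

lemma mid_U_root:
  fixes x :: "'a::field mat"
  assumes x: "x \<in> U_set n" and a: "\<alpha> \<in> roots n" and d: "idx \<alpha> \<subseteq> lev n i"
  shows "mid n i x \<in> U_root n \<alpha> \<longleftrightarrow> x \<in> U_root n \<alpha>"
    and "ent n (mid n i x) (fst (main_entry \<alpha>)) (snd (main_entry \<alpha>)) =
       ent n x (fst (main_entry \<alpha>)) (snd (main_entry \<alpha>))"
proof -
  have e: "ent n (mid n i x) p q = ent n x p q" if "p \<in> lev n i" "q \<in> lev n i" for p q
    using that by (subst ent_mid) (auto simp: lev_def)
  have "(mid n i x \<in> U_root n \<alpha> \<longleftrightarrow> x \<in> U_root n \<alpha>) \<and>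
    ent n (mid n i x) (fst (main_entry \<alpha>)) (snd (main_entry \<alpha>)) =
       ent n x (fst (main_entry \<alpha>)) (snd (main_entry \<alpha>))"
  proof (cases \<alpha>)
    case (EpsDiff p q)
    have pq: "1 \<le> p" "p < q" "q \<le> n" using a by (auto simp: roots_def EpsDiff)
    have "int p \<in> lev n i" "int q \<in> lev n i" using d by (auto simp: EpsDiff)
    moreover have "int k \<in> lev n i" if "p < k" "k < q" for k using d that pq by (auto simp: EpsDiff lev_def labels_def)
    ultimately show ?thesis using e mid_U[OF x, of i] x by (auto simp: EpsDiff)
  next
    case (EpsSingle p)
    have pq: "1 \<le> p" "p \<le> n" using a by (auto simp: roots_def EpsSingle)
    have "int p \<in> lev n i" using d by (auto simp: EpsSingle)
    moreover have "int k \<in> lev n i" if "p < k" "k \<le> n" for k using d that pq by (auto simp: EpsSingle lev_def labels_def)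
    ultimately show ?thesis using e mid_U[OF x, of i] x by (auto simp: EpsSingle)
  next
    case (EpsSum p q)
    have pq: "1 \<le> p" "p < q" "q \<le> n" using a by (auto simp: roots_def EpsSum)
    have 1: "int p \<in> lev n i" "int q \<in> lev n i" using d by (auto simp: EpsSum)
    moreover have "- int q \<in> lev n i" using 1 symm_uminus[OF symm_lev] by blast
    moreover have "int k \<in> lev n i" if "p < k" "k \<le> n" for k using d that pq by (auto simp: EpsSum lev_def labels_def)
    moreover have "l \<in> lev n i" if "l \<in> labels n" "prec n (int q) l" "preceq n l 0" for l
      by (rule lev_between[OF 1(2) zero_lev that(1)]) (use that in \<open>auto simp: prec_def preceq_def\<close>)
    ultimately show ?thesis using e mid_U[OF x, of i] x by (auto simp: EpsSum)
  qed
  thus "mid n i x \<in> U_root n \<alpha> \<longleftrightarrow> x \<in> U_root n \<alpha>"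
    and "ent n (mid n i x) (fst (main_entry \<alpha>)) (snd (main_entry \<alpha>)) =
       ent n x (fst (main_entry \<alpha>)) (snd (main_entry \<alpha>))" by auto
qed

lemma mid_eich:
  assumes a: "a \<in> labels n" "a \<notin> lev n i"
  shows "mid n i (eich n (bas a) y) = (1\<^sub>m (2*n+1) :: 'a::field mat)"
proof (rule mat_eq_entI[OF mid_carrier])
  fix p q assume pq: "p \<in> labels n" "q \<in> labels n"
  have "- q \<in> lev n i \<longleftrightarrow> q \<in> lev n i" by (rule symm_uminus[OF symm_lev])
  thus "ent n (mid n i (eich n (bas a) y)) p q = ent n (1\<^sub>m (2*n+1)) p q"
    using pq a ent_one[OF pq, where 'a='a] by (auto simp: ent_mid ent_eich bas_apply)
qed simp

section \<open>Linear characters extended by zero, and their conjugates\<close>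

definition lam :: "nat \<Rightarrow> ('a::field \<Rightarrow> complex) \<Rightarrow> root \<Rightarrow> 'a \<Rightarrow> 'a mat \<Rightarrow> complex" where
  "lam n \<theta> \<alpha> c x = (if x \<in> U_root n \<alpha> then lin_char n \<theta> \<alpha> c x else 0)"

abbreviation cj :: "nat \<Rightarrow> 'a::field mat \<Rightarrow> 'a mat \<Rightarrow> 'a mat" where
  "cj n y g \<equiv> uinv n y * g * y"

lemma cj_U: "y \<in> U_set n \<Longrightarrow> g \<in> U_set n \<Longrightarrow> cj n y g \<in> U_set n"
  by (simp add: mult_U uinv_U)

lemma U_assoc: "x \<in> U_set n \<Longrightarrow> y \<in> U_set n \<Longrightarrow> z \<in> U_set n \<Longrightarrow> x * y * z = x * (y * z)"
  using U_carrier assoc_mult_mat by blast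

lemma U_one_left: "x \<in> U_set n \<Longrightarrow> 1\<^sub>m (2*n+1) * x = x"
  and U_one_right: "x \<in> U_set n \<Longrightarrow> x * 1\<^sub>m (2*n+1) = x"
  using U_carrier left_mult_one_mat right_mult_one_mat by blast+

lemma U_cancel:
  assumes "x \<in> U_set n" "y \<in> U_set n"
  shows "uinv n x * (x * y) = y" "x * (uinv n x * y) = y" "y * x * uinv n x = y" "y * uinv n x * x = y"
proof -
  note u = uinv_U[OF assms(1)]
  show "uinv n x * (x * y) = y" "x * (uinv n x * y) = y"
    unfolding U_assoc[OF u assms, symmetric] U_assoc[OF assms(1) u assms(2), symmetric] uinv_mult[OF assms(1)]
    by (rule U_one_left[OF assms(2)])+
  show "y * x * uinv n x = y" "y * uinv n x * x = y"
    unfolding U_assoc[OF assms(2,1) u] U_assoc[OF assms(2) u assms(1)] uinv_mult[OF assms(1)]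
    by (rule U_one_right[OF assms(2)])+
qed

lemma uinv_mult_distrib:
  assumes "x \<in> U_set n" "y \<in> U_set n"
  shows "uinv n (x * y) = uinv n y * uinv n x"
proof -
  note u = uinv_U[OF assms(1)] uinv_U[OF assms(2)]
  have "uinv n y * uinv n x * (x * y) = uinv n y * (uinv n x * (x * y))"
    by (rule U_assoc[OF u(2,1) mult_U[OF assms]])
  hence "uinv n y * uinv n x * (x * y) = 1\<^sub>m (2*n+1)"
    by (simp only: U_cancel[OF assms] uinv_mult[OF assms(2)])
  thus ?thesis by (rule uinv_unique[OF mult_U[OF assms] mult_U[OF u(2,1)]])
qed

lemma sum_U_conj:
  assumes y: "y \<in> U_set n"
  shows "(\<Sum>g\<in>U_set n. f (cj n y g)) = (\<Sum>g\<in>U_set n. f g)"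
proof (rule sum.reindex_bij_witness[where i="\<lambda>g. y * g * uinv n y" and j="cj n y"])
  note u = uinv_U[OF y]
  fix g :: "'a mat" assume g: "g \<in> U_set n"
  show "y * cj n y g * uinv n y = g"
    unfolding U_assoc[OF u g y] U_cancel(2)[OF y mult_U[OF g y]] by (rule U_cancel(3)[OF y g])
  show "cj n y (y * g * uinv n y) = g"
    unfolding U_assoc[OF y g u] U_cancel(1)[OF y mult_U[OF g u]] by (rule U_cancel(4)[OF y g])
qed (use y in \<open>auto simp: mult_U uinv_U\<close>)

lemma sum_U_left:
  assumes k: "k \<in> U_set n"
  shows "(\<Sum>g\<in>U_set n. f (k * g)) = (\<Sum>g\<in>U_set n. f g)"
  by (rule sum.reindex_bij_witness[where i="\<lambda>g. uinv n k * g" and j="\<lambda>g. k * g"])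
     (use k in \<open>simp_all add: mult_U uinv_U U_cancel\<close>)

lemma xi_root_eq:
  fixes g :: "'a::field mat"
  assumes g: "g \<in> U_set n"
  shows "xi_root n \<theta> \<alpha> c g = (\<Sum>y\<in>U_set n. lam n \<theta> \<alpha> c (cj n y g)) / of_nat (card (U_root n \<alpha> :: 'a mat set))"
  unfolding xi_root_def induced_char_def lam_def by (simp cong: if_cong)

lemma xi_root_conj:
  assumes z: "z \<in> U_set n" and g: "g \<in> U_set n"
  shows "xi_root n \<theta> \<alpha> c (cj n z g) = xi_root n \<theta> \<alpha> c (g :: 'a::field mat)"
proof -
  have "(\<Sum>y\<in>U_set n. lam n \<theta> \<alpha> c (cj n y (cj n z g))) = (\<Sum>y\<in>U_set n. lam n \<theta> \<alpha> c (cj n (z * y) g))"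
  proof (intro sum.cong refl arg_cong[where f="lam n \<theta> \<alpha> c"])
    fix y :: "'a mat" assume y: "y \<in> U_set n"
    note u = uinv_U[OF y] uinv_U[OF z]
    show "cj n y (cj n z g) = cj n (z * y) g"
      unfolding uinv_mult_distrib[OF z y]
      by (simp only: U_assoc[where n=n] u y z g mult_U)
  qed
  also have "\<dots> = (\<Sum>y\<in>U_set n. lam n \<theta> \<alpha> c (cj n y g))" by (rule sum_U_left[OF z])
  finally show ?thesis unfolding xi_root_eq[OF g] xi_root_eq[OF cj_U[OF z g]] by simp
qed

lemma mid_cj:
  assumes "y \<in> U_set n" "g \<in> U_set n"
  shows "mid n i (cj n y g) = cj n (mid n i y) (mid n i (g :: 'a::field mat))"
  using assms by (simp add: mid_mult mid_uinv mult_U uinv_U)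

section \<open>The chain of roots and Frobenius reciprocity along it\<close>

definition cr :: "nat \<Rightarrow> root" where
  "cr j = EpsSum (2 * j + 1) (2 * j + 2)"

lemma cr_roots: "2 * j + 2 \<le> n \<Longrightarrow> cr j \<in> roots n"
  by (auto simp: cr_def roots_def)

lemma idx_cr: "2 * j + 2 \<le> n \<Longrightarrow> i \<le> j \<Longrightarrow> idx (cr j) \<subseteq> lev n i"
  by (auto simp: cr_def lev_def labels_def)

lemma idx_cr_disjoint: "j < i \<Longrightarrow> idx (cr j) \<inter> lev n i = {}"
  by (auto simp: cr_def lev_def)

lemma inj_cr: "inj_on cr A"
  by (rule inj_onI) (simp add: cr_def)

context odd_char begin

lemma lin_char_mult:
  assumes "\<alpha> \<in> roots n" "x \<in> U_root n \<alpha>" "y \<in> U_root n \<alpha>"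
  shows "lin_char n \<theta> \<alpha> c (x * y) = lin_char n \<theta> \<alpha> c x * lin_char n \<theta> \<alpha> c y"
  using U_root_mult(2)[OF assms] by (simp add: lin_char_def distrib_left theta_add)

lemma lam_mult_left:
  assumes "\<alpha> \<in> roots n" "k \<in> U_root n \<alpha>" "h \<in> U_set n"
  shows "lam n \<theta> \<alpha> c (k * h) = lin_char n \<theta> \<alpha> c k * lam n \<theta> \<alpha> c h"
  using U_root_cancel(1)[OF assms] lin_char_mult[OF assms(1,2)] by (simp add: lam_def)

lemma lam_mult_right:
  assumes "\<alpha> \<in> roots n" "k \<in> U_root n \<alpha>" "h \<in> U_set n"
  shows "lam n \<theta> \<alpha> c (h * k) = lam n \<theta> \<alpha> c h * lin_char n \<theta> \<alpha> c k"
  using U_root_cancel(2)[OF assms] lin_char_mult[OF assms(1) _ assms(2)] by (simp add: lam_def)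

lemma lam_one:
  assumes "\<alpha> \<in> roots n"
  shows "lam n \<theta> \<alpha> c (1\<^sub>m (2*n+1)) = 1"
proof -
  have s: "symm n {}" by (simp add: symm_def)
  show ?thesis
    unfolding lam_def lin_char_def stab_U_root(2)[OF stab_one s assms Int_empty_right]
    using stab_U_root(1)[OF stab_one s assms Int_empty_right] by simp
qed

lemma lam_norm: "lam n \<theta> \<alpha> c x \<noteq> 0 \<Longrightarrow> lam n \<theta> \<alpha> c x * cnj (lam n \<theta> \<alpha> c x) = 1"
  by (auto simp: lam_def lin_char_def cnj_theta theta_minus_mult split: if_splits)

lemma lin_char_stab:
  assumes "x \<in> stab n I" "symm n I" "\<alpha> \<in> roots n" "idx \<alpha> \<inter> I = {}"
  shows "lin_char n \<theta> \<alpha> c x = 1"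
  using stab_U_root(2)[OF assms] by (simp add: lin_char_def)

lemma lam_conj_stab:
  assumes y: "y \<in> stab n I" and s: "symm n I" "\<alpha> \<in> roots n" "idx \<alpha> \<inter> I = {}" and g: "g \<in> U_set n"
  shows "lam n \<theta> \<alpha> c (cj n y g) = lam n \<theta> \<alpha> c g"
proof -
  note y' = stab_uinv[OF y]
  show ?thesis
    using lam_mult_right[OF s(2) stab_U_root(1)[OF y s] mult_U[OF uinv_U[OF stab_U[OF y]] g]]
      lam_mult_left[OF s(2) stab_U_root(1)[OF y' s] g] lin_char_stab[OF y s] lin_char_stab[OF y' s] by simp
qed

lemma lam_mid:
  assumes "x \<in> U_set n" "\<alpha> \<in> roots n" "idx \<alpha> \<subseteq> lev n i"
  shows "lam n \<theta> \<alpha> c (mid n i x) = lam n \<theta> \<alpha> c x"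
  using mid_U_root[OF assms] by (simp add: lam_def lin_char_def)

text \<open>By Frobenius reciprocity, an induced character may be replaced by the linear character it is
  induced from; the conjugating element can be taken in the middle block.\<close>

lemma sum_xi_root_lam:
  assumes a: "\<alpha> \<in> roots n" "idx \<alpha> \<subseteq> lev n i"
    and F: "\<And>y g. y \<in> stab n (lev n i) \<Longrightarrow> g \<in> U_set n \<Longrightarrow> F (cj n y g) = F g"
    and nz: "(\<Sum>g\<in>U_set n. F g * cnj (xi_root n \<theta> \<alpha> c g)) \<noteq> 0"
  shows "(\<Sum>g\<in>U_set n. F g * cnj (lam n \<theta> \<alpha> c g)) \<noteq> 0"
proof
  assume z: "(\<Sum>g\<in>U_set n. F g * cnj (lam n \<theta> \<alpha> c g)) = 0"
  have inner: "(\<Sum>g\<in>U_set n. F g * cnj (lam n \<theta> \<alpha> c (cj n y g))) = 0" if y: "y \<in> U_set n" for y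
  proof -
    let ?y = "mid n i y"
    have y': "?y \<in> stab n (lev n i)" by (rule mid_stab[OF y])
    \<comment> \<open>\<open>lam\<close> depends on the middle block alone, so conjugation by
      \<open>y\<close> may be replaced by conjugation by its middle block, under which F is
      invariant.\<close>
    have "lam n \<theta> \<alpha> c (cj n y g) = lam n \<theta> \<alpha> c (cj n ?y g)" if g: "g \<in> U_set n" for g
    proof -
      have "mid n i (cj n ?y g) = mid n i (cj n y g)"
        unfolding mid_cj[OF y g] mid_cj[OF stab_U[OF y'] g] mid_id[OF y'] ..
      thus ?thesis using lam_mid[OF cj_U[OF y g] a] lam_mid[OF cj_U[OF stab_U[OF y'] g] a] by metis
    qed
    hence "(\<Sum>g\<in>U_set n. F g * cnj (lam n \<theta> \<alpha> c (cj n y g))) =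
      (\<Sum>g\<in>U_set n. F (cj n ?y g) * cnj (lam n \<theta> \<alpha> c (cj n ?y g)))"
      by (intro sum.cong refl) (simp add: F[OF y'])
    also have "\<dots> = (\<Sum>g\<in>U_set n. F g * cnj (lam n \<theta> \<alpha> c g))"
      by (rule sum_U_conj[OF stab_U[OF y'], of "\<lambda>g. F g * cnj (lam n \<theta> \<alpha> c g)"])
    finally show ?thesis using z by simp
  qed
  have "(\<Sum>g\<in>U_set n. F g * cnj (xi_root n \<theta> \<alpha> c g)) =
    (\<Sum>g\<in>U_set n. \<Sum>y\<in>U_set n. F g * cnj (lam n \<theta> \<alpha> c (cj n y g))) / of_nat (card (U_root n \<alpha> :: 'a mat set))"
    unfolding sum_divide_distrib
    by (intro sum.cong refl) (simp add: xi_root_eq sum_distrib_left sum_divide_distrib)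
  also have "\<dots> = 0" by (subst sum.swap) (simp add: inner)
  finally show False using nz by simp
qed

text \<open>The supercharacter with the factors of the chain replaced by the linear characters they
  are induced from. Averages against it are eigenvectors for the root subgroups of the
  chain.\<close>

definition Psi :: "nat \<Rightarrow> root set \<Rightarrow> (root \<Rightarrow> 'a) \<Rightarrow> 'a mat \<Rightarrow> complex" where
  "Psi m D' \<phi> g = (\<Prod>j<m. lam n \<theta> (cr j) (\<phi> (cr j)) g) * (\<Prod>\<alpha>\<in>D'. xi_root n \<theta> \<alpha> (\<phi> \<alpha>) g)"

text \<open>The factors are replaced one at a time, in the order of the chain. At step i those
  already replaced belong to roots cr j with j < i. Conjugation by \<open>stab n (lev n i)\<close>
  leaves them unchanged, since this group lies in their root subgroups with trivial linear
  character; so \<open>sum_xi_root_lam\<close> applies.\<close>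

lemma sum_xi_Psi:
  assumes m: "2 * m \<le> n" and D': "finite D'" "cr ` {..<m} \<inter> D' = {}"
    and f: "\<And>y g. y \<in> U_set n \<Longrightarrow> g \<in> U_set n \<Longrightarrow> f (cj n y g) = f g"
    and nz: "(\<Sum>g\<in>U_set n. f g * cnj (xi n \<theta> (cr ` {..<m} \<union> D') \<phi> g)) \<noteq> 0"
  shows "(\<Sum>g\<in>U_set n. f g * cnj (Psi m D' \<phi> g)) \<noteq> 0"
proof -
  let ?x = "\<lambda>j. xi_root n \<theta> (cr j) (\<phi> (cr j))" and ?l = "\<lambda>j. lam n \<theta> (cr j) (\<phi> (cr j))"
  let ?e = "\<lambda>g. \<Prod>\<alpha>\<in>D'. xi_root n \<theta> \<alpha> (\<phi> \<alpha>) g"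
  have xi: "xi n \<theta> (cr ` {..<m} \<union> D') \<phi> g = (\<Prod>j<m. ?x j g) * ?e g" for g
    unfolding xi_def using D' by (subst prod.union_disjoint) (simp_all add: prod.reindex[OF inj_cr])
  have "(\<Sum>g\<in>U_set n. f g * cnj ((\<Prod>j<i. ?l j g) * (\<Prod>j=i..<m. ?x j g) * ?e g)) \<noteq> 0" if "i \<le> m" for i
    using that
  proof (induction i)
    case 0
    thus ?case using nz unfolding xi by (simp add: atLeast0LessThan)
  next
    case (Suc i)
    define F where "F g = f g * cnj ((\<Prod>j<i. ?l j g) * (\<Prod>j=Suc i..<m. ?x j g) * ?e g)" for g
    have i2: "2 * i + 2 \<le> n" using Suc.prems m by simp
    have "(\<Prod>j=i..<m. ?x j g) = ?x i g * (\<Prod>j=Suc i..<m. ?x j g)" for g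
      using Suc.prems by (subst prod.atLeast_Suc_lessThan) simp_all
    hence "(\<Sum>g\<in>U_set n. F g * cnj (?x i g)) \<noteq> 0"
      using Suc.IH Suc.prems by (simp add: F_def ac_simps)
    hence "(\<Sum>g\<in>U_set n. F g * cnj (?l i g)) \<noteq> 0"
    proof (rule sum_xi_root_lam[OF cr_roots[OF i2] idx_cr[OF i2 order_refl], rotated])
      fix y g :: "'a mat" assume y: "y \<in> stab n (lev n i)" and g: "g \<in> U_set n"
      note yU = stab_U[OF y]
      have "?l j (cj n y g) = ?l j g" if "j < i" for j
        by (rule lam_conj_stab[OF y symm_lev cr_roots idx_cr_disjoint[OF that] g]) (use that i2 in simp)
      thus "F (cj n y g) = F g" unfolding F_def f[OF yU g] by (simp add: xi_root_conj[OF yU g])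
    qed
    thus ?case by (simp add: F_def ac_simps)
  qed
  from this[of m] show ?thesis by (simp add: Psi_def)
qed

lemma lam_mid_one:
  assumes k: "k \<in> U_set n" "mid n i k = 1\<^sub>m (2*n+1)" and h: "h \<in> U_set n" and a: "\<alpha> \<in> roots n" "idx \<alpha> \<subseteq> lev n i"
  shows "lam n \<theta> \<alpha> c (k * h) = lam n \<theta> \<alpha> c h"
proof -
  have "mid n i (k * h) = mid n i h" unfolding mid_mult[OF k(1) h] k(2) by (rule U_one_left[OF mid_U[OF h]])
  thus ?thesis using lam_mid[OF mult_U[OF k(1) h] a] lam_mid[OF h a] by metis
qed

lemma xi_root_eigen:
  assumes a: "\<alpha> \<in> roots n" and k: "k \<in> U_set n" and h: "h \<in> U_set n"
    and e: "\<And>y g. y \<in> U_set n \<Longrightarrow> g \<in> U_set n \<Longrightarrow> lam n \<theta> \<alpha> c (cj n y k * g) = d * lam n \<theta> \<alpha> c g"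
  shows "xi_root n \<theta> \<alpha> c (k * h) = d * xi_root n \<theta> \<alpha> c h"
proof -
  have "(\<Sum>y\<in>U_set n. lam n \<theta> \<alpha> c (cj n y (k * h))) = (\<Sum>y\<in>U_set n. d * lam n \<theta> \<alpha> c (cj n y h))"
  proof (intro sum.cong refl)
    fix y :: "'a mat" assume y: "y \<in> U_set n"
    note u = uinv_U[OF y]
    have "cj n y k * cj n y h = uinv n y * k * (y * (uinv n y * (h * y)))"
      by (simp only: U_assoc[where n=n] u y k h mult_U)
    also have "\<dots> = uinv n y * k * (h * y)" by (simp only: U_cancel(2)[OF y mult_U[OF h y]])
    also have "\<dots> = cj n y (k * h)" by (simp only: U_assoc[where n=n] u y k h mult_U)
    finally show "lam n \<theta> \<alpha> c (cj n y (k * h)) = d * lam n \<theta> \<alpha> c (cj n y h)"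
      using e[OF y cj_U[OF y h]] by simp
  qed
  thus ?thesis unfolding xi_root_eq[OF h] xi_root_eq[OF mult_U[OF k h]] by (simp add: sum_distrib_left)
qed

text \<open>The kernel of \<open>mid n i\<close> is normal, so every conjugate of \<open>k\<close>
  also leaves \<open>lam\<close> unchanged.\<close>

lemma xi_root_mid_one:
  assumes k: "k \<in> U_set n" "mid n i k = 1\<^sub>m (2*n+1)" and h: "h \<in> U_set n" and a: "\<alpha> \<in> roots n" "idx \<alpha> \<subseteq> lev n i"
  shows "xi_root n \<theta> \<alpha> c (k * h) = xi_root n \<theta> \<alpha> c h"
proof -
  have "xi_root n \<theta> \<alpha> c (k * h) = 1 * xi_root n \<theta> \<alpha> c h"
  proof (rule xi_root_eigen[OF a(1) k(1) h])
    fix y g :: "'a mat" assume y: "y \<in> U_set n" and g: "g \<in> U_set n"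
    have "mid n i (cj n y k) = 1\<^sub>m (2*n+1)"
      unfolding mid_cj[OF y k(1)] k(2)
      using uinv_mult(1)[OF mid_U[OF y]] U_one_right[OF uinv_U[OF mid_U[OF y]]] by simp
    from lam_mid_one[OF cj_U[OF y k(1)] this g a]
    show "lam n \<theta> \<alpha> c (cj n y k * g) = 1 * lam n \<theta> \<alpha> c g" by simp
  qed
  thus ?thesis by simp
qed

lemma above_stab:
  assumes "a \<in> labels n" "0 < a" "y \<in> vecs (insert 0 (above n a))" "2 * int i + 1 \<le> a"
  shows "eich n (bas a) (y :: int \<Rightarrow> 'a) \<in> stab n (lev n i)"
proof (rule eich_stab[OF two up_adm[OF assms(1,2,3)] symm_lev])
  show "bas a \<in> vecs (lev n i)" using assms by (intro vecs_bas) (auto simp: lev_def)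
  have "insert 0 (above n a) \<subseteq> lev n i" using assms by (auto simp: above_def lev_def)
  from vecs_mono[OF this] assms(3) show "y \<in> vecs (lev n i)" by blast
qed

text \<open>The element affects only the factor of cr i. It belongs to the group of
  \<open>lev n i\<close>, on which the linear characters of the earlier roots are trivial, and it
  lies in the kernel of the projection to the blocks of the later roots and of those in D'.\<close>

lemma Psi_chain:
  assumes m: "2 * m \<le> n" and D': "\<And>\<alpha>. \<alpha> \<in> D' \<Longrightarrow> \<alpha> \<in> roots n \<and> idx \<alpha> \<subseteq> lev n m" and i: "i < m"
    and a: "a = 2 * int i + 1 \<or> a = 2 * int i + 2" and y: "y \<in> vecs (insert 0 (above n a))"
    and R: "eich n (bas a) y \<in> U_root n (cr i)" and h: "h \<in> U_set n"
  shows "Psi m D' \<phi> (eich n (bas a) y * h) = lin_char n \<theta> (cr i) (\<phi> (cr i)) (eich n (bas a) y) * Psi m D' \<phi> h"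
proof -
  let ?k = "eich n (bas a) y"
  have i2: "2 * i + 2 \<le> n" using i m by simp
  have al: "a \<in> labels n" "0 < a" "2 * int i + 1 \<le> a" using a i2 by (auto simp: labels_def)
  have ks: "?k \<in> stab n (lev n i)" by (rule above_stab[OF al(1,2) y al(3)])
  note kU = stab_U[OF ks]
  have mid: "mid n j ?k = 1\<^sub>m (2*n+1)" if "i < j" for j
    by (rule mid_eich[OF al(1)]) (use a that in \<open>auto simp: lev_def\<close>)
  have 1: "lam n \<theta> (cr j) c (?k * h) = (if j = i then lin_char n \<theta> (cr i) c ?k else 1) * lam n \<theta> (cr j) c h"
    if j: "j < m" for j c
  proof -
    have j2: "2 * j + 2 \<le> n" using j m by simp
    consider "j < i" | "j = i" | "i < j" by linarith
    thus ?thesis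
    proof cases
      case 1
      show ?thesis using 1 lam_mult_left[OF cr_roots[OF j2] stab_U_root(1)[OF ks symm_lev cr_roots[OF j2] idx_cr_disjoint[OF 1]] h]
        lin_char_stab[OF ks symm_lev cr_roots[OF j2] idx_cr_disjoint[OF 1]] by simp
    next
      case 2
      thus ?thesis using lam_mult_left[OF cr_roots[OF i2] R h] by simp
    next
      case 3
      thus ?thesis using lam_mid_one[OF kU mid[OF 3] h cr_roots[OF j2] idx_cr[OF j2 order_refl]] by simp
    qed
  qed
  have "(\<Prod>j<m. lam n \<theta> (cr j) (\<phi> (cr j)) (?k * h)) =
    (\<Prod>j<m. (if j = i then lin_char n \<theta> (cr i) (\<phi> (cr i)) ?k else 1) * lam n \<theta> (cr j) (\<phi> (cr j)) h)"
    by (intro prod.cong refl) (auto simp: 1)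
  also have "\<dots> = lin_char n \<theta> (cr i) (\<phi> (cr i)) ?k * (\<Prod>j<m. lam n \<theta> (cr j) (\<phi> (cr j)) h)"
    using i by (simp add: prod.distrib)
  finally have "(\<Prod>j<m. lam n \<theta> (cr j) (\<phi> (cr j)) (?k * h)) =
    lin_char n \<theta> (cr i) (\<phi> (cr i)) ?k * (\<Prod>j<m. lam n \<theta> (cr j) (\<phi> (cr j)) h)" .
  moreover have "(\<Prod>\<alpha>\<in>D'. xi_root n \<theta> \<alpha> (\<phi> \<alpha>) (?k * h)) = (\<Prod>\<alpha>\<in>D'. xi_root n \<theta> \<alpha> (\<phi> \<alpha>) h)"
    using D' by (intro prod.cong refl xi_root_mid_one[OF kU mid[OF i] h]) auto
  ultimately show ?thesis by (simp add: Psi_def)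
qed

text \<open>The minus sign is that of the term -B(v, y) e: the entry at (a, -(a + 1)) is -y(a + 1).
  It explains the negated values of \<phi> in the instances of \<open>chain\<close>.\<close>

lemma eich_cr_first:
  assumes i2: "2 * i + 2 \<le> n" and a: "a = 2 * int i + 1" and y: "y \<in> vecs (insert 0 (above n a))"
  shows "eich n (bas a) y \<in> U_root n (cr i)"
    and "lin_char n \<theta> (cr i) c (eich n (bas a) y) = \<theta> (- (c * y (2 * int i + 2)))"
proof -
  have al: "a \<in> labels n" "0 < a" "int (2 * i + 1) = a" "int (2 * i + 2) = a + 1" using a i2 by (auto simp: labels_def)
  have kU: "eich n (bas a) y \<in> U_set n" by (rule eich_U[OF two up_adm[OF al(1,2) y]])
  have y0: "y p = 0" if "p \<noteq> 0" "p \<le> a" for p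
    by (rule vecs_D[OF y]) (use that in \<open>auto simp: above_def\<close>)
  have e: "ent n (eich n (bas a) y) p q = (if p = q then 1 else 0) + bas a (- q) * y p - y (- q) * bas a p - qf n y * bas a (- q) * bas a p"
    if "p \<in> labels n" "q \<in> labels n" for p q by (rule ent_eich[OF that])
  have "ent n (eich n (bas a) y) a q = 0" if "a < q" "q \<le> int n" for q
    using that al y0[of "- q"] by (subst e) (auto simp: labels_def bas_apply)
  moreover have "ent n (eich n (bas a) y) (a + 1) l = 0" if "l \<in> labels n" "pos n (a + 1) < pos n l" "pos n l \<le> pos n 0" for l
  proof -
    have "a + 1 \<in> labels n" using al i2 a by (auto simp: labels_def)
    moreover have "0 \<le> l"
    proof (rule ccontr)
      assume "\<not> 0 \<le> l"
      hence "pos n 0 < pos n l" using that(1) by (simp add: pos_less_iff)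
      thus False using that(3) by simp
    qed
    ultimately show ?thesis using that al by (subst e) (auto simp: bas_apply)
  qed
  ultimately show "eich n (bas a) y \<in> U_root n (cr i)"
    using kU al by (auto simp: cr_def prec_def preceq_def)
  have "a + 1 \<in> labels n" using al i2 a by (auto simp: labels_def)
  hence ql: "- (a + 1) \<in> labels n" by (simp only: uminus_labels)
  have "ent n (eich n (bas a) y) a (- (a + 1)) = - y (a + 1)"
    unfolding e[OF al(1) ql] using al(2) by (simp add: bas_apply add.commute)
  moreover have b: "2 * int i + 2 = a + 1" using a by simp
  ultimately show "lin_char n \<theta> (cr i) c (eich n (bas a) y) = \<theta> (- (c * y (2 * int i + 2)))"
    unfolding lin_char_def cr_def main_entry.simps fst_conv snd_conv al(3,4) b by simp
qed

text \<open>Here \<open>y\<close> vanishes at 0 as well, because \<open>U_root n (cr i)\<close>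
  requires the row of its second index to vanish up to and including the label 0.\<close>

lemma eich_cr_second:
  assumes i2: "2 * i + 2 \<le> n" and b: "b = 2 * int i + 2" and y: "y \<in> vecs (above n b)"
  shows "eich n (bas b) y \<in> U_root n (cr i)"
    and "lin_char n \<theta> (cr i) c (eich n (bas b) y) = 1"
proof -
  have bl: "b \<in> labels n" "0 < b" "int (2 * i + 1) = b - 1" "int (2 * i + 2) = b" "b - 1 \<in> labels n"
    using b i2 by (auto simp: labels_def)
  have y': "y \<in> vecs (insert 0 (above n b))" using y vecs_mono[of "above n b" "insert 0 (above n b)"] by auto
  have kU: "eich n (bas b) y \<in> U_set n" by (rule eich_U[OF two up_adm[OF bl(1,2) y']])
  have y0: "y p = 0" if "p \<le> b" for p
    by (rule vecs_D[OF y]) (use that in \<open>auto simp: above_def\<close>)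
  have e: "ent n (eich n (bas b) y) p q = (if p = q then 1 else 0) + bas b (- q) * y p - y (- q) * bas b p - qf n y * bas b (- q) * bas b p"
    if "p \<in> labels n" "q \<in> labels n" for p q by (rule ent_eich[OF that])
  have "ent n (eich n (bas b) y) (b - 1) q = (if b - 1 = q then 1 else 0)" if "q \<in> labels n" for q
    using that bl y0[of "b - 1"] by (subst e) (auto simp: bas_apply)
  moreover have "ent n (eich n (bas b) y) b l = 0" if "l \<in> labels n" "pos n b < pos n l" "pos n l \<le> pos n 0" for l
  proof -
    have "0 \<le> l"
    proof (rule ccontr)
      assume "\<not> 0 \<le> l"
      hence "pos n 0 < pos n l" using that(1) by (simp add: pos_less_iff)
      thus False using that(3) by simp
    qed
    thus ?thesis using that bl y0[of "- l"] by (subst e) (auto simp: bas_apply)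
  qed
  ultimately show "eich n (bas b) y \<in> U_root n (cr i)" "lin_char n \<theta> (cr i) c (eich n (bas b) y) = 1"
    using kU bl by (auto simp: cr_def prec_def preceq_def labels_def lin_char_def)
qed

text \<open>The factors outside the chain are still induced, so all conjugates of the element must
  be controlled. Their middle blocks are again attached to \<open>vecs Q\<close>, with the same
  coordinate at 0, which is why the eigenvalue is expressed by y(0) alone.\<close>

lemma Psi_end:
  assumes m: "2 * m + 1 \<le> n" and D': "\<And>\<alpha>. \<alpha> \<in> D' \<Longrightarrow> \<alpha> \<in> roots n \<and> idx \<alpha> \<subseteq> lev n m" "finite D'"
    and a: "a = 2 * int m + 1" and Q: "Q \<subseteq> insert 0 (above n a)"
    and cl: "\<And>p q. q \<in> Q \<Longrightarrow> p \<in> lev n m \<Longrightarrow> pos n p < pos n q \<Longrightarrow> p = a \<or> p \<in> Q"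
    and R: "\<And>\<alpha> y. \<alpha> \<in> D' \<Longrightarrow> y \<in> vecs Q \<Longrightarrow> eich n (bas a) y \<in> U_root n \<alpha> \<and>
       lin_char n \<theta> \<alpha> (\<phi> \<alpha>) (eich n (bas a) y) = \<theta> (d \<alpha> * y 0)"
    and y: "y \<in> vecs Q" and h: "h \<in> U_set n"
  shows "Psi m D' \<phi> (eich n (bas a) y * h) = \<theta> ((\<Sum>\<alpha>\<in>D'. d \<alpha>) * y 0) * Psi m D' \<phi> h"
proof -
  let ?k = "eich n (bas a) y"
  have al: "a \<in> labels n" "0 < a" using a m by (auto simp: labels_def)
  have ma: "minpos (lev n m) a" unfolding a by (rule minpos_lev[OF m])
  have QI: "Q \<subseteq> lev n m" using Q by (auto simp: lev_def above_def a)
  have ks': "eich n (bas a) z \<in> stab n (lev n m)" if "z \<in> vecs Q" for z :: "int \<Rightarrow> 'a"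
    by (rule above_stab[OF al]) (use vecs_mono[OF Q] that a in auto)
  note ks = ks'[OF y]
  note kU = stab_U[OF ks]
  have 1: "lam n \<theta> (cr j) c (?k * h) = lam n \<theta> (cr j) c h" if j: "j < m" for j c
  proof -
    have j2: "2 * j + 2 \<le> n" using j m by simp
    show ?thesis using lam_mult_left[OF cr_roots[OF j2] stab_U_root(1)[OF ks symm_lev cr_roots[OF j2] idx_cr_disjoint[OF j]] h]
        lin_char_stab[OF ks symm_lev cr_roots[OF j2] idx_cr_disjoint[OF j]] by simp
  qed
  have 2: "xi_root n \<theta> \<alpha> (\<phi> \<alpha>) (?k * h) = \<theta> (d \<alpha> * y 0) * xi_root n \<theta> \<alpha> (\<phi> \<alpha>) h" if \<alpha>: "\<alpha> \<in> D'" for \<alpha>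
  proof (rule xi_root_eigen[OF _ kU h])
    show ar: "\<alpha> \<in> roots n" using D' \<alpha> by blast
    have ai: "idx \<alpha> \<subseteq> lev n m" using D' \<alpha> by blast
    fix z g :: "'a mat" assume z: "z \<in> U_set n" and g: "g \<in> U_set n"
    have zs: "mid n m z \<in> stab n (lev n m)" by (rule mid_stab[OF z])
    obtain y' where y': "y' \<in> vecs Q" "?k * mid n m z = mid n m z * eich n (bas a) y'" "y' 0 = y 0"
    proof (rule eich_conj_above[OF two symm_lev ma QI Q cl zs y])
      fix y' :: "int \<Rightarrow> 'a"
      assume y': "y' \<in> vecs Q" "?k * mid n m z = mid n m z * eich n (bas a) y'"
        "(\<And>p. p \<in> lev n m \<Longrightarrow> pos n 0 < pos n p \<Longrightarrow> y p = 0) \<Longrightarrow> 0 \<in> lev n m \<Longrightarrow> y' 0 = y 0"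
      have "y p = 0" if "p \<in> lev n m" "pos n 0 < pos n p" for p
      proof (rule vecs_D[OF y])
        have "p < 0" using that by (auto simp: lev_def pos_less_iff split: if_splits)
        thus "p \<notin> Q" using Q al by (auto simp: above_def)
      qed
      thus thesis using that[OF y'(1,2)] y'(3) by simp
    qed
    note k' = ks'[OF y'(1)]
    have "cj n (mid n m z) ?k = eich n (bas a) y'"
      unfolding U_assoc[OF uinv_U[OF stab_U[OF zs]] kU stab_U[OF zs]] y'(2)
      by (rule U_cancel(1)[OF stab_U[OF zs] stab_U[OF k']])
    hence e: "mid n m (cj n z ?k) = eich n (bas a) y'" unfolding mid_cj[OF z kU] mid_id[OF ks] .
    have "lam n \<theta> \<alpha> (\<phi> \<alpha>) (cj n z ?k * g) = lam n \<theta> \<alpha> (\<phi> \<alpha>) (eich n (bas a) y' * mid n m g)"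
      using lam_mid[OF mult_U[OF cj_U[OF z kU] g] ar ai] unfolding mid_mult[OF cj_U[OF z kU] g] e by simp
    also have "\<dots> = \<theta> (d \<alpha> * y' 0) * lam n \<theta> \<alpha> (\<phi> \<alpha>) (mid n m g)"
      using R[OF \<alpha> y'(1)] lam_mult_left[OF ar _ mid_U[OF g]] by simp
    finally show "lam n \<theta> \<alpha> (\<phi> \<alpha>) (cj n z ?k * g) = \<theta> (d \<alpha> * y 0) * lam n \<theta> \<alpha> (\<phi> \<alpha>) g"
      using lam_mid[OF g ar ai] y'(3) by simp
  qed
  have "(\<Prod>\<alpha>\<in>D'. \<theta> (d \<alpha> * y 0)) = \<theta> ((\<Sum>\<alpha>\<in>D'. d \<alpha>) * y 0)"
    using D'(2) by (induction rule: finite_induct) (auto simp: theta_add distrib_right)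
  thus ?thesis unfolding Psi_def by (simp add: 1 2 prod.distrib)
qed

end

context linear_action begin

lemma average_eigen:
  assumes k: "k \<in> U_set n" and v: "v \<in> M" and e: "\<And>h. h \<in> U_set n \<Longrightarrow> \<Psi> (uinv n k * h) = cnj c * \<Psi> h"
  shows "act k (\<Sum>h\<in>U_set n. cnj (\<Psi> h) *s act h v) = c *s (\<Sum>h\<in>U_set n. cnj (\<Psi> h) *s act h v)"
proof -
  have "act k (\<Sum>h\<in>U_set n. cnj (\<Psi> h) *s act h v) = (\<Sum>h\<in>U_set n. cnj (\<Psi> (uinv n k * (k * h))) *s act (k * h) v)"
    unfolding act_sum by (intro sum.cong refl) (simp add: act_scale act_mult k v U_cancel)
  also have "\<dots> = (\<Sum>h\<in>U_set n. cnj (\<Psi> (uinv n k * h)) *s act h v)"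
    by (rule sum_U_left[OF k, of "\<lambda>h. cnj (\<Psi> (uinv n k * h)) *s act h v"])
  also have "\<dots> = (\<Sum>h\<in>U_set n. c *s (cnj (\<Psi> h) *s act h v))"
    by (intro sum.cong refl) (simp add: e)
  finally show ?thesis by (simp add: scale_sum_right)
qed

end

section \<open>Eigenvectors from supercharacters\<close>

context odd_char begin

text \<open>Since q(y) = 0, the element differs from the identity only at the two entries of the
  root cr m, and these occur neither in the conditions nor in the main entry of another root of the
  block.\<close>

lemma eich_end_sum:
  assumes m2: "2 * m + 2 \<le> n" and a: "a = 2 * int m + 1" and \<alpha>: "\<alpha> \<in> roots n" "idx \<alpha> \<subseteq> lev n m" "\<alpha> \<noteq> cr m"
    and y: "y \<in> vecs {a + 1}"
  shows "eich n (bas a) y \<in> U_root n \<alpha>" and "lin_char n \<theta> \<alpha> c (eich n (bas a) y) = 1"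
proof -
  have al: "a \<in> labels n" "0 < a" "a + 1 \<in> labels n" using a m2 by (auto simp: labels_def)
  have "{a + 1} \<subseteq> insert 0 (above n a)" using al by (auto simp: above_def)
  hence yU: "y \<in> vecs (insert 0 (above n a))" using y vecs_mono by blast
  have kU: "eich n (bas a) y \<in> U_set n" by (rule eich_U[OF two up_adm[OF al(1,2) yU]])
  have y0: "y p = 0" if "p \<noteq> a + 1" for p by (rule vecs_D[OF y]) (use that in simp)
  have "y j * y (- j) = 0" for j using al(2) y0[of j] y0[of "- j"] by (cases "j = a + 1") auto
  hence "bil n y y = 0" by (simp add: bil_def)
  hence q: "qf n y = 0" by (simp add: qf_def)
  have e: "ent n (eich n (bas a) y) p r = (if p = r then 1 else 0)"
    if "p \<in> labels n" "r \<in> labels n" "r \<noteq> - a \<or> p \<noteq> a + 1" "r \<noteq> - (a + 1) \<or> p \<noteq> a" for p r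
  proof -
    have "y (- r) = 0 \<or> p \<noteq> a" using that y0[of "- r"] by auto
    moreover have "r \<noteq> - a \<or> y p = 0" using that y0[of p] by auto
    ultimately show ?thesis unfolding ent_eich[OF that(1,2)] q by (auto simp: bas_apply)
  qed
  have "eich n (bas a) y \<in> U_root n \<alpha> \<and> lin_char n \<theta> \<alpha> c (eich n (bas a) y) = 1"
  proof (cases \<alpha>)
    case (EpsDiff p r)
    have pr: "1 \<le> p" "p < r" "r \<le> n" using \<alpha> by (auto simp: roots_def EpsDiff)
    have "ent n (eich n (bas a) y) (int p) (int k) = 0" if "p < k" "k \<le> r" for k
      using that pr al by (subst e) (auto simp: labels_def)
    thus ?thesis using kU pr by (auto simp: EpsDiff lin_char_def)
  next
    case (EpsSingle p)
    have pr: "1 \<le> p" "p \<le> n" using \<alpha> by (auto simp: roots_def EpsSingle)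
    have "ent n (eich n (bas a) y) (int p) k = 0" if "int p < k \<and> k \<le> int n \<or> k = 0" for k
      using that pr al by (subst e) (auto simp: labels_def)
    thus ?thesis using kU pr by (auto simp: EpsSingle lin_char_def)
  next
    case (EpsSum p r)
    have pr: "1 \<le> p" "p < r" "r \<le> n" "a \<le> int p" "a \<le> int r" using \<alpha> a by (auto simp: roots_def EpsSum lev_def)
    have ne: "int p \<noteq> a \<or> int r \<noteq> a + 1" using \<alpha>(3) a by (auto simp: EpsSum cr_def)
    have 1: "ent n (eich n (bas a) y) (int p) k = 0" if "int p < k \<and> k \<le> int n" for k
      using that pr al by (subst e) (auto simp: labels_def)
    have 2: "ent n (eich n (bas a) y) (int r) l = 0" if l: "l \<in> labels n" "prec n (int r) l" "preceq n l 0" for l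
    proof -
      have "0 \<le> l"
      proof (rule ccontr)
        assume "\<not> 0 \<le> l"
        hence "pos n 0 < pos n l" using l(1) by (simp add: pos_less_iff)
        thus False using l(3) by (simp add: preceq_def)
      qed
      moreover have "int r \<noteq> l" using l(2) by (auto simp: prec_def)
      moreover have "int r \<in> labels n" using pr by (simp add: labels_def)
      ultimately show ?thesis using l al by (subst e) auto
    qed
    have 3: "ent n (eich n (bas a) y) (int p) (- int r) = 0"
      using pr ne al by (subst e) (auto simp: labels_def)
    show ?thesis using kU 1 2 3 by (simp add: EpsSum lin_char_def)
  qed
  thus "eich n (bas a) y \<in> U_root n \<alpha>" and "lin_char n \<theta> \<alpha> c (eich n (bas a) y) = 1" by auto
qed

text \<open>In rank 2 there are three roots besides cr m. Of these only \<epsilon>_{2m+1} sees the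
  coordinate of \<open>y\<close> at 0, through the entry -y(0) at (a, 0).\<close>

lemma eich_end_zero:
  assumes m2: "n = 2 * m + 2" and a: "a = 2 * int m + 1"
    and \<alpha>: "\<alpha> \<in> {EpsDiff (2 * m + 1) (2 * m + 2), EpsSingle (2 * m + 1), EpsSingle (2 * m + 2)}"
    and y: "y \<in> vecs {0, a + 1}"
  shows "eich n (bas a) y \<in> U_root n \<alpha>"
    and "lin_char n \<theta> \<alpha> c (eich n (bas a) y) = \<theta> ((if \<alpha> = EpsSingle (2 * m + 1) then - c else 0) * y 0)"
proof -
  have al: "a \<in> labels n" "0 < a" "a + 1 \<in> labels n" using a m2 by (auto simp: labels_def)
  have i: "int (2 * m + 1) = a" "int (2 * m + 2) = a + 1" using a by auto
  have "{0, a + 1} \<subseteq> insert 0 (above n a)" using al by (auto simp: above_def)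
  hence yU: "y \<in> vecs (insert 0 (above n a))" using y vecs_mono by blast
  have kU: "eich n (bas a) y \<in> U_set n" by (rule eich_U[OF two up_adm[OF al(1,2) yU]])
  have y0: "y p = 0" if "p \<noteq> a + 1" "p \<noteq> 0" for p by (rule vecs_D[OF y]) (use that in simp)
  have e1: "ent n (eich n (bas a) y) a (a + 1) = 0"
    using al y0[of "- (a + 1)"] by (subst ent_eich) (auto simp: bas_apply)
  have e2: "ent n (eich n (bas a) y) a 0 = - y 0"
    using al by (subst ent_eich) (auto simp: bas_apply)
  have e3: "ent n (eich n (bas a) y) (a + 1) 0 = 0"
    using al by (subst ent_eich) (auto simp: bas_apply)
  have "k = 2 * m + 2" if "2 * m + 1 < k" "k \<le> n" for k using that m2 by simp
  hence k: "ent n (eich n (bas a) y) a (int k) = 0" if "2 * m + 1 < k" "k \<le> n" for k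
    using that e1 i by metis
  show "eich n (bas a) y \<in> U_root n \<alpha>"
    using \<alpha> kU k by (auto simp: i[simplified] m2)
  show "lin_char n \<theta> \<alpha> c (eich n (bas a) y) = \<theta> ((if \<alpha> = EpsSingle (2 * m + 1) then - c else 0) * y 0)"
    using \<alpha>
  proof (elim insertE emptyE)
    assume "\<alpha> = EpsDiff (2 * m + 1) (2 * m + 2)"
    thus ?thesis unfolding lin_char_def using e1 by (simp only: main_entry.simps fst_conv snd_conv i) simp
  next
    assume "\<alpha> = EpsSingle (2 * m + 1)"
    thus ?thesis unfolding lin_char_def using e2 by (simp only: main_entry.simps fst_conv snd_conv i) simp
  next
    assume "\<alpha> = EpsSingle (2 * m + 2)"
    thus ?thesis unfolding lin_char_def using e3 by (simp only: main_entry.simps fst_conv snd_conv i) simp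
  qed
qed

text \<open>The last set of prescriptions concerns the block after the chain and is switched off by
  Q = {}; \<open>d\<close> collects the contributions of the roots outside the chain to the
  eigenvalues there.\<close>

definition Eg :: "nat \<Rightarrow> (root \<Rightarrow> 'a) \<Rightarrow> int set \<Rightarrow> 'a \<Rightarrow> (int \<times> (int \<Rightarrow> 'a) \<times> complex) set" where
  "Eg m \<phi> Q d =
     {(2 * int i + 1, y, \<theta> (- \<phi> (cr i) * y (2 * int i + 2))) | i y. i < m \<and> y \<in> vecs (insert 0 (above n (2 * int i + 1)))} \<union>
     {(2 * int i + 2, y, 1) | i y. i < m \<and> y \<in> vecs (above n (2 * int i + 2))} \<union>
     {(2 * int m + 1, y, \<theta> (d * y 0)) | y. Q \<noteq> {} \<and> y \<in> vecs Q}"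

lemma Eg_cases:
  assumes "(a, y, c) \<in> Eg m \<phi> Q d"
  obtains i where "i < m" "a = 2 * int i + 1" "y \<in> vecs (insert 0 (above n a))" "c = \<theta> (- \<phi> (cr i) * y (2 * int i + 2))"
  | i where "i < m" "a = 2 * int i + 2" "y \<in> vecs (above n a)" "c = 1"
  | "a = 2 * int m + 1" "Q \<noteq> {}" "y \<in> vecs Q" "c = \<theta> (d * y 0)"
  using assms unfolding Eg_def by blast

end

context linear_action begin

lemma chain_Eg:
  assumes m: "2 * m \<le> n" and \<phi>: "\<And>i. i < m \<Longrightarrow> \<phi> (cr i) \<noteq> 0"
    and Q: "Q \<noteq> {} \<Longrightarrow> 2 * m + 1 \<le> n \<and> Q \<subseteq> insert 0 (above n (2 * int m + 1))"
  shows "chain n \<theta> scale act M m (\<lambda>i. - \<phi> (cr i)) (Eg m \<phi> Q d)"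
proof
  fix i assume "i < m"
  thus "- \<phi> (cr i) \<noteq> 0" using \<phi> by simp
next
  show "2 * m \<le> n" by (rule m)
next
  fix a y c assume "(a, y, c) \<in> Eg m \<phi> Q d"
  thus "a \<in> labels n \<and> 0 < a \<and> y \<in> vecs (insert 0 (above n a))"
  proof (cases rule: Eg_cases)
    case (1 i)
    thus ?thesis using m by (auto simp: labels_def)
  next
    case (2 i)
    thus ?thesis using m vecs_mono[of "above n a" "insert 0 (above n a)"] by (auto simp: labels_def)
  next
    case 3
    thus ?thesis using Q vecs_mono[of Q "insert 0 (above n a)"] by (auto simp: labels_def)
  qed
next
  fix i and y :: "int \<Rightarrow> 'a" assume "i < m" "y \<in> vecs (insert 0 (above n (2 * int i + 1)))"
  thus "(2 * int i + 1, y, \<theta> (- \<phi> (cr i) * y (2 * int i + 2))) \<in> Eg m \<phi> Q d" unfolding Eg_def by blast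
next
  fix i and y :: "int \<Rightarrow> 'a" assume "i < m" "y \<in> vecs (above n (2 * int i + 2))"
  thus "(2 * int i + 2, y, 1) \<in> Eg m \<phi> Q d" unfolding Eg_def by blast
qed

text \<open>The inverse of the transformation attached to \<open>y\<close> is the one attached to
  -y, so \<open>average_eigen\<close> reduces the claim to the behaviour of \<open>Psi\<close> under
  left multiplication, given by \<open>Psi_chain\<close> for the labels of the chain and by
  \<open>Psi_end\<close> for the next one.\<close>

lemma Psi_eigen:
  assumes m: "2 * m \<le> n" and \<phi>: "\<And>i. i < m \<Longrightarrow> \<phi> (cr i) \<noteq> 0"
    and Q: "Q \<noteq> {} \<Longrightarrow> 2 * m + 1 \<le> n \<and> Q \<subseteq> insert 0 (above n (2 * int m + 1))"
    and D': "\<And>\<alpha>. \<alpha> \<in> D' \<Longrightarrow> \<alpha> \<in> roots n \<and> idx \<alpha> \<subseteq> lev n m" "finite D'"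
    and cl: "\<And>p q. q \<in> Q \<Longrightarrow> p \<in> lev n m \<Longrightarrow> pos n p < pos n q \<Longrightarrow> p = 2 * int m + 1 \<or> p \<in> Q"
    and R: "\<And>\<alpha> y. \<alpha> \<in> D' \<Longrightarrow> y \<in> vecs Q \<Longrightarrow> Q \<noteq> {} \<Longrightarrow> eich n (bas (2 * int m + 1)) y \<in> U_root n \<alpha> \<and>
       lin_char n \<theta> \<alpha> (\<phi> \<alpha>) (eich n (bas (2 * int m + 1)) y) = \<theta> (d \<alpha> * y 0)"
    and v: "v \<in> M"
  shows "chain.eigen n scale act M (Eg m \<phi> Q (\<Sum>\<alpha>\<in>D'. d \<alpha>)) 0 (\<Sum>h\<in>U_set n. cnj (Psi m D' \<phi> h) *s act h v)"
proof -
  let ?E = "Eg m \<phi> Q (\<Sum>\<alpha>\<in>D'. d \<alpha>)"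
  interpret C: chain n \<theta> scale act M m "\<lambda>i. - \<phi> (cr i)" ?E by (rule chain_Eg[where \<phi>=\<phi>, OF m \<phi> Q])
  let ?u = "\<Sum>h\<in>U_set n. cnj (Psi m D' \<phi> h) *s act h v"
  have "?u \<in> M" by (intro subspace_sum[OF subspace_M] subspace_scale[OF subspace_M] act_M v)
  moreover have "V a y ?u = c *s ?u" if e: "(a, y, c) \<in> ?E" for a y c
  proof -
    have ad: "adm n (bas a) y" using C.Eg_adm[OF e] up_adm by blast
    have kU: "eich n (bas a) y \<in> U_set n" by (rule eich_U[OF two ad])
    have "Psi m D' \<phi> (eich n (bas a) (- y) * h) = cnj c * Psi m D' \<phi> h" if h: "h \<in> U_set n" for h
      using e
    proof (cases rule: Eg_cases)
      case (1 i)
      have i2: "2 * i + 2 \<le> n" using 1 m by simp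
      have y': "- y \<in> vecs (insert 0 (above n a))" by (rule vecs_uminus[OF 1(3)])
      show ?thesis
        using Psi_chain[OF m D'(1) 1(1) disjI1[OF 1(2)] y' eich_cr_first(1)[OF i2 1(2) y'] h]
          eich_cr_first(2)[OF i2 1(2) y'] 1(4) by (simp add: cnj_theta)
    next
      case (2 i)
      have i2: "2 * i + 2 \<le> n" using 2 m by simp
      have y': "- y \<in> vecs (above n a)" by (rule vecs_uminus[OF 2(3)])
      have y'': "- y \<in> vecs (insert 0 (above n a))" using y' vecs_mono[of "above n a" "insert 0 (above n a)"] by blast
      show ?thesis
        using Psi_chain[OF m D'(1) 2(1) disjI2[OF 2(2)] y'' eich_cr_second(1)[OF i2 2(2) y'] h]
          eich_cr_second(2)[OF i2 2(2) y'] 2(4) by simp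
    next
      case 3
      have y': "- y \<in> vecs Q" by (rule vecs_uminus[OF 3(3)])
      have m1: "2 * m + 1 \<le> n" and Qa: "Q \<subseteq> insert 0 (above n a)" using Q[OF 3(2)] 3(1) by auto
      have cl': "p = a \<or> p \<in> Q" if "q \<in> Q" "p \<in> lev n m" "pos n p < pos n q" for p q
        using cl[OF that] 3(1) by simp
      have R': "eich n (bas a) z \<in> U_root n \<alpha> \<and> lin_char n \<theta> \<alpha> (\<phi> \<alpha>) (eich n (bas a) z) = \<theta> (d \<alpha> * z 0)"
        if "\<alpha> \<in> D'" "z \<in> vecs Q" for \<alpha> z
        using R[OF that 3(2)] 3(1) by simp
      show ?thesis
        using Psi_end[OF m1 D' 3(1) Qa cl' R' y' h] 3(4) by (simp add: cnj_theta)
    qed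
    hence "Psi m D' \<phi> (uinv n (eich n (bas a) y) * h) = cnj c * Psi m D' \<phi> h" if "h \<in> U_set n" for h
      using that unfolding eich_uinv[OF two ad] .
    thus ?thesis by (rule average_eigen[where \<Psi>="Psi m D' \<phi>" and c=c, OF kU v])
  qed
  ultimately show ?thesis unfolding C.eigen_def by blast
qed

lemma inv_on_M: "inv_on (lev n 0) M"
  unfolding lev_0 inv_on_def stab_labels using subspace_M act_M by blast

text \<open>The block after the chain has rank 0 or 1, where the exponent is 0, so one nonzero
  vector is enough to start from.\<close>

lemma chain_end_large:
  assumes m: "2 * m \<le> n" "n \<le> 2 * m + 1" and \<phi>: "\<And>i. i < m \<Longrightarrow> \<phi> (cr i) \<noteq> 0"
    and D': "\<And>\<alpha>. \<alpha> \<in> D' \<Longrightarrow> \<alpha> \<in> roots n \<and> idx \<alpha> \<subseteq> lev n m" "finite D'"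
    and v: "v \<in> M" and W: "inv_on (lev n 0) W"
    and u: "(\<Sum>h\<in>U_set n. cnj (Psi m D' \<phi> h) *s act h v) \<in> W" "(\<Sum>h\<in>U_set n. cnj (Psi m D' \<phi> h) *s act h v) \<noteq> 0"
  shows "large W (CARD('a) ^ tri n)"
proof -
  interpret C: chain n \<theta> scale act M m "\<lambda>i. - \<phi> (cr i)" "Eg m \<phi> {} (\<Sum>\<alpha>\<in>D'. 0)"
    by (rule chain_Eg[where \<phi>=\<phi>, OF m(1) \<phi>]) auto
  have E: "C.eigen 0 (\<Sum>h\<in>U_set n. cnj (Psi m D' \<phi> h) *s act h v)"
    by (rule Psi_eigen[where \<phi>=\<phi>, OF m(1) \<phi> _ D' _ _ v]) auto
  have t: "tri (n - 2 * m) = 0"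
  proof -
    have "n - 2 * m = 0 \<or> n - 2 * m = Suc 0" using m by arith
    thus ?thesis using tri_Suc[of 0] by auto
  qed
  have "large W (CARD('a) ^ (0 + (tri (n - 2 * 0) - tri (n - 2 * m))))"
    by (rule C.chain_large[OF _ W u E]) (use large_one in auto)
  thus ?thesis by (simp add: t)
qed

text \<open>The block after the chain has rank 2, and there the root \<epsilon>_{n-1} yields the
  factor q, whose exponent is tri(2) = 1.\<close>

lemma chain_end_large2:
  assumes m: "n = 2 * m + 2" and \<phi>: "\<And>i. i < m \<Longrightarrow> \<phi> (cr i) \<noteq> 0" "\<phi> (EpsSingle (2 * m + 1)) \<noteq> 0"
    and D': "D' = {EpsSingle (2 * m + 1)}"
    and v: "v \<in> M" and W: "inv_on (lev n 0) W"
    and u: "(\<Sum>h\<in>U_set n. cnj (Psi m D' \<phi> h) *s act h v) \<in> W" "(\<Sum>h\<in>U_set n. cnj (Psi m D' \<phi> h) *s act h v) \<noteq> 0"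
  shows "large W (CARD('a) ^ tri n)"
proof -
  let ?a = "2 * int m + 1" and ?c = "\<phi> (EpsSingle (2 * m + 1))"
  let ?Q = "{0, ?a + 1}" and ?d = "\<lambda>\<alpha>. if \<alpha> = EpsSingle (2 * m + 1) then - \<phi> \<alpha> else 0"
  have m': "2 * m \<le> n" using m by simp
  have Q: "2 * m + 1 \<le> n \<and> ?Q \<subseteq> insert 0 (above n ?a)" using m by (auto simp: above_def labels_def)
  have D'': "\<alpha> \<in> roots n \<and> idx \<alpha> \<subseteq> lev n m" if "\<alpha> \<in> D'" for \<alpha>
    using that m unfolding D' by (auto simp: roots_def lev_def labels_def)
  have cl: "p = ?a \<or> p \<in> ?Q" if "q \<in> ?Q" "p \<in> lev n m" "pos n p < pos n q" for p q
  proof -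
    have "p \<in> labels n" "q \<in> labels n" using that m by (auto simp: lev_def labels_def)
    thus ?thesis using that m by (auto simp: pos_less_iff lev_def labels_def split: if_splits)
  qed
  interpret C: chain n \<theta> scale act M m "\<lambda>i. - \<phi> (cr i)" "Eg m \<phi> ?Q (\<Sum>\<alpha>\<in>D'. ?d \<alpha>)"
    by (rule chain_Eg[where \<phi>=\<phi>, OF m' \<phi>(1) Q])
  have R: "eich n (bas ?a) y \<in> U_root n \<alpha> \<and> lin_char n \<theta> \<alpha> (\<phi> \<alpha>) (eich n (bas ?a) y) = \<theta> (?d \<alpha> * y 0)"
    if "\<alpha> \<in> D'" "y \<in> vecs ?Q" for \<alpha> y
    using eich_end_zero[OF m refl _ that(2), of \<alpha>] that(1) unfolding D' by simp
  have E: "C.eigen 0 (\<Sum>h\<in>U_set n. cnj (Psi m D' \<phi> h) *s act h v)"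
    by (rule Psi_eigen[where \<phi>=\<phi>, OF m' \<phi>(1) Q D'' _ cl R v]) (simp_all add: D')
  have d: "(\<Sum>\<alpha>\<in>D'. ?d \<alpha>) = - ?c" by (simp add: D')
  have t: "tri (n - 2 * m) = 1" using tri_Suc[of 1] tri_Suc[of 0] m by (simp add: numeral_2_eq_2)
  have "large W (CARD('a) ^ (1 + (tri (n - 2 * 0) - tri (n - 2 * m))))"
  proof (rule C.chain_large[OF _ W u E])
    fix W u assume W: "inv_on (lev n m) W" and u: "u \<in> W" "u \<noteq> 0" "C.eigen m u"
    have Qe: "{0, 2 * int m + 2} = ?Q" by (simp add: add.commute)
    have "V ?a y u = \<theta> (- ?c * y 0) *s u" if "y \<in> vecs {0, 2 * int m + 2}" for y
    proof (rule C.eigenD[OF u(3) _ order_refl])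
      show "(?a, y, \<theta> (- ?c * y 0)) \<in> Eg m \<phi> ?Q (\<Sum>\<alpha>\<in>D'. ?d \<alpha>)"
        unfolding d Eg_def using that[unfolded Qe] by blast
    qed
    from C.end_large[OF m W u(1,2) _ this] \<phi>(2) show "large W (CARD('a) ^ 1)" by simp
  qed simp
  moreover have "1 \<le> tri n" using tri_pos[of n] m by simp
  ultimately show ?thesis by (simp add: t)
qed

text \<open>As cr m is missing, its root subgroup fixes the averaged vector; in rank 2 the absence
  of \<epsilon>_{n-1} gives the same for the coordinate at 0. The last block then loses a factor q
  by \<open>end_small\<close>, and the chain before it multiplies by its exact factors.\<close>

lemma chain_end_small:
  assumes m: "2 * m + 2 \<le> n" and \<phi>: "\<And>i. i < m \<Longrightarrow> \<phi> (cr i) \<noteq> 0"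
    and D': "\<And>\<alpha>. \<alpha> \<in> D' \<Longrightarrow> \<alpha> \<in> roots n \<and> idx \<alpha> \<subseteq> lev n m" "finite D'"
    and nD: "cr m \<notin> D'" "n = 2 * m + 2 \<Longrightarrow> EpsSingle (2 * m + 1) \<notin> D'"
    and v: "v \<in> M" and W: "inv_on (lev n 0) W"
    and u: "(\<Sum>h\<in>U_set n. cnj (Psi m D' \<phi> h) *s act h v) \<in> W" "(\<Sum>h\<in>U_set n. cnj (Psi m D' \<phi> h) *s act h v) \<noteq> 0"
  shows "small (labels n) W (CARD('a) ^ (tri n - 1))"
proof -
  let ?a = "2 * int m + 1"
  define Q where "Q = (if n = 2 * m + 2 then {0, ?a + 1} else {?a + 1})"
  have m': "2 * m \<le> n" using m by simp
  have Q: "2 * m + 1 \<le> n \<and> Q \<subseteq> insert 0 (above n ?a)" using m by (auto simp: above_def labels_def Q_def)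
  have Q2: "2 * m + 3 \<le> n \<and> Q = {2 * int m + 2} \<or> n = 2 * m + 2 \<and> Q = {0, 2 * int m + 2}"
    using m by (auto simp: Q_def)
  have cl: "p = ?a \<or> p \<in> Q" if "q \<in> Q" "p \<in> lev n m" "pos n p < pos n q" for p q
  proof -
    have "p \<in> labels n" "q \<in> labels n" using that m Q2 by (auto simp: lev_def labels_def)
    thus ?thesis using that Q2 by (auto simp: pos_less_iff lev_def labels_def split: if_splits)
  qed
  interpret C: chain n \<theta> scale act M m "\<lambda>i. - \<phi> (cr i)" "Eg m \<phi> Q (\<Sum>\<alpha>\<in>D'. 0)"
    by (rule chain_Eg[where \<phi>=\<phi>, OF m' \<phi> Q])
  have R: "eich n (bas ?a) y \<in> U_root n \<alpha> \<and> lin_char n \<theta> \<alpha> (\<phi> \<alpha>) (eich n (bas ?a) y) = \<theta> (0 * y 0)"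
    if \<alpha>: "\<alpha> \<in> D'" and y: "y \<in> vecs Q" for \<alpha> y
  proof (cases "n = 2 * m + 2")
    case True
    have yQ: "y \<in> vecs {0, ?a + 1}" using y True by (simp add: Q_def)
    have ne: "\<alpha> \<noteq> cr m" "\<alpha> \<noteq> EpsSingle (2 * m + 1)" using nD True \<alpha> by auto
    have "\<alpha> \<in> {EpsDiff (2 * m + 1) (2 * m + 2), EpsSingle (2 * m + 1), EpsSingle (2 * m + 2)}"
      using D'(1)[OF \<alpha>] ne True by (cases \<alpha>) (auto simp: roots_def lev_def cr_def)
    from eich_end_zero(1)[OF True refl this yQ] eich_end_zero(2)[OF True refl this yQ, of "\<phi> \<alpha>"] ne(2) show ?thesis by simp
  next
    case False
    hence yQ: "y \<in> vecs {?a + 1}" using y by (simp add: Q_def)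
    have "\<alpha> \<noteq> cr m" using nD \<alpha> by auto
    from eich_end_sum[OF m refl _ _ this yQ] D'(1)[OF \<alpha>] show ?thesis by simp
  qed
  have E: "C.eigen 0 (\<Sum>h\<in>U_set n. cnj (Psi m D' \<phi> h) *s act h v)"
    by (rule Psi_eigen[where \<phi>=\<phi>, OF m' \<phi> Q D' cl R v])
  have Qn: "Q \<noteq> {}" by (simp add: Q_def)
  have "small (lev n 0) W (CARD('a) ^ ((tri (n - 2 * m) - 1) + (tri (n - 2 * 0) - tri (n - 2 * m))))"
  proof (rule C.chain_small[OF _ W u E])
    fix W u assume W: "inv_on (lev n m) W" and u: "u \<in> W" "u \<noteq> 0" "C.eigen m u"
    have "V ?a y u = u" if "y \<in> vecs Q" for y
    proof -
      have "(?a, y, \<theta> ((\<Sum>\<alpha>\<in>D'. 0) * y 0)) \<in> Eg m \<phi> Q (\<Sum>\<alpha>\<in>D'. 0)"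
        unfolding Eg_def using that Qn by blast
      from C.eigenD[OF u(3) this] show ?thesis by simp
    qed
    from C.end_small[OF m W u(1,2) Q2 this]
    show "small (lev n m) W (CARD('a) ^ (tri (n - 2 * m) - 1))" .
  qed simp
  moreover have "1 \<le> tri (n - 2 * m)" using tri_pos[of "n - 2 * m"] m by simp
  moreover have "tri (n - 2 * m) \<le> tri n" using C.tri_mono_chain[of 0] by simp
  ultimately show ?thesis by (simp add: lev_0)
qed

lemma ex_small_M:
  assumes "x \<in> M" "x \<noteq> 0"
  shows "small (labels n) M (CARD('a) ^ tri n)"
proof -
  obtain d where d: "small (lev n 0) M (CARD('a) ^ d)" "d \<le> dexp (lev n 0)"
    using ex_small[OF symm_lev inv_on_M assms] by blast
  hence "CARD('a) ^ d \<le> CARD('a) ^ tri n" by (intro power_increasing) (auto simp: dexp_lev Suc_le_eq)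
  from small_mono[OF d(1) order_refl this] show ?thesis by (simp add: lev_0)
qed

end

section \<open>Matrix representations\<close>

lemma subspace_vec_iff:
  "VectorSpace.subspace class_ring W (module_vec TYPE('b::field) d) \<longleftrightarrow>
    W \<subseteq> carrier_vec d \<and> 0\<^sub>v d \<in> W \<and> (\<forall>v\<in>W. \<forall>w\<in>W. v + w \<in> W) \<and> (\<forall>c. \<forall>v\<in>W. c \<cdot>\<^sub>v v \<in> W)"
  unfolding VectorSpace.subspace_def LinearCombinations.submodule_def
  using vec_vs[of d, where 'a='b] vec_module[of d, where 'a='b] by (auto simp: module_vec_simps class_ring_simps)

lemma GL_simps:
  "x \<otimes>\<^bsub>GL d\<^esub> y = x * y" "\<one>\<^bsub>GL d\<^esub> = 1\<^sub>m d"
  "x \<in> carrier (GL d) \<longleftrightarrow> x \<in> carrier_mat d d \<and> (\<exists>y\<in>carrier_mat d d. y * x = 1\<^sub>m d \<and> x * y = 1\<^sub>m d)"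
  by (auto simp: units_of_def Units_def ring_mat_def)

lemma vector_space_scl: "vector_space (scl :: 'b::field \<Rightarrow> ('i \<Rightarrow> 'b) \<Rightarrow> 'i \<Rightarrow> 'b)"
  by standard (auto simp: fun_eq_iff algebra_simps)

lemma sum_scl_bas:
  fixes v :: "'i \<Rightarrow> 'b::comm_ring_1"
  assumes "v \<in> vecs A" "finite A"
  shows "(\<Sum>i\<in>A. scl (v i) (bas i)) = v"
proof
  fix j
  have "(\<Sum>i\<in>A. scl (v i) (bas i)) j = (\<Sum>i\<in>A. if i = j then v i else 0)"
    unfolding sum_fun_apply by (intro sum.cong refl) (auto simp: bas_apply)
  also have "\<dots> = v j" using assms by (auto simp: vecs_def)
  finally show "(\<Sum>i\<in>A. scl (v i) (bas i)) j = v j" .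
qed

lemma span_bas:
  assumes "finite A"
  shows "vecs A \<subseteq> Modules.module.span scl (bas ` A :: ('i \<Rightarrow> 'b::field) set)"
proof
  interpret vector_space "scl :: 'b \<Rightarrow> ('i \<Rightarrow> 'b) \<Rightarrow> 'i \<Rightarrow> 'b" by (rule vector_space_scl)
  fix v :: "'i \<Rightarrow> 'b" assume v: "v \<in> vecs A"
  have "(\<Sum>i\<in>A. scl (v i) (bas i)) \<in> span (bas ` A)"
    by (intro span_sum span_scale span_base imageI)
  thus "v \<in> span (bas ` A)" by (simp only: sum_scl_bas[OF v assms])
qed

lemma inj_bas: "inj (bas :: 'i \<Rightarrow> 'i \<Rightarrow> 'b::zero_neq_one)"
  by (rule injI) (metis bas_apply zero_neq_one)

lemma independent_bas:
  assumes "finite A"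
  shows "\<not> Modules.module.dependent scl (bas ` A :: ('i \<Rightarrow> 'b::field) set)"
proof -
  interpret vector_space "scl :: 'b \<Rightarrow> ('i \<Rightarrow> 'b) \<Rightarrow> 'i \<Rightarrow> 'b" by (rule vector_space_scl)
  have "u (bas i) = 0" if u: "(\<Sum>v\<in>bas ` A. scl (u v) v) = 0" and i: "i \<in> A" for u :: "('i \<Rightarrow> 'b) \<Rightarrow> 'b" and i
  proof -
    let ?w = "\<lambda>i. if i \<in> A then u (bas i) else 0"
    have "(\<Sum>v\<in>bas ` A. scl (u v) v) = (\<Sum>i\<in>A. scl (u (bas i)) (bas i))"
      by (rule sum.reindex_cong[OF inj_on_subset[OF inj_bas subset_UNIV] refl refl])
    also have "\<dots> = (\<Sum>i\<in>A. scl (?w i) (bas i))" by (intro sum.cong refl) simp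
    also have "\<dots> = ?w" by (rule sum_scl_bas[OF _ assms]) (simp add: vecs_def)
    finally have "?w = 0" unfolding u by (rule sym)
    from fun_cong[OF this, of i] show ?thesis using i by simp
  qed
  thus ?thesis unfolding dependent_finite[OF finite_imageI[OF assms]] by blast
qed

definition mact :: "nat \<Rightarrow> ('g \<Rightarrow> complex mat) \<Rightarrow> 'g \<Rightarrow> (nat \<Rightarrow> complex) \<Rightarrow> nat \<Rightarrow> complex" where
  "mact d \<rho> g f = (\<lambda>i. if i < d then \<Sum>j<d. \<rho> g $$ (i, j) * f j else 0)"

definition vfun :: "nat \<Rightarrow> complex vec \<Rightarrow> nat \<Rightarrow> complex" where
  "vfun d v = (\<lambda>i. if i < d then v $ i else 0)"

lemma vfun_mult: "\<rho> g \<in> carrier_mat d d \<Longrightarrow> v \<in> carrier_vec d \<Longrightarrow> vfun d (\<rho> g *\<^sub>v v) = mact d \<rho> g (vfun d v)"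
  by (auto simp: vfun_def mact_def fun_eq_iff scalar_prod_def atLeast0LessThan)

locale matrix_action = odd_char n \<theta> for n and \<theta> :: "'a::{field,finite} \<Rightarrow> complex" +
  fixes d :: nat and \<rho> :: "'a mat \<Rightarrow> complex mat"
  assumes irr: "irreducible_rep (U_group n) d \<rho>"
begin

lemma rho_carrier: "g \<in> U_set n \<Longrightarrow> \<rho> g \<in> carrier_mat d d"
  using irr by (auto simp: irreducible_rep_def hom_def Pi_iff GL_simps)

lemma rho_mult: "g \<in> U_set n \<Longrightarrow> h \<in> U_set n \<Longrightarrow> \<rho> (g * h) = \<rho> g * \<rho> h"
  using irr by (auto simp: irreducible_rep_def hom_def GL_simps)

lemma rho_one: "\<rho> (1\<^sub>m (2*n+1)) = 1\<^sub>m d"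
proof -
  have e: "1\<^sub>m (2*n+1) \<in> U_set n" by (rule one_U)
  obtain y where y: "y \<in> carrier_mat d d" "y * \<rho> (1\<^sub>m (2*n+1)) = 1\<^sub>m d"
    using irr e by (auto simp: irreducible_rep_def hom_def Pi_iff GL_simps)
  let ?r = "\<rho> (1\<^sub>m (2*n+1))"
  note r = rho_carrier[OF e]
  have "?r * ?r = ?r" using rho_mult[OF e e] by simp
  hence "y * ?r * ?r = y * ?r" using assoc_mult_mat[OF y(1) r r] by simp
  thus ?thesis unfolding y(2) using r by simp
qed

sublocale linear_action n \<theta> scl "mact d \<rho>" "vecs {..<d}"
proof (intro linear_action.intro linear_action_axioms.intro vector_space_scl)
  interpret vector_space "scl :: complex \<Rightarrow> (nat \<Rightarrow> complex) \<Rightarrow> nat \<Rightarrow> complex" by (rule vector_space_scl)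
  show "odd_char \<theta>" by unfold_locales
  show "mact d \<rho> g (x + y) = mact d \<rho> g x + mact d \<rho> g y" for g x y
    by (auto simp: mact_def fun_eq_iff distrib_left sum.distrib)
  show "mact d \<rho> g (scl c x) = scl c (mact d \<rho> g x)" for g c x
    by (auto simp: mact_def fun_eq_iff sum_distrib_left mult.left_commute)
  show "mact d \<rho> (g * h) x = mact d \<rho> g (mact d \<rho> h x)"
    if g: "g \<in> U_set n" and h: "h \<in> U_set n" and x: "x \<in> vecs {..<d}" for g h x
  proof
    fix i
    have "(\<Sum>j<d. \<rho> (g * h) $$ (i, j) * x j) = (\<Sum>j<d. \<rho> g $$ (i, j) * mact d \<rho> h x j)" if i: "i < d"
    proof -
      have "(\<Sum>j<d. \<rho> (g * h) $$ (i, j) * x j) = (\<Sum>j<d. \<Sum>k<d. \<rho> g $$ (i, k) * \<rho> h $$ (k, j) * x j)"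
        using i rho_carrier[OF g] rho_carrier[OF h]
        by (intro sum.cong refl) (simp add: rho_mult[OF g h] scalar_prod_def atLeast0LessThan sum_distrib_right)
      also have "\<dots> = (\<Sum>k<d. \<Sum>j<d. \<rho> g $$ (i, k) * \<rho> h $$ (k, j) * x j)" by (rule sum.swap)
      also have "\<dots> = (\<Sum>k<d. \<rho> g $$ (i, k) * mact d \<rho> h x k)"
        by (intro sum.cong refl) (simp add: mact_def sum_distrib_left mult.assoc)
      finally show ?thesis .
    qed
    thus "mact d \<rho> (g * h) x i = mact d \<rho> g (mact d \<rho> h x) i"
      by (simp add: mact_def[of d \<rho> "g * h"] mact_def[of d \<rho> g])
  qed
  show "mact d \<rho> (1\<^sub>m (2*n+1)) x = x" if x: "x \<in> vecs {..<d}" for x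
  proof
    fix i
    have "(\<Sum>j<d. 1\<^sub>m d $$ (i, j) * x j) = (\<Sum>j<d. if j = i then x j else 0)" if "i < d"
      using that by (intro sum.cong refl) auto
    thus "mact d \<rho> (1\<^sub>m (2*n+1)) x i = x i"
      unfolding mact_def rho_one using vecs_D[OF x, of i] by simp
  qed
  show "subspace (vecs {..<d})"
    unfolding subspace_def by (auto simp: vecs_add vecs_zero vecs_scl)
  show "mact d \<rho> g x \<in> vecs {..<d}" for g x
    by (simp add: mact_def vecs_def)
qed

lemma irr_inv:
  assumes W: "inv_on (labels n) W" and x: "x \<in> W" "x \<noteq> 0"
  shows "W = vecs {..<d}"
proof -
  have iW: "mact d \<rho> g f \<in> W" if "g \<in> U_set n" "f \<in> W" for g f
    using W that by (simp add: inv_on_def stab_labels)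
  have sW: "subspace W" and WM: "W \<subseteq> vecs {..<d}" using W by (auto simp: inv_on_def)
  let ?W = "{v \<in> carrier_vec d. vfun d v \<in> W}"
  have vz: "vfun d (0\<^sub>v d) = 0" by (auto simp: vfun_def)
  have va: "vfun d (v + w) = vfun d v + vfun d w" if "v \<in> carrier_vec d" "w \<in> carrier_vec d" for v w
    using that by (auto simp: vfun_def fun_eq_iff)
  have vs: "vfun d (c \<cdot>\<^sub>v v) = scl c (vfun d v)" if "v \<in> carrier_vec d" for c v
    using that by (auto simp: vfun_def fun_eq_iff)
  have "VectorSpace.subspace class_ring ?W (module_vec TYPE(complex) d)"
    unfolding subspace_vec_iff using subspace_0[OF sW] subspace_add[OF sW] subspace_scale[OF sW]
    by (auto simp: va vs vz)
  moreover have "\<rho> g *\<^sub>v v \<in> ?W" if "g \<in> U_set n" "v \<in> ?W" for g v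
    using that iW[OF that(1), of "vfun d v"] rho_carrier[OF that(1)] by (auto simp: vfun_mult)
  ultimately have alt: "?W = {0\<^sub>v d} \<or> ?W = carrier_vec d"
    using irr unfolding irreducible_rep_def U_group_simps by blast
  have fv: "vfun d (vec d f) = f" if "f \<in> vecs {..<d}" for f
    using that by (auto simp: vfun_def vecs_def fun_eq_iff)
  have "vec d x \<in> ?W" using x WM fv[of x] by auto
  moreover have "vec d x \<noteq> 0\<^sub>v d" using fv[of x] x WM vz by auto
  ultimately have "?W = carrier_vec d" using alt by blast
  hence "f \<in> W" if "f \<in> vecs {..<d}" for f
    using fv[OF that] by (metis (mono_tags, lifting) mem_Collect_eq vec_carrier)
  thus ?thesis using WM by blast
qed

lemma large_degree:
  assumes "large W m" "W \<subseteq> vecs {..<d}" shows "m \<le> d"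
proof -
  obtain T where T: "finite T" "\<not> dependent T" "T \<subseteq> W" "m \<le> card T" using assms(1) by (auto simp: large_def)
  have "T \<subseteq> span (bas ` {..<d})" using T(3) assms(2) span_bas[of "{..<d}"] by blast
  hence "card T \<le> card (bas ` {..<d} :: (nat \<Rightarrow> complex) set)"
    using independent_span_bound[OF _ T(2)] by blast
  also have "\<dots> \<le> d" using card_image_le[of "{..<d}"] by simp
  finally show ?thesis using T(4) by simp
qed

lemma small_degree:
  assumes "small (labels n) W m" "W \<subseteq> vecs {..<d}" shows "d \<le> m"
proof -
  obtain S x where S: "finite S" "S \<subseteq> W" "card S \<le> m" "x \<in> S" "x \<noteq> 0"
    "\<And>g x. g \<in> stab n (labels n) \<Longrightarrow> x \<in> span S \<Longrightarrow> mact d \<rho> g x \<in> span S"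
    using assms(1) unfolding small_def by blast
  have "inv_on (labels n) (span S)"
    unfolding inv_on_def using S(6) span_M[of S] S(2) assms(2) by blast
  from irr_inv[OF this span_base[OF S(4)] S(5)] have s: "span S = vecs {..<d}" .
  have "bas ` {..<d} \<subseteq> span S" unfolding s by (auto intro: vecs_bas)
  from independent_span_bound[OF S(1) independent_bas[OF finite_lessThan] this]
  have "card (bas ` {..<d} :: (nat \<Rightarrow> complex) set) \<le> card S" by blast
  thus ?thesis using S(3) by (simp add: card_image[OF inj_on_subset[OF inj_bas subset_UNIV]])
qed

lemma d_pos: "0 < d"
  using irr by (simp add: irreducible_rep_def)

lemma degree_le: "d \<le> CARD('a) ^ tri n"
proof (rule small_degree[OF ex_small_M order_refl])
  show "bas 0 \<in> vecs {..<d}" using d_pos by (intro vecs_bas) simp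
  show "bas 0 \<noteq> (0 :: nat \<Rightarrow> complex)" by (auto simp: fun_eq_iff bas_apply)
qed

text \<open>The trace is the sum of the diagonal coefficients, so one of them has a nonzero pairing
  with \<open>f\<close>. This pairing is the p-th coordinate of the average of the p-th basis
  vector.\<close>

lemma average_nonzero:
  assumes nz: "(\<Sum>g\<in>U_set n. mat_trace (\<rho> g) * cnj (f g)) \<noteq> 0"
  obtains v where "v \<in> vecs {..<d}" "(\<Sum>g\<in>U_set n. scl (cnj (f g)) (mact d \<rho> g v)) \<noteq> 0"
proof -
  have "(\<Sum>g\<in>U_set n. mat_trace (\<rho> g) * cnj (f g)) = (\<Sum>g\<in>U_set n. \<Sum>p<d. \<rho> g $$ (p, p) * cnj (f g))"
    using rho_carrier by (intro sum.cong refl) (auto simp: mat_trace_def sum_distrib_right)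
  also have "\<dots> = (\<Sum>p<d. \<Sum>g\<in>U_set n. \<rho> g $$ (p, p) * cnj (f g))" by (rule sum.swap)
  finally obtain p where p: "p < d" "(\<Sum>g\<in>U_set n. \<rho> g $$ (p, p) * cnj (f g)) \<noteq> 0"
    using nz by (metis (no_types, lifting) lessThan_iff sum.neutral)
  let ?u = "\<Sum>g\<in>U_set n. scl (cnj (f g)) (mact d \<rho> g (bas p))"
  have m: "mact d \<rho> g (bas p) p = \<rho> g $$ (p, p)" for g
  proof -
    have "(\<Sum>j<d. \<rho> g $$ (p, j) * bas p j) = (\<Sum>j<d. if j = p then \<rho> g $$ (p, j) else 0)"
      by (intro sum.cong refl) (auto simp: bas_apply)
    thus ?thesis using p(1) by (simp add: mact_def)
  qed
  have "?u p = (\<Sum>g\<in>U_set n. \<rho> g $$ (p, p) * cnj (f g))"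
    unfolding sum_fun_apply by (intro sum.cong refl) (simp add: m mult.commute)
  hence "?u \<noteq> 0" using p(2) by (metis zero_fun_apply)
  thus ?thesis using p(1) by (intro that[of "bas p"] vecs_bas) auto
qed

lemma trace_conj:
  assumes "y \<in> U_set n" "g \<in> U_set n"
  shows "mat_trace (\<rho> (cj n y g)) = mat_trace (\<rho> g)"
proof -
  have tr: "mat_trace (A * B) = mat_trace (B * A)" if "A \<in> carrier_mat d d" "B \<in> carrier_mat d d" for A B :: "complex mat"
  proof -
    have "mat_trace (A * B) = (\<Sum>i<d. \<Sum>j<d. A $$ (i, j) * B $$ (j, i))"
      using that by (simp add: mat_trace_def scalar_prod_def atLeast0LessThan)
    also have "\<dots> = (\<Sum>j<d. \<Sum>i<d. A $$ (i, j) * B $$ (j, i))" by (rule sum.swap)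
    also have "\<dots> = mat_trace (B * A)"
      using that by (simp add: mat_trace_def scalar_prod_def atLeast0LessThan mult.commute)
    finally show ?thesis .
  qed
  note u = uinv_U[OF assms(1)]
  have "\<rho> (cj n y g) = \<rho> (uinv n y * g) * \<rho> y" by (rule rho_mult[OF mult_U[OF u assms(2)] assms(1)])
  hence "mat_trace (\<rho> (cj n y g)) = mat_trace (\<rho> y * \<rho> (uinv n y * g))"
    using tr[OF rho_carrier[OF mult_U[OF u assms(2)]] rho_carrier[OF assms(1)]] by simp
  also have "\<rho> y * \<rho> (uinv n y * g) = \<rho> g"
    using rho_mult[OF assms(1) mult_U[OF u assms(2)]] U_cancel(2)[OF assms] by simp
  finally show ?thesis .
qed

lemma degree_eq: "char_degree (U_group n) \<chi> = real d"
  if "\<forall>g\<in>U_set n. \<chi> g = mat_trace (\<rho> g)"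
proof -
  have e: "1\<^sub>m (2*n+1) \<in> U_set n" by (rule one_U)
  have "\<chi> (1\<^sub>m (2*n+1)) = of_nat d" using that[rule_format, OF e] unfolding rho_one by (simp add: mat_trace_def)
  thus ?thesis by (simp add: char_degree_def)
qed

end

section \<open>An irreducible character of large degree\<close>

context linear_action begin

text \<open>An invariant subspace with the smallest possible basis is minimal: a basis of a proper
  subspace stays independent after adding a vector from outside, hence is smaller. The finite
  spanning set of \<open>M\<close> makes all these bases finite.\<close>

lemma ex_minimal:
  assumes T: "finite T" "M \<subseteq> span T" and W: "inv_on (labels n) W" "x \<in> W" "x \<noteq> 0"
  obtains Y y where "inv_on (labels n) Y" "Y \<subseteq> W" "y \<in> Y" "y \<noteq> 0"
    "\<And>Z z. inv_on (labels n) Z \<Longrightarrow> Z \<subseteq> Y \<Longrightarrow> z \<in> Z \<Longrightarrow> z \<noteq> 0 \<Longrightarrow> Z = Y"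
proof -
  define P where "P k \<longleftrightarrow> (\<exists>Y B. inv_on (labels n) Y \<and> Y \<subseteq> W \<and> (\<exists>y\<in>Y. y \<noteq> 0) \<and>
    B \<subseteq> Y \<and> independent B \<and> Y \<subseteq> span B \<and> card B = k)" for k
  have P: "P (card B)" if "inv_on (labels n) Y" "Y \<subseteq> W" "y \<in> Y" "y \<noteq> 0" "B \<subseteq> Y" "independent B" "Y \<subseteq> span B" for Y y B
    using that unfolding P_def by blast
  obtain B0 where "B0 \<subseteq> W" "independent B0" "W \<subseteq> span B0" using maximal_independent_subset by blast
  hence "P (card B0)" using P[OF W(1) order_refl W(2,3)] by blast
  hence L: "P (LEAST k. P k)" by (rule LeastI)
  then obtain Y B y where Y: "inv_on (labels n) Y" "Y \<subseteq> W" "y \<in> Y" "y \<noteq> 0"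
    "B \<subseteq> Y" "independent B" "Y \<subseteq> span B" "card B = (LEAST k. P k)" unfolding P_def by blast
  have YM: "Y \<subseteq> span T" using Y(1) T(2) by (auto simp: inv_on_def)
  have fB: "finite B" using independent_span_bound[OF T(1) Y(6)] Y(5) YM by blast
  have "Z = Y" if Z: "inv_on (labels n) Z" "Z \<subseteq> Y" "z \<in> Z" "z \<noteq> 0" for Z z
  proof (rule ccontr)
    assume "Z \<noteq> Y"
    then obtain b where b: "b \<in> Y" "b \<notin> Z" using Z(2) by blast
    obtain C where C: "C \<subseteq> Z" "independent C" "Z \<subseteq> span C" using maximal_independent_subset by blast
    have fC: "finite C" using independent_span_bound[OF T(1) C(2)] C(1) Z(2) YM by blast
    have sC: "span C \<subseteq> Z" using Z(1) C(1) by (auto simp: inv_on_def intro: span_minimal[THEN subsetD])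
    hence bC: "b \<notin> C" "b \<notin> span C" using b(2) C(1) by auto
    hence "independent (insert b C)" using C(2) by (simp add: independent_insert)
    moreover have "insert b C \<subseteq> span B" using b(1) C(1) Z(2) Y(7) by blast
    ultimately have "card (insert b C) \<le> card B" using independent_span_bound[OF fB] by blast
    moreover have "card B \<le> card C"
      unfolding Y(8) by (rule Least_le) (rule P[OF Z(1) _ Z(3,4) C], use Z(2) Y(2) in blast)
    ultimately show False using bC(1) fC by simp
  qed
  thus ?thesis by (rule that[OF Y(1-4)])
qed

text \<open>Writing the action in a basis of \<open>Y\<close> gives matrices. An invariant subspace
  of the coordinate space corresponds to one of \<open>Y\<close>, so minimality becomes
  irreducibility.\<close>

lemma matrix_of_action:
  assumes T: "finite T" "M \<subseteq> span T" and Y: "inv_on (labels n) Y" "y \<in> Y" "y \<noteq> 0"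
    and min: "\<And>Z z. inv_on (labels n) Z \<Longrightarrow> Z \<subseteq> Y \<Longrightarrow> z \<in> Z \<Longrightarrow> z \<noteq> 0 \<Longrightarrow> Z = Y"
  obtains d \<rho> where "irreducible_rep (U_group n) d (\<rho> :: 'a mat \<Rightarrow> complex mat)" "\<And>m. large Y m \<Longrightarrow> m \<le> d"
proof -
  obtain B where B: "B \<subseteq> Y" "independent B" "Y \<subseteq> span B" using maximal_independent_subset by blast
  have YM: "Y \<subseteq> M" and sY: "subspace Y" and aY: "act g v \<in> Y" if "g \<in> U_set n" "v \<in> Y" for g v
    using Y(1) that by (simp_all add: inv_on_def stab_labels)
  have YM: "Y \<subseteq> M" and sY: "subspace Y" using Y(1) by (simp_all add: inv_on_def)
  have fB: "finite B" using independent_span_bound[OF T(1) B(2)] B(1) YM T(2) by blast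
  define d where "d = card B"
  obtain b where b: "bij_betw b {..<d} B"
    using ex_bij_betw_nat_finite[OF fB] by (auto simp: d_def atLeast0LessThan)
  hence bY: "b j \<in> Y" if "j < d" for j using that B(1) by (auto simp: bij_betw_def)
  define lc where "lc c = (\<Sum>i<d. c i *s b i)" for c :: "nat \<Rightarrow> complex"
  define co where "co v i = representation B v (b i)" for v i
  have lc_co: "lc (co v) = v" if "v \<in> Y" for v
  proof -
    have "lc (co v) = (\<Sum>w\<in>B. representation B v w *s w)"
      unfolding lc_def co_def by (rule sum.reindex_bij_betw[OF b])
    also have "\<dots> = v" by (rule sum_representation_eq[OF B(2) _ fB order_refl]) (use that B(3) in blast)
    finally show ?thesis .
  qed
  have lc_add: "lc (\<lambda>i. c i + c' i) = lc c + lc c'" for c c'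
    by (simp add: lc_def scale_left_distrib sum.distrib)
  have lc_scale: "lc (\<lambda>i. t * c i) = t *s lc c" for t c
    by (simp add: lc_def scale_sum_right)
  have lc_zero: "c i = 0" if "lc c = 0" "i < d" for c i
  proof -
    let ?b' = "the_inv_into {..<d} b"
    have "(\<Sum>w\<in>B. c (?b' w) *s w) = (\<Sum>i<d. c (?b' (b i)) *s b i)"
      by (rule sum.reindex_bij_betw[OF b, symmetric])
    also have "\<dots> = lc c"
      unfolding lc_def using b by (intro sum.cong refl) (simp add: bij_betw_def the_inv_into_f_f)
    finally have "(\<Sum>w\<in>B. c (?b' w) *s w) = 0" using that(1) by simp
    from scale_fact_eq_0[OF B(2) fB this, of "b i"] show ?thesis
      using that(2) b by (auto simp: bij_betw_def the_inv_into_f_f)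
  qed
  have lc_inj: "c i = c' i" if "lc c = lc c'" "i < d" for c c' i
  proof -
    have "lc (\<lambda>i. c i + (-1) * c' i) = 0" unfolding lc_add lc_scale using that(1) by simp
    from lc_zero[OF this that(2)] show ?thesis by simp
  qed
  define \<rho> where "\<rho> g = mat d d (\<lambda>(i, j). co (act g (b j)) i)" for g
  have rc: "\<rho> g \<in> carrier_mat d d" for g by (simp add: \<rho>_def)
  have col: "act g (b j) = lc (\<lambda>i. \<rho> g $$ (i, j))" if "g \<in> U_set n" "j < d" for g j
  proof -
    have "lc (\<lambda>i. \<rho> g $$ (i, j)) = lc (co (act g (b j)))"
      unfolding lc_def using that(2) by (intro sum.cong refl) (simp add: \<rho>_def)
    thus ?thesis using lc_co[OF aY[OF that(1) bY[OF that(2)]]] by simp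
  qed
  have act_lc: "act g (lc c) = lc (\<lambda>i. \<Sum>j<d. \<rho> g $$ (i, j) * c j)" if "g \<in> U_set n" for g c
  proof -
    have "act g (lc c) = (\<Sum>j<d. c j *s lc (\<lambda>i. \<rho> g $$ (i, j)))"
      unfolding lc_def act_sum act_scale by (intro sum.cong refl) (simp add: col[OF that] lc_def)
    also have "\<dots> = (\<Sum>j<d. \<Sum>i<d. (\<rho> g $$ (i, j) * c j) *s b i)"
      by (simp add: lc_def scale_sum_right mult.commute)
    also have "\<dots> = (\<Sum>i<d. \<Sum>j<d. (\<rho> g $$ (i, j) * c j) *s b i)" by (rule sum.swap)
    finally show ?thesis by (simp add: lc_def scale_sum_left)
  qed
  have rm: "\<rho> (g * h) = \<rho> g * \<rho> h" if gh: "g \<in> U_set n" "h \<in> U_set n" for g h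
  proof (rule eq_matI)
    fix i j assume "i < dim_row (\<rho> g * \<rho> h)" "j < dim_col (\<rho> g * \<rho> h)"
    hence ij: "i < d" "j < d" using rc[of g] rc[of h] by auto
    have "lc (\<lambda>i. \<rho> (g * h) $$ (i, j)) = act g (act h (b j))"
      using col[OF mult_U[OF gh] ij(2)] act_mult[OF gh] bY[OF ij(2)] YM by auto
    also have "\<dots> = lc (\<lambda>i. \<Sum>k<d. \<rho> g $$ (i, k) * \<rho> h $$ (k, j))"
      unfolding col[OF gh(2) ij(2)] by (rule act_lc[OF gh(1)])
    finally have "\<rho> (g * h) $$ (i, j) = (\<Sum>k<d. \<rho> g $$ (i, k) * \<rho> h $$ (k, j))"
      by (rule lc_inj[OF _ ij(1)])
    thus "\<rho> (g * h) $$ (i, j) = (\<rho> g * \<rho> h) $$ (i, j)"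
      using ij rc[of g] rc[of h] by (simp add: scalar_prod_def atLeast0LessThan)
  qed (simp_all add: \<rho>_def)
  have e: "(1\<^sub>m (2*n+1) :: 'a mat) \<in> U_set n" by (rule one_U)
  have r1: "\<rho> (1\<^sub>m (2*n+1)) = 1\<^sub>m d"
  proof (rule eq_matI)
    fix i j assume "i < dim_row (1\<^sub>m d :: complex mat)" "j < dim_col (1\<^sub>m d :: complex mat)"
    hence ij: "i < d" "j < d" by auto
    have "lc (\<lambda>i. if i = j then 1 else 0) = (\<Sum>i<d. if i = j then b i else 0)"
      unfolding lc_def by (intro sum.cong refl) auto
    also have "\<dots> = b j" using ij by simp
    also have "b j = act (1\<^sub>m (2*n+1)) (b j)" using act_one[of "b j"] bY[OF ij(2)] YM by auto
    finally have "lc (\<lambda>i. \<rho> (1\<^sub>m (2*n+1)) $$ (i, j)) = lc (\<lambda>i. if i = j then 1 else 0)"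
      using col[OF e ij(2)] by simp
    from lc_inj[OF this ij(1)] show "\<rho> (1\<^sub>m (2*n+1)) $$ (i, j) = 1\<^sub>m d $$ (i, j)" using ij by simp
  qed (simp_all add: \<rho>_def)
  have hom: "\<rho> \<in> hom (U_group n) (GL d)"
  proof (rule homI)
    fix g h :: "'a mat" assume gh: "g \<in> carrier (U_group n)" "h \<in> carrier (U_group n)"
    hence g: "g \<in> U_set n" by simp
    have "\<rho> (uinv n g) * \<rho> g = 1\<^sub>m d" "\<rho> g * \<rho> (uinv n g) = 1\<^sub>m d"
      unfolding rm[OF uinv_U[OF g] g, symmetric] rm[OF g uinv_U[OF g], symmetric] uinv_mult[OF g] by (rule r1)+
    thus "\<rho> g \<in> carrier (GL d)" unfolding GL_simps using rc by blast
    show "\<rho> (g \<otimes>\<^bsub>U_group n\<^esub> h) = \<rho> g \<otimes>\<^bsub>GL d\<^esub> \<rho> h" using gh rm by (simp add: GL_simps)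
  qed
  have d1: "1 \<le> d"
  proof (rule ccontr)
    assume "\<not> 1 \<le> d"
    hence "d = 0" by simp
    hence "lc (co y) = 0" by (simp add: lc_def)
    thus False using lc_co[OF Y(2)] Y(3) by simp
  qed
  have "W = {0\<^sub>v d} \<or> W = carrier_vec d"
    if W: "VectorSpace.subspace class_ring W (module_vec TYPE(complex) d)"
      and iW: "\<And>g v. g \<in> U_set n \<Longrightarrow> v \<in> W \<Longrightarrow> \<rho> g *\<^sub>v v \<in> W" for W
  proof -
    note W' = W[unfolded subspace_vec_iff]
    let ?f = "\<lambda>v. lc (\<lambda>i. v $ i)"
    have f_cong: "lc c = lc c'" if "\<And>i. i < d \<Longrightarrow> c i = c' i" for c c'
      unfolding lc_def using that by (intro sum.cong refl) simp
    have fY: "?f v \<in> Y" for v unfolding lc_def by (intro subspace_sum[OF sY] subspace_scale[OF sY] bY) simp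
    have f_add: "?f (v + w) = ?f v + ?f w" if "v \<in> W" "w \<in> W" for v w
      unfolding lc_add[symmetric] by (rule f_cong) (use that W' in auto)
    have f_scale: "?f (c \<cdot>\<^sub>v v) = c *s ?f v" if "v \<in> W" for c v
      unfolding lc_scale[symmetric] by (rule f_cong) (use that W' in auto)
    have f_zero: "?f (0\<^sub>v d) = 0" unfolding lc_def by (intro sum.neutral) simp
    have f_act: "act g (?f v) = ?f (\<rho> g *\<^sub>v v)" if "g \<in> U_set n" "v \<in> W" for g v
      unfolding act_lc[OF that(1)] using rc[of g] that(2) W'
      by (intro f_cong) (auto simp: scalar_prod_def atLeast0LessThan)
    have f_inj: "v = w" if "?f v = ?f w" "v \<in> carrier_vec d" "w \<in> carrier_vec d" for v w
      using lc_inj[OF that(1)] that(2,3) by (intro eq_vecI) auto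
    have "subspace (?f ` W)"
      unfolding subspace_def
    proof (intro conjI ballI allI)
      show "0 \<in> ?f ` W" unfolding f_zero[symmetric] using W' by blast
      fix p q assume "p \<in> ?f ` W" "q \<in> ?f ` W"
      then obtain v w where vw: "v \<in> W" "w \<in> W" "p = ?f v" "q = ?f w" by blast
      show "p + q \<in> ?f ` W" unfolding vw(3,4) f_add[OF vw(1,2), symmetric] using W' vw by blast
    next
      fix c p assume "p \<in> ?f ` W"
      then obtain v where v: "v \<in> W" "p = ?f v" by blast
      show "c *s p \<in> ?f ` W" unfolding v(2) f_scale[OF v(1), symmetric] using W' v by blast
    qed
    moreover have "?f ` W \<subseteq> M" using fY YM by blast
    moreover have "act g x \<in> ?f ` W" if "g \<in> U_set n" "x \<in> ?f ` W" for g x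
      using that f_act iW by blast
    ultimately have inv: "inv_on (labels n) (?f ` W)"
      unfolding inv_on_def stab_labels by blast
    show ?thesis
    proof (cases "W = {0\<^sub>v d}")
      case False
      then obtain v where v: "v \<in> W" "v \<noteq> 0\<^sub>v d" using W' by blast
      have "?f v \<noteq> 0"
      proof
        assume "?f v = 0"
        hence "v = 0\<^sub>v d" using f_zero v(1) W' by (intro f_inj) auto
        thus False using v(2) by blast
      qed
      from min[OF inv _ imageI[OF v(1)] this] have eq: "?f ` W = Y" using fY by blast
      have "w \<in> W" if w: "w \<in> carrier_vec d" for w
      proof -
        obtain v where "v \<in> W" "?f w = ?f v" using fY[of w] unfolding eq[symmetric] by blast
        thus ?thesis using f_inj[of w v] w W' by blast
      qed
      thus ?thesis using W' by blast
    qed simp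
  qed
  hence irr: "irreducible_rep (U_group n) d \<rho>"
    unfolding irreducible_rep_def U_group_simps using hom d1 by blast
  have lg: "m \<le> d" if l: "large Y m" for m
  proof -
    obtain S where S: "independent S" "S \<subseteq> Y" "m \<le> card S" using l unfolding large_def by blast
    thus ?thesis using independent_span_bound[OF fB S(1)] B(3) unfolding d_def by (meson order_trans)
  qed
  show ?thesis by (rule that[OF irr]) (rule lg)
qed

end

definition ract :: "nat \<Rightarrow> 'a::field mat \<Rightarrow> ('a mat \<Rightarrow> complex) \<Rightarrow> 'a mat \<Rightarrow> complex" where
  "ract n g f = (\<lambda>x. if x \<in> U_set n then f (uinv n g * x) else 0)"

context odd_char begin

lemma regular_action: "linear_action n \<theta> scl (ract n) (vecs (U_set n :: 'a mat set))"
proof (intro linear_action.intro linear_action_axioms.intro vector_space_scl)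
  interpret vector_space "scl :: complex \<Rightarrow> ('a mat \<Rightarrow> complex) \<Rightarrow> 'a mat \<Rightarrow> complex" by (rule vector_space_scl)
  show "odd_char \<theta>" by unfold_locales
  show "ract n g (x + y) = ract n g x + ract n g y" for g :: "'a mat" and x y
    by (auto simp: ract_def fun_eq_iff)
  show "ract n g (scl c x) = scl c (ract n g x)" for g :: "'a mat" and c x
    by (auto simp: ract_def fun_eq_iff)
  show "ract n (g * h) f = ract n g (ract n h f)"
    if g: "g \<in> U_set n" and h: "h \<in> U_set n" and f: "f \<in> vecs (U_set n)" for g h :: "'a mat" and f
  proof
    fix x
    have "uinv n (g * h) * x = uinv n h * (uinv n g * x)" if x: "x \<in> U_set n"
      using group.inv_mult_group[OF group_U, of g n h] g h
        U_assoc[OF uinv_U[OF h] uinv_U[OF g] x] by simp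
    thus "ract n (g * h) f x = ract n g (ract n h f) x"
      using mult_U[OF uinv_U[OF g], of x] by (simp add: ract_def)
  qed
  show "ract n (1\<^sub>m (2*n+1)) f = f" if f: "f \<in> vecs (U_set n)" for f :: "'a mat \<Rightarrow> complex"
  proof
    fix x
    have "uinv n (1\<^sub>m (2*n+1)) = (1\<^sub>m (2*n+1) :: 'a mat)"
      using monoid.inv_one[OF group.is_monoid[OF group_U, of n]] by simp
    thus "ract n (1\<^sub>m (2*n+1)) f x = f x"
      using vecs_D[OF f, of x] U_one_left[of x n] by (simp add: ract_def)
  qed
  show "subspace (vecs (U_set n))"
    unfolding subspace_def by (auto simp: vecs_add vecs_zero vecs_scl)
  show "ract n g f \<in> vecs (U_set n)" for g :: "'a mat" and f
    by (simp add: ract_def vecs_def)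
qed

text \<open>\<open>degree_le\<close> alone does not give the maximum: some irreducible character
  must reach q^tri(n). It is found in the space of functions f on the group with f(x h) P(h) = f(x),
  a model of the representation induced from the product P of the chain characters. Any minimal
  invariant subspace of it will do, since it contains a nonzero eigenvector for the chain.\<close>

lemma ex_large_degree:
  obtains d \<rho> where "irreducible_rep (U_group n) d (\<rho> :: 'a mat \<Rightarrow> complex mat)" "CARD('a) ^ tri n \<le> d"
proof -
  interpret R: linear_action n \<theta> scl "ract n" "vecs (U_set n) :: ('a mat \<Rightarrow> complex) set" by (rule regular_action)
  define m where "m = n div 2"
  define P where "P = Psi m {} (\<lambda>_. 1)"
  have P: "P g = (\<Prod>j<m. lam n \<theta> (cr j) 1 g)" for g by (simp add: P_def Psi_def)
  have cr: "cr j \<in> roots n" if "j < m" for j using that by (intro cr_roots) (simp add: m_def)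
  have P_mult: "P (g * h) = P g * P h" if g: "g \<in> U_set n" "h \<in> U_set n" "P h \<noteq> 0" for g h
  proof -
    have "lam n \<theta> (cr j) 1 (g * h) = lam n \<theta> (cr j) 1 g * lam n \<theta> (cr j) 1 h" if j: "j < m" for j
    proof -
      have "lam n \<theta> (cr j) 1 h \<noteq> 0" using \<open>P h \<noteq> 0\<close> j by (auto simp: P)
      hence h': "h \<in> U_root n (cr j)" by (auto simp: lam_def split: if_splits)
      hence "lam n \<theta> (cr j) 1 h = lin_char n \<theta> (cr j) 1 h" by (simp add: lam_def)
      thus ?thesis using lam_mult_right[OF cr[OF j] h' g(1), of 1] by simp
    qed
    thus ?thesis by (simp add: P prod.distrib)
  qed
  have P_norm: "cnj (P g) * P g = 1" if "P g \<noteq> 0" for g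
  proof -
    have "cnj (P g) * P g = (\<Prod>j<m. lam n \<theta> (cr j) 1 g * cnj (lam n \<theta> (cr j) 1 g))"
      by (simp add: P prod.distrib mult.commute)
    also have "\<dots> = 1" by (intro prod.neutral ballI lam_norm) (use that in \<open>auto simp: P\<close>)
    finally show ?thesis .
  qed
  have P_one: "P (1\<^sub>m (2*n+1)) = 1"
    unfolding P by (intro prod.neutral ballI lam_one cr) simp
  have e: "(1\<^sub>m (2*n+1) :: 'a mat) \<in> U_set n" by (rule one_U)
  let ?W = "{f \<in> vecs (U_set n). \<forall>x\<in>U_set n. \<forall>h\<in>U_set n. P h \<noteq> 0 \<longrightarrow> f (x * h) * P h = f x}"
  have W: "R.inv_on (labels n) ?W"
    unfolding R.inv_on_def stab_labels
  proof (intro conjI ballI)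
    show "R.subspace ?W"
      unfolding R.subspace_def by (auto simp: vecs_add vecs_zero vecs_scl distrib_right mult.assoc)
    fix g :: "'a mat" and f assume g: "g \<in> U_set n" and f: "f \<in> ?W"
    have "ract n g f (x * h) * P h = ract n g f x" if xh: "x \<in> U_set n" "h \<in> U_set n" "P h \<noteq> 0" for x h
    proof -
      note gx = mult_U[OF uinv_U[OF g] xh(1)]
      have "f (uinv n g * x * h) * P h = f (uinv n g * x)" using f gx xh by blast
      thus ?thesis using xh mult_U[OF xh(1,2)] U_assoc[OF uinv_U[OF g] xh(1,2)] by (simp add: ract_def)
    qed
    thus "ract n g f \<in> ?W" using R.act_M[OF g] f by simp
  qed auto
  let ?f = "\<lambda>x. if x \<in> U_set n then cnj (P x) else 0"
  have fW: "?f \<in> ?W"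
    using P_norm by (auto simp: vecs_def mult_U P_mult)
  have fnz: "?f \<noteq> 0"
  proof
    assume "?f = 0"
    from fun_cong[OF this, of "1\<^sub>m (2*n+1)"] show False using e P_one by simp
  qed
  have T: "finite (bas ` U_set n :: ('a mat \<Rightarrow> complex) set)" "vecs (U_set n) \<subseteq> R.span (bas ` U_set n)"
    using finite_U span_bas[OF finite_U] by auto
  obtain Y f where Y: "R.inv_on (labels n) Y" "Y \<subseteq> ?W" "f \<in> Y" "f \<noteq> 0"
    and min: "\<And>Z z. R.inv_on (labels n) Z \<Longrightarrow> Z \<subseteq> Y \<Longrightarrow> z \<in> Z \<Longrightarrow> z \<noteq> 0 \<Longrightarrow> Z = Y"
    using R.ex_minimal[OF T W fW fnz] by blast
  obtain x0 where x0: "f x0 \<noteq> 0" using Y(4) by (auto simp: fun_eq_iff)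
  have x0U: "x0 \<in> U_set n" using Y(2,3) x0 vecs_D[of f "U_set n" x0] by blast
  \<comment> \<open>Left translation moves a point where f is nonzero to the identity.\<close>
  define f1 where "f1 = ract n (uinv n x0) f"
  have f1Y: "f1 \<in> Y" using Y(1,3) uinv_U[OF x0U] by (simp add: f1_def R.inv_on_def stab_labels)
  have f1W: "f1 \<in> ?W" using f1Y Y(2) by blast
  have ii: "uinv n (uinv n x0) = x0" using group.inv_inv[OF group_U, of x0 n] x0U by simp
  have f1_one: "f1 (1\<^sub>m (2*n+1)) \<noteq> 0"
    using x0 e U_one_right[OF x0U] unfolding f1_def ract_def ii by simp
  \<comment> \<open>At the identity every term with P h \<noteq> 0 takes the same value f1(1),
    because the transformation law gives f1(1) P(h) as the value of f1 at the inverse of h. So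
    nothing cancels.\<close>
  let ?u = "\<Sum>h\<in>U_set n. scl (cnj (P h)) (ract n h f1)"
  have "?u (1\<^sub>m (2*n+1)) = (\<Sum>h\<in>U_set n. if P h \<noteq> 0 then f1 (1\<^sub>m (2*n+1)) else 0)"
    unfolding sum_fun_apply
  proof (intro sum.cong refl)
    fix h :: "'a mat" assume h: "h \<in> U_set n"
    have "ract n h f1 (1\<^sub>m (2*n+1)) = f1 (uinv n h)"
      using e U_one_right[OF uinv_U[OF h]] by (simp add: ract_def)
    moreover have "f1 (uinv n h) = f1 (1\<^sub>m (2*n+1)) * P h" if "P h \<noteq> 0"
      using f1W uinv_U[OF h] h that uinv_mult(1)[OF h] by force
    ultimately show "scl (cnj (P h)) (ract n h f1) (1\<^sub>m (2*n+1)) = (if P h \<noteq> 0 then f1 (1\<^sub>m (2*n+1)) else 0)"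
      using P_norm[of h] by (simp add: mult.left_commute[of _ "f1 _"])
  qed
  also have "\<dots> = of_nat (card {h \<in> U_set n. P h \<noteq> 0}) * f1 (1\<^sub>m (2*n+1))"
    by (simp add: sum.inter_filter[symmetric] finite_U)
  also have "\<dots> \<noteq> 0"
  proof -
    have "1\<^sub>m (2*n+1) \<in> {h \<in> U_set n. P h \<noteq> 0}" using e P_one by simp
    hence "card {h \<in> U_set n. P h \<noteq> 0} \<noteq> 0" by (subst card_0_eq) (auto simp: finite_U)
    thus ?thesis using f1_one by simp
  qed
  finally have unz: "?u \<noteq> 0" by (metis zero_fun_apply)
  have uY: "?u \<in> Y"
    using Y(1) f1Y unfolding R.inv_on_def stab_labels
    by (intro R.subspace_sum R.subspace_scale) auto
  have "R.large Y (CARD('a) ^ tri n)"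
    by (rule R.chain_end_large[where m=m and \<phi>="\<lambda>_. 1" and D'="{}", OF _ _ _ _ _ _ Y(1)[folded lev_0] uY[unfolded P_def] unz[unfolded P_def]])
       (use f1W in \<open>auto simp: m_def\<close>)
  moreover have "\<exists>d \<rho>. irreducible_rep (U_group n) d (\<rho> :: 'a mat \<Rightarrow> complex mat) \<and> (\<forall>m. R.large Y m \<longrightarrow> m \<le> d)"
    by (rule R.matrix_of_action[OF T Y(1,3,4)], rule min) blast+
  ultimately show ?thesis using that by blast
qed

end

section \<open>Basic sets\<close>

text \<open>\<open>m\<close> is the length of the part of the chain after which a block of rank 0, 1
  or 2 remains. For even n the first and the third alternative are the two choices at the end of the
  chain.\<close>

definition top_form :: "nat \<Rightarrow> root set \<Rightarrow> bool" where
  "top_form n D \<longleftrightarrow> (\<exists>m. n = 2 * m \<and> D = cr ` {..<m} \<or>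
     n = 2 * m + 1 \<and> (\<exists>D1\<subseteq>{EpsSingle n}. D = cr ` {..<m} \<union> D1) \<or>
     n = 2 * m + 2 \<and> D = cr ` {..<m} \<union> {EpsSingle (2 * m + 1)})"

lemma cr_image: "{EpsSum (2 * k - 1) (2 * k) | k. 1 \<le> k \<and> 2 * k \<le> 2 * m} = cr ` {..<m}"
proof (intro equalityI subsetI)
  fix \<alpha> assume "\<alpha> \<in> {EpsSum (2 * k - 1) (2 * k) | k. 1 \<le> k \<and> 2 * k \<le> 2 * m}"
  then obtain k where k: "1 \<le> k" "2 * k \<le> 2 * m" "\<alpha> = EpsSum (2 * k - 1) (2 * k)" by blast
  define j where "j = k - 1"
  have "k = Suc j" using k(1) by (simp add: j_def)
  hence "\<alpha> = cr j" "j < m" using k by (auto simp: cr_def)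
  thus "\<alpha> \<in> cr ` {..<m}" by blast
next
  fix \<alpha> assume "\<alpha> \<in> cr ` {..<m}"
  then obtain j where j: "j < m" "\<alpha> = cr j" by blast
  hence "\<alpha> = EpsSum (2 * Suc j - 1) (2 * Suc j)" by (simp add: cr_def)
  thus "\<alpha> \<in> {EpsSum (2 * k - 1) (2 * k) | k. 1 \<le> k \<and> 2 * k \<le> 2 * m}" using j by fastforce
qed

lemma cr_neq [simp]: "cr j \<noteq> EpsSingle p" "EpsSingle p \<noteq> cr j"
  by (auto simp: cr_def)

lemma top_form_even:
  assumes "even n" "1 \<le> n"
  shows "top_form n D \<longleftrightarrow> (\<exists>D1. (D1 = {EpsSum (n - 1) n} \<or> D1 = {EpsSingle (n - 1)}) \<and>
    D = {EpsSum (2 * k - 1) (2 * k) | k. 1 \<le> k \<and> 2 * k \<le> n - 2} \<union> D1)"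
proof -
  obtain k where "n = 2 * k" using assms(1) by blast
  then obtain m where n: "n = 2 * m + 2" using assms(2) by (cases k) auto
  have s: "cr ` {..<Suc m} = cr ` {..<m} \<union> {cr m}" by (auto simp: lessThan_Suc)
  have "top_form n D \<longleftrightarrow> D = cr ` {..<Suc m} \<or> D = cr ` {..<m} \<union> {EpsSingle (2 * m + 1)}"
  proof
    assume "top_form n D"
    then obtain k where "n = 2 * k \<and> D = cr ` {..<k} \<or>
       n = 2 * k + 1 \<and> (\<exists>D1\<subseteq>{EpsSingle n}. D = cr ` {..<k} \<union> D1) \<or>
       n = 2 * k + 2 \<and> D = cr ` {..<k} \<union> {EpsSingle (2 * k + 1)}"
      unfolding top_form_def by blast
    thus "D = cr ` {..<Suc m} \<or> D = cr ` {..<m} \<union> {EpsSingle (2 * m + 1)}"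
    proof (elim disjE)
      assume "n = 2 * k \<and> D = cr ` {..<k}"
      moreover from this have "k = Suc m" using n by simp
      ultimately show ?thesis by blast
    next
      assume "n = 2 * k + 1 \<and> (\<exists>D1\<subseteq>{EpsSingle n}. D = cr ` {..<k} \<union> D1)"
      hence "2 * m + 2 = 2 * k + 1" using n by simp
      thus ?thesis by presburger
    next
      assume "n = 2 * k + 2 \<and> D = cr ` {..<k} \<union> {EpsSingle (2 * k + 1)}"
      moreover from this have "k = m" using n by simp
      ultimately show ?thesis by blast
    qed
  next
    assume "D = cr ` {..<Suc m} \<or> D = cr ` {..<m} \<union> {EpsSingle (2 * m + 1)}"
    moreover have "n = 2 * Suc m" using n by simp
    ultimately show "top_form n D" unfolding top_form_def using n by blast
  qed
  moreover have "EpsSum (n - 1) n = cr m" "n - 1 = 2 * m + 1" "n - 2 = 2 * m" using n by (simp_all add: cr_def)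
  ultimately show ?thesis by (simp only: s cr_image) blast
qed

lemma top_form_odd:
  assumes "odd n"
  shows "top_form n D \<longleftrightarrow> (\<exists>D1. D1 \<subseteq> {EpsSingle n} \<and>
    D = {EpsSum (2 * k - 1) (2 * k) | k. 1 \<le> k \<and> 2 * k \<le> n - 1} \<union> D1)"
proof -
  obtain m where n: "n = 2 * m + 1" using assms by (rule oddE)
  have "n \<noteq> 2 * k" "n \<noteq> 2 * k + 2" "n = 2 * k + 1 \<longleftrightarrow> k = m" for k using n by presburger+
  hence "top_form n D \<longleftrightarrow> (\<exists>D1. D1 \<subseteq> {EpsSingle n} \<and> D = cr ` {..<m} \<union> D1)"
    unfolding top_form_def by simp
  moreover have "n - 1 = 2 * m" using n by simp
  ultimately show ?thesis by (simp only: cr_image)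
qed

lemma finite_roots: "finite (roots n)"
proof (rule finite_subset)
  show "roots n \<subseteq> (\<lambda>(i, j). EpsDiff i j) ` ({..n} \<times> {..n}) \<union> (\<lambda>(i, j). EpsSum i j) ` ({..n} \<times> {..n}) \<union>
    EpsSingle ` {..n}"
    unfolding roots_def by force
qed simp

lemma basic_row: "basic n D \<Longrightarrow> \<alpha> \<in> D \<Longrightarrow> \<beta> \<in> D \<Longrightarrow> (i, j) \<in> root_entries \<alpha> \<Longrightarrow> (i, k) \<in> root_entries \<beta> \<Longrightarrow> j = k"
  unfolding basic_def entries_def by blast

lemma basic_col: "basic n D \<Longrightarrow> \<alpha> \<in> D \<Longrightarrow> \<beta> \<in> D \<Longrightarrow> (i, k) \<in> root_entries \<alpha> \<Longrightarrow> (j, k) \<in> root_entries \<beta> \<Longrightarrow> i = j"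
  unfolding basic_def entries_def by blast

text \<open>The roots of the chain occupy the rows 1, ..., 2m of \<open>entries D\<close>, so any
  other root of the basic set has all its indices beyond 2m.\<close>

lemma basic_outside:
  assumes D: "basic n D" and m: "cr ` {..<m} \<subseteq> D" and \<alpha>: "\<alpha> \<in> D" "\<alpha> \<notin> cr ` {..<m}"
  shows "idx \<alpha> \<subseteq> lev n m"
proof -
  have \<alpha>r: "\<alpha> \<in> roots n" using D \<alpha>(1) by (auto simp: basic_def)
  have row: "\<exists>j<m. int p = 2 * int j + 1 \<and> k = - (2 * int j + 2) \<or> int p = 2 * int j + 2 \<and> k = - (2 * int j + 1)"
    if p: "1 \<le> p" "p \<le> 2 * m" "(int p, k) \<in> root_entries \<alpha>" for p k
  proof -
    define j where "j = (p - 1) div 2"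
    have j: "p = 2 * j + 1 \<or> p = 2 * j + 2" "j < m" using p by (auto simp: j_def)
    hence c: "cr j \<in> D" using m by blast
    from j(1) show ?thesis
    proof
      assume e: "p = 2 * j + 1"
      have "(int p, - (2 * int j + 2)) \<in> root_entries (cr j)" by (simp add: cr_def e)
      from basic_row[OF D \<alpha>(1) c p(3) this] show ?thesis using e j(2) by force
    next
      assume e: "p = 2 * j + 2"
      have "(int p, - (2 * int j + 1)) \<in> root_entries (cr j)" by (simp add: cr_def e)
      from basic_row[OF D \<alpha>(1) c p(3) this] show ?thesis using e j(2) by force
    qed
  qed
  show ?thesis
  proof (cases \<alpha>)
    case (EpsDiff p q)
    hence pq: "1 \<le> p" "p < q" "q \<le> n" using \<alpha>r by (auto simp: roots_def)
    have "\<not> p \<le> 2 * m"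
    proof
      assume "p \<le> 2 * m"
      from row[OF pq(1) this, of "int q"] show False using EpsDiff by auto
    qed
    thus ?thesis using pq by (auto simp: EpsDiff lev_def labels_def)
  next
    case (EpsSum p q)
    hence pq: "1 \<le> p" "p < q" "q \<le> n" using \<alpha>r by (auto simp: roots_def)
    have "\<not> p \<le> 2 * m"
    proof
      assume "p \<le> 2 * m"
      from row[OF pq(1) this, of "- int q"] obtain j where
        "j < m" "int p = 2 * int j + 1 \<and> int q = 2 * int j + 2 \<or> int p = 2 * int j + 2 \<and> int q = 2 * int j + 1"
        using EpsSum by auto
      hence "j < m" "p = 2 * j + 1" "q = 2 * j + 2" using pq by linarith+
      thus False using \<alpha>(2) EpsSum by (auto simp: cr_def)
    qed
    thus ?thesis using pq by (auto simp: EpsSum lev_def labels_def)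
  next
    case (EpsSingle p)
    hence p: "1 \<le> p" "p \<le> n" using \<alpha>r by (auto simp: roots_def)
    have "\<not> p \<le> 2 * m"
    proof
      assume "p \<le> 2 * m"
      from row[OF p(1) this, of 0] show False using EpsSingle by auto
    qed
    thus ?thesis using p by (auto simp: EpsSingle lev_def labels_def)
  qed
qed

text \<open>The initial part of the chain contained in \<open>D\<close> is taken of maximal length
  \<open>m\<close>, so cr m is missing whenever it would fit. If rank 2 remains, \<epsilon>_{2m+1}
  excludes the other two roots of that block: it shares a row with \<epsilon>_{2m+1} -
  \<epsilon>_{2m+2} and the column 0 with \<epsilon>_{2m+2}.\<close>

lemma basic_cases:
  assumes D: "basic n D"
  obtains m D' where "2 * m \<le> n" "D = cr ` {..<m} \<union> D'" "cr ` {..<m} \<inter> D' = {}" "finite D'"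
    "\<And>\<alpha>. \<alpha> \<in> D' \<Longrightarrow> \<alpha> \<in> roots n \<and> idx \<alpha> \<subseteq> lev n m"
    "n \<le> 2 * m + 1 \<and> top_form n D \<or> n = 2 * m + 2 \<and> D' = {EpsSingle (2 * m + 1)} \<and> top_form n D \<or>
     2 * m + 2 \<le> n \<and> cr m \<notin> D' \<and> (n = 2 * m + 2 \<longrightarrow> EpsSingle (2 * m + 1) \<notin> D') \<and> \<not> top_form n D"
proof -
  let ?P = "\<lambda>m. 2 * m \<le> n \<and> cr ` {..<m} \<subseteq> D"
  define m where "m = (GREATEST m. ?P m)"
  have "?P 0" by simp
  hence m: "?P m" unfolding m_def by (rule GreatestI_nat[where P="?P" and b=n]) simp
  have max: "k \<le> m" if "?P k" for k unfolding m_def by (rule Greatest_le_nat[where P="?P" and b=n, OF that]) simp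
  define D' where "D' = D - cr ` {..<m}"
  have DD: "D = cr ` {..<m} \<union> D'" "cr ` {..<m} \<inter> D' = {}" using m by (auto simp: D'_def)
  have D'r: "\<alpha> \<in> roots n \<and> idx \<alpha> \<subseteq> lev n m" if "\<alpha> \<in> D'" for \<alpha>
    using that basic_outside[OF D conjunct2[OF m]] D by (auto simp: D'_def basic_def)
  have fin: "finite D'" by (rule finite_subset[OF _ finite_roots[of n]]) (use D'r in blast)
  have crm: "cr m \<notin> D" if "2 * m + 2 \<le> n"
  proof
    assume "cr m \<in> D"
    hence "?P (Suc m)" using m that by (auto simp: lessThan_Suc)
    from max[OF this] show False by simp
  qed
  have "n = 2 * m \<or> n = 2 * m + 1 \<or> 2 * m + 2 \<le> n" using m by arith
  hence c: "n \<le> 2 * m + 1 \<and> top_form n D \<or> n = 2 * m + 2 \<and> D' = {EpsSingle (2 * m + 1)} \<and> top_form n D \<or>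
     2 * m + 2 \<le> n \<and> cr m \<notin> D' \<and> (n = 2 * m + 2 \<longrightarrow> EpsSingle (2 * m + 1) \<notin> D') \<and> \<not> top_form n D"
  proof (elim disjE)
    assume n: "n = 2 * m"
    have "\<alpha> \<notin> D'" for \<alpha>
    proof
      assume "\<alpha> \<in> D'"
      from D'r[OF this] show False using n by (cases \<alpha>) (auto simp: roots_def lev_def labels_def)
    qed
    hence "D' = {}" by blast
    hence "D = cr ` {..<m}" using DD(1) by simp
    hence "top_form n D" unfolding top_form_def using n by blast
    thus ?thesis using n by simp
  next
    assume n: "n = 2 * m + 1"
    have "\<alpha> = EpsSingle n" if "\<alpha> \<in> D'" for \<alpha>
      using D'r[OF that] n by (cases \<alpha>) (auto simp: roots_def lev_def labels_def)
    hence "D' \<subseteq> {EpsSingle n}" by blast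
    hence "top_form n D" unfolding top_form_def using n DD(1) by blast
    thus ?thesis using n by simp
  next
    assume n: "2 * m + 2 \<le> n"
    show ?thesis
    proof (cases "n = 2 * m + 2 \<and> EpsSingle (2 * m + 1) \<in> D'")
      case True
      let ?\<beta> = "EpsSingle (2 * m + 1)"
      have \<beta>: "?\<beta> \<in> D" using True DD(1) by blast
      have "\<alpha> = ?\<beta>" if a: "\<alpha> \<in> D'" for \<alpha>
      proof -
        have aD: "\<alpha> \<in> D" using a DD(1) by blast
        have "\<alpha> \<noteq> cr m" using crm[OF n] aD by blast
        hence "\<alpha> = EpsDiff (2 * m + 1) (2 * m + 2) \<or> \<alpha> = ?\<beta> \<or> \<alpha> = EpsSingle (2 * m + 2)"
          using D'r[OF a] True by (cases \<alpha>) (auto simp: roots_def lev_def cr_def)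
        moreover have "\<alpha> \<noteq> EpsDiff (2 * m + 1) (2 * m + 2)"
          using basic_row[OF D aD \<beta>, of "int (2 * m + 1)" "int (2 * m + 2)" 0] by auto
        moreover have "\<alpha> \<noteq> EpsSingle (2 * m + 2)"
          using basic_col[OF D aD \<beta>, of "int (2 * m + 2)" 0 "int (2 * m + 1)"] by auto
        ultimately show ?thesis by blast
      qed
      hence "D' = {?\<beta>}" using True by blast
      moreover from this have "top_form n D" unfolding top_form_def using True DD(1) by blast
      ultimately show ?thesis using True by blast
    next
      case False
      have c: "cr m \<notin> D'" using crm[OF n] DD(1) by blast
      have "\<not> top_form n D"
      proof
        assume "top_form n D"
        then obtain k where k: "n = 2 * k \<and> D = cr ` {..<k} \<or>
           n = 2 * k + 1 \<and> (\<exists>D1\<subseteq>{EpsSingle n}. D = cr ` {..<k} \<union> D1) \<or>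
           n = 2 * k + 2 \<and> D = cr ` {..<k} \<union> {EpsSingle (2 * k + 1)}"
          unfolding top_form_def by blast
        hence "?P k" by auto
        hence "k \<le> m" by (rule max)
        hence kn: "n = 2 * k + 2" "k = m" using k n by auto
        hence "EpsSingle (2 * m + 1) \<in> D" using k by auto
        hence "EpsSingle (2 * m + 1) \<in> D'" unfolding D'_def by auto
        thus False using False kn by blast
      qed
      thus ?thesis using n c False by blast
    qed
  qed
  show ?thesis by (rule that[OF conjunct1[OF m] DD fin _ c]) (rule D'r)
qed

section \<open>Degrees and the shape of the basic set\<close>

context matrix_action begin

text \<open>Both directions use one vector, the nonzero average against \<open>Psi\<close>. If
  \<open>D\<close> has the right shape, it yields q^tri(n) independent vectors, matching
  \<open>degree_le\<close>; otherwise it lies in a space with a small invariant subspace, which by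
  irreducibility is everything.\<close>

lemma degree_eq_iff:
  assumes D: "basic n D" and \<phi>: "\<And>\<alpha>. \<alpha> \<in> D \<Longrightarrow> \<phi> \<alpha> \<noteq> 0"
    and nz: "(\<Sum>g\<in>U_set n. mat_trace (\<rho> g) * cnj (xi n \<theta> D \<phi> g)) \<noteq> 0"
  shows "d = CARD('a) ^ tri n \<longleftrightarrow> top_form n D"
proof -
  obtain m D' where m: "2 * m \<le> n" and DD: "D = cr ` {..<m} \<union> D'" "cr ` {..<m} \<inter> D' = {}" and fin: "finite D'"
    and D': "\<And>\<alpha>. \<alpha> \<in> D' \<Longrightarrow> \<alpha> \<in> roots n \<and> idx \<alpha> \<subseteq> lev n m"
    and c: "n \<le> 2 * m + 1 \<and> top_form n D \<or> n = 2 * m + 2 \<and> D' = {EpsSingle (2 * m + 1)} \<and> top_form n D \<or>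
     2 * m + 2 \<le> n \<and> cr m \<notin> D' \<and> (n = 2 * m + 2 \<longrightarrow> EpsSingle (2 * m + 1) \<notin> D') \<and> \<not> top_form n D"
    using basic_cases[OF D] by blast
  have \<phi>c: "\<phi> (cr i) \<noteq> 0" if "i < m" for i using \<phi> that DD(1) by blast
  have "(\<Sum>g\<in>U_set n. mat_trace (\<rho> g) * cnj (Psi m D' \<phi> g)) \<noteq> 0"
    using sum_xi_Psi[OF m fin DD(2), of "\<lambda>g. mat_trace (\<rho> g)" \<phi>] trace_conj nz unfolding DD(1) by blast
  then obtain v where v: "v \<in> vecs {..<d}"
    and u: "(\<Sum>g\<in>U_set n. scl (cnj (Psi m D' \<phi> g)) (mact d \<rho> g v)) \<noteq> 0"
    by (rule average_nonzero)
  let ?M = "vecs {..<d} :: (nat \<Rightarrow> complex) set"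
  have uM: "(\<Sum>g\<in>U_set n. scl (cnj (Psi m D' \<phi> g)) (mact d \<rho> g v)) \<in> ?M"
    by (intro subspace_sum[OF subspace_M] subspace_scale[OF subspace_M] act_M v)
  from c show ?thesis
  proof (elim disjE conjE)
    assume n: "n \<le> 2 * m + 1" and t: "top_form n D"
    have "large ?M (CARD('a) ^ tri n)"
      by (rule chain_end_large[where \<phi>=\<phi>, OF m n \<phi>c D' fin v inv_on_M uM u])
    from large_degree[OF this order_refl] degree_le t show ?thesis by simp
  next
    assume n: "n = 2 * m + 2" and e: "D' = {EpsSingle (2 * m + 1)}" and t: "top_form n D"
    have p: "\<phi> (EpsSingle (2 * m + 1)) \<noteq> 0" using \<phi> DD(1) e by blast
    have "large ?M (CARD('a) ^ tri n)"
      by (rule chain_end_large2[where \<phi>=\<phi>, OF n \<phi>c p e v inv_on_M uM u])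
    from large_degree[OF this order_refl] degree_le t show ?thesis by simp
  next
    assume n: "2 * m + 2 \<le> n" "cr m \<notin> D'" "n = 2 * m + 2 \<longrightarrow> EpsSingle (2 * m + 1) \<notin> D'" and t: "\<not> top_form n D"
    have "small (labels n) ?M (CARD('a) ^ (tri n - 1))"
      by (rule chain_end_small[where \<phi>=\<phi>, OF n(1) \<phi>c D' fin n(2) mp[OF n(3)] v inv_on_M uM u])
    from small_degree[OF this order_refl] have le: "d \<le> CARD('a) ^ (tri n - 1)" .
    have "2 \<le> CARD('a)" using card_mono[of "UNIV :: 'a set" "{0, 1}"] by simp
    moreover have "1 \<le> tri n" using n(1) by (intro tri_pos) simp
    ultimately have "CARD('a) ^ (tri n - 1) < CARD('a) ^ tri n" by (intro power_strict_increasing) auto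
    thus ?thesis using le t by simp
  qed
qed

text \<open>The largest degree is the upper bound of \<open>degree_le\<close>, because
  \<open>ex_large_degree\<close> shows that it is attained.\<close>

lemma has_max_degree_iff:
  assumes \<chi>: "\<forall>g\<in>U_set n. \<chi> g = mat_trace (\<rho> g)"
  shows "has_max_degree (U_group n) \<chi> \<longleftrightarrow> d = CARD('a) ^ tri n"
proof
  have \<chi>i: "\<chi> \<in> irr_chars (U_group n)" unfolding irr_chars_def using irr \<chi> by auto
  {
    assume max: "has_max_degree (U_group n) \<chi>"
    obtain d' \<rho>' where r: "irreducible_rep (U_group n) d' (\<rho>' :: 'a mat \<Rightarrow> complex mat)" "CARD('a) ^ tri n \<le> d'"
      by (rule ex_large_degree)
    interpret R: matrix_action n \<theta> d' \<rho>' by unfold_locales (rule r(1))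
    have "(\<lambda>g. mat_trace (\<rho>' g)) \<in> irr_chars (U_group n)" unfolding irr_chars_def using r(1) by auto
    hence "char_degree (U_group n) (\<lambda>g. mat_trace (\<rho>' g)) \<le> char_degree (U_group n) \<chi>"
      using max by (simp add: has_max_degree_def)
    hence "d' \<le> d" using R.degree_eq[of "\<lambda>g. mat_trace (\<rho>' g)"] degree_eq[OF \<chi>] by simp
    thus "d = CARD('a) ^ tri n" using r(2) degree_le by simp
  }
  assume d: "d = CARD('a) ^ tri n"
  have "char_degree (U_group n) \<psi> \<le> char_degree (U_group n) \<chi>" if p: "\<psi> \<in> irr_chars (U_group n)" for \<psi> :: "'a mat \<Rightarrow> complex"
  proof -
    obtain d' \<rho>' where r: "irreducible_rep (U_group n) d' \<rho>'" "\<forall>g\<in>U_set n. \<psi> g = mat_trace (\<rho>' g)"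
      using p unfolding irr_chars_def mem_Collect_eq U_group_simps by blast
    interpret R: matrix_action n \<theta> d' \<rho>' by unfold_locales (rule r(1))
    show ?thesis using R.degree_le R.degree_eq[OF r(2)] degree_eq[OF \<chi>] d by simp
  qed
  thus "has_max_degree (U_group n) \<chi>" using \<chi>i by (simp add: has_max_degree_def)
qed

end

lemma two_neq_zero:
  assumes "Factorial_Ring.prime p" "3 \<le> p" "CARD('a::{field,finite}) = p ^ e"
  shows "(2::'a) \<noteq> 0"
proof
  assume 2: "(2::'a) = 0"
  have "odd (CARD('a))" using assms prime_odd_nat[of p] by auto
  then obtain k where k: "CARD('a) = 2 * k + 1" by (rule oddE)
  have "of_nat CARD('a) = (0::'a)" by (rule of_nat_card_eq_0)
  thus False unfolding k using 2 by simp
qed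

theorem theorem7p3:
  fixes p e n :: nat
    and \<theta> :: "'a::{field, finite} \<Rightarrow> complex"
    and \<chi> :: "'a mat \<Rightarrow> complex"
    and D :: "root set"
    and \<phi> :: "root \<Rightarrow> 'a"
  assumes "Factorial_Ring.prime p" and "3 \<le> p" and "1 \<le> e" and "CARD('a) = p ^ e"
    and "1 \<le> n"
    and "nontrivial_additive_char \<theta>"
    and "\<chi> \<in> irr_chars (U_group n)"
    and "basic n D"
    and "\<forall>\<alpha>\<in>D. \<phi> \<alpha> \<noteq> 0"
    and "char_inner (U_group n) \<chi> (xi n \<theta> D \<phi>) \<noteq> 0"
  shows
    "(even n \<longrightarrow>
       (has_max_degree (U_group n) \<chi> \<longleftrightarrow>
        (\<exists>D1. (D1 = {EpsSum (n - 1) n} \<or> D1 = {EpsSingle (n - 1)}) \<and>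
              D = {EpsSum (2 * k - 1) (2 * k) | k. 1 \<le> k \<and> 2 * k \<le> n - 2} \<union> D1))) \<and>
     (odd n \<longrightarrow>
       (has_max_degree (U_group n) \<chi> \<longleftrightarrow>
        (\<exists>D1. D1 \<subseteq> {EpsSingle n} \<and>
              D = {EpsSum (2 * k - 1) (2 * k) | k. 1 \<le> k \<and> 2 * k \<le> n - 1} \<union> D1)))"
proof -
  obtain d \<rho> where r: "irreducible_rep (U_group n) d \<rho>" "\<forall>g\<in>U_set n. \<chi> g = mat_trace (\<rho> g)"
    using assms(7) by (auto simp: irr_chars_def)
  interpret matrix_action n \<theta> d \<rho>
    by unfold_locales (rule two_neq_zero[OF assms(1,2,4)], rule assms(6), rule r(1))
  have "(\<Sum>g\<in>U_set n. \<chi> g * cnj (xi n \<theta> D \<phi> g)) \<noteq> 0"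
    using assms(10) by (auto simp: char_inner_def)
  also have "(\<Sum>g\<in>U_set n. \<chi> g * cnj (xi n \<theta> D \<phi> g)) = (\<Sum>g\<in>U_set n. mat_trace (\<rho> g) * cnj (xi n \<theta> D \<phi> g))"
    using r(2) by (intro sum.cong refl) simp
  finally have "d = CARD('a) ^ tri n \<longleftrightarrow> top_form n D"
    using degree_eq_iff[OF assms(8), of \<phi>] assms(9) by blast
  hence m: "has_max_degree (U_group n) \<chi> \<longleftrightarrow> top_form n D"
    unfolding has_max_degree_iff[OF r(2)] .
  show ?thesis
    unfolding m by (intro conjI impI top_form_even[OF _ assms(5)] top_form_odd)
qed

end
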